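(* Let $S$ be a scheme, let $T_0$ be an $S$-scheme, and let $d=(d_0,d_1):T_1\to T_0\times_ST_0$ be an equivalence relation on $T_0$ such that $d$ is a quasi-compact immersion. Consider the factorization of $d$ by schematic closure $$T_1\xrightarrow{i}\widetilde{T_1}\xrightarrow{\widetilde d}T_0\times_ST_0 .$$ If the two morphisms $\widetilde{d_0},\widetilde{d_1}:\widetilde{T_1}\rightrightarrows T_0$, obtained by composing $\widetilde d$ with the projections to $T_0$, are flat, then they come from an equivalence relation on $T_0$ (i.e. $\widetilde d:\widetilde{T_1}\to T_0\times_ST_0$ is an equivalence relation on $T_0$).
   Context: An equivalence relation on an $S$-scheme $T_0$ is an $S$-scheme $T_1$ with an immersion $d=(d_0,d_1):T_1\to T_0\times_ST_0$ such that for every $S$-scheme $X$ the subset $T_1(X)\subset T_0(X)\times T_0(X)$ is an equivalence relation; equivalently, the diagonal of $T_0$ factors through $d$, there is an automorphism of $T_1$ compatible with exchange of the factors of $T_0\times_ST_0$, and the morphism $(T_1,d_0)\times_{T_0}(T_1,d_1)\to T_0\times_ST_0$ obtained from the outer two coordinates factors through $d$. For a quasi-compact quasi-separated morphism $t:Y\to X$, the schematic closure of $t$ is the closed subscheme of $X$ defined by the quasi-coherent ideal $\ker(\mathcal O_X\to t_*\mathcal O_Y)$; $t$ factors through it. *)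

theory Defs
  imports
    "HOL-Analysis.Abstract_Topology"
    "HOL-Algebra.Module"
    "HOL-Algebra.RingHom"
    "HOL-Algebra.Free_Abelian_Groups"
begin

section \<open>Ringed spaces and stalks\<close>

text \<open>
  \<open>sec X U\<close> is the ring of sections over the open set \<open>U\<close> and \<open>res X U V\<close> the restriction map
  from \<open>U\<close> to \<open>V \<subseteq> U\<close>. Values at sets that are not open are irrelevant.
\<close>

record ('p, 'r) ringed_space =
  top_of :: "'p topology"
  sec :: "'p set \<Rightarrow> 'r ring"
  res :: "'p set \<Rightarrow> 'p set \<Rightarrow> 'r \<Rightarrow> 'r"

abbreviation points :: "('p, 'r) ringed_space \<Rightarrow> 'p set"
  where "points X \<equiv> topspace (top_of X)"

abbreviation opn :: "('p, 'r) ringed_space \<Rightarrow> 'p set \<Rightarrow> bool"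
  where "opn X U \<equiv> openin (top_of X) U"

text \<open>The cover \<open>\<U> = {}\<close> is allowed in the last two clauses; it forces \<open>sec X {}\<close> to be a zero ring.\<close>

definition ringed_space :: "('p, 'r) ringed_space \<Rightarrow> bool" where
  "ringed_space X \<longleftrightarrow>
     (\<forall>U. opn X U \<longrightarrow> cring (sec X U)) \<and>
     (\<forall>U V. opn X U \<and> opn X V \<and> V \<subseteq> U \<longrightarrow> res X U V \<in> ring_hom (sec X U) (sec X V)) \<and>
     (\<forall>U. \<forall>s \<in> carrier (sec X U). opn X U \<longrightarrow> res X U U s = s) \<and>
     (\<forall>U V W. \<forall>s \<in> carrier (sec X U). opn X U \<and> opn X V \<and> opn X W \<and> W \<subseteq> V \<and> V \<subseteq> U \<longrightarrow>
        res X V W (res X U V s) = res X U W s) \<and>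
     (\<forall>\<U>. (\<forall>V \<in> \<U>. opn X V) \<longrightarrow>
        (\<forall>s \<in> carrier (sec X (\<Union>\<U>)). \<forall>t \<in> carrier (sec X (\<Union>\<U>)).
           (\<forall>V \<in> \<U>. res X (\<Union>\<U>) V s = res X (\<Union>\<U>) V t) \<longrightarrow> s = t)) \<and>
     (\<forall>\<U> s. (\<forall>V \<in> \<U>. opn X V \<and> s V \<in> carrier (sec X V)) \<and>
        (\<forall>V \<in> \<U>. \<forall>W \<in> \<U>. res X V (V \<inter> W) (s V) = res X W (V \<inter> W) (s W)) \<longrightarrow>
        (\<exists>t \<in> carrier (sec X (\<Union>\<U>)). \<forall>V \<in> \<U>. res X (\<Union>\<U>) V t = s V))"

definition germ :: "('p, 'r) ringed_space \<Rightarrow> 'p \<Rightarrow> 'p set \<Rightarrow> 'r \<Rightarrow> ('p set \<times> 'r) set" where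
  "germ X x U s =
     {(V, t). opn X V \<and> x \<in> V \<and> t \<in> carrier (sec X V) \<and>
        (\<exists>W. opn X W \<and> x \<in> W \<and> W \<subseteq> U \<inter> V \<and> res X U W s = res X V W t)}"

text \<open>
  Here, for localizations and for the maps induced on stalks, an operation on equivalence classes
  is given as the union of the classes obtained from all representatives, which all coincide.
\<close>

definition stalk :: "('p, 'r) ringed_space \<Rightarrow> 'p \<Rightarrow> ('p set \<times> 'r) set ring" where
  "stalk X x =
     \<lparr>carrier = {germ X x U s | U s. opn X U \<and> x \<in> U \<and> s \<in> carrier (sec X U)},
      monoid.mult = (\<lambda>A B. \<Union>{germ X x (U \<inter> V) (res X U (U \<inter> V) s \<otimes>\<^bsub>sec X (U \<inter> V)\<^esub> res X V (U \<inter> V) t)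
                      | U s V t. (U, s) \<in> A \<and> (V, t) \<in> B}),
      one = germ X x (points X) \<one>\<^bsub>sec X (points X)\<^esub>,
      ring.zero = germ X x (points X) \<zero>\<^bsub>sec X (points X)\<^esub>,
      add = (\<lambda>A B. \<Union>{germ X x (U \<inter> V) (res X U (U \<inter> V) s \<oplus>\<^bsub>sec X (U \<inter> V)\<^esub> res X V (U \<inter> V) t)
                      | U s V t. (U, s) \<in> A \<and> (V, t) \<in> B})\<rparr>"

definition local_ring :: "('a, 'm) ring_scheme \<Rightarrow> bool" where
  "local_ring R \<longleftrightarrow> cring R \<and> (\<exists>!I. maximalideal I R)"

definition locally_ringed_space :: "('p, 'r) ringed_space \<Rightarrow> bool" where
  "locally_ringed_space X \<longleftrightarrow> ringed_space X \<and> (\<forall>x \<in> points X. local_ring (stalk X x))"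

definition restr :: "('p, 'r) ringed_space \<Rightarrow> 'p set \<Rightarrow> ('p, 'r) ringed_space" where
  "restr X U = X\<lparr>top_of := subtopology (top_of X) U\<rparr>"


section \<open>Morphisms of locally ringed spaces\<close>

text \<open>
  \<open>cm f V\<close> is the map from sections of the target over \<open>V\<close> to sections of the source over the
  preimage of \<open>V\<close>. Both components are required to be undefined outside their domains,
  so that equality of morphisms is HOL equality.
\<close>

record ('p, 'r, 'q, 's) morphism =
  src :: "('p, 'r) ringed_space"
  tgt :: "('q, 's) ringed_space"
  pt :: "'p \<Rightarrow> 'q"
  cm :: "'q set \<Rightarrow> 's \<Rightarrow> 'r"

definition preim :: "('p, 'r, 'q, 's) morphism \<Rightarrow> 'q set \<Rightarrow> 'p set" where
  "preim f V = {x \<in> points (src f). pt f x \<in> V}"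

definition stalk_map ::
    "('p, 'r, 'q, 's) morphism \<Rightarrow> 'p \<Rightarrow> ('q set \<times> 's) set \<Rightarrow> ('p set \<times> 'r) set" where
  "stalk_map f x A = \<Union>{germ (src f) x (preim f V) (cm f V s) | V s. (V, s) \<in> A}"

definition lrs_hom ::
    "('p, 'r) ringed_space \<Rightarrow> ('q, 's) ringed_space \<Rightarrow> ('p, 'r, 'q, 's) morphism set" where
  "lrs_hom X Y = {f. src f = X \<and> tgt f = Y \<and>
     continuous_map (top_of X) (top_of Y) (pt f) \<and>
     pt f \<in> extensional (points X) \<and>
     (\<forall>V. opn Y V \<longrightarrow> cm f V \<in> ring_hom (sec Y V) (sec X (preim f V)) \<inter> extensional (carrier (sec Y V))) \<and>
     (\<forall>V. \<not> opn Y V \<longrightarrow> cm f V = (\<lambda>_. undefined)) \<and>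
     (\<forall>V W. opn Y V \<and> opn Y W \<and> W \<subseteq> V \<longrightarrow> (\<forall>s \<in> carrier (sec Y V).
        cm f W (res Y V W s) = res X (preim f V) (preim f W) (cm f V s))) \<and>
     (\<forall>x \<in> points X. \<forall>A \<in> carrier (stalk Y (pt f x)).
        stalk_map f x A \<in> Units (stalk X x) \<longrightarrow> A \<in> Units (stalk Y (pt f x)))}"

definition lrs_id :: "('p, 'r) ringed_space \<Rightarrow> ('p, 'r, 'p, 'r) morphism" where
  "lrs_id X = \<lparr>src = X, tgt = X, pt = (\<lambda>x \<in> points X. x),
     cm = (\<lambda>V. if opn X V then (\<lambda>s \<in> carrier (sec X V). s) else (\<lambda>_. undefined))\<rparr>"

definition lrs_comp ::
    "('q, 's, 'o, 't) morphism \<Rightarrow> ('p, 'r, 'q, 's) morphism \<Rightarrow> ('p, 'r, 'o, 't) morphism"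
    (infixr \<open>\<circ>\<^sub>s\<close> 55) where
  "g \<circ>\<^sub>s f = \<lparr>src = src f, tgt = tgt g, pt = compose (points (src f)) (pt g) (pt f),
     cm = (\<lambda>V. if opn (tgt g) V then (\<lambda>s \<in> carrier (sec (tgt g) V). cm f (preim g V) (cm g V s))
               else (\<lambda>_. undefined))\<rparr>"

definition lrs_iso :: "('p, 'r, 'q, 's) morphism \<Rightarrow> bool" where
  "lrs_iso f \<longleftrightarrow> f \<in> lrs_hom (src f) (tgt f) \<and>
     (\<exists>g \<in> lrs_hom (tgt f) (src f). g \<circ>\<^sub>s f = lrs_id (src f) \<and> f \<circ>\<^sub>s g = lrs_id (tgt f))"

definition open_incl :: "('p, 'r) ringed_space \<Rightarrow> 'p set \<Rightarrow> ('p, 'r, 'p, 'r) morphism" where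
  "open_incl X U = \<lparr>src = restr X U, tgt = X, pt = (\<lambda>x \<in> points (restr X U). x),
     cm = (\<lambda>V. if opn X V then (\<lambda>s \<in> carrier (sec X V). res X V (V \<inter> U) s) else (\<lambda>_. undefined))\<rparr>"


section \<open>Schemes\<close>

definition frac :: "('a, 'm) ring_scheme \<Rightarrow> 'a set \<Rightarrow> 'a \<Rightarrow> 'a \<Rightarrow> ('a \<times> 'a) set" where
  "frac R W a s =
     {(b, t). b \<in> carrier R \<and> t \<in> W \<and> (\<exists>u \<in> W. u \<otimes>\<^bsub>R\<^esub> (t \<otimes>\<^bsub>R\<^esub> a) = u \<otimes>\<^bsub>R\<^esub> (s \<otimes>\<^bsub>R\<^esub> b))}"

definition localization :: "('a, 'm) ring_scheme \<Rightarrow> 'a set \<Rightarrow> ('a \<times> 'a) set ring" where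
  "localization R W =
     \<lparr>carrier = {frac R W a s | a s. a \<in> carrier R \<and> s \<in> W},
      monoid.mult = (\<lambda>A B. \<Union>{frac R W (a \<otimes>\<^bsub>R\<^esub> b) (s \<otimes>\<^bsub>R\<^esub> t) | a s b t. (a, s) \<in> A \<and> (b, t) \<in> B}),
      one = frac R W \<one>\<^bsub>R\<^esub> \<one>\<^bsub>R\<^esub>,
      ring.zero = frac R W \<zero>\<^bsub>R\<^esub> \<one>\<^bsub>R\<^esub>,
      add = (\<lambda>A B. \<Union>{frac R W (a \<otimes>\<^bsub>R\<^esub> t \<oplus>\<^bsub>R\<^esub> b \<otimes>\<^bsub>R\<^esub> s) (s \<otimes>\<^bsub>R\<^esub> t)
                      | a s b t. (a, s) \<in> A \<and> (b, t) \<in> B})\<rparr>"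

definition zariski :: "('a, 'm) ring_scheme \<Rightarrow> 'a set topology" where
  "zariski R = topology (\<lambda>U. \<exists>I \<subseteq> carrier R. U = {P. primeideal P R \<and> \<not> I \<subseteq> P})"

lemma openin_zariski:
  "openin (zariski R) U \<longleftrightarrow> (\<exists>I \<subseteq> carrier R. U = {P. primeideal P R \<and> \<not> I \<subseteq> P})"
proof -
  let ?L = "\<lambda>U. \<exists>I \<subseteq> carrier R. U = {P. primeideal P R \<and> \<not> I \<subseteq> P}"
  have "istopology ?L"
    unfolding istopology_def
  proof (intro conjI allI impI)
    fix A B assume "?L A" "?L B"
    then obtain I J where I: "I \<subseteq> carrier R" "A = {P. primeideal P R \<and> \<not> I \<subseteq> P}"
      and J: "J \<subseteq> carrier R" "B = {P. primeideal P R \<and> \<not> J \<subseteq> P}" by auto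
    let ?K = "{a \<otimes>\<^bsub>R\<^esub> b | a b. a \<in> I \<and> b \<in> J \<and> a \<otimes>\<^bsub>R\<^esub> b \<in> carrier R}"
    have *: "(\<not> I \<subseteq> P \<and> \<not> J \<subseteq> P) = (\<not> ?K \<subseteq> P)" if "primeideal P R" for P
    proof -
      interpret primeideal P R by fact
      show ?thesis
      proof
        assume "\<not> I \<subseteq> P \<and> \<not> J \<subseteq> P"
        then obtain a b where "a \<in> I" "a \<notin> P" "b \<in> J" "b \<notin> P" by auto
        moreover from this have "a \<otimes>\<^bsub>R\<^esub> b \<notin> P" using I_prime I(1) J(1) by blast
        ultimately show "\<not> ?K \<subseteq> P" using I(1) J(1) by blast
      next
        assume "\<not> ?K \<subseteq> P"
        then obtain a b where "a \<in> I" "b \<in> J" "a \<otimes>\<^bsub>R\<^esub> b \<notin> P" by auto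
        then show "\<not> I \<subseteq> P \<and> \<not> J \<subseteq> P" using I(1) J(1) I_l_closed I_r_closed by blast
      qed
    qed
    have "A \<inter> B = {P. primeideal P R \<and> (\<not> I \<subseteq> P \<and> \<not> J \<subseteq> P)}" using I(2) J(2) by blast
    also have "\<dots> = {P. primeideal P R \<and> \<not> ?K \<subseteq> P}"
      by (intro Collect_cong conj_cong refl *)
    finally have "A \<inter> B = {P. primeideal P R \<and> \<not> ?K \<subseteq> P}" .
    moreover have "?K \<subseteq> carrier R" by blast
    ultimately show "?L (A \<inter> B)" by (intro exI[of _ ?K] conjI) simp_all
  next
    fix \<K> assume "\<forall>K \<in> \<K>. ?L K"
    then obtain I where I: "\<And>K. K \<in> \<K> \<Longrightarrow> I K \<subseteq> carrier R"
        "\<And>K. K \<in> \<K> \<Longrightarrow> K = {P. primeideal P R \<and> \<not> I K \<subseteq> P}"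
      by metis
    have "P \<in> \<Union>\<K> \<longleftrightarrow> primeideal P R \<and> \<not> \<Union>(I ` \<K>) \<subseteq> P" for P
    proof -
      have "P \<in> \<Union>\<K> \<longleftrightarrow> (\<exists>K \<in> \<K>. primeideal P R \<and> \<not> I K \<subseteq> P)"
        using I(2) by (metis (mono_tags, lifting) Union_iff mem_Collect_eq)
      then show ?thesis by (simp add: UN_subset_iff)
    qed
    then have "\<Union>\<K> = {P. primeideal P R \<and> \<not> \<Union>(I ` \<K>) \<subseteq> P}" by blast
    moreover have "\<Union>(I ` \<K>) \<subseteq> carrier R" using I(1) by (rule UN_least)
    ultimately show "?L (\<Union>\<K>)" by (intro exI[of _ "\<Union>(I ` \<K>)"] conjI)
  qed
  then show ?thesis unfolding zariski_def by (simp add: topology_inverse')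
qed

definition spec_sections ::
    "('a, 'm) ring_scheme \<Rightarrow> 'a set set \<Rightarrow> ('a set \<Rightarrow> ('a \<times> 'a) set) ring" where
  "spec_sections R U =
     \<lparr>carrier = {s \<in> (\<Pi>\<^sub>E P \<in> U. carrier (localization R (carrier R - P))).
        \<forall>P \<in> U. \<exists>V. openin (zariski R) V \<and> P \<in> V \<and> V \<subseteq> U \<and>
          (\<exists>a \<in> carrier R. \<exists>f \<in> carrier R. \<forall>Q \<in> V. f \<notin> Q \<and> s Q = frac R (carrier R - Q) a f)},
      monoid.mult = (\<lambda>s t. \<lambda>P \<in> U. s P \<otimes>\<^bsub>localization R (carrier R - P)\<^esub> t P),
      one = (\<lambda>P \<in> U. \<one>\<^bsub>localization R (carrier R - P)\<^esub>),
      ring.zero = (\<lambda>P \<in> U. \<zero>\<^bsub>localization R (carrier R - P)\<^esub>),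
      add = (\<lambda>s t. \<lambda>P \<in> U. s P \<oplus>\<^bsub>localization R (carrier R - P)\<^esub> t P)\<rparr>"

definition Spec ::
    "('a, 'm) ring_scheme \<Rightarrow> ('a set, 'a set \<Rightarrow> ('a \<times> 'a) set) ringed_space" where
  "Spec R = \<lparr>top_of = zariski R, sec = spec_sections R, res = (\<lambda>U V s. restrict s V)\<rparr>"

text \<open>
  Taking \<open>R\<close> over the type \<open>'r\<close> of sections of \<open>X\<close> loses nothing, since necessarily
  \<open>R\<close> is isomorphic to \<open>sec X (points X)\<close>.
\<close>

definition affine_scheme :: "('p, 'r) ringed_space \<Rightarrow> bool" where
  "affine_scheme X \<longleftrightarrow> locally_ringed_space X \<and>
     (\<exists>R :: 'r ring. cring R \<and> (\<exists>f \<in> lrs_hom X (Spec R). lrs_iso f))"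

definition scheme :: "('p, 'r) ringed_space \<Rightarrow> bool" where
  "scheme X \<longleftrightarrow> locally_ringed_space X \<and>
     (\<forall>x \<in> points X. \<exists>U. opn X U \<and> x \<in> U \<and> affine_scheme (restr X U))"


section \<open>Immersions, quasi-compact morphisms and schematic closure\<close>

definition closed_immersion :: "('p, 'r, 'q, 's) morphism \<Rightarrow> bool" where
  "closed_immersion f \<longleftrightarrow> scheme (src f) \<and> scheme (tgt f) \<and> f \<in> lrs_hom (src f) (tgt f) \<and>
     embedding_map (top_of (src f)) (top_of (tgt f)) (pt f) \<and>
     closedin (top_of (tgt f)) (pt f ` points (src f)) \<and>
     (\<forall>V. \<forall>s \<in> carrier (sec (src f) (preim f V)). opn (tgt f) V \<longrightarrow>
        (\<forall>y \<in> V. \<exists>W. opn (tgt f) W \<and> y \<in> W \<and> W \<subseteq> V \<and>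
          (\<exists>t \<in> carrier (sec (tgt f) W). cm f W t = res (src f) (preim f V) (preim f W) s)))"

definition immersion :: "('p, 'r, 'q, 's) morphism \<Rightarrow> bool" where
  "immersion f \<longleftrightarrow> scheme (src f) \<and> scheme (tgt f) \<and>
     (\<exists>U. opn (tgt f) U \<and>
        (\<exists>g \<in> lrs_hom (src f) (restr (tgt f) U). closed_immersion g \<and> f = open_incl (tgt f) U \<circ>\<^sub>s g))"

definition quasi_compact :: "('p, 'r, 'q, 's) morphism \<Rightarrow> bool" where
  "quasi_compact f \<longleftrightarrow>
     (\<forall>V. opn (tgt f) V \<and> compactin (top_of (tgt f)) V \<longrightarrow> compactin (top_of (src f)) (preim f V))"

text \<open>
  The closed immersion \<open>j\<close> is the inclusion of the schematic closure of \<open>t\<close>: its ideal sheaf,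
  the kernel of the comorphism of \<open>j\<close>, is the kernel of the comorphism of \<open>t\<close>.
\<close>

definition schematic_closure ::
    "('p, 'r, 'q, 's) morphism \<Rightarrow> ('k, 'l, 'q, 's) morphism \<Rightarrow> bool" where
  "schematic_closure t j \<longleftrightarrow> closed_immersion j \<and> tgt j = tgt t \<and>
     (\<forall>V. opn (tgt t) V \<longrightarrow>
        a_kernel (sec (tgt t) V) (sec (src j) (preim j V)) (cm j V) =
        a_kernel (sec (tgt t) V) (sec (src t) (preim t V)) (cm t V))"


section \<open>Flatness\<close>

definition tensor_rel ::
    "('a, 'm) ring_scheme \<Rightarrow> ('a, 'b) module \<Rightarrow> ('a, 'c) module \<Rightarrow> ('b \<times> 'c \<Rightarrow>\<^sub>0 int) set" where
  "tensor_rel A M N = generate (free_Abelian_group (carrier M \<times> carrier N))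
     ({frag_of (x \<oplus>\<^bsub>M\<^esub> x', y) - frag_of (x, y) - frag_of (x', y)
         | x x' y. x \<in> carrier M \<and> x' \<in> carrier M \<and> y \<in> carrier N} \<union>
      {frag_of (x, y \<oplus>\<^bsub>N\<^esub> y') - frag_of (x, y) - frag_of (x, y')
         | x y y'. x \<in> carrier M \<and> y \<in> carrier N \<and> y' \<in> carrier N} \<union>
      {frag_of (a \<odot>\<^bsub>M\<^esub> x, y) - frag_of (x, a \<odot>\<^bsub>N\<^esub> y)
         | a x y. a \<in> carrier A \<and> x \<in> carrier M \<and> y \<in> carrier N})"

definition tensor ::
    "('a, 'm) ring_scheme \<Rightarrow> ('a, 'b) module \<Rightarrow> ('a, 'c) module \<Rightarrow> ('b \<times> 'c \<Rightarrow>\<^sub>0 int) set monoid" where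
  "tensor A M N = free_Abelian_group (carrier M \<times> carrier N) Mod tensor_rel A M N"

text \<open>\<open>tensor_map A M' N f\<close> is the map from \<open>M \<otimes> N\<close> to \<open>M' \<otimes> N\<close> induced by \<open>f\<close> from \<open>M\<close> to \<open>M'\<close>.\<close>

definition tensor_map ::
    "('a, 'm) ring_scheme \<Rightarrow> ('a, 'd) module \<Rightarrow> ('a, 'c) module \<Rightarrow> ('b \<Rightarrow> 'd) \<Rightarrow>
     ('b \<times> 'c \<Rightarrow>\<^sub>0 int) set \<Rightarrow> ('d \<times> 'c \<Rightarrow>\<^sub>0 int) set" where
  "tensor_map A M' N f C = (\<Union>z \<in> C. tensor_rel A M' N
     #>\<^bsub>free_Abelian_group (carrier M' \<times> carrier N)\<^esub> frag_extend (\<lambda>(x, y). frag_of (f x, y)) z)"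

definition linear_maps ::
    "('a, 'm) ring_scheme \<Rightarrow> ('a, 'b) module \<Rightarrow> ('a, 'c) module \<Rightarrow> ('b \<Rightarrow> 'c) set" where
  "linear_maps A M N = {f \<in> carrier M \<rightarrow> carrier N.
     (\<forall>x \<in> carrier M. \<forall>y \<in> carrier M. f (x \<oplus>\<^bsub>M\<^esub> y) = f x \<oplus>\<^bsub>N\<^esub> f y) \<and>
     (\<forall>a \<in> carrier A. \<forall>x \<in> carrier M. f (a \<odot>\<^bsub>M\<^esub> x) = a \<odot>\<^bsub>N\<^esub> f x)}"

text \<open>
  The test modules \<open>M\<close>, \<open>M'\<close> range over modules whose elements lie in the type of elements
  of \<open>A\<close>. This includes \<open>A\<close> and all its ideals, which by the ideal criterion already
  determine flatness, so the condition is not weaker than the one over all modules.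
\<close>

definition flat_module :: "'a ring \<Rightarrow> ('a, 'c) module \<Rightarrow> bool" where
  "flat_module A N \<longleftrightarrow> module A N \<and>
     (\<forall>(M :: ('a, 'a) module) (M' :: ('a, 'a) module) f.
        module A M \<and> module A M' \<and> f \<in> linear_maps A M M' \<and> inj_on f (carrier M) \<longrightarrow>
        inj_on (tensor_map A M' N f) (carrier (tensor A M N)))"

definition module_via :: "('a \<Rightarrow> 'b) \<Rightarrow> 'b ring \<Rightarrow> ('a, 'b) module" where
  "module_via \<phi> B = ring.extend B \<lparr>smult = (\<lambda>a b. \<phi> a \<otimes>\<^bsub>B\<^esub> b)\<rparr>"

definition flat_morphism :: "('p, 'r, 'q, 's) morphism \<Rightarrow> bool" where
  "flat_morphism f \<longleftrightarrow> f \<in> lrs_hom (src f) (tgt f) \<and>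
     (\<forall>x \<in> points (src f).
        flat_module (stalk (tgt f) (pt f x)) (module_via (stalk_map f x) (stalk (src f) x)))"


section \<open>Fibre products and equivalence relations\<close>

text \<open>
  A HOL formula cannot quantify over the carrier types of test schemes, so test schemes are taken
  in a universe: points and sections are elements of a type \<open>'u\<close>. The universe may be any type large
  enough, with respect to the types \<open>'p\<close> and \<open>'r\<close> of points and sections of the given schemes,
  to hold a copy of every fibre product of schemes over \<open>'p\<close> and \<open>'r\<close>. Such a fibre product has at most
  \<open>2 ^ \<kappa>\<close> points and stalks of cardinality at most \<open>\<kappa>\<close>, hence at most \<open>2 ^ (2 ^ \<kappa>)\<close> sections,
  where \<open>\<kappa>\<close> is the cardinality of \<open>('p + 'r) list\<close>. As \<open>'u\<close> is a type variable, every scheme,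
  over any types, occurs up to isomorphism in some such universe.
\<close>

definition universe_over :: "'p itself \<Rightarrow> 'r itself \<Rightarrow> 'u itself \<Rightarrow> bool" where
  "universe_over TYPE('p) TYPE('r) TYPE('u) \<longleftrightarrow>
     (\<exists>e :: ('p + 'r) list set set set \<Rightarrow> 'u. inj e)"

definition is_fibre_product ::
    "'u itself \<Rightarrow> ('p0, 'r0, 'ps, 'rs) morphism \<Rightarrow> ('p1, 'r1, 'ps, 'rs) morphism \<Rightarrow>
     ('p, 'r, 'p0, 'r0) morphism \<Rightarrow> ('p, 'r, 'p1, 'r1) morphism \<Rightarrow> bool" where
  "is_fibre_product (_ :: 'u itself) f g p q \<longleftrightarrow>
     scheme (src p) \<and> src q = src p \<and>
     p \<in> lrs_hom (src p) (src f) \<and> q \<in> lrs_hom (src p) (src g) \<and> f \<circ>\<^sub>s p = g \<circ>\<^sub>s q \<and>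
     (\<forall>X :: ('u, 'u) ringed_space. scheme X \<longrightarrow>
        (\<forall>a \<in> lrs_hom X (src f). \<forall>b \<in> lrs_hom X (src g). f \<circ>\<^sub>s a = g \<circ>\<^sub>s b \<longrightarrow>
           (\<exists>!h. h \<in> lrs_hom X (src p) \<and> p \<circ>\<^sub>s h = a \<and> q \<circ>\<^sub>s h = b)))"

text \<open>\<open>over_hom x y\<close> is the set of morphisms over \<open>S\<close> between \<open>S\<close>-schemes given by their structure morphisms.\<close>

definition over_hom ::
    "('p, 'r, 'ps, 'rs) morphism \<Rightarrow> ('q, 's, 'ps, 'rs) morphism \<Rightarrow> ('p, 'r, 'q, 's) morphism set" where
  "over_hom x y = {h \<in> lrs_hom (src x) (src y). y \<circ>\<^sub>s h = x}"

text \<open>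
  \<open>t0\<close> is the structure morphism of the \<open>S\<close>-scheme \<open>T0\<close>, and \<open>p0\<close>, \<open>p1\<close> are the projections
  of the fibre product of \<open>T0\<close> with itself over \<open>S\<close>. The source \<open>T1\<close> of \<open>d\<close> is an \<open>S\<close>-scheme via \<open>d\<close>,
  the only structure for which \<open>d\<close> is a morphism over \<open>S\<close>.
\<close>

definition equivalence_relation ::
    "'u itself \<Rightarrow> ('p0, 'r0, 'ps, 'rs) morphism \<Rightarrow>
     ('p, 'r, 'p0, 'r0) morphism \<Rightarrow> ('p, 'r, 'p0, 'r0) morphism \<Rightarrow>
     ('p1, 'r1, 'p, 'r) morphism \<Rightarrow> bool" where
  "equivalence_relation (_ :: 'u itself) t0 p0 p1 d \<longleftrightarrow>
     scheme (src d) \<and> d \<in> lrs_hom (src d) (src p0) \<and> immersion d \<and>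
     (\<forall>x :: ('u, 'u, 'ps, 'rs) morphism. scheme (src x) \<and> x \<in> lrs_hom (src x) (tgt t0) \<longrightarrow>
        equiv (over_hom x t0)
          {(p0 \<circ>\<^sub>s d \<circ>\<^sub>s h, p1 \<circ>\<^sub>s d \<circ>\<^sub>s h) | h. h \<in> over_hom x (t0 \<circ>\<^sub>s p0 \<circ>\<^sub>s d)})"

end

theory Submission
  imports Defs "HOL-Algebra.Weak_Morphisms" "HOL-Algebra.Subrings" "HOL-Algebra.Ring_Divisibility"
begin

text \<open>
  The morphism \<open>d\<close> is quasi-compact, so near each point of the closure \<open>T1c\<close> there are finitely many functions
  \<open>f\<close> on the product \<open>P\<close> whose nonvanishing loci cover \<open>T1\<close> and lie in the open part of \<open>P\<close> in which \<open>T1\<close> is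
  closed. Where some \<open>f\<close> is invertible, \<open>T1c\<close> agrees with \<open>T1\<close>; and, by the definition of the schematic
  closure, no nonzero germ of a function on \<open>T1c\<close> is annihilated by powers of all \<open>f\<close>.

  Let \<open>b1\<close>, \<open>b2\<close> be composable points of \<open>T1c\<close> over \<open>X\<close>. The composite is a point \<open>m\<close> of \<open>P\<close>, and it lies in
  \<open>T1c\<close> if each function \<open>s\<close> that vanishes on \<open>T1\<close> pulls back to zero in each local ring of \<open>X\<close>. This pull back
  comes from an element of the tensor product \<open>C\<close> of the local rings of \<open>T1c\<close> at the two points, localized
  at a prime. By flatness of the projections, no nonzero element of \<open>C\<close> is annihilated by powers of all products
  \<open>f \<otimes> g\<close> of cutting functions. At a prime at which \<open>f \<otimes> g\<close> is invertible both points lie in \<open>T1\<close>, hence so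
  does their composite, because \<open>T1\<close> is an equivalence relation, and \<open>s\<close> becomes zero. Hence the element is
  killed by powers of all \<open>f \<otimes> g\<close>, and it is zero. For symmetry, \<open>C\<close> is a local ring of \<open>T1c\<close> itself;
  reflexivity is inherited from \<open>T1\<close>.

  Only spectra of local rings occur as test schemes, and these can be taken small enough for the universe.
\<close>

text \<open>Transitivity is naturally proved on the scheme of composable pairs of
  \<open>T1c\<close>, which would first have to be constructed. Only its local rings are used: a
  morphism from the spectrum of a local ring is a point together with a local homomorphism, so all
  test morphisms can be prescribed on stalks. The prime of \<open>C\<close> is the preimage of the
  maximal ideal of a local ring of \<open>X\<close>. That local ring may be too large for a spectrum
  in the universe, so its comparison with \<open>C\<close> passes through a small local subring.
  With k the cardinality of \<open>('p + 'r) list\<close>, the local rings used have at most k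
  elements, their spectra at most 2^k points and 2^(2^k) sections. \<open>flat_module\<close> tests
  only modules over the type of the base ring. This fits because \<open>T0\<close> and
  \<open>T1c\<close> have the same types of points and sections, so a local ring of
  \<open>T1c\<close> is itself a test module over a local ring of \<open>T0\<close>. Flatness is
  used for one kernel at a time. Hence the cutting functions must form a finite family: tensoring
  with a flat module respects finite intersections of kernels, but not infinite ones in general.
  This is the role of quasi-compactness.\<close>

abbreviation "secs X U \<equiv> carrier (sec X U)"
abbreviation "spec_secs R U \<equiv> carrier (spec_sections R U)"
abbreviation "stk X x \<equiv> carrier (stalk X x)"

text \<open>Germs, fractions and stalk maps are computed as unions over all representatives. Such a
  union collapses as soon as the class is nonempty and every representative yields the same
  set.\<close>

lemma union_class_eq:
  assumes "(V0, s0) \<in> A" "\<And>V s. (V, s) \<in> A \<Longrightarrow> F V s = C"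
  shows "\<Union>{F V s | V s. (V, s) \<in> A} = C"
proof -
  have "{F V s | V s. (V, s) \<in> A} = {C}" using assms by blast
  then show ?thesis by simp
qed

lemma union_classes_eq:
  assumes "(a0, s0) \<in> A" "(b0, t0) \<in> B"
    "\<And>a s b t. (a, s) \<in> A \<Longrightarrow> (b, t) \<in> B \<Longrightarrow> F a s b t = C"
  shows "\<Union>{F a s b t | a s b t. (a, s) \<in> A \<and> (b, t) \<in> B} = C"
proof -
  have "{F a s b t | a s b t. (a, s) \<in> A \<and> (b, t) \<in> B} = {C}" using assms by blast
  then show ?thesis by simp
qed

section \<open>Units, prime ideals and local rings\<close>

lemma (in cring) Units_of_mult_one:
  assumes "a \<in> carrier R" "b \<in> carrier R" "a \<otimes> b = \<one>"
  shows "a \<in> Units R"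
  unfolding Units_def using assms m_comm[of a b] by auto

lemma (in cring) Units_factor:
  assumes "a \<in> carrier R" "b \<in> carrier R" "a \<otimes> b \<in> Units R"
  shows "a \<in> Units R"
proof (rule Units_of_mult_one)
  show "b \<otimes> inv (a \<otimes> b) \<in> carrier R" using assms by simp
  show "a \<otimes> (b \<otimes> inv (a \<otimes> b)) = \<one>" using assms by (simp flip: m_assoc)
qed fact

lemma ring_hom_cringI2: "cring R \<Longrightarrow> cring S \<Longrightarrow> h \<in> ring_hom R S \<Longrightarrow> ring_hom_cring R S h"
  by (simp add: ring_hom_cring_def ring_hom_cring_axioms_def)

lemma ring_hom_cong:
  assumes "ring R" "h \<in> ring_hom R S" "\<And>x. x \<in> carrier R \<Longrightarrow> k x = h x"
  shows "k \<in> ring_hom R S"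
proof -
  interpret R: ring R by fact
  show ?thesis
    by (rule ring_hom_memI)
      (simp_all add: assms(3) ring_hom_closed[OF assms(2)] ring_hom_add[OF assms(2)] ring_hom_mult[OF assms(2)] ring_hom_one[OF assms(2)])
qed

lemma hom_Units:
  assumes "h \<in> ring_hom R S" "ring R" "ring S" "a \<in> Units R"
  shows "h a \<in> Units S"
proof -
  interpret R: ring R by fact
  obtain b where "b \<in> carrier R" "a \<in> carrier R" "a \<otimes>\<^bsub>R\<^esub> b = \<one>\<^bsub>R\<^esub>" "b \<otimes>\<^bsub>R\<^esub> a = \<one>\<^bsub>R\<^esub>"
    using assms(4) unfolding Units_def by auto
  then have "h b \<in> carrier S" "h a \<in> carrier S" "h a \<otimes>\<^bsub>S\<^esub> h b = \<one>\<^bsub>S\<^esub>" "h b \<otimes>\<^bsub>S\<^esub> h a = \<one>\<^bsub>S\<^esub>"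
    using ring_hom_closed[OF assms(1)] ring_hom_mult[OF assms(1)] ring_hom_one[OF assms(1)] by metis+
  then show ?thesis unfolding Units_def by auto
qed

text \<open>Zorn's lemma on the ideals above \<open>I\<close> that miss \<open>W\<close>. The set
  \<open>W\<close> is arbitrary because two cases are used: a multiplicative set leads to prime
  ideals, and \<open>{\<one>}\<close> to maximal ideals.\<close>

lemma (in cring) exists_ideal_maximal_avoiding:
  assumes I: "ideal I R" and dis: "I \<inter> W = {}"
  shows "\<exists>P. ideal P R \<and> I \<subseteq> P \<and> P \<inter> W = {} \<and> (\<forall>J. ideal J R \<and> P \<subseteq> J \<and> J \<inter> W = {} \<longrightarrow> J = P)"
proof -
  let ?S = "{J. ideal J R \<and> I \<subseteq> J \<and> J \<inter> W = {}}"
  have "\<exists>M\<in>?S. \<forall>X\<in>?S. M \<subseteq> X \<longrightarrow> X = M"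
  proof (rule subset_Zorn_nonempty)
    show "?S \<noteq> {}" using I dis by blast
    fix C assume "C \<noteq> {}" and C: "subset.chain ?S C"
    have sub: "C \<subseteq> ?S" and "subset.chain {J. ideal J R} C" using C unfolding subset_chain_def by auto
    then have "ideal (\<Union>C) R" using chain_Union_is_ideal[of C] \<open>C \<noteq> {}\<close> by simp
    moreover have "I \<subseteq> \<Union>C" using sub \<open>C \<noteq> {}\<close> by blast
    moreover have "\<Union>C \<inter> W = {}" using sub by blast
    ultimately show "\<Union>C \<in> ?S" by blast
  qed
  then obtain M where M: "ideal M R" "I \<subseteq> M" "M \<inter> W = {}" and mx: "\<And>X. X \<in> ?S \<Longrightarrow> M \<subseteq> X \<Longrightarrow> X = M"
    by auto
  have "\<forall>J. ideal J R \<and> M \<subseteq> J \<and> J \<inter> W = {} \<longrightarrow> J = M" using mx M(2) by blast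
  then show ?thesis using M by (intro exI[of _ M]) simp
qed

lemma (in cring) exists_prime_avoiding:
  assumes I: "ideal I R" and dis: "I \<inter> W = {}" and W: "W \<subseteq> carrier R" "\<one> \<in> W"
    "\<And>a b. a \<in> W \<Longrightarrow> b \<in> W \<Longrightarrow> a \<otimes> b \<in> W"
  obtains P where "primeideal P R" "I \<subseteq> P" "P \<inter> W = {}"
proof -
  obtain P where P: "ideal P R" "I \<subseteq> P" "P \<inter> W = {}" "\<And>J. ideal J R \<Longrightarrow> P \<subseteq> J \<Longrightarrow> J \<inter> W = {} \<Longrightarrow> J = P"
    using exists_ideal_maximal_avoiding[OF I dis] by auto
  interpret P: ideal P R by fact
  \<comment> \<open>By maximality, enlarging \<open>P\<close> by a principal ideal must run into
    \<open>W\<close>. For two elements outside \<open>P\<close> this gives two elements of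
    \<open>W\<close> whose product lies in \<open>P\<close> as soon as \<open>a \<otimes> b\<close>
    does.\<close>
  have meet: "\<exists>p \<in> P. \<exists>r \<in> carrier R. p \<oplus> r \<otimes> a \<in> W" if a: "a \<in> carrier R" "a \<notin> P" for a
  proof -
    let ?J = "P <+>\<^bsub>R\<^esub> PIdl a"
    have id: "ideal ?J R" by (rule add_ideals[OF P(1) cgenideal_ideal[OF a(1)]])
    have "P \<subseteq> ?J"
    proof
      fix p assume p: "p \<in> P"
      have "p = p \<oplus> \<zero> \<otimes> a" using P.Icarr[OF p] a by simp
      then show "p \<in> ?J" unfolding set_add_def' cgenideal_def using p by fast
    qed
    moreover have "a \<in> ?J"
    proof -
      have "a = \<zero> \<oplus> \<one> \<otimes> a" using a by simp
      moreover have "\<zero> \<in> P" by (rule P.zero_closed)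
      ultimately show "a \<in> ?J" unfolding set_add_def' cgenideal_def by fast
    qed
    ultimately have "?J \<inter> W \<noteq> {}" using P(4)[OF id] a(2) by blast
    then obtain w where "w \<in> W" "w \<in> ?J" by blast
    then show ?thesis by (auto simp: set_add_def' cgenideal_def)
  qed
  have "primeideal P R"
  proof (rule primeidealI)
    show "ideal P R" by fact
    show "cring R" by (rule is_cring)
    show "carrier R \<noteq> P" using P(3) W by blast
  next
    fix a b assume ab: "a \<in> carrier R" "b \<in> carrier R" "a \<otimes> b \<in> P"
    show "a \<in> P \<or> b \<in> P"
    proof (rule ccontr)
      assume "\<not> (a \<in> P \<or> b \<in> P)"
      then obtain p r q t where h: "p \<in> P" "r \<in> carrier R" "p \<oplus> r \<otimes> a \<in> W" "q \<in> P" "t \<in> carrier R" "q \<oplus> t \<otimes> b \<in> W"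
        using meet ab by meson
      have pq: "p \<in> carrier R" "q \<in> carrier R" using h P.Icarr by auto
      have "(p \<oplus> r \<otimes> a) \<otimes> (q \<oplus> t \<otimes> b) = p \<otimes> (q \<oplus> t \<otimes> b) \<oplus> (q \<otimes> (r \<otimes> a) \<oplus> (r \<otimes> t) \<otimes> (a \<otimes> b))"
        using h pq ab by algebra
      moreover have "\<dots> \<in> P" by (intro P.a_closed P.I_r_closed[OF h(1)] P.I_r_closed[OF h(4)] P.I_l_closed[OF ab(3)]) (use h pq ab in auto)
      ultimately show False using W(3)[OF h(3) h(6)] P(3) by auto
    qed
  qed
  then show thesis using that P by blast
qed

lemma (in cring) ideal_unit_carrier:
  assumes "ideal I R" "u \<in> I" "u \<in> Units R" shows "I = carrier R"
proof -
  interpret ideal I R by fact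
  have "u \<otimes> inv u \<in> I" using assms I_r_closed Units_inv_closed by blast
  then show ?thesis using assms one_imp_carrier by simp
qed

lemma (in cring) maximalideal_of_avoiding:
  assumes "ideal P R" "\<one> \<notin> P" "\<And>J. ideal J R \<Longrightarrow> P \<subseteq> J \<Longrightarrow> \<one> \<notin> J \<Longrightarrow> J = P"
  shows "maximalideal P R"
proof (rule maximalidealI)
  show "carrier R \<noteq> P" using assms(2) by auto
  fix J assume "ideal J R" "P \<subseteq> J" "J \<subseteq> carrier R"
  then show "J = P \<or> J = carrier R" using assms(3) ideal.one_imp_carrier by blast
qed fact

lemma zero_not_Unit: fixes R (structure) assumes "cring R" "\<one>\<^bsub>R\<^esub> \<noteq> \<zero>\<^bsub>R\<^esub>" shows "\<zero>\<^bsub>R\<^esub> \<notin> Units R"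
proof
  interpret cring R by fact
  assume z: "\<zero> \<in> Units R"
  have "\<one> = \<zero> \<otimes> inv \<zero>" using Units_r_inv[OF z] by simp
  also have "\<dots> = \<zero>" using Units_inv_closed[OF z] by simp
  finally show False using assms by simp
qed

text \<open>Every nonunit lies in some maximal ideal, hence in the only one. The criterion by sums
  of nonunits is the form in which localness passes to localizations, to small subrings and to
  images under surjections that reflect units.\<close>

lemma local_ring_iff:
  fixes R (structure)
  shows "local_ring R \<longleftrightarrow> cring R \<and> \<one>\<^bsub>R\<^esub> \<noteq> \<zero>\<^bsub>R\<^esub> \<and> (\<forall>a \<in> carrier R. \<forall>b \<in> carrier R. a \<notin> Units R \<and> b \<notin> Units R \<longrightarrow> a \<oplus>\<^bsub>R\<^esub> b \<notin> Units R)"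
    (is "_ \<longleftrightarrow> _ \<and> ?nz \<and> ?add")
proof
  assume l: "local_ring R"
  then interpret cring R unfolding local_ring_def by blast
  obtain M where M: "maximalideal M R" and u: "\<And>I. maximalideal I R \<Longrightarrow> I = M"
    using l unfolding local_ring_def by auto
  interpret M: maximalideal M R by fact
  have inM: "a \<in> M" if a: "a \<in> carrier R" "a \<notin> Units R" for a
  proof -
    have "\<one> \<noteq> r \<otimes> a" if "r \<in> carrier R" for r using Units_of_mult_one[OF a(1) that] m_comm[OF that a(1)] a(2) by auto
    then have "PIdl a \<inter> {\<one>} = {}" by (auto simp: cgenideal_def)
    then obtain P where P: "ideal P R" "PIdl a \<subseteq> P" "P \<inter> {\<one>} = {}" "\<And>J. ideal J R \<Longrightarrow> P \<subseteq> J \<Longrightarrow> J \<inter> {\<one>} = {} \<Longrightarrow> J = P"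
      using exists_ideal_maximal_avoiding[OF cgenideal_ideal[OF a(1)], of "{\<one>}"] by auto
    have "maximalideal P R" by (rule maximalideal_of_avoiding) (use P in auto)
    then have "P = M" by (rule u)
    then show "a \<in> M" using P(2) cgenideal_self[OF a(1)] by auto
  qed
  have nM: "a \<notin> Units R" if "a \<in> M" for a
    using ideal_unit_carrier[OF M.is_ideal that] M.I_notcarr by auto
  have ?nz using nM[OF M.zero_closed] Units_one_closed by metis
  moreover have ?add
  proof (intro ballI impI)
    fix a b assume "a \<in> carrier R" "b \<in> carrier R" "a \<notin> Units R \<and> b \<notin> Units R"
    then have "a \<oplus> b \<in> M" using inM M.a_closed by simp
    then show "a \<oplus> b \<notin> Units R" by (rule nM)
  qed
  ultimately show "cring R \<and> ?nz \<and> ?add" using is_cring by blast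
next
  assume h: "cring R \<and> ?nz \<and> ?add"
  then interpret cring R by blast
  let ?M = "carrier R - Units R"
  have mult: "x \<otimes> a \<in> ?M" if "a \<in> ?M" "x \<in> carrier R" for a x
    using that Units_factor[of a x] m_comm[of x a] by auto
  have id: "ideal ?M R"
  proof (rule idealI)
    show "ring R" by (rule ring_axioms)
    show "subgroup ?M (add_monoid R)"
    proof (rule add.subgroupI)
      show "?M \<noteq> {}" using zero_not_Unit[OF is_cring] h by auto
      fix a assume a: "a \<in> ?M"
      have "\<ominus> a = (\<ominus> \<one>) \<otimes> a" using a by (simp add: l_minus)
      then show "\<ominus> a \<in> ?M" using mult[OF a, of "\<ominus> \<one>"] by simp
    qed (use h in auto)
    fix a x assume "a \<in> ?M" "x \<in> carrier R"
    then show "x \<otimes> a \<in> ?M" "a \<otimes> x \<in> ?M" using mult m_comm by auto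
  qed
  interpret M: ideal ?M R by fact
  have mx: "J \<subseteq> ?M" if J: "ideal J R" "J \<noteq> carrier R" for J
    using ideal_unit_carrier[OF J(1)] J ideal.Icarr[OF J(1)] by blast
  have "maximalideal ?M R"
  proof (rule maximalidealI)
    fix J assume "ideal J R" "?M \<subseteq> J" "J \<subseteq> carrier R"
    then show "J = ?M \<or> J = carrier R" using mx by blast
  qed (use id in auto)
  moreover have "I = ?M" if "maximalideal I R" for I
    using mx[of I] maximalideal.I_maximal[OF that id] that maximalideal.axioms(1) M.a_subset
      maximalideal.I_notcarr Units_one_closed by blast
  ultimately show "local_ring R" unfolding local_ring_def using is_cring by blast
qed

lemma local_ring_cring: "local_ring R \<Longrightarrow> cring R"
  unfolding local_ring_def by blast

lemma local_ring_nontriv: "local_ring R \<Longrightarrow> \<one>\<^bsub>R\<^esub> \<noteq> \<zero>\<^bsub>R\<^esub>"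
  unfolding local_ring_iff by blast

text \<open>This is the preimage of the maximal ideal of \<open>L\<close>, described through units
  alone. It is the point of the spectrum of \<open>R\<close> that a local ring maps to; for the
  identity of a local ring it is the closed point.\<close>

lemma hom_nonunits_prime:
  assumes R: "cring R" and L: "local_ring L" and h: "h \<in> ring_hom R L"
  shows "primeideal {a \<in> carrier R. h a \<notin> Units L} R"
proof -
  interpret R: cring R by fact
  interpret L: cring L using L by (rule local_ring_cring)
  interpret h: ring_hom_cring R L h by (rule ring_hom_cringI2[OF R.is_cring L.is_cring h])
  let ?P = "{a \<in> carrier R. h a \<notin> Units L}"
  have fac: "h a \<in> Units L" if "a \<in> carrier R" "b \<in> carrier R" "h (a \<otimes>\<^bsub>R\<^esub> b) \<in> Units L" for a b
    using that L.Units_factor[of "h a" "h b"] by simp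
  have mult: "x \<otimes>\<^bsub>R\<^esub> a \<in> ?P" "a \<otimes>\<^bsub>R\<^esub> x \<in> ?P" if "a \<in> ?P" "x \<in> carrier R" for a x
    using that fac[of a x] R.m_comm[of x a] by auto
  have id: "ideal ?P R"
  proof (rule idealI)
    show "ring R" by (rule R.ring_axioms)
    show "subgroup ?P (add_monoid R)"
    proof (rule R.add.subgroupI)
      have "\<zero>\<^bsub>R\<^esub> \<in> ?P" using zero_not_Unit[OF L.is_cring local_ring_nontriv[OF L]] by simp
      then show "?P \<noteq> {}" by blast
      fix a assume a: "a \<in> ?P"
      have "\<ominus>\<^bsub>R\<^esub> a = (\<ominus>\<^bsub>R\<^esub> \<one>\<^bsub>R\<^esub>) \<otimes>\<^bsub>R\<^esub> a" using a by (simp add: R.l_minus)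
      then show "\<ominus>\<^bsub>R\<^esub> a \<in> ?P" using mult[OF a, of "\<ominus>\<^bsub>R\<^esub> \<one>\<^bsub>R\<^esub>"] by simp
    next
      fix a b assume "a \<in> ?P" "b \<in> ?P"
      then show "a \<oplus>\<^bsub>R\<^esub> b \<in> ?P" using L unfolding local_ring_iff by simp
    qed auto
  qed (use mult in auto)
  show ?thesis
  proof (rule primeidealI[OF id R.is_cring])
    have "\<one>\<^bsub>R\<^esub> \<notin> ?P" by simp
    then show "carrier R \<noteq> ?P" using R.one_closed by blast
    fix a b assume "a \<in> carrier R" "b \<in> carrier R" "a \<otimes>\<^bsub>R\<^esub> b \<in> ?P"
    then show "a \<in> ?P \<or> b \<in> ?P" by auto
  qed
qed

lemma cringI3:
  fixes R (structure)
  assumes "\<And>a b. a \<in> carrier R \<Longrightarrow> b \<in> carrier R \<Longrightarrow> a \<oplus> b \<in> carrier R \<and> a \<otimes> b \<in> carrier R \<and> a \<oplus> b = b \<oplus> a \<and> a \<otimes> b = b \<otimes> a"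
    and "\<And>a b c. a \<in> carrier R \<Longrightarrow> b \<in> carrier R \<Longrightarrow> c \<in> carrier R \<Longrightarrow>
      a \<oplus> b \<oplus> c = a \<oplus> (b \<oplus> c) \<and> a \<otimes> b \<otimes> c = a \<otimes> (b \<otimes> c) \<and> (a \<oplus> b) \<otimes> c = a \<otimes> c \<oplus> b \<otimes> c"
    and "\<zero> \<in> carrier R \<and> \<one> \<in> carrier R"
    and "\<And>a. a \<in> carrier R \<Longrightarrow> \<zero> \<oplus> a = a \<and> \<one> \<otimes> a = a \<and> (\<exists>b \<in> carrier R. b \<oplus> a = \<zero>)"
  shows "cring R"
  by (rule cringI; (rule abelian_groupI | rule comm_monoidI)?) (use assms in blast)+

section \<open>Sections, germs and stalks of a ringed space\<close>

locale rspace = fixes X :: "('p, 'r) ringed_space" assumes ringed: "ringed_space X"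
begin

lemmas ringed_conds = ringed[unfolded ringed_space_def]

lemma sec_cring: "opn X U \<Longrightarrow> cring (sec X U)"
  using ringed_conds[THEN conjunct1] by simp

lemma sec_ring: "opn X U \<Longrightarrow> ring (sec X U)"
  by (rule cring.axioms(1)[OF sec_cring])

lemma res_hom: "opn X U \<Longrightarrow> opn X V \<Longrightarrow> V \<subseteq> U \<Longrightarrow> res X U V \<in> ring_hom (sec X U) (sec X V)"
  using ringed_conds[THEN conjunct2, THEN conjunct1] by simp

lemma res_closed: "opn X U \<Longrightarrow> opn X V \<Longrightarrow> V \<subseteq> U \<Longrightarrow> s \<in> secs X U \<Longrightarrow> res X U V s \<in> secs X V"
  by (rule ring_hom_closed[OF res_hom])

lemma res_id: "opn X U \<Longrightarrow> s \<in> secs X U \<Longrightarrow> res X U U s = s"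
  using ringed_conds[THEN conjunct2, THEN conjunct2, THEN conjunct1] by simp

lemma res_res: "opn X U \<Longrightarrow> opn X V \<Longrightarrow> opn X W \<Longrightarrow> W \<subseteq> V \<Longrightarrow> V \<subseteq> U \<Longrightarrow> s \<in> secs X U \<Longrightarrow>
    res X V W (res X U V s) = res X U W s"
  using ringed_conds[THEN conjunct2, THEN conjunct2, THEN conjunct2, THEN conjunct1] by simp

lemma res_add: "opn X U \<Longrightarrow> opn X V \<Longrightarrow> V \<subseteq> U \<Longrightarrow> s \<in> secs X U \<Longrightarrow> t \<in> secs X U \<Longrightarrow>
    res X U V (s \<oplus>\<^bsub>sec X U\<^esub> t) = res X U V s \<oplus>\<^bsub>sec X V\<^esub> res X U V t"
  by (rule ring_hom_add[OF res_hom])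

lemma res_mult: "opn X U \<Longrightarrow> opn X V \<Longrightarrow> V \<subseteq> U \<Longrightarrow> s \<in> secs X U \<Longrightarrow> t \<in> secs X U \<Longrightarrow>
    res X U V (s \<otimes>\<^bsub>sec X U\<^esub> t) = res X U V s \<otimes>\<^bsub>sec X V\<^esub> res X U V t"
  by (rule ring_hom_mult[OF res_hom])

lemma res_one: "opn X U \<Longrightarrow> opn X V \<Longrightarrow> V \<subseteq> U \<Longrightarrow> res X U V \<one>\<^bsub>sec X U\<^esub> = \<one>\<^bsub>sec X V\<^esub>"
  by (rule ring_hom_one[OF res_hom])

lemma res_zero: "opn X U \<Longrightarrow> opn X V \<Longrightarrow> V \<subseteq> U \<Longrightarrow> res X U V \<zero>\<^bsub>sec X U\<^esub> = \<zero>\<^bsub>sec X V\<^esub>"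
  by (rule ring_hom_zero[OF res_hom sec_ring sec_ring])

lemma sep: "(\<And>V. V \<in> \<U> \<Longrightarrow> opn X V) \<Longrightarrow> s \<in> secs X (\<Union>\<U>) \<Longrightarrow> t \<in> secs X (\<Union>\<U>) \<Longrightarrow>
    (\<And>V. V \<in> \<U> \<Longrightarrow> res X (\<Union>\<U>) V s = res X (\<Union>\<U>) V t) \<Longrightarrow> s = t"
proof -
  assume a: "\<And>V. V \<in> \<U> \<Longrightarrow> opn X V" "s \<in> secs X (\<Union>\<U>)" "t \<in> secs X (\<Union>\<U>)"
    "\<And>V. V \<in> \<U> \<Longrightarrow> res X (\<Union>\<U>) V s = res X (\<Union>\<U>) V t"
  have "\<forall>\<U>. (\<forall>V \<in> \<U>. opn X V) \<longrightarrow>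
        (\<forall>s \<in> secs X (\<Union>\<U>). \<forall>t \<in> secs X (\<Union>\<U>).
           (\<forall>V \<in> \<U>. res X (\<Union>\<U>) V s = res X (\<Union>\<U>) V t) \<longrightarrow> s = t)"
    by (rule ringed_conds[THEN conjunct2, THEN conjunct2, THEN conjunct2, THEN conjunct2, THEN conjunct1])
  from spec[OF this, of \<U>] a show ?thesis by simp
qed

lemma glue: assumes "\<And>V. V \<in> \<U> \<Longrightarrow> opn X V" "\<And>V. V \<in> \<U> \<Longrightarrow> s V \<in> secs X V"
    "\<And>V W. V \<in> \<U> \<Longrightarrow> W \<in> \<U> \<Longrightarrow> res X V (V \<inter> W) (s V) = res X W (V \<inter> W) (s W)"
  shows "\<exists>t \<in> secs X (\<Union>\<U>). \<forall>V \<in> \<U>. res X (\<Union>\<U>) V t = s V"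
proof -
  have "\<forall>\<U> s. (\<forall>V \<in> \<U>. opn X V \<and> s V \<in> secs X V) \<and>
        (\<forall>V \<in> \<U>. \<forall>W \<in> \<U>. res X V (V \<inter> W) (s V) = res X W (V \<inter> W) (s W)) \<longrightarrow>
        (\<exists>t \<in> secs X (\<Union>\<U>). \<forall>V \<in> \<U>. res X (\<Union>\<U>) V t = s V)"
    by (rule ringed_conds[THEN conjunct2, THEN conjunct2, THEN conjunct2, THEN conjunct2, THEN conjunct2])
  from spec[OF spec[OF this, of \<U>], of s] show ?thesis by (rule mp) (use assms in blast)
qed

lemma germ_eq_iff:
  assumes "opn X U" "x \<in> U" "s \<in> secs X U" "opn X V" "x \<in> V" "t \<in> secs X V"
  shows "germ X x U s = germ X x V t \<longleftrightarrow> (\<exists>W. opn X W \<and> x \<in> W \<and> W \<subseteq> U \<inter> V \<and> res X U W s = res X V W t)"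
    (is "_ \<longleftrightarrow> ?R")
proof
  have "(V, t) \<in> germ X x V t" using assms unfolding germ_def by blast
  moreover assume "germ X x U s = germ X x V t"
  ultimately have "(V, t) \<in> germ X x U s" by simp
  then show ?R unfolding germ_def by blast
next
  have sub: "germ X x V' t' \<subseteq> germ X x U' s'" if "opn X W" "x \<in> W" "W \<subseteq> U' \<inter> V'" "res X U' W s' = res X V' W t'"
    "opn X U'" "x \<in> U'" "s' \<in> secs X U'" "opn X V'" "x \<in> V'" "t' \<in> secs X V'" for U' V' W s' t'
  proof (clarsimp simp: germ_def)
    fix V2 t2 W2
    assume h: "opn X V2" "x \<in> V2" "t2 \<in> secs X V2" "opn X W2" "x \<in> W2" "W2 \<subseteq> V'" "W2 \<subseteq> V2"
      "res X V' W2 t' = res X V2 W2 t2"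
    have o: "opn X (W \<inter> W2)" using h that by blast
    have "res X U' (W \<inter> W2) s' = res X W (W \<inter> W2) (res X U' W s')"
      using res_res[of U' W "W \<inter> W2" s'] that h o by auto
    also have "\<dots> = res X V' (W \<inter> W2) t'"
      using res_res[of V' W "W \<inter> W2" t'] that h o by auto
    also have "\<dots> = res X W2 (W \<inter> W2) (res X V' W2 t')"
      using res_res[of V' W2 "W \<inter> W2" t'] that h o by auto
    also have "\<dots> = res X V2 (W \<inter> W2) t2"
      using res_res[of V2 W2 "W \<inter> W2" t2] that h o by auto
    finally show "\<exists>W. opn X W \<and> x \<in> W \<and> W \<subseteq> U' \<and> W \<subseteq> V2 \<and> res X U' W s' = res X V2 W t2"
      using o that h by (intro exI[of _ "W \<inter> W2"]) auto
  qed
  assume ?R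
  then obtain W where W: "opn X W" "x \<in> W" "W \<subseteq> U \<inter> V" "res X U W s = res X V W t" by blast
  show "germ X x U s = germ X x V t"
  proof (rule subset_antisym)
    show "germ X x V t \<subseteq> germ X x U s" by (rule sub[OF W assms])
    show "germ X x U s \<subseteq> germ X x V t" by (rule sub[OF W(1,2) _ W(4)[symmetric] assms(4-6) assms(1-3)]) (use W in blast)
  qed
qed

lemmas germ_eqD = germ_eq_iff[THEN iffD1]

lemma germ_res: "opn X U \<Longrightarrow> opn X W \<Longrightarrow> x \<in> W \<Longrightarrow> W \<subseteq> U \<Longrightarrow> s \<in> secs X U \<Longrightarrow>
   germ X x W (res X U W s) = germ X x U s"
  by (subst germ_eq_iff) (auto simp: res_closed res_id intro!: exI[of _ W])

lemma germ_self: "opn X U \<Longrightarrow> x \<in> U \<Longrightarrow> s \<in> secs X U \<Longrightarrow> (U, s) \<in> germ X x U s"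
  unfolding germ_def by blast

lemma germ_memD: assumes "(V, t) \<in> germ X x U s" "opn X U" "x \<in> U" "s \<in> secs X U"
  shows "opn X V" "x \<in> V" "t \<in> secs X V" "germ X x V t = germ X x U s"
proof -
  show *: "opn X V" "x \<in> V" "t \<in> secs X V" using assms unfolding germ_def by auto
  show "germ X x V t = germ X x U s"
    using * assms by (subst eq_commute, subst germ_eq_iff) (auto simp: germ_def)
qed

lemma carrier_stalk: "stk X x = {germ X x U s | U s. opn X U \<and> x \<in> U \<and> s \<in> secs X U}"
  by (simp add: stalk_def)

lemma germ_in_stalk: "opn X U \<Longrightarrow> x \<in> U \<Longrightarrow> s \<in> secs X U \<Longrightarrow> germ X x U s \<in> stk X x"
  unfolding carrier_stalk by blast

lemma stalkE: assumes "A \<in> stk X x"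
  obtains U s where "opn X U" "x \<in> U" "s \<in> secs X U" "A = germ X x U s"
  using assms unfolding carrier_stalk by blast

lemma stalkE_sub: assumes "A \<in> stk X x" "opn X V" "x \<in> V"
  obtains U s where "opn X U" "x \<in> U" "U \<subseteq> V" "s \<in> secs X U" "A = germ X x U s"
proof -
  obtain U s where *: "opn X U" "x \<in> U" "s \<in> secs X U" "A = germ X x U s" using assms(1) by (rule stalkE)
  show thesis
    by (rule that[of "U \<inter> V" "res X U (U \<inter> V) s"]) (use * assms in \<open>auto simp: germ_res res_closed openin_Int\<close>)
qed

lemma stalkE2: assumes "A \<in> stk X x" "B \<in> stk X x"
  obtains U s t where "opn X U" "x \<in> U" "s \<in> secs X U" "A = germ X x U s"
    "t \<in> secs X U" "B = germ X x U t"
proof -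
  obtain V t where *: "opn X V" "x \<in> V" "t \<in> secs X V" "B = germ X x V t" using assms(2) by (rule stalkE)
  obtain U s where **: "opn X U" "x \<in> U" "U \<subseteq> V" "s \<in> secs X U" "A = germ X x U s"
    using stalkE_sub[OF assms(1) *(1,2)] by metis
  show thesis
    by (rule that[of U s "res X V U t"]) (use * ** in \<open>auto simp: germ_res res_closed\<close>)
qed

lemma stalkE3: assumes "A \<in> stk X x" "B \<in> stk X x" "C \<in> stk X x"
  obtains U s t u where "opn X U" "x \<in> U" "s \<in> secs X U" "A = germ X x U s"
    "t \<in> secs X U" "B = germ X x U t" "u \<in> secs X U" "C = germ X x U u"
proof -
  obtain V t u where *: "opn X V" "x \<in> V" "t \<in> secs X V" "B = germ X x V t"
    "u \<in> secs X V" "C = germ X x V u" using assms(2,3) by (rule stalkE2)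
  obtain U s where **: "opn X U" "x \<in> U" "U \<subseteq> V" "s \<in> secs X U" "A = germ X x U s"
    using stalkE_sub[OF assms(1) *(1,2)] by metis
  show thesis
    by (rule that[of U s "res X V U t" "res X V U u"]) (use * ** in \<open>auto simp: germ_res res_closed\<close>)
qed

text \<open>Independence of representatives for both operations: the two given equalities of germs
  hold on neighbourhoods \<open>W1\<close> and \<open>W2\<close>, and on their intersection products
  and sums can be compared.\<close>

lemma germ_cong2:
  assumes "opn X U" "x \<in> U" "s \<in> secs X U" "t \<in> secs X U"
    "opn X U'" "x \<in> U'" "s' \<in> secs X U'" "germ X x U' s' = germ X x U s"
    "opn X V'" "x \<in> V'" "t' \<in> secs X V'" "germ X x V' t' = germ X x U t"
  shows "germ X x (U' \<inter> V') (res X U' (U' \<inter> V') s' \<otimes>\<^bsub>sec X (U' \<inter> V')\<^esub> res X V' (U' \<inter> V') t') = germ X x U (s \<otimes>\<^bsub>sec X U\<^esub> t)" (is ?T1)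
    "germ X x (U' \<inter> V') (res X U' (U' \<inter> V') s' \<oplus>\<^bsub>sec X (U' \<inter> V')\<^esub> res X V' (U' \<inter> V') t') = germ X x U (s \<oplus>\<^bsub>sec X U\<^esub> t)" (is ?T2)
proof -
  obtain W1 where W1: "opn X W1" "x \<in> W1" "W1 \<subseteq> U' \<inter> U" "res X U' W1 s' = res X U W1 s"
    using assms(8) germ_eq_iff[OF assms(5-7) assms(1-3)] by blast
  obtain W2 where W2: "opn X W2" "x \<in> W2" "W2 \<subseteq> V' \<inter> U" "res X V' W2 t' = res X U W2 t"
    using assms(12) germ_eq_iff[OF assms(9-11) assms(1,2,4)] by blast
  define W where "W = W1 \<inter> W2"
  have W: "opn X W" "x \<in> W" "W \<subseteq> U" "W \<subseteq> U' \<inter> V'" "W \<subseteq> W1" "W \<subseteq> W2" using W1 W2 by (auto simp: W_def)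
  have a: "res X U' W s' = res X U W s"
    using res_res[of U' W1 W s'] res_res[of U W1 W s] assms W1 W by auto
  have b: "res X V' W t' = res X U W t"
    using res_res[of V' W2 W t'] res_res[of U W2 W t] assms W2 W by auto
  have o: "opn X (U' \<inter> V')" using assms by blast
  interpret R: ring "sec X U" using sec_ring assms by blast
  interpret R': ring "sec X (U' \<inter> V')" using sec_ring o by blast
  have c: "res X U' (U' \<inter> V') s' \<in> secs X (U' \<inter> V')" "res X V' (U' \<inter> V') t' \<in> secs X (U' \<inter> V')"
    using assms o by (auto intro!: res_closed)
  have r: "res X (U' \<inter> V') W (res X U' (U' \<inter> V') s') = res X U W s"
       "res X (U' \<inter> V') W (res X V' (U' \<inter> V') t') = res X U W t"
    using res_res[of U' "U' \<inter> V'" W s'] res_res[of V' "U' \<inter> V'" W t'] a b assms o W by auto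
  have xI: "x \<in> U' \<inter> V'" using assms by blast
  have WI: "W \<subseteq> (U' \<inter> V') \<inter> U" using W by blast
  show ?T1
    by (rule germ_eq_iff[OF o xI R'.m_closed[OF c] assms(1,2) R.m_closed[OF assms(3,4)], THEN iffD2], rule exI[of _ W])
      (use W WI assms c o r in \<open>simp add: res_mult\<close>)
  show ?T2
    by (rule germ_eq_iff[OF o xI R'.a_closed[OF c] assms(1,2) R.a_closed[OF assms(3,4)], THEN iffD2], rule exI[of _ W])
      (use W WI assms c o r in \<open>simp add: res_add\<close>)
qed

lemma stalk_mult: assumes "opn X U" "x \<in> U" "s \<in> secs X U" "t \<in> secs X U"
  shows "germ X x U s \<otimes>\<^bsub>stalk X x\<^esub> germ X x U t = germ X x U (s \<otimes>\<^bsub>sec X U\<^esub> t)"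
  unfolding stalk_def monoid.simps
proof (rule union_classes_eq)
  show "(U, s) \<in> germ X x U s" "(U, t) \<in> germ X x U t" using assms germ_self by auto
next
  fix U' s' V' t' assume a: "(U', s') \<in> germ X x U s" and b: "(V', t') \<in> germ X x U t"
  show "germ X x (U' \<inter> V') (res X U' (U' \<inter> V') s' \<otimes>\<^bsub>sec X (U' \<inter> V')\<^esub> res X V' (U' \<inter> V') t') = germ X x U (s \<otimes>\<^bsub>sec X U\<^esub> t)"
    by (rule germ_cong2(1)[OF assms germ_memD[OF a assms(1-3)] germ_memD[OF b assms(1,2,4)]])
qed

lemma stalk_add: assumes "opn X U" "x \<in> U" "s \<in> secs X U" "t \<in> secs X U"
  shows "germ X x U s \<oplus>\<^bsub>stalk X x\<^esub> germ X x U t = germ X x U (s \<oplus>\<^bsub>sec X U\<^esub> t)"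
  unfolding stalk_def ring.simps
proof (rule union_classes_eq)
  show "(U, s) \<in> germ X x U s" "(U, t) \<in> germ X x U t" using assms germ_self by auto
next
  fix U' s' V' t' assume a: "(U', s') \<in> germ X x U s" and b: "(V', t') \<in> germ X x U t"
  show "germ X x (U' \<inter> V') (res X U' (U' \<inter> V') s' \<oplus>\<^bsub>sec X (U' \<inter> V')\<^esub> res X V' (U' \<inter> V') t') = germ X x U (s \<oplus>\<^bsub>sec X U\<^esub> t)"
    by (rule germ_cong2(2)[OF assms germ_memD[OF a assms(1-3)] germ_memD[OF b assms(1,2,4)]])
qed

lemma opn_points: "opn X (points X)" by simp

lemma opn_sub: "opn X U \<Longrightarrow> U \<subseteq> points X" by (rule openin_subset)

lemma stalk_one: assumes "opn X U" "x \<in> U" shows "\<one>\<^bsub>stalk X x\<^esub> = germ X x U \<one>\<^bsub>sec X U\<^esub>"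
proof -
  interpret R: ring "sec X (points X)" using sec_ring by simp
  show ?thesis using germ_res[OF opn_points assms(1,2) opn_sub[OF assms(1)] R.one_closed]
    by (simp add: stalk_def res_one[OF opn_points assms(1) opn_sub[OF assms(1)]])
qed

lemma stalk_zero: assumes "opn X U" "x \<in> U" shows "\<zero>\<^bsub>stalk X x\<^esub> = germ X x U \<zero>\<^bsub>sec X U\<^esub>"
proof -
  interpret R: ring "sec X (points X)" using sec_ring by simp
  show ?thesis using germ_res[OF opn_points assms(1,2) opn_sub[OF assms(1)] R.zero_closed]
    by (simp add: stalk_def res_zero[OF opn_points assms(1) opn_sub[OF assms(1)]])
qed

lemma stalk_cring: assumes x: "x \<in> points X" shows "cring (stalk X x)"
proof (rule cringI3)
  fix A B C assume A: "A \<in> stk X x" and B: "B \<in> stk X x" and C: "C \<in> stk X x"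
  obtain U s t u where *: "opn X U" "x \<in> U" "s \<in> secs X U" "A = germ X x U s"
    "t \<in> secs X U" "B = germ X x U t" "u \<in> secs X U" "C = germ X x U u" by (rule stalkE3[OF A B C])
  interpret cring "sec X U" using * sec_cring by blast
  show "A \<oplus>\<^bsub>stalk X x\<^esub> B \<oplus>\<^bsub>stalk X x\<^esub> C = A \<oplus>\<^bsub>stalk X x\<^esub> (B \<oplus>\<^bsub>stalk X x\<^esub> C) \<and> A \<otimes>\<^bsub>stalk X x\<^esub> B \<otimes>\<^bsub>stalk X x\<^esub> C = A \<otimes>\<^bsub>stalk X x\<^esub> (B \<otimes>\<^bsub>stalk X x\<^esub> C) \<and>
      (A \<oplus>\<^bsub>stalk X x\<^esub> B) \<otimes>\<^bsub>stalk X x\<^esub> C = A \<otimes>\<^bsub>stalk X x\<^esub> C \<oplus>\<^bsub>stalk X x\<^esub> B \<otimes>\<^bsub>stalk X x\<^esub> C"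
    using * by (simp add: stalk_mult stalk_add a_assoc m_assoc l_distr)
next
  fix A B assume A: "A \<in> stk X x" and B: "B \<in> stk X x"
  obtain U s t where *: "opn X U" "x \<in> U" "s \<in> secs X U" "A = germ X x U s"
    "t \<in> secs X U" "B = germ X x U t" by (rule stalkE2[OF A B])
  interpret cring "sec X U" using * sec_cring by blast
  show "A \<oplus>\<^bsub>stalk X x\<^esub> B \<in> stk X x \<and> A \<otimes>\<^bsub>stalk X x\<^esub> B \<in> stk X x \<and>
      A \<oplus>\<^bsub>stalk X x\<^esub> B = B \<oplus>\<^bsub>stalk X x\<^esub> A \<and> A \<otimes>\<^bsub>stalk X x\<^esub> B = B \<otimes>\<^bsub>stalk X x\<^esub> A"
    using * by (simp add: stalk_mult stalk_add germ_in_stalk a_comm m_comm)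
  show "\<zero>\<^bsub>stalk X x\<^esub> \<oplus>\<^bsub>stalk X x\<^esub> A = A \<and> \<one>\<^bsub>stalk X x\<^esub> \<otimes>\<^bsub>stalk X x\<^esub> A = A \<and> (\<exists>B \<in> stk X x. B \<oplus>\<^bsub>stalk X x\<^esub> A = \<zero>\<^bsub>stalk X x\<^esub>)"
    using * by (auto simp: stalk_mult stalk_add stalk_zero[of U] stalk_one[of U] l_neg germ_in_stalk intro!: bexI[of _ "germ X x U (\<ominus>\<^bsub>sec X U\<^esub> s)"])
next
  interpret cring "sec X (points X)" using sec_cring by simp
  show "\<zero>\<^bsub>stalk X x\<^esub> \<in> stk X x \<and> \<one>\<^bsub>stalk X x\<^esub> \<in> stk X x"
    by (simp add: stalk_zero[OF opn_points x] stalk_one[OF opn_points x] germ_in_stalk x)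
qed

lemma germ_hom: assumes "opn X U" "x \<in> U" shows "germ X x U \<in> ring_hom (sec X U) (stalk X x)"
  by (rule ring_hom_memI) (simp_all add: germ_in_stalk stalk_mult stalk_add stalk_one[OF assms] assms)

lemma sec_eqI:
  assumes "opn X U" "s \<in> secs X U" "t \<in> secs X U"
    "\<And>x. x \<in> U \<Longrightarrow> germ X x U s = germ X x U t"
  shows "s = t"
proof -
  let ?U = "{W. opn X W \<and> W \<subseteq> U \<and> res X U W s = res X U W t}"
  have "\<exists>W \<in> ?U. x \<in> W" if "x \<in> U" for x
    using assms(4)[OF that] germ_eq_iff[OF assms(1) that assms(2) assms(1) that assms(3)] by auto
  then have "U = \<Union>?U" by blast
  then show ?thesis using sep[of ?U s t] assms by auto
qed

text \<open>Sections are treated as functions with values in the stalks: local representability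
  gives existence by gluing, and separation gives uniqueness. Comorphisms can then be defined stalk
  by stalk.\<close>

lemma glue_germs:
  assumes U: "opn X U"
    and loc: "\<And>x. x \<in> U \<Longrightarrow> \<exists>W t. opn X W \<and> x \<in> W \<and> W \<subseteq> U \<and> t \<in> secs X W \<and> (\<forall>y \<in> W. germ X y W t = \<gamma> y)"
  shows "\<exists>!t. t \<in> secs X U \<and> (\<forall>x \<in> U. germ X x U t = \<gamma> x)"
proof -
  define P where "P = (\<lambda>W t. t \<in> secs X W \<and> (\<forall>y \<in> W. germ X y W t = \<gamma> y))"
  define \<U> where "\<U> = {W. opn X W \<and> W \<subseteq> U \<and> (\<exists>t. P W t)}"
  define s where "s = (\<lambda>W. SOME t. P W t)"
  have s: "P W (s W)" if "W \<in> \<U>" for W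
    using that someI_ex[of "P W"] unfolding \<U>_def s_def by blast
  have UU: "U = \<Union>\<U>"
  proof (rule subset_antisym)
    show "U \<subseteq> \<Union>\<U>"
    proof
      fix x assume "x \<in> U"
      then obtain W t where W: "opn X W" "x \<in> W" "W \<subseteq> U" "P W t" using loc[of x] unfolding P_def by auto
      then have "W \<in> \<U>" unfolding \<U>_def by auto
      then show "x \<in> \<Union>\<U>" using W(2) by auto
    qed
  qed (auto simp: \<U>_def)
  have "\<exists>t \<in> secs X (\<Union>\<U>). \<forall>V \<in> \<U>. res X (\<Union>\<U>) V t = s V"
  proof (rule glue)
    fix V W assume VW: "V \<in> \<U>" "W \<in> \<U>"
    have o: "opn X V" "opn X W" "opn X (V \<inter> W)" using VW \<U>_def by auto
    have c: "s V \<in> secs X V" "s W \<in> secs X W" using s VW P_def by auto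
    show "res X V (V \<inter> W) (s V) = res X W (V \<inter> W) (s W)"
    proof (rule sec_eqI)
      fix x assume "x \<in> V \<inter> W"
      then have "germ X x (V \<inter> W) (res X V (V \<inter> W) (s V)) = \<gamma> x" "germ X x (V \<inter> W) (res X W (V \<inter> W) (s W)) = \<gamma> x"
        using s VW P_def germ_res o c by auto
      then show "germ X x (V \<inter> W) (res X V (V \<inter> W) (s V)) = germ X x (V \<inter> W) (res X W (V \<inter> W) (s W))" by simp
    qed (use o c res_closed in auto)
  qed (use s in \<open>auto simp: P_def \<U>_def\<close>)
  then obtain t where t: "t \<in> secs X U" "\<And>V. V \<in> \<U> \<Longrightarrow> res X U V t = s V" using UU by auto
  have g: "germ X x U t = \<gamma> x" if "x \<in> U" for x
  proof -
    obtain V where V: "V \<in> \<U>" "x \<in> V" using \<open>x \<in> U\<close> UU by auto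
    then have "germ X x U t = germ X x V (res X U V t)" using germ_res U t(1) unfolding \<U>_def by simp
    also have "\<dots> = \<gamma> x" using t(2)[OF V(1)] s[OF V(1)] V(2) P_def by simp
    finally show ?thesis .
  qed
  show ?thesis
  proof (rule ex1I[of _ t])
    fix t' assume "t' \<in> secs X U \<and> (\<forall>x \<in> U. germ X x U t' = \<gamma> x)"
    then show "t' = t" using sec_eqI[OF U, of t' t] t(1) g by simp
  qed (use t g in blast)
qed

text \<open>An inverse germ and the equation that it satisfies extend to a common neighbourhood.
  Invertibility at a point is therefore an open condition.\<close>

lemma germ_unit_iff:
  assumes "opn X U" "x \<in> U" "s \<in> secs X U"
  shows "germ X x U s \<in> Units (stalk X x) \<longleftrightarrow> (\<exists>W. opn X W \<and> x \<in> W \<and> W \<subseteq> U \<and> res X U W s \<in> Units (sec X W))"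
proof
  assume "germ X x U s \<in> Units (stalk X x)"
  then obtain B where B: "B \<in> stk X x" "germ X x U s \<otimes>\<^bsub>stalk X x\<^esub> B = \<one>\<^bsub>stalk X x\<^esub>"
    unfolding Units_def by blast
  obtain V t where V: "opn X V" "x \<in> V" "V \<subseteq> U" "t \<in> secs X V" "B = germ X x V t"
    using stalkE_sub[OF B(1) assms(1,2)] by metis
  have r: "res X U V s \<in> secs X V" using res_closed V assms by blast
  interpret RV: cring "sec X V" using V sec_cring by blast
  have "germ X x V (res X U V s \<otimes>\<^bsub>sec X V\<^esub> t) = germ X x V \<one>\<^bsub>sec X V\<^esub>"
    using B(2) V assms r by (simp add: stalk_mult stalk_one[of V] flip: germ_res[of U V x s])
  then obtain W where W: "opn X W" "x \<in> W" "W \<subseteq> V" "res X V W (res X U V s \<otimes>\<^bsub>sec X V\<^esub> t) = res X V W \<one>\<^bsub>sec X V\<^esub>"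
    using germ_eq_iff[of V x "res X U V s \<otimes>\<^bsub>sec X V\<^esub> t" V "\<one>\<^bsub>sec X V\<^esub>"] V r by auto
  interpret RW: cring "sec X W" using W sec_cring by blast
  have "res X U W s \<otimes>\<^bsub>sec X W\<^esub> res X V W t = \<one>\<^bsub>sec X W\<^esub>"
    using W V assms r res_res[of U V W s] by (simp add: res_mult res_one)
  then have "res X U W s \<in> Units (sec X W)"
    using W V assms res_closed[of U W s] res_closed[of V W t] by (intro RW.Units_of_mult_one[of _ "res X V W t"]) auto
  then show "\<exists>W. opn X W \<and> x \<in> W \<and> W \<subseteq> U \<and> res X U W s \<in> Units (sec X W)" using W V by blast
next
  assume "\<exists>W. opn X W \<and> x \<in> W \<and> W \<subseteq> U \<and> res X U W s \<in> Units (sec X W)"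
  then obtain W where W: "opn X W" "x \<in> W" "W \<subseteq> U" "res X U W s \<in> Units (sec X W)" by blast
  interpret RW: cring "sec X W" using W sec_cring by blast
  let ?t = "inv\<^bsub>sec X W\<^esub> (res X U W s)"
  have c: "?t \<in> secs X W" "res X U W s \<in> secs X W" using W by auto
  have "germ X x U s \<otimes>\<^bsub>stalk X x\<^esub> germ X x W ?t = \<one>\<^bsub>stalk X x\<^esub>" "germ X x W ?t \<otimes>\<^bsub>stalk X x\<^esub> germ X x U s = \<one>\<^bsub>stalk X x\<^esub>"
    using W assms c by (simp_all add: stalk_mult stalk_one[of W] flip: germ_res[of U W x s])
  then show "germ X x U s \<in> Units (stalk X x)"
    using germ_in_stalk assms c W unfolding Units_def by blast
qed

end

lemma lrs_ringed: "locally_ringed_space X \<Longrightarrow> ringed_space X"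
  unfolding locally_ringed_space_def by simp

lemma lrs_rspace: "locally_ringed_space X \<Longrightarrow> rspace X"
  unfolding locally_ringed_space_def rspace_def by simp

lemma lrs_stalk_local: "locally_ringed_space X \<Longrightarrow> x \<in> points X \<Longrightarrow> local_ring (stalk X x)"
  unfolding locally_ringed_space_def by simp

lemma scheme_lrs: "scheme X \<Longrightarrow> locally_ringed_space X"
  unfolding scheme_def by simp

lemma scheme_ringed: "scheme X \<Longrightarrow> ringed_space X"
  by (rule lrs_ringed[OF scheme_lrs])

lemma scheme_rspace: "scheme X \<Longrightarrow> rspace X"
  by (rule lrs_rspace[OF scheme_lrs])

section \<open>Morphisms of locally ringed spaces through their stalk maps\<close>

lemma lrs_homD:
  assumes "f \<in> lrs_hom X Y"
  shows "src f = X" "tgt f = Y" "continuous_map (top_of X) (top_of Y) (pt f)"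
    "pt f \<in> extensional (points X)"
    "\<And>V. opn Y V \<Longrightarrow> cm f V \<in> ring_hom (sec Y V) (sec X (preim f V))"
    "\<And>V. opn Y V \<Longrightarrow> cm f V \<in> extensional (secs Y V)"
    "\<And>V. \<not> opn Y V \<Longrightarrow> cm f V = (\<lambda>_. undefined)"
    "\<And>V W s. opn Y V \<Longrightarrow> opn Y W \<Longrightarrow> W \<subseteq> V \<Longrightarrow> s \<in> secs Y V \<Longrightarrow>
        cm f W (res Y V W s) = res X (preim f V) (preim f W) (cm f V s)"
    "\<And>x A. x \<in> points X \<Longrightarrow> A \<in> stk Y (pt f x) \<Longrightarrow>
        stalk_map f x A \<in> Units (stalk X x) \<Longrightarrow> A \<in> Units (stalk Y (pt f x))"
  using assms unfolding lrs_hom_def by simp_all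

locale lrs_mor = X: rspace X + Y: rspace Y
  for X :: "('p, 'r) ringed_space" and Y :: "('q, 's) ringed_space" +
  fixes f :: "('p, 'r, 'q, 's) morphism"
  assumes hom: "f \<in> lrs_hom X Y"
begin

lemmas src_tgt = lrs_homD(1,2)[OF hom]

lemma cont: "continuous_map (top_of X) (top_of Y) (pt f)"
  by (rule lrs_homD(3)[OF hom])

lemma pt_in: "x \<in> points X \<Longrightarrow> pt f x \<in> points Y"
  using cont continuous_map_image_subset_topspace[of "top_of X" "top_of Y" "pt f"] by auto

lemma mem_preim: "x \<in> preim f V \<longleftrightarrow> x \<in> points X \<and> pt f x \<in> V"
  unfolding preim_def src_tgt by simp

lemma preim_open: "opn Y V \<Longrightarrow> opn X (preim f V)"
  unfolding preim_def src_tgt using cont by (simp add: continuous_map_def)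

lemma preim_mono: "V \<subseteq> W \<Longrightarrow> preim f V \<subseteq> preim f W"
  unfolding preim_def by auto

lemma preim_points: "preim f (points Y) = points X"
  using pt_in by (auto simp: mem_preim)

lemma cm_hom: "opn Y V \<Longrightarrow> cm f V \<in> ring_hom (sec Y V) (sec X (preim f V))"
  by (rule lrs_homD(5)[OF hom])

lemma cm_closed: "opn Y V \<Longrightarrow> s \<in> secs Y V \<Longrightarrow> cm f V s \<in> secs X (preim f V)"
  by (rule ring_hom_closed[OF cm_hom])

lemmas cm_res = lrs_homD(8)[OF hom]

lemma stalk_map_germ:
  assumes "x \<in> points X" "opn Y V" "pt f x \<in> V" "s \<in> secs Y V"
  shows "stalk_map f x (germ Y (pt f x) V s) = germ X x (preim f V) (cm f V s)"
proof -
  have "germ X x (preim f V') (cm f V' s') = germ X x (preim f V) (cm f V s)"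
    if "(V', s') \<in> germ Y (pt f x) V s" for V' s'
  proof -
    note m = Y.germ_memD[OF that assms(2-4)]
    obtain W where W: "opn Y W" "pt f x \<in> W" "W \<subseteq> V' \<inter> V" "res Y V' W s' = res Y V W s"
      using Y.germ_eqD[OF m(1-3) assms(2-4) m(4)] by auto
    have x: "x \<in> preim f W" using W assms by (simp add: mem_preim)
    have mono: "preim f W \<subseteq> preim f V'" "preim f W \<subseteq> preim f V" using W(3) by (auto simp: preim_def)
    note o = preim_open[OF m(1)] preim_open[OF assms(2)] preim_open[OF W(1)]
    have "germ X x (preim f V') (cm f V' s') = germ X x (preim f W) (res X (preim f V') (preim f W) (cm f V' s'))"
      by (rule X.germ_res[OF o(1,3) x mono(1) cm_closed[OF m(1,3)], symmetric])
    also have "\<dots> = germ X x (preim f W) (res X (preim f V) (preim f W) (cm f V s))"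
      using cm_res[of V' W s'] cm_res[of V W s] W m assms by simp
    also have "\<dots> = germ X x (preim f V) (cm f V s)"
      by (rule X.germ_res[OF o(2,3) x mono(2) cm_closed[OF assms(2,4)]])
    finally show ?thesis .
  qed
  then show ?thesis unfolding stalk_map_def src_tgt by (rule union_class_eq[OF Y.germ_self[OF assms(2-4)]])
qed

lemma stalk_map_hom:
  assumes x: "x \<in> points X"
  shows "stalk_map f x \<in> ring_hom (stalk Y (pt f x)) (stalk X x)"
proof (rule ring_hom_memI)
  fix A assume "A \<in> stk Y (pt f x)"
  then obtain U s where *: "opn Y U" "pt f x \<in> U" "s \<in> secs Y U" "A = germ Y (pt f x) U s"
    by (rule Y.stalkE)
  then show "stalk_map f x A \<in> stk X x"
    using x by (simp add: stalk_map_germ X.germ_in_stalk preim_open mem_preim cm_closed)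
next
  fix A B assume "A \<in> stk Y (pt f x)" "B \<in> stk Y (pt f x)"
  then obtain U s t where *: "opn Y U" "pt f x \<in> U" "s \<in> secs Y U" "A = germ Y (pt f x) U s"
    "t \<in> secs Y U" "B = germ Y (pt f x) U t" by (rule Y.stalkE2)
  interpret R: ring "sec Y U" by (rule Y.sec_ring[OF *(1)])
  show "stalk_map f x (A \<otimes>\<^bsub>stalk Y (pt f x)\<^esub> B) = stalk_map f x A \<otimes>\<^bsub>stalk X x\<^esub> stalk_map f x B"
    using * x ring_hom_mult[OF cm_hom[OF *(1)]]
    by (simp add: Y.stalk_mult stalk_map_germ X.stalk_mult preim_open mem_preim cm_closed)
  show "stalk_map f x (A \<oplus>\<^bsub>stalk Y (pt f x)\<^esub> B) = stalk_map f x A \<oplus>\<^bsub>stalk X x\<^esub> stalk_map f x B"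
    using * x ring_hom_add[OF cm_hom[OF *(1)]]
    by (simp add: Y.stalk_add stalk_map_germ X.stalk_add preim_open mem_preim cm_closed)
next
  interpret R: ring "sec Y (points Y)" by (rule Y.sec_ring) simp
  show "stalk_map f x \<one>\<^bsub>stalk Y (pt f x)\<^esub> = \<one>\<^bsub>stalk X x\<^esub>"
    using x pt_in[OF x] ring_hom_one[OF cm_hom[OF Y.opn_points]]
    by (simp add: Y.stalk_one[of "points Y"] stalk_map_germ X.stalk_one[of "points X"] preim_points)
qed

lemma stalk_map_closed: "x \<in> points X \<Longrightarrow> A \<in> stk Y (pt f x) \<Longrightarrow> stalk_map f x A \<in> stk X x"
  by (rule ring_hom_closed[OF stalk_map_hom])

lemma stalk_map_unit_iff:
  assumes "x \<in> points X" "A \<in> stk Y (pt f x)"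
  shows "stalk_map f x A \<in> Units (stalk X x) \<longleftrightarrow> A \<in> Units (stalk Y (pt f x))"
  using lrs_homD(9)[OF hom assms]
    hom_Units[OF stalk_map_hom[OF assms(1)] cring.axioms(1)[OF Y.stalk_cring[OF pt_in[OF assms(1)]]] cring.axioms(1)[OF X.stalk_cring[OF assms(1)]], of A]
  by blast

lemma germ_cm_unit_iff:
  assumes "x \<in> points X" "opn Y V" "pt f x \<in> V" "s \<in> secs Y V"
  shows "germ X x (preim f V) (cm f V s) \<in> Units (stalk X x) \<longleftrightarrow> germ Y (pt f x) V s \<in> Units (stalk Y (pt f x))"
  using stalk_map_unit_iff[OF assms(1) Y.germ_in_stalk[OF assms(2-4)]] stalk_map_germ[OF assms] by simp

end

lemma lrs_morI: "ringed_space X \<Longrightarrow> ringed_space Y \<Longrightarrow> f \<in> lrs_hom X Y \<Longrightarrow> lrs_mor X Y f"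
  unfolding lrs_mor_def lrs_mor_axioms_def rspace_def by simp

text \<open>Locality is asked only for germs of sections. The union that defines
  \<open>stalk_map\<close> has to be evaluated before \<open>f\<close> is known to be a morphism,
  which is why the computation behind \<open>stalk_map_germ\<close> is repeated here.\<close>

lemma lrs_homI:
  fixes X :: "('p, 'r) ringed_space" and Y :: "('q, 's) ringed_space"
  assumes X: "ringed_space X" and Y: "ringed_space Y"
    and st: "src f = X" "tgt f = Y" and c: "continuous_map (top_of X) (top_of Y) (pt f)"
    and e: "pt f \<in> extensional (points X)"
    and ch: "\<And>V. opn Y V \<Longrightarrow> cm f V \<in> ring_hom (sec Y V) (sec X (preim f V))"
    and ce: "\<And>V. opn Y V \<Longrightarrow> cm f V \<in> extensional (secs Y V)"
    and cu: "\<And>V. \<not> opn Y V \<Longrightarrow> cm f V = (\<lambda>_. undefined)"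
    and cr: "\<And>V W s. opn Y V \<Longrightarrow> opn Y W \<Longrightarrow> W \<subseteq> V \<Longrightarrow> s \<in> secs Y V \<Longrightarrow>
        cm f W (res Y V W s) = res X (preim f V) (preim f W) (cm f V s)"
    and l: "\<And>x V s. x \<in> points X \<Longrightarrow> opn Y V \<Longrightarrow> pt f x \<in> V \<Longrightarrow> s \<in> secs Y V \<Longrightarrow>
        germ X x (preim f V) (cm f V s) \<in> Units (stalk X x) \<Longrightarrow> germ Y (pt f x) V s \<in> Units (stalk Y (pt f x))"
  shows "f \<in> lrs_hom X Y"
proof -
  interpret X: rspace X using X by (rule rspace.intro)
  interpret Y: rspace Y using Y by (rule rspace.intro)
  have po: "opn X (preim f V)" if "opn Y V" for V
    unfolding preim_def st using c that by (simp add: continuous_map_def)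
  have "A \<in> Units (stalk Y (pt f x))" if h: "x \<in> points X" "A \<in> stk Y (pt f x)" "stalk_map f x A \<in> Units (stalk X x)" for x A
  proof -
    obtain V s where *: "opn Y V" "pt f x \<in> V" "s \<in> secs Y V" "A = germ Y (pt f x) V s"
      using h(2) by (rule Y.stalkE)
    have "germ X x (preim f V') (cm f V' s') = germ X x (preim f V) (cm f V s)"
      if "(V', s') \<in> A" for V' s'
    proof -
      note m = Y.germ_memD[OF that[unfolded *(4)] *(1-3)]
      obtain W where W: "opn Y W" "pt f x \<in> W" "W \<subseteq> V' \<inter> V" "res Y V' W s' = res Y V W s"
        using Y.germ_eqD[OF m(1-3) *(1-3) m(4)] by auto
      have x: "x \<in> preim f W" using W h by (simp add: preim_def st)
      have mono: "preim f W \<subseteq> preim f V'" "preim f W \<subseteq> preim f V" using W by (auto simp: preim_def)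
      have cl: "cm f V' s' \<in> secs X (preim f V')" "cm f V s \<in> secs X (preim f V)"
        by (rule ring_hom_closed[OF ch[OF m(1)] m(3)], rule ring_hom_closed[OF ch[OF *(1)] *(3)])
      have "germ X x (preim f V') (cm f V' s') = germ X x (preim f W) (res X (preim f V') (preim f W) (cm f V' s'))"
        by (rule X.germ_res[OF po[OF m(1)] po[OF W(1)] x mono(1) cl(1), symmetric])
      also have "\<dots> = germ X x (preim f W) (res X (preim f V) (preim f W) (cm f V s))"
        using cr[of V' W s'] cr[of V W s] W m * by simp
      also have "\<dots> = germ X x (preim f V) (cm f V s)"
        by (rule X.germ_res[OF po[OF *(1)] po[OF W(1)] x mono(2) cl(2)])
      finally show ?thesis .
    qed
    then have "stalk_map f x A = germ X x (preim f V) (cm f V s)"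
      unfolding stalk_map_def st *(4) by (rule union_class_eq[OF Y.germ_self[OF *(1-3)]])
    then show ?thesis using l[OF h(1) *(1-3)] h(3) *(4) by simp
  qed
  then show ?thesis unfolding lrs_hom_def using assms by simp
qed

text \<open>Sections are determined by their germs, and both components of a morphism are
  extensional, so agreement on points and germs amounts to HOL equality.\<close>

lemma lrs_hom_eqI:
  assumes X: "ringed_space X" and Y: "ringed_space Y" and f: "f \<in> lrs_hom X Y" and g: "g \<in> lrs_hom X Y"
    and p: "\<And>x. x \<in> points X \<Longrightarrow> pt f x = pt g x"
    and s: "\<And>x V s. x \<in> points X \<Longrightarrow> opn Y V \<Longrightarrow> pt f x \<in> V \<Longrightarrow> s \<in> secs Y V \<Longrightarrow>
        germ X x (preim f V) (cm f V s) = germ X x (preim g V) (cm g V s)"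
  shows "f = g"
proof -
  interpret f: lrs_mor X Y f by (rule lrs_morI[OF X Y f])
  interpret g: lrs_mor X Y g by (rule lrs_morI[OF X Y g])
  have pt: "pt f = pt g"
    using p lrs_homD(4)[OF f] lrs_homD(4)[OF g] by (rule extensionalityI[rotated 2])
  have pr: "preim f V = preim g V" for V
    unfolding preim_def f.src_tgt g.src_tgt pt by simp
  have "cm f V = cm g V" for V
  proof (cases "opn Y V")
    case True
    show ?thesis
    proof (rule extensionalityI[OF lrs_homD(6)[OF f True] lrs_homD(6)[OF g True]])
      fix t assume t: "t \<in> secs Y V"
      show "cm f V t = cm g V t"
      proof (rule f.X.sec_eqI[OF f.preim_open[OF True]])
        show "cm f V t \<in> secs X (preim f V)" by (rule f.cm_closed[OF True t])
        show "cm g V t \<in> secs X (preim f V)" unfolding pr by (rule g.cm_closed[OF True t])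
        fix x assume "x \<in> preim f V"
        then have "x \<in> points X" "pt f x \<in> V" by (simp_all add: f.mem_preim)
        from s[OF this(1) True this(2) t] show "germ X x (preim f V) (cm f V t) = germ X x (preim f V) (cm g V t)"
          by (simp only: pr)
      qed
    qed
  next
    case False
    then show ?thesis using lrs_homD(7)[OF f] lrs_homD(7)[OF g] by simp
  qed
  then show ?thesis using pt f.src_tgt g.src_tgt by (intro morphism.equality) auto
qed

text \<open>The comorphism is glued from the stalk maps; \<open>loc\<close> says that the family
  \<psi> sends the germs of a section to germs of a section. Morphisms into spectra and into closed
  subschemes are obtained in this way.\<close>

lemma mor_from_stalks:
  fixes X :: "('p, 'r) ringed_space" and Y :: "('q, 's) ringed_space"
  assumes X: "ringed_space X" and Y: "ringed_space Y"
    and c: "continuous_map (top_of X) (top_of Y) k"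
    and h: "\<And>x. x \<in> points X \<Longrightarrow> \<psi> x \<in> ring_hom (stalk Y (k x)) (stalk X x)"
    and l: "\<And>x A. x \<in> points X \<Longrightarrow> A \<in> stk Y (k x) \<Longrightarrow> \<psi> x A \<in> Units (stalk X x) \<Longrightarrow> A \<in> Units (stalk Y (k x))"
    and loc: "\<And>x V s. x \<in> points X \<Longrightarrow> opn Y V \<Longrightarrow> k x \<in> V \<Longrightarrow> s \<in> secs Y V \<Longrightarrow>
      \<exists>W t. opn X W \<and> x \<in> W \<and> k ` W \<subseteq> V \<and> t \<in> secs X W \<and> (\<forall>y \<in> W. germ X y W t = \<psi> y (germ Y (k y) V s))"
  shows "\<exists>f \<in> lrs_hom X Y. (\<forall>x \<in> points X. pt f x = k x) \<and>
     (\<forall>x \<in> points X. \<forall>V s. opn Y V \<longrightarrow> k x \<in> V \<longrightarrow> s \<in> secs Y V \<longrightarrow>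
        germ X x (preim f V) (cm f V s) = \<psi> x (germ Y (k x) V s))"
proof -
  interpret X: rspace X using X by (rule rspace.intro)
  interpret Y: rspace Y using Y by (rule rspace.intro)
  define pr where "pr = (\<lambda>V. {x \<in> points X. k x \<in> V})"
  have pro: "opn X (pr V)" if "opn Y V" for V
    using c that unfolding pr_def by (simp add: continuous_map_def)
  define P where "P = (\<lambda>V s t. t \<in> secs X (pr V) \<and> (\<forall>x \<in> pr V. germ X x (pr V) t = \<psi> x (germ Y (k x) V s)))"
  \<comment> \<open>Uniqueness is what makes the comorphism a homomorphism compatible with
    restriction: each law is an equality of sections, checked on germs, where it is a law of
    \<psi>.\<close>
  have ex1: "\<exists>!t. P V s t" if V: "opn Y V" "s \<in> secs Y V" for V s
    unfolding P_def
  proof (rule X.glue_germs[OF pro[OF V(1)]])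
    fix x assume "x \<in> pr V"
    then have "x \<in> points X" "k x \<in> V" unfolding pr_def by auto
    then obtain W t where W: "opn X W" "x \<in> W" "k ` W \<subseteq> V" "t \<in> secs X W" "\<forall>y \<in> W. germ X y W t = \<psi> y (germ Y (k y) V s)"
      using loc[OF _ V(1) _ V(2), of x] by blast
    then have "W \<subseteq> pr V" unfolding pr_def using X.opn_sub[OF W(1)] by auto
    then show "\<exists>W t. opn X W \<and> x \<in> W \<and> W \<subseteq> pr V \<and> t \<in> secs X W \<and> (\<forall>y \<in> W. germ X y W t = \<psi> y (germ Y (k y) V s))"
      using W by blast
  qed
  define \<phi> where "\<phi> = (\<lambda>V s. THE t. P V s t)"
  have \<phi>P: "P V s (\<phi> V s)" if "opn Y V" "s \<in> secs Y V" for V s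
    using theI'[OF ex1[OF that]] unfolding \<phi>_def .
  have \<phi>c: "\<phi> V s \<in> secs X (pr V)" if "opn Y V" "s \<in> secs Y V" for V s
    using \<phi>P[OF that] unfolding P_def by simp
  have \<phi>g: "germ X x (pr V) (\<phi> V s) = \<psi> x (germ Y (k x) V s)" if "opn Y V" "s \<in> secs Y V" "x \<in> pr V" for V s x
    using \<phi>P[OF that(1,2)] that(3) unfolding P_def by simp
  define f :: "('p, 'r, 'q, 's) morphism" where "f = \<lparr>src = X, tgt = Y, pt = restrict k (points X),
     cm = (\<lambda>V. if opn Y V then restrict (\<phi> V) (secs Y V) else (\<lambda>_. undefined))\<rparr>"
  have pf: "pt f x = k x" if "x \<in> points X" for x using that by (simp add: f_def)
  have pref: "preim f V = pr V" for V unfolding preim_def pr_def by (auto simp: f_def)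
  have cf: "cm f V s = \<phi> V s" if "opn Y V" "s \<in> secs Y V" for V s
    using that by (simp add: f_def)
  have prD: "x \<in> points X" "k x \<in> V" if "x \<in> pr V" for x V using that by (auto simp: pr_def)
  have "f \<in> lrs_hom X Y"
  proof (rule lrs_homI[OF X Y])
    show "src f = X" "tgt f = Y" "pt f \<in> extensional (points X)" by (simp_all add: f_def)
    show "continuous_map (top_of X) (top_of Y) (pt f)"
      by (rule continuous_map_eq[OF c]) (simp add: pf)
    fix V
    show "\<not> opn Y V \<Longrightarrow> cm f V = (\<lambda>_. undefined)" by (simp add: f_def)
    assume V: "opn Y V"
    show "cm f V \<in> extensional (secs Y V)" using V by (simp add: f_def)
    note pV = pro[OF V]
    interpret SY: ring "sec Y V" by (rule Y.sec_ring[OF V])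
    interpret SX: ring "sec X (pr V)" by (rule X.sec_ring[OF pV])
    show "cm f V \<in> ring_hom (sec Y V) (sec X (preim f V))"
      unfolding pref
    proof (rule ring_hom_memI)
      fix s assume s: "s \<in> secs Y V"
      show "cm f V s \<in> secs X (pr V)" using \<phi>c[OF V s] cf[OF V s] by simp
      fix t assume t: "t \<in> secs Y V"
      show "cm f V (s \<otimes>\<^bsub>sec Y V\<^esub> t) = cm f V s \<otimes>\<^bsub>sec X (pr V)\<^esub> cm f V t"
      proof (rule X.sec_eqI[OF pV])
        fix x assume x: "x \<in> pr V"
        show "germ X x (pr V) (cm f V (s \<otimes>\<^bsub>sec Y V\<^esub> t)) = germ X x (pr V) (cm f V s \<otimes>\<^bsub>sec X (pr V)\<^esub> cm f V t)"
          using x V s t prD[OF x] pV ring_hom_mult[OF h[OF prD(1)[OF x]]]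
          by (simp add: cf \<phi>g \<phi>c flip: X.stalk_mult Y.stalk_mult) (simp add: Y.germ_in_stalk)
      qed (use V s t in \<open>auto simp: cf \<phi>c\<close>)
      show "cm f V (s \<oplus>\<^bsub>sec Y V\<^esub> t) = cm f V s \<oplus>\<^bsub>sec X (pr V)\<^esub> cm f V t"
      proof (rule X.sec_eqI[OF pV])
        fix x assume x: "x \<in> pr V"
        show "germ X x (pr V) (cm f V (s \<oplus>\<^bsub>sec Y V\<^esub> t)) = germ X x (pr V) (cm f V s \<oplus>\<^bsub>sec X (pr V)\<^esub> cm f V t)"
          using x V s t prD[OF x] pV ring_hom_add[OF h[OF prD(1)[OF x]]]
          by (simp add: cf \<phi>g \<phi>c flip: X.stalk_add Y.stalk_add) (simp add: Y.germ_in_stalk)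
      qed (use V s t in \<open>auto simp: cf \<phi>c\<close>)
    next
      show "cm f V \<one>\<^bsub>sec Y V\<^esub> = \<one>\<^bsub>sec X (pr V)\<^esub>"
      proof (rule X.sec_eqI[OF pV])
        fix x assume x: "x \<in> pr V"
        show "germ X x (pr V) (cm f V \<one>\<^bsub>sec Y V\<^esub>) = germ X x (pr V) \<one>\<^bsub>sec X (pr V)\<^esub>"
          using x V prD[OF x] pV ring_hom_one[OF h[OF prD(1)[OF x]]]
          by (simp add: cf \<phi>g flip: X.stalk_one Y.stalk_one)
      qed (use V in \<open>auto simp: cf \<phi>c\<close>)
    qed
    fix W s assume W: "opn Y W" "W \<subseteq> V" and s: "s \<in> secs Y V"
    have WV: "pr W \<subseteq> pr V" using W by (auto simp: pr_def)
    show "cm f W (res Y V W s) = res X (preim f V) (preim f W) (cm f V s)"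
      unfolding pref
    proof (rule X.sec_eqI[OF pro[OF W(1)]])
      fix x assume x: "x \<in> pr W"
      show "germ X x (pr W) (cm f W (res Y V W s)) = germ X x (pr W) (res X (pr V) (pr W) (cm f V s))"
        using x V W s WV prD[OF x] pro by (simp add: cf \<phi>g \<phi>c X.germ_res Y.germ_res Y.res_closed subsetD[OF WV])
    qed (use V W s WV pro in \<open>auto simp: cf \<phi>c Y.res_closed X.res_closed\<close>)
  next
    fix x V s assume *: "x \<in> points X" "opn Y V" "pt f x \<in> V" "s \<in> secs Y V"
        "germ X x (preim f V) (cm f V s) \<in> Units (stalk X x)"
    then have "x \<in> pr V" by (simp add: pf pr_def)
    then show "germ Y (pt f x) V s \<in> Units (stalk Y (pt f x))"
      using * l[of x "germ Y (k x) V s"] by (simp add: pf pref cf \<phi>g Y.germ_in_stalk)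
  qed
  then show ?thesis using pf pref cf \<phi>g by (intro bexI[of _ f]) (auto simp: pr_def)
qed

lemma pt_comp: "x \<in> points (src f) \<Longrightarrow> pt (g \<circ>\<^sub>s f) x = pt g (pt f x)"
  by (simp add: lrs_comp_def compose_def)

lemma src_comp [simp]: "src (g \<circ>\<^sub>s f) = src f" and tgt_comp [simp]: "tgt (g \<circ>\<^sub>s f) = tgt g"
  by (simp_all add: lrs_comp_def)

lemma cm_comp: "opn (tgt g) V \<Longrightarrow> s \<in> secs (tgt g) V \<Longrightarrow> cm (g \<circ>\<^sub>s f) V s = cm f (preim g V) (cm g V s)"
  by (simp add: lrs_comp_def)

context
  fixes X :: "('p, 'r) ringed_space" and Y :: "('q, 's) ringed_space" and Z :: "('o, 't) ringed_space"
    and f g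
  assumes X: "ringed_space X" and Y: "ringed_space Y" and Z: "ringed_space Z"
    and f: "f \<in> lrs_hom X Y" and g: "g \<in> lrs_hom Y Z"
begin

interpretation f: lrs_mor X Y f by (rule lrs_morI[OF X Y f])
interpretation g: lrs_mor Y Z g by (rule lrs_morI[OF Y Z g])

lemma preim_comp: "preim (g \<circ>\<^sub>s f) V = preim f (preim g V)"
proof -
  have "x \<in> preim (g \<circ>\<^sub>s f) V \<longleftrightarrow> x \<in> preim f (preim g V)" for x
  proof (cases "x \<in> points X")
    case True
    then show ?thesis using f.pt_in[OF True] by (simp add: preim_def pt_comp f.src_tgt g.src_tgt)
  qed (simp add: preim_def f.src_tgt)
  then show ?thesis by blast
qed

lemma lrs_comp_hom: "g \<circ>\<^sub>s f \<in> lrs_hom X Z"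
proof (rule lrs_homI[OF X Z])
  show "src (g \<circ>\<^sub>s f) = X" "tgt (g \<circ>\<^sub>s f) = Z" by (simp_all add: f.src_tgt g.src_tgt)
  show "continuous_map (top_of X) (top_of Z) (pt (g \<circ>\<^sub>s f))"
    by (rule continuous_map_eq[OF continuous_map_compose[OF f.cont g.cont]]) (simp add: pt_comp f.src_tgt)
  show "pt (g \<circ>\<^sub>s f) \<in> extensional (points X)"
    by (simp add: lrs_comp_def f.src_tgt compose_def)
  fix V
  show "\<not> opn Z V \<Longrightarrow> cm (g \<circ>\<^sub>s f) V = (\<lambda>_. undefined)" by (simp add: lrs_comp_def g.src_tgt)
  assume V: "opn Z V"
  note gV = g.preim_open[OF V]
  show "cm (g \<circ>\<^sub>s f) V \<in> extensional (secs Z V)" using V by (simp add: lrs_comp_def g.src_tgt)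
  interpret R: ring "sec Z V" by (rule g.Y.sec_ring[OF V])
  have e: "cm (g \<circ>\<^sub>s f) V s = (cm f (preim g V) \<circ> cm g V) s" if "s \<in> secs Z V" for s
    using cm_comp[of g V s f] V that g.src_tgt by simp
  have "cm f (preim g V) \<circ> cm g V \<in> ring_hom (sec Z V) (sec X (preim f (preim g V)))"
    by (rule ring_hom_trans[OF g.cm_hom[OF V] f.cm_hom[OF gV]])
  then show "cm (g \<circ>\<^sub>s f) V \<in> ring_hom (sec Z V) (sec X (preim (g \<circ>\<^sub>s f) V))"
    unfolding preim_comp by (rule ring_hom_cong[OF R.ring_axioms]) (rule e)
  fix W s assume W: "opn Z W" "W \<subseteq> V" and s: "s \<in> secs Z V"
  show "cm (g \<circ>\<^sub>s f) W (res Z V W s) = res X (preim (g \<circ>\<^sub>s f) V) (preim (g \<circ>\<^sub>s f) W) (cm (g \<circ>\<^sub>s f) V s)"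
    unfolding preim_comp
    using cm_comp[of g V s f] cm_comp[of g W "res Z V W s" f] g.cm_res[OF V W s]
      f.cm_res[OF gV g.preim_open[OF W(1)] g.preim_mono[OF W(2)] g.cm_closed[OF V s]]
      V W s g.src_tgt g.Y.res_closed[OF V W s] by simp
next
  fix x V s assume *: "x \<in> points X" "opn Z V" "pt (g \<circ>\<^sub>s f) x \<in> V" "s \<in> secs Z V"
        "germ X x (preim (g \<circ>\<^sub>s f) V) (cm (g \<circ>\<^sub>s f) V s) \<in> Units (stalk X x)"
  have p: "pt (g \<circ>\<^sub>s f) x = pt g (pt f x)" using * by (simp add: pt_comp f.src_tgt)
  have y: "pt f x \<in> preim g V" using * f.pt_in[OF *(1)] p by (simp add: g.mem_preim)
  have "germ X x (preim f (preim g V)) (cm f (preim g V) (cm g V s)) \<in> Units (stalk X x)"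
    using *(5) cm_comp[of g V s f] * g.src_tgt unfolding preim_comp by simp
  then have "germ Y (pt f x) (preim g V) (cm g V s) \<in> Units (stalk Y (pt f x))"
    using f.germ_cm_unit_iff[OF *(1) g.preim_open[OF *(2)] y g.cm_closed[OF *(2,4)]] by simp
  then show "germ Z (pt (g \<circ>\<^sub>s f) x) V s \<in> Units (stalk Z (pt (g \<circ>\<^sub>s f) x))"
    using g.germ_cm_unit_iff[OF f.pt_in[OF *(1)] *(2) _ *(4)] * p by simp
qed

end

lemma lrs_comp_assoc:
  assumes X: "ringed_space X" and Y: "ringed_space Y" and Z: "ringed_space Z" and W: "ringed_space W"
    and f: "f \<in> lrs_hom X Y" and g: "g \<in> lrs_hom Y Z" and h: "h \<in> lrs_hom Z W"
  shows "(h \<circ>\<^sub>s g) \<circ>\<^sub>s f = h \<circ>\<^sub>s g \<circ>\<^sub>s f"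
proof -
  interpret f: lrs_mor X Y f by (rule lrs_morI[OF X Y f])
  interpret g: lrs_mor Y Z g by (rule lrs_morI[OF Y Z g])
  interpret h: lrs_mor Z W h by (rule lrs_morI[OF Z W h])
  note gf = lrs_comp_hom[OF X Y Z f g] and hg = lrs_comp_hom[OF Y Z W g h]
  show ?thesis
  proof (rule lrs_hom_eqI[OF X W lrs_comp_hom[OF X Y W f hg] lrs_comp_hom[OF X Z W gf h]])
    fix x assume x: "x \<in> points X"
    show "pt ((h \<circ>\<^sub>s g) \<circ>\<^sub>s f) x = pt (h \<circ>\<^sub>s g \<circ>\<^sub>s f) x"
      using x f.pt_in[OF x] by (simp add: pt_comp f.src_tgt g.src_tgt)
    fix V s assume V: "opn W V" and s: "s \<in> secs W V"
    show "germ X x (preim ((h \<circ>\<^sub>s g) \<circ>\<^sub>s f) V) (cm ((h \<circ>\<^sub>s g) \<circ>\<^sub>s f) V s) = germ X x (preim (h \<circ>\<^sub>s g \<circ>\<^sub>s f) V) (cm (h \<circ>\<^sub>s g \<circ>\<^sub>s f) V s)"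
      unfolding preim_comp[OF X Y W f hg] preim_comp[OF X Z W gf h] preim_comp[OF Y Z W g h] preim_comp[OF X Y Z f g]
      using V s h.preim_open[OF V] h.cm_closed[OF V s]
      by (simp add: cm_comp h.src_tgt g.src_tgt preim_comp[OF Y Z W g h])
  qed
qed

lemma lrs_id_hom: assumes "ringed_space X" shows "lrs_id X \<in> lrs_hom X X"
proof -
  interpret X: rspace X using assms by (rule rspace.intro)
  have p: "preim (lrs_id X) V = V" if "opn X V" for V
    using X.opn_sub[OF that] by (auto simp: preim_def lrs_id_def)
  show ?thesis
  proof (rule lrs_homI[OF assms assms])
    show "continuous_map (top_of X) (top_of X) (pt (lrs_id X))"
      by (rule continuous_map_eq[OF continuous_map_id]) (simp add: lrs_id_def)
    fix V assume V: "opn X V"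
    interpret ring "sec X V" by (rule X.sec_ring[OF V])
    show "cm (lrs_id X) V \<in> ring_hom (sec X V) (sec X (preim (lrs_id X) V))"
      unfolding p[OF V] by (rule ring_hom_memI) (simp_all add: lrs_id_def V)
  qed (simp_all add: p, simp_all add: lrs_id_def X.res_closed)
qed

lemma preim_id: "opn X V \<Longrightarrow> preim (lrs_id X) V = V"
  using openin_subset[of "top_of X" V] by (auto simp: preim_def lrs_id_def)

lemma lrs_id_left: assumes "ringed_space X" "ringed_space Y" "f \<in> lrs_hom X Y" shows "lrs_id Y \<circ>\<^sub>s f = f"
proof -
  interpret f: lrs_mor X Y f by (rule lrs_morI[OF assms])
  show ?thesis
  proof (rule lrs_hom_eqI[OF assms(1,2) lrs_comp_hom[OF assms(1,2,2,3) lrs_id_hom[OF assms(2)]] assms(3)])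
    fix x assume x: "x \<in> points X"
    show "pt (lrs_id Y \<circ>\<^sub>s f) x = pt f x" using x f.pt_in[OF x] by (simp add: pt_comp f.src_tgt lrs_id_def)
    fix V s assume V: "opn Y V" and s: "s \<in> secs Y V"
    show "germ X x (preim (lrs_id Y \<circ>\<^sub>s f) V) (cm (lrs_id Y \<circ>\<^sub>s f) V s) = germ X x (preim f V) (cm f V s)"
      unfolding preim_comp[OF assms(1,2,2,3) lrs_id_hom[OF assms(2)]] preim_id[OF V]
      using V s cm_comp[of "lrs_id Y" V s f] preim_id[OF V] by (simp add: lrs_id_def)
  qed
qed

text \<open>Because \<open>h\<close> reflects units, nonunits of \<open>S\<close> lift to nonunits
  of \<open>R\<close>, and sums of nonunits can be formed upstairs. It is applied to stalks of
  spectra, to transported spaces and to ring copies.\<close>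

lemma local_ring_surj:
  assumes R: "local_ring R" and S: "cring S" and h: "h \<in> ring_hom R S"
    and surj: "carrier S \<subseteq> h ` carrier R" and ref: "\<And>a. a \<in> carrier R \<Longrightarrow> h a \<in> Units S \<Longrightarrow> a \<in> Units R"
  shows "local_ring S"
proof -
  interpret R: cring R using R by (rule local_ring_cring)
  interpret S: cring S by fact
  interpret h: ring_hom_cring R S h by (rule ring_hom_cringI2[OF R.is_cring S h])
  have nz: "\<one>\<^bsub>S\<^esub> \<noteq> \<zero>\<^bsub>S\<^esub>"
  proof
    assume "\<one>\<^bsub>S\<^esub> = \<zero>\<^bsub>S\<^esub>"
    then have "h \<zero>\<^bsub>R\<^esub> \<in> Units S" using S.Units_one_closed by simp
    then have "\<zero>\<^bsub>R\<^esub> \<in> Units R" using ref by simp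
    then show False using zero_not_Unit[OF R.is_cring local_ring_nontriv[OF R]] by simp
  qed
  have u: "h a \<in> Units S \<longleftrightarrow> a \<in> Units R" if "a \<in> carrier R" for a
    using ref[OF that] hom_Units[OF h R.ring_axioms S.ring_axioms] by blast
  have "a \<oplus>\<^bsub>S\<^esub> b \<notin> Units S" if ab: "a \<in> carrier S" "b \<in> carrier S" "a \<notin> Units S" "b \<notin> Units S" for a b
  proof -
    obtain a' b' where "a' \<in> carrier R" "a = h a'" "b' \<in> carrier R" "b = h b'" using surj ab(1,2) by blast
    then show ?thesis using ab(3,4) u[of "a' \<oplus>\<^bsub>R\<^esub> b'"] u[of a'] u[of b'] R unfolding local_ring_iff by simp
  qed
  then show ?thesis unfolding local_ring_iff using S nz by blast
qed

subsection \<open>Open subspaces\<close>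

lemma sec_restr [simp]: "sec (restr X U) = sec X" and res_restr [simp]: "res (restr X U) = res X"
  by (simp_all add: restr_def)

lemma opn_restr: "opn X U \<Longrightarrow> opn (restr X U) V \<longleftrightarrow> opn X V \<and> V \<subseteq> U"
  by (simp add: restr_def openin_open_subtopology)

lemma points_restr: "opn X U \<Longrightarrow> points (restr X U) = U"
  using openin_subset[of "top_of X" U] by (auto simp: restr_def)

context
  fixes X :: "('p, 'r) ringed_space" and U
  assumes X: "ringed_space X" and U: "opn X U"
begin

interpretation X: rspace X using X by (rule rspace.intro)

lemma ringed_restr: "ringed_space (restr X U)"
  unfolding ringed_space_def sec_restr res_restr opn_restr[OF U]
proof (intro conjI allI impI ballI)
  fix \<U> s t assume *: "\<forall>V\<in>\<U>. opn X V \<and> V \<subseteq> U" "s \<in> secs X (\<Union>\<U>)" "t \<in> secs X (\<Union>\<U>)"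
    "\<forall>V\<in>\<U>. res X (\<Union>\<U>) V s = res X (\<Union>\<U>) V t"
  show "s = t" by (rule X.sep[of \<U>]) (use * in simp_all)
next
  fix \<U> s assume *: "(\<forall>V\<in>\<U>. (opn X V \<and> V \<subseteq> U) \<and> s V \<in> secs X V) \<and>
            (\<forall>V\<in>\<U>. \<forall>W\<in>\<U>. res X V (V \<inter> W) (s V) = res X W (V \<inter> W) (s W))"
  show "\<exists>t\<in>secs X (\<Union> \<U>). \<forall>V\<in>\<U>. res X (\<Union> \<U>) V t = s V"
    by (rule X.glue) (use * in blast)+
qed (simp_all add: X.sec_cring X.res_hom X.res_id X.res_res)

interpretation R: rspace "restr X U" using ringed_restr by (rule rspace.intro)

text \<open>The stalks of \<open>restr X U\<close> and of \<open>X\<close> are different sets, since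
  a germ collects all its representatives and the larger space has more of them. Only invertibility
  and equality of germs are therefore carried over.\<close>

lemma germ_restr_unit_iff:
  assumes "opn X V" "V \<subseteq> U" "x \<in> V" "s \<in> secs X V"
  shows "germ (restr X U) x V s \<in> Units (stalk (restr X U) x) \<longleftrightarrow> germ X x V s \<in> Units (stalk X x)"
proof -
  have "opn (restr X U) V" using assms by (simp add: opn_restr[OF U])
  from R.germ_unit_iff[OF this assms(3)] X.germ_unit_iff[OF assms(1,3,4)] show ?thesis
    using assms by (simp add: opn_restr[OF U]) (meson order_trans)
qed

lemma germ_restr_eq_iff:
  assumes "opn X V" "V \<subseteq> U" "x \<in> V" "s \<in> secs X V" "opn X W" "W \<subseteq> U" "x \<in> W" "t \<in> secs X W"
  shows "germ (restr X U) x V s = germ (restr X U) x W t \<longleftrightarrow> germ X x V s = germ X x W t"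
proof -
  have "opn (restr X U) V" "opn (restr X U) W" using assms by (simp_all add: opn_restr[OF U])
  from R.germ_eq_iff[OF this(1) assms(3) _ this(2) assms(7)] X.germ_eq_iff[OF assms(1,3,4,5,7,8)] show ?thesis
    using assms by (simp add: opn_restr[OF U]) (meson order_trans)
qed

lemma preim_open_incl: "preim (open_incl X U) V = V \<inter> U"
  using X.opn_sub[OF U] by (auto simp: preim_def open_incl_def points_restr[OF U])

lemma open_incl_hom: "open_incl X U \<in> lrs_hom (restr X U) X"
proof (rule lrs_homI[OF ringed_restr X])
  have o: "opn X (V \<inter> U)" "V \<inter> U \<subseteq> V" if "opn X V" for V using that U by auto
  show "continuous_map (top_of (restr X U)) (top_of X) (pt (open_incl X U))"
    by (rule continuous_map_eq[of _ _ id]) (simp_all add: restr_def open_incl_def continuous_map_from_subtopology)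
  fix V assume V: "opn X V"
  show "cm (open_incl X U) V \<in> ring_hom (sec X V) (sec (restr X U) (preim (open_incl X U) V))"
    unfolding preim_open_incl sec_restr
    by (rule ring_hom_cong[OF X.sec_ring[OF V] X.res_hom[OF V o[OF V]]]) (simp add: open_incl_def V)
  show "cm (open_incl X U) V \<in> extensional (secs X V)" by (simp add: open_incl_def V)
  fix W s assume W: "opn X W" "W \<subseteq> V" and s: "s \<in> secs X V"
  show "cm (open_incl X U) W (res X V W s) = res (restr X U) (preim (open_incl X U) V) (preim (open_incl X U) W) (cm (open_incl X U) V s)"
    unfolding preim_open_incl res_restr
  proof -
    have WU: "W \<inter> U \<subseteq> V \<inter> U" using W by blast
    show "cm (open_incl X U) W (res X V W s) = res X (V \<inter> U) (W \<inter> U) (cm (open_incl X U) V s)"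
      using X.res_res[OF V W(1) o(1)[OF W(1)] o(2)[OF W(1)] W(2) s] X.res_res[OF V o(1)[OF V] o(1)[OF W(1)] WU o(2)[OF V] s]
        W(1) V s X.res_closed[OF V W s] by (simp add: open_incl_def)
  qed
next
  fix x V s assume *: "x \<in> points (restr X U)" "opn X V" "pt (open_incl X U) x \<in> V" "s \<in> secs X V"
     "germ (restr X U) x (preim (open_incl X U) V) (cm (open_incl X U) V s) \<in> Units (stalk (restr X U) x)"
  have x: "x \<in> V \<inter> U" "pt (open_incl X U) x = x" using * by (simp_all add: open_incl_def points_restr[OF U])
  have o: "opn X (V \<inter> U)" using * U by auto
  have "germ X x (V \<inter> U) (res X V (V \<inter> U) s) \<in> Units (stalk X x)"
    using *(5) germ_restr_unit_iff[OF o _ x(1) X.res_closed[OF *(2) o _ *(4)]] *(2,4) unfolding preim_open_incl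
    by (simp add: open_incl_def)
  then show "germ X (pt (open_incl X U) x) V s \<in> Units (stalk X (pt (open_incl X U) x))"
    using X.germ_res[OF *(2) o x(1) _ *(4)] x(2) by simp
qed (simp_all add: open_incl_def)

text \<open>The map is \<open>f\<close> with a new target; its comorphism is kept on open sets
  inside \<open>U\<close> and made undefined elsewhere, as extensionality demands.\<close>

lemma lrs_hom_into_open:
  assumes Y: "ringed_space Y" and f: "f \<in> lrs_hom Y X" and im: "\<And>y. y \<in> points Y \<Longrightarrow> pt f y \<in> U"
  obtains g where "g \<in> lrs_hom Y (restr X U)" "open_incl X U \<circ>\<^sub>s g = f"
    "\<And>V. opn X V \<Longrightarrow> V \<subseteq> U \<Longrightarrow> cm g V = cm f V" "pt g = pt f"
proof -
  interpret f: lrs_mor Y X f by (rule lrs_morI[OF Y X f])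
  define g where "g = f\<lparr>tgt := restr X U, cm := \<lambda>V. if opn X V \<and> V \<subseteq> U then cm f V else (\<lambda>_. undefined)\<rparr>"
  have pg: "pt g = pt f" "preim g V = preim f V" for V by (simp_all add: g_def preim_def)
  have g: "g \<in> lrs_hom Y (restr X U)"
  proof (rule lrs_homI[OF Y ringed_restr])
    show "continuous_map (top_of Y) (top_of (restr X U)) (pt g)"
      unfolding pg restr_def using f.cont im by (auto simp: continuous_map_in_subtopology)
    show "pt g \<in> extensional (points Y)" using lrs_homD(4)[OF f] pg by simp
    fix V assume "opn (restr X U) V"
    then have V: "opn X V" "V \<subseteq> U" by (simp_all add: opn_restr[OF U])
    show "cm g V \<in> ring_hom (sec (restr X U) V) (sec Y (preim g V))"
      using f.cm_hom[OF V(1)] V pg by (simp add: g_def)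
    show "cm g V \<in> extensional (secs (restr X U) V)" using lrs_homD(6)[OF f V(1)] V by (simp add: g_def)
    fix W s assume W: "opn (restr X U) W" "W \<subseteq> V" and s: "s \<in> secs (restr X U) V"
    then have "opn X W" "W \<subseteq> U" by (simp_all add: opn_restr[OF U])
    then show "cm g W (res (restr X U) V W s) = res Y (preim g V) (preim g W) (cm g V s)"
      using f.cm_res[OF V(1) _ W(2)] s V W pg by (simp add: g_def)
  next
    fix x V s assume *: "x \<in> points Y" "opn (restr X U) V" "pt g x \<in> V" "s \<in> secs (restr X U) V"
      "germ Y x (preim g V) (cm g V s) \<in> Units (stalk Y x)"
    then have V: "opn X V" "V \<subseteq> U" by (simp_all add: opn_restr[OF U])
    then show "germ (restr X U) (pt g x) V s \<in> Units (stalk (restr X U) (pt g x))"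
      using f.germ_cm_unit_iff[OF *(1) V(1), of s] * pg germ_restr_unit_iff[OF V] by (simp add: g_def)
  next
    show "src g = Y" "tgt g = restr X U" by (simp_all add: g_def f.src_tgt)
    fix V assume "\<not> opn (restr X U) V"
    then show "cm g V = (\<lambda>_. undefined)" by (auto simp: g_def opn_restr[OF U])
  qed
  interpret g: lrs_mor Y "restr X U" g by (rule lrs_morI[OF Y ringed_restr g])
  have "open_incl X U \<circ>\<^sub>s g = f"
  proof (rule lrs_hom_eqI[OF Y X lrs_comp_hom[OF Y ringed_restr X g open_incl_hom] f])
    fix x assume x: "x \<in> points Y"
    show "pt (open_incl X U \<circ>\<^sub>s g) x = pt f x"
      using x im[OF x] by (simp add: pt_comp g.src_tgt pg open_incl_def points_restr[OF U])
    fix V s assume V: "opn X V" and s: "s \<in> secs X V" and "pt (open_incl X U \<circ>\<^sub>s g) x \<in> V"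
    have o: "opn X (V \<inter> U)" using V U by auto
    have pr: "preim f (V \<inter> U) = preim f V" using im by (auto simp: f.mem_preim)
    have t: "tgt (open_incl X U) = X" by (simp add: open_incl_def)
    have "cm (open_incl X U \<circ>\<^sub>s g) V s = cm g (V \<inter> U) (res X V (V \<inter> U) s)"
      using cm_comp[of "open_incl X U" V s g] V s t unfolding preim_open_incl by (simp add: open_incl_def)
    also have "\<dots> = res Y (preim f V) (preim f (V \<inter> U)) (cm f V s)"
      using o f.cm_res[OF V o _ s] by (simp add: g_def)
    also have "\<dots> = cm f V s" unfolding pr by (rule f.X.res_id[OF f.preim_open[OF V] f.cm_closed[OF V s]])
    finally show "germ Y x (preim (open_incl X U \<circ>\<^sub>s g) V) (cm (open_incl X U \<circ>\<^sub>s g) V s) = germ Y x (preim f V) (cm f V s)"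
      unfolding preim_comp[OF Y ringed_restr X g open_incl_hom] preim_open_incl pg(2) pr by simp
  qed
  then show thesis using that[OF g] pg(1) by (simp add: g_def)
qed

end

section \<open>Localizations and their mapping property\<close>

section \<open>Localization\<close>

locale localization_set = cring R for R :: "('a, 'm) ring_scheme" (structure) +
  fixes W
  assumes W_sub: "W \<subseteq> carrier R" and W_one: "\<one> \<in> W" and W_mult: "\<And>a b. a \<in> W \<Longrightarrow> b \<in> W \<Longrightarrow> a \<otimes> b \<in> W"
begin

abbreviation fr where "fr \<equiv> frac R W"
abbreviation L where "L \<equiv> localization R W"

lemma W_closed: "s \<in> W \<Longrightarrow> s \<in> carrier R" using W_sub by blast

lemma frac_eq_iff:
  assumes "a \<in> carrier R" "s \<in> W" "b \<in> carrier R" "t \<in> W"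
  shows "fr a s = fr b t \<longleftrightarrow> (\<exists>u\<in>W. u \<otimes> (t \<otimes> a) = u \<otimes> (s \<otimes> b))"
proof
  have "(b, t) \<in> fr b t" unfolding frac_def using assms W_one by auto
  moreover assume "fr a s = fr b t"
  ultimately have "(b, t) \<in> fr a s" by simp
  then show "\<exists>u\<in>W. u \<otimes> (t \<otimes> a) = u \<otimes> (s \<otimes> b)" unfolding frac_def by simp
next
  have key: "(b', t') \<in> fr b t" if m: "(b', t') \<in> fr a s" "u \<in> W" "u \<otimes> (t \<otimes> a) = u \<otimes> (s \<otimes> b)"
    "a \<in> carrier R" "s \<in> W" "b \<in> carrier R" "t \<in> W" for a s b t b' t' u
  proof -
    obtain v where v: "b' \<in> carrier R" "t' \<in> W" "v \<in> W" "v \<otimes> (t' \<otimes> a) = v \<otimes> (s \<otimes> b')"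
      using m unfolding frac_def by auto
    note c = v(1) v(2,3)[THEN W_closed] that(2)[THEN W_closed] that(4) that(5)[THEN W_closed] that(6) that(7)[THEN W_closed]
    have "(u \<otimes> v \<otimes> s) \<otimes> (t' \<otimes> b) = (v \<otimes> t') \<otimes> (u \<otimes> (s \<otimes> b))" using c by algebra
    also have "\<dots> = (u \<otimes> t) \<otimes> (v \<otimes> (t' \<otimes> a))" unfolding that(3)[symmetric] using c by algebra
    also have "\<dots> = (u \<otimes> v \<otimes> s) \<otimes> (t \<otimes> b')" unfolding v(4) using c by algebra
    finally show ?thesis unfolding frac_def using v that W_mult by auto
  qed
  assume "\<exists>u\<in>W. u \<otimes> (t \<otimes> a) = u \<otimes> (s \<otimes> b)"
  then obtain u where u: "u \<in> W" "u \<otimes> (t \<otimes> a) = u \<otimes> (s \<otimes> b)" by auto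
  show "fr a s = fr b t"
  proof (rule subset_antisym; rule subrelI)
    fix b' t'
    show "(b', t') \<in> fr a s \<Longrightarrow> (b', t') \<in> fr b t" by (rule key[OF _ u assms])
    show "(b', t') \<in> fr b t \<Longrightarrow> (b', t') \<in> fr a s" by (rule key[OF _ u(1) u(2)[symmetric] assms(3,4,1,2)])
  qed
qed

lemma frac_self: "a \<in> carrier R \<Longrightarrow> s \<in> W \<Longrightarrow> (a, s) \<in> fr a s"
  unfolding frac_def using W_one by auto

lemma frac_memD:
  assumes "(b, t) \<in> fr a s" "a \<in> carrier R" "s \<in> W"
  shows "b \<in> carrier R" "t \<in> W" "fr b t = fr a s"
proof -
  show *: "b \<in> carrier R" "t \<in> W" using assms unfolding frac_def by auto
  obtain u where "u \<in> W" "u \<otimes> (t \<otimes> a) = u \<otimes> (s \<otimes> b)" using assms unfolding frac_def by auto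
  then have "fr a s = fr b t" using frac_eq_iff[OF assms(2,3) *] by auto
  then show "fr b t = fr a s" by simp
qed

lemma frac_cancel: assumes "a \<in> carrier R" "s \<in> W" "t \<in> W" shows "fr (t \<otimes> a) (t \<otimes> s) = fr a s"
proof -
  note c = assms(1) assms(2,3)[THEN W_closed]
  have e: "\<one> \<otimes> (s \<otimes> (t \<otimes> a)) = \<one> \<otimes> ((t \<otimes> s) \<otimes> a)" using c by algebra
  show ?thesis
    by (rule frac_eq_iff[THEN iffD2]) (use c assms W_mult W_one e in auto)
qed

lemma carrier_loc: "carrier L = {fr a s | a s. a \<in> carrier R \<and> s \<in> W}"
  by (simp add: localization_def)

lemma frac_closed: "a \<in> carrier R \<Longrightarrow> s \<in> W \<Longrightarrow> fr a s \<in> carrier L"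
  unfolding carrier_loc by blast

lemma locE: assumes "A \<in> carrier L" obtains a s where "a \<in> carrier R" "s \<in> W" "A = fr a s"
  using assms unfolding carrier_loc by blast

lemma frac_mult:
  assumes "a \<in> carrier R" "s \<in> W" "b \<in> carrier R" "t \<in> W"
  shows "fr a s \<otimes>\<^bsub>L\<^esub> fr b t = fr (a \<otimes> b) (s \<otimes> t)"
  unfolding localization_def monoid.simps
proof (rule union_classes_eq)
  show "(a, s) \<in> fr a s" "(b, t) \<in> fr b t" by (rule frac_self[OF assms(1,2)], rule frac_self[OF assms(3,4)])
  fix a' s' b' t' assume m: "(a', s') \<in> fr a s" "(b', t') \<in> fr b t"
  note m1 = frac_memD[OF m(1) assms(1,2)] and m2 = frac_memD[OF m(2) assms(3,4)]
  obtain u where u: "u \<in> W" "u \<otimes> (s' \<otimes> a) = u \<otimes> (s \<otimes> a')" using m(1) unfolding frac_def by auto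
  obtain v where v: "v \<in> W" "v \<otimes> (t' \<otimes> b) = v \<otimes> (t \<otimes> b')" using m(2) unfolding frac_def by auto
  note c = u(1)[THEN W_closed] v(1)[THEN W_closed] m1(1) m2(1) m1(2)[THEN W_closed] m2(2)[THEN W_closed] assms(1,3) assms(2,4)[THEN W_closed]
  have "(u \<otimes> v) \<otimes> ((s \<otimes> t) \<otimes> (a' \<otimes> b')) = (u \<otimes> (s \<otimes> a')) \<otimes> (v \<otimes> (t \<otimes> b'))" using c by algebra
  also have "\<dots> = (u \<otimes> v) \<otimes> ((s' \<otimes> t') \<otimes> (a \<otimes> b))" unfolding u(2)[symmetric] v(2)[symmetric] using c by algebra
  finally have "(u \<otimes> v) \<otimes> ((s \<otimes> t) \<otimes> (a' \<otimes> b')) = (u \<otimes> v) \<otimes> ((s' \<otimes> t') \<otimes> (a \<otimes> b))" .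
  moreover have "u \<otimes> v \<in> W" "s \<otimes> t \<in> W" "s' \<otimes> t' \<in> W" using W_mult u v m1 m2 assms by auto
  ultimately show "fr (a' \<otimes> b') (s' \<otimes> t') = fr (a \<otimes> b) (s \<otimes> t)"
    using frac_eq_iff[of "a' \<otimes> b'" "s' \<otimes> t'" "a \<otimes> b" "s \<otimes> t"] c by auto
qed

lemma frac_add:
  assumes "a \<in> carrier R" "s \<in> W" "b \<in> carrier R" "t \<in> W"
  shows "fr a s \<oplus>\<^bsub>L\<^esub> fr b t = fr (a \<otimes> t \<oplus> b \<otimes> s) (s \<otimes> t)"
  unfolding localization_def ring.simps
proof (rule union_classes_eq)
  show "(a, s) \<in> fr a s" "(b, t) \<in> fr b t" by (rule frac_self[OF assms(1,2)], rule frac_self[OF assms(3,4)])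
  fix a' s' b' t' assume m: "(a', s') \<in> fr a s" "(b', t') \<in> fr b t"
  note m1 = frac_memD[OF m(1) assms(1,2)] and m2 = frac_memD[OF m(2) assms(3,4)]
  obtain u where u: "u \<in> W" "u \<otimes> (s' \<otimes> a) = u \<otimes> (s \<otimes> a')" using m(1) unfolding frac_def by auto
  obtain v where v: "v \<in> W" "v \<otimes> (t' \<otimes> b) = v \<otimes> (t \<otimes> b')" using m(2) unfolding frac_def by auto
  note c = u(1)[THEN W_closed] v(1)[THEN W_closed] m1(1) m2(1) m1(2)[THEN W_closed] m2(2)[THEN W_closed] assms(1,3) assms(2,4)[THEN W_closed]
  have "(u \<otimes> v) \<otimes> ((s \<otimes> t) \<otimes> (a' \<otimes> t' \<oplus> b' \<otimes> s')) = (v \<otimes> t \<otimes> t') \<otimes> (u \<otimes> (s \<otimes> a')) \<oplus> (u \<otimes> s \<otimes> s') \<otimes> (v \<otimes> (t \<otimes> b'))" using c by algebra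
  also have "\<dots> = (u \<otimes> v) \<otimes> ((s' \<otimes> t') \<otimes> (a \<otimes> t \<oplus> b \<otimes> s))" unfolding u(2)[symmetric] v(2)[symmetric] using c by algebra
  finally have "(u \<otimes> v) \<otimes> ((s \<otimes> t) \<otimes> (a' \<otimes> t' \<oplus> b' \<otimes> s')) = (u \<otimes> v) \<otimes> ((s' \<otimes> t') \<otimes> (a \<otimes> t \<oplus> b \<otimes> s))" .
  moreover have "u \<otimes> v \<in> W" "s \<otimes> t \<in> W" "s' \<otimes> t' \<in> W" using W_mult u v m1 m2 assms by auto
  ultimately show "fr (a' \<otimes> t' \<oplus> b' \<otimes> s') (s' \<otimes> t') = fr (a \<otimes> t \<oplus> b \<otimes> s) (s \<otimes> t)"
    using frac_eq_iff[of "a' \<otimes> t' \<oplus> b' \<otimes> s'" "s' \<otimes> t'" "a \<otimes> t \<oplus> b \<otimes> s" "s \<otimes> t"] c by auto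
qed

lemma loc_one: "\<one>\<^bsub>L\<^esub> = fr \<one> \<one>" and loc_zero: "\<zero>\<^bsub>L\<^esub> = fr \<zero> \<one>"
  by (simp_all add: localization_def)

lemma frac_eqI: "a \<in> carrier R \<Longrightarrow> s \<in> W \<Longrightarrow> b \<in> carrier R \<Longrightarrow> t \<in> W \<Longrightarrow> t \<otimes> a = s \<otimes> b \<Longrightarrow> fr a s = fr b t"
  using frac_eq_iff W_one by auto

text \<open>With a common denominator the ring axioms of the localization reduce to those of the
  numerators.\<close>

lemma locE3:
  assumes "A \<in> carrier L" "B \<in> carrier L" "C \<in> carrier L"
  obtains a b c s where "a \<in> carrier R" "b \<in> carrier R" "c \<in> carrier R" "s \<in> W" "A = fr a s" "B = fr b s" "C = fr c s"
proof -
  obtain a s b t c v where *: "a \<in> carrier R" "s \<in> W" "A = fr a s" "b \<in> carrier R" "t \<in> W" "B = fr b t"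
      "c \<in> carrier R" "v \<in> W" "C = fr c v" by (metis locE assms)
  note W = *(2,5,8) and Wc = *(2,5,8)[THEN W_closed]
  have e: "t \<otimes> v \<otimes> s = s \<otimes> t \<otimes> v" "s \<otimes> v \<otimes> t = s \<otimes> t \<otimes> v" using Wc by algebra+
  show thesis
    using that[of "t \<otimes> v \<otimes> a" "s \<otimes> v \<otimes> b" "s \<otimes> t \<otimes> c" "s \<otimes> t \<otimes> v"] * W Wc W_mult e
      frac_cancel[OF *(1,2) W_mult[OF W(2,3)]] frac_cancel[OF *(4,5) W_mult[OF W(1,3)]] frac_cancel[OF *(7,8) W_mult[OF W(1,2)]] by simp
qed

lemma frac_add_same: assumes "a \<in> carrier R" "b \<in> carrier R" "s \<in> W" shows "fr a s \<oplus>\<^bsub>L\<^esub> fr b s = fr (a \<oplus> b) s"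
  using assms frac_cancel[of "a \<oplus> b" s s] W_closed by (simp add: frac_add l_distr[symmetric] m_comm)

lemma loc_cring: "cring L"
proof (rule cringI3)
  note c = W_closed W_mult W_one frac_mult frac_add_same frac_closed loc_one loc_zero
  fix A B C assume A: "A \<in> carrier L" and B: "B \<in> carrier L" and C: "C \<in> carrier L"
  obtain a b d s where *: "a \<in> carrier R" "b \<in> carrier R" "d \<in> carrier R" "s \<in> W" "A = fr a s" "B = fr b s" "C = fr d s"
    by (rule locE3[OF A B C])
  show "A \<oplus>\<^bsub>L\<^esub> B \<oplus>\<^bsub>L\<^esub> C = A \<oplus>\<^bsub>L\<^esub> (B \<oplus>\<^bsub>L\<^esub> C) \<and> A \<otimes>\<^bsub>L\<^esub> B \<otimes>\<^bsub>L\<^esub> C = A \<otimes>\<^bsub>L\<^esub> (B \<otimes>\<^bsub>L\<^esub> C) \<and> (A \<oplus>\<^bsub>L\<^esub> B) \<otimes>\<^bsub>L\<^esub> C = A \<otimes>\<^bsub>L\<^esub> C \<oplus>\<^bsub>L\<^esub> B \<otimes>\<^bsub>L\<^esub> C"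
    using * by (simp add: c a_assoc m_assoc l_distr)
next
  note c = W_closed W_mult W_one frac_mult frac_add_same frac_closed loc_one
  fix A B assume A: "A \<in> carrier L" and B: "B \<in> carrier L"
  obtain a b d s where *: "a \<in> carrier R" "b \<in> carrier R" "d \<in> carrier R" "s \<in> W" "A = fr a s" "B = fr b s" "B = fr d s"
    by (rule locE3[OF A B B])
  show "A \<oplus>\<^bsub>L\<^esub> B \<in> carrier L \<and> A \<otimes>\<^bsub>L\<^esub> B \<in> carrier L \<and> A \<oplus>\<^bsub>L\<^esub> B = B \<oplus>\<^bsub>L\<^esub> A \<and> A \<otimes>\<^bsub>L\<^esub> B = B \<otimes>\<^bsub>L\<^esub> A"
    using *(1,2,4,5,6) by (simp add: c a_comm m_comm)
  have z: "\<zero>\<^bsub>L\<^esub> = fr \<zero> s" unfolding loc_zero by (rule frac_eqI) (use * in \<open>simp_all add: c\<close>)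
  show "\<zero>\<^bsub>L\<^esub> \<oplus>\<^bsub>L\<^esub> A = A \<and> \<one>\<^bsub>L\<^esub> \<otimes>\<^bsub>L\<^esub> A = A \<and> (\<exists>B \<in> carrier L. B \<oplus>\<^bsub>L\<^esub> A = \<zero>\<^bsub>L\<^esub>)"
    using *(1,4,5) by (auto simp: c z l_neg intro!: bexI[of _ "fr (\<ominus> a) s"])
qed (simp add: loc_one loc_zero frac_closed W_one)

lemma frac_hom: "(\<lambda>a. fr a \<one>) \<in> ring_hom R L"
  by (rule ring_hom_memI) (simp_all add: frac_closed frac_mult frac_add W_one loc_one)

lemma frac_unit: "s \<in> W \<Longrightarrow> t \<in> W \<Longrightarrow> fr s t \<in> Units L"
  by (rule cring.Units_of_mult_one[OF loc_cring, of _ "fr t s"])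
    (simp_all add: frac_closed frac_mult loc_one W_closed W_mult W_one m_comm[of s t] frac_eqI)

end

lemma localization_set_prime:
  assumes "primeideal P R" shows "localization_set R (carrier R - P)"
proof -
  interpret primeideal P R by fact
  show ?thesis
    by unfold_locales (use I_prime one_imp_carrier I_notcarr in auto)
qed

text \<open>The extension of \<open>h\<close> to fractions in the universal property of the
  localization. Quantifying over all representatives of the class \<open>A\<close> turns
  independence of the fraction into the existence of \<open>y\<close>.\<close>

definition loc_lift :: "('a, 'm) ring_scheme \<Rightarrow> ('b, 'n) ring_scheme \<Rightarrow> ('a \<Rightarrow> 'b) \<Rightarrow> ('a \<times> 'a) set \<Rightarrow> 'b" where
  "loc_lift R S h A = (THE y. \<forall>(a, s) \<in> A. y = h a \<otimes>\<^bsub>S\<^esub> inv\<^bsub>S\<^esub> (h s))"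

context localization_set
begin

context
  fixes S :: "('s, 'n) ring_scheme" and h
  assumes S: "cring S" and h: "h \<in> ring_hom R S" and hW': "h ` W \<subseteq> Units S"
begin

lemma hW: "s \<in> W \<Longrightarrow> h s \<in> Units S"
  using hW' by blast

interpretation S: cring S by (rule S)
interpretation h: ring_hom_cring R S h by (rule ring_hom_cringI2[OF is_cring S h])

lemma loc_lift_frac:
  assumes "a \<in> carrier R" "s \<in> W"
  shows "loc_lift R S h (fr a s) = h a \<otimes>\<^bsub>S\<^esub> inv\<^bsub>S\<^esub> (h s)"
  unfolding loc_lift_def
proof (rule the_equality)
  show "\<forall>(b, t) \<in> fr a s. h a \<otimes>\<^bsub>S\<^esub> inv\<^bsub>S\<^esub> (h s) = h b \<otimes>\<^bsub>S\<^esub> inv\<^bsub>S\<^esub> (h t)"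
  proof (clarify)
    fix b t assume m: "(b, t) \<in> fr a s"
    then obtain u where u: "b \<in> carrier R" "t \<in> W" "u \<in> W" "u \<otimes> (t \<otimes> a) = u \<otimes> (s \<otimes> b)" unfolding frac_def by auto
    have c: "h a \<in> carrier S" "h b \<in> carrier S" "h t \<in> Units S" "h s \<in> Units S" "h u \<in> Units S"
      using assms u hW by auto
    have cc: "h t \<in> carrier S" "h s \<in> carrier S" "h u \<in> carrier S" using c by auto
    have "h (u \<otimes> (t \<otimes> a)) = h (u \<otimes> (s \<otimes> b))" using u by simp
    then have "h u \<otimes>\<^bsub>S\<^esub> (h t \<otimes>\<^bsub>S\<^esub> h a) = h u \<otimes>\<^bsub>S\<^esub> (h s \<otimes>\<^bsub>S\<^esub> h b)"
      using u(1) assms(1) u(2,3)[THEN W_closed] assms(2)[THEN W_closed] by simp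
    then have e: "h t \<otimes>\<^bsub>S\<^esub> h a = h s \<otimes>\<^bsub>S\<^esub> h b" using c cc by (simp add: S.Units_l_cancel)
    have "h a \<otimes>\<^bsub>S\<^esub> inv\<^bsub>S\<^esub> (h s) = (h t \<otimes>\<^bsub>S\<^esub> inv\<^bsub>S\<^esub> (h t)) \<otimes>\<^bsub>S\<^esub> (h a \<otimes>\<^bsub>S\<^esub> inv\<^bsub>S\<^esub> (h s))" using c by simp
    also have "\<dots> = (h t \<otimes>\<^bsub>S\<^esub> h a) \<otimes>\<^bsub>S\<^esub> (inv\<^bsub>S\<^esub> (h t) \<otimes>\<^bsub>S\<^esub> inv\<^bsub>S\<^esub> (h s))" using c cc S.Units_inv_closed[OF c(3)] S.Units_inv_closed[OF c(4)] by algebra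
    also have "\<dots> = (h s \<otimes>\<^bsub>S\<^esub> inv\<^bsub>S\<^esub> (h s)) \<otimes>\<^bsub>S\<^esub> (h b \<otimes>\<^bsub>S\<^esub> inv\<^bsub>S\<^esub> (h t))" unfolding e using c cc S.Units_inv_closed[OF c(3)] S.Units_inv_closed[OF c(4)] by algebra
    also have "\<dots> = h b \<otimes>\<^bsub>S\<^esub> inv\<^bsub>S\<^esub> (h t)" using c by simp
    finally show "h a \<otimes>\<^bsub>S\<^esub> inv\<^bsub>S\<^esub> (h s) = h b \<otimes>\<^bsub>S\<^esub> inv\<^bsub>S\<^esub> (h t)" .
  qed
  fix y assume "\<forall>(b, t) \<in> fr a s. y = h b \<otimes>\<^bsub>S\<^esub> inv\<^bsub>S\<^esub> (h t)"
  then show "y = h a \<otimes>\<^bsub>S\<^esub> inv\<^bsub>S\<^esub> (h s)" using frac_self[OF assms] by auto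
qed

lemma loc_lift_cross:
  assumes "a \<in> carrier R" "s \<in> W"
  shows "h s \<otimes>\<^bsub>S\<^esub> loc_lift R S h (fr a s) = h a"
  unfolding loc_lift_frac[OF assms]
  using assms hW[OF assms(2)] by (simp add: S.m_lcomm[of "h s" "h a"] S.Units_closed)

text \<open>The value is recognised by the cross-multiplied equation, so that a germ can be
  identified with a quotient without forming the quotient.\<close>

lemma loc_lift_eqI:
  assumes "a \<in> carrier R" "s \<in> W" "y \<in> carrier S" "h s \<otimes>\<^bsub>S\<^esub> y = h a"
  shows "loc_lift R S h (fr a s) = y"
proof -
  have "loc_lift R S h (fr a s) \<in> carrier S" unfolding loc_lift_frac[OF assms(1,2)] using hW assms by simp
  then show ?thesis using loc_lift_cross[OF assms(1,2)] assms hW[OF assms(2)] S.Units_l_cancel[OF hW[OF assms(2)], of _ y] by simp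
qed

lemma loc_lift_hom: "loc_lift R S h \<in> ring_hom L S"
proof (rule ring_hom_memI)
  fix A assume "A \<in> carrier L"
  then obtain a s where *: "a \<in> carrier R" "s \<in> W" "A = fr a s" by (rule locE)
  then show "loc_lift R S h A \<in> carrier S" using hW by (simp add: loc_lift_frac)
next
  fix A B assume "A \<in> carrier L" "B \<in> carrier L"
  then obtain a s b t where *: "a \<in> carrier R" "s \<in> W" "A = fr a s" "b \<in> carrier R" "t \<in> W" "B = fr b t"
    by (metis locE)
  let ?A = "loc_lift R S h A" and ?B = "loc_lift R S h B"
  have c: "?A \<in> carrier S" "?B \<in> carrier S" "h a \<in> carrier S" "h b \<in> carrier S" "h s \<in> carrier S" "h t \<in> carrier S"
    using * hW by (auto simp: loc_lift_frac S.Units_closed)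
  have e: "h s \<otimes>\<^bsub>S\<^esub> ?A = h a" "h t \<otimes>\<^bsub>S\<^esub> ?B = h b" using * by (simp_all add: loc_lift_cross)
  have st: "s \<otimes> t \<in> W" using * W_mult by blast
  have sc: "s \<in> carrier R" "t \<in> carrier R" using * W_closed by auto
  have hs: "h (s \<otimes> t) = h s \<otimes>\<^bsub>S\<^esub> h t" using sc by simp
  have "h (s \<otimes> t) \<otimes>\<^bsub>S\<^esub> (?A \<otimes>\<^bsub>S\<^esub> ?B) = (h s \<otimes>\<^bsub>S\<^esub> ?A) \<otimes>\<^bsub>S\<^esub> (h t \<otimes>\<^bsub>S\<^esub> ?B)" unfolding hs using c by algebra
  also have "\<dots> = h (a \<otimes> b)" unfolding e using *(1,4) by simp
  finally have m: "h (s \<otimes> t) \<otimes>\<^bsub>S\<^esub> (?A \<otimes>\<^bsub>S\<^esub> ?B) = h (a \<otimes> b)" .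
  show "loc_lift R S h (A \<otimes>\<^bsub>L\<^esub> B) = ?A \<otimes>\<^bsub>S\<^esub> ?B"
    unfolding *(3,6) frac_mult[OF *(1,2,4,5)]
    by (rule loc_lift_eqI[OF _ st _ m[unfolded *(3,6)]]) (use *(1,4) c(1,2) in \<open>simp_all add: *(3,6)\<close>)
  have "h (s \<otimes> t) \<otimes>\<^bsub>S\<^esub> (?A \<oplus>\<^bsub>S\<^esub> ?B) = (h s \<otimes>\<^bsub>S\<^esub> ?A) \<otimes>\<^bsub>S\<^esub> h t \<oplus>\<^bsub>S\<^esub> (h t \<otimes>\<^bsub>S\<^esub> ?B) \<otimes>\<^bsub>S\<^esub> h s"
    unfolding hs using c by algebra
  also have "\<dots> = h (a \<otimes> t \<oplus> b \<otimes> s)" unfolding e using *(1,4) sc by simp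
  finally have m: "h (s \<otimes> t) \<otimes>\<^bsub>S\<^esub> (?A \<oplus>\<^bsub>S\<^esub> ?B) = h (a \<otimes> t \<oplus> b \<otimes> s)" .
  show "loc_lift R S h (A \<oplus>\<^bsub>L\<^esub> B) = ?A \<oplus>\<^bsub>S\<^esub> ?B"
    unfolding *(3,6) frac_add[OF *(1,2,4,5)]
    by (rule loc_lift_eqI[OF _ st _ m[unfolded *(3,6)]]) (use *(1,4) sc c(1,2) in \<open>simp_all add: *(3,6)\<close>)
next
  show "loc_lift R S h \<one>\<^bsub>L\<^esub> = \<one>\<^bsub>S\<^esub>" unfolding loc_one by (rule loc_lift_eqI) (simp_all add: W_one)
qed

end

end

context primeideal
begin

abbreviation RP where "RP \<equiv> localization R (carrier R - I)"

lemma frac_prime_unit_iff: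
  assumes "a \<in> carrier R" "s \<in> carrier R" "s \<notin> I"
  shows "frac R (carrier R - I) a s \<in> Units RP \<longleftrightarrow> a \<notin> I"
proof -
  interpret l: localization_set R "carrier R - I" by (rule localization_set_prime) (rule primeideal_axioms)
  have s: "s \<in> carrier R - I" using assms by simp
  show ?thesis
  proof
    assume "l.fr a s \<in> Units RP"
    then obtain B where B: "B \<in> carrier RP" "l.fr a s \<otimes>\<^bsub>RP\<^esub> B = \<one>\<^bsub>RP\<^esub>" unfolding Units_def by auto
    then obtain b t where b: "b \<in> carrier R" "t \<in> carrier R - I" "B = l.fr b t" by (auto elim: l.locE)
    have "l.fr (a \<otimes> b) (s \<otimes> t) = l.fr \<one> \<one>"
      using B(2) l.frac_mult[OF assms(1) s b(1,2)] unfolding b(3) l.loc_one by simp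
    then obtain u where u: "u \<in> carrier R - I" "u \<otimes> (\<one> \<otimes> (a \<otimes> b)) = u \<otimes> ((s \<otimes> t) \<otimes> \<one>)"
      using l.frac_eq_iff[of "a \<otimes> b" "s \<otimes> t" \<one> \<one>] assms b l.W_mult[OF s b(2)] l.W_one by auto
    have "u \<otimes> (s \<otimes> t) \<in> carrier R - I" by (intro l.W_mult u s b)
    then have "u \<otimes> (a \<otimes> b) \<notin> I" using u assms b by simp
    moreover have "u \<otimes> (a \<otimes> b) \<in> I" if "a \<in> I"
      using I_l_closed[OF I_r_closed[OF that b(1)], of u] u by simp
    ultimately show "a \<notin> I" by blast
  next
    assume "a \<notin> I"
    then show "l.fr a s \<in> Units RP" using l.frac_unit assms by auto
  qed
qed

lemma localization_local: "local_ring RP"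
proof -
  interpret l: localization_set R "carrier R - I" by (rule localization_set_prime) (rule primeideal_axioms)
  have "\<one>\<^bsub>RP\<^esub> \<noteq> \<zero>\<^bsub>RP\<^esub>"
  proof
    assume "\<one>\<^bsub>RP\<^esub> = \<zero>\<^bsub>RP\<^esub>"
    then have "l.fr \<zero> \<one> \<in> Units RP"
      using monoid.Units_one_closed[of RP] ring.is_monoid[OF cring.axioms(1)[OF l.loc_cring]] unfolding l.loc_zero by simp
    then show False using frac_prime_unit_iff[of \<zero> \<one>] l.W_one by auto
  qed
  moreover have "A \<oplus>\<^bsub>RP\<^esub> B \<notin> Units RP" if AB: "A \<in> carrier RP" "B \<in> carrier RP" "A \<notin> Units RP" "B \<notin> Units RP" for A B
  proof -
    obtain a s where a: "a \<in> carrier R" "s \<in> carrier R - I" "A = l.fr a s" using AB(1) by (rule l.locE)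
    obtain b t where b: "b \<in> carrier R" "t \<in> carrier R - I" "B = l.fr b t" using AB(2) by (rule l.locE)
    have "a \<in> I" "b \<in> I" using AB a b frac_prime_unit_iff by auto
    then have "a \<otimes> t \<oplus> b \<otimes> s \<in> I" using additive_subgroup.a_closed[OF is_additive_subgroup I_r_closed[of a t] I_r_closed[of b s]] a b by simp
    then show ?thesis using l.frac_add[OF a(1,2) b(1,2)] a b l.W_mult[OF a(2) b(2)]
      frac_prime_unit_iff[of "a \<otimes> t \<oplus> b \<otimes> s" "s \<otimes> t"] by auto
  qed
  ultimately show ?thesis unfolding local_ring_iff using l.loc_cring by blast
qed

end

section \<open>Spectra\<close>

lemma sec_Spec [simp]: "sec (Spec R) = spec_sections R" and res_Spec [simp]: "res (Spec R) = (\<lambda>U V s. restrict s V)"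
  and top_of_Spec [simp]: "top_of (Spec R) = zariski R"
  by (simp_all add: Spec_def)

locale spectrum = cring R for R :: "('a, 'm) ring_scheme" (structure)
begin

abbreviation Lo where "Lo P \<equiv> localization R (carrier R - P)"
abbreviation fr where "fr P \<equiv> frac R (carrier R - P)"

lemma lset: "primeideal P R \<Longrightarrow> localization_set R (carrier R - P)"
  by (rule localization_set_prime)

lemma points_Spec: "topspace (zariski R) = {P. primeideal P R}"
proof -
  have "openin (zariski R) {P. primeideal P R}"
    unfolding openin_zariski
  proof (intro exI conjI)
    have "\<not> carrier R \<subseteq> P" if "primeideal P R" for P
      using that primeideal.I_notcarr[OF that] ideal.Icarr[OF primeideal.axioms(1)[OF that]] by auto
    then show "{P. primeideal P R} = {P. primeideal P R \<and> \<not> carrier R \<subseteq> P}" by blast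
  qed simp
  moreover have "U \<subseteq> {P. primeideal P R}" if "openin (zariski R) U" for U
    using that unfolding openin_zariski by blast
  ultimately show ?thesis unfolding topspace_def by blast
qed

lemma open_prime: "openin (zariski R) U \<Longrightarrow> P \<in> U \<Longrightarrow> primeideal P R"
  using openin_subset[of "zariski R" U] points_Spec by blast

definition D where "D f = {P. primeideal P R \<and> f \<notin> P}"

lemma D_open: "f \<in> carrier R \<Longrightarrow> openin (zariski R) (D f)"
  unfolding openin_zariski D_def by (intro exI[of _ "{f}"]) auto

lemma D_basis: assumes "openin (zariski R) U" "P \<in> U"
  obtains f where "f \<in> carrier R" "P \<in> D f" "D f \<subseteq> U"
proof -
  obtain I where I: "I \<subseteq> carrier R" "U = {P. primeideal P R \<and> \<not> I \<subseteq> P}" using assms(1) unfolding openin_zariski by auto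
  then obtain f where f: "f \<in> I" "f \<notin> P" using assms(2) by auto
  show thesis
  proof (rule that)
    show "f \<in> carrier R" using f I by auto
    show "P \<in> D f" "D f \<subseteq> U" using f I assms(2) unfolding D_def by auto
  qed
qed

lemma one_notin: "primeideal P R \<Longrightarrow> \<one> \<notin> P"
  using ideal.one_imp_carrier[OF primeideal.axioms(1)] primeideal.I_notcarr by blast

text \<open>In place of writing \<open>\<one>\<close> as a combination of functions,
  \<open>J\<close> collects the elements that lie in every prime containing some finite part of
  \<open>F0\<close>. It is a directed union of radicals of finitely generated ideals, and
  \<open>\<one> \<in> J\<close> is exactly a finite subcover.\<close>

lemma compact_points: "compactin (zariski R) {P. primeideal P R}"
  unfolding compactin_def
proof (intro conjI allI impI)
  show "{P. primeideal P R} \<subseteq> topspace (zariski R)" by (simp add: points_Spec)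
  fix \<U> assume h: "Ball \<U> (openin (zariski R)) \<and> {P. primeideal P R} \<subseteq> \<Union>\<U>"
  define F0 where "F0 = {f \<in> carrier R. \<exists>U \<in> \<U>. D f \<subseteq> U}"
  define J where "J = {a \<in> carrier R. \<exists>F. finite F \<and> F \<subseteq> F0 \<and> (\<forall>P. primeideal P R \<longrightarrow> F \<subseteq> P \<longrightarrow> a \<in> P)}"
  have J_I: "a \<in> J" if "a \<in> carrier R" "finite F" "F \<subseteq> F0" "\<And>P. primeideal P R \<Longrightarrow> F \<subseteq> P \<Longrightarrow> a \<in> P" for a F
    unfolding J_def using that by blast
  have J_E: "\<exists>F. a \<in> carrier R \<and> finite F \<and> F \<subseteq> F0 \<and> (\<forall>P. primeideal P R \<longrightarrow> F \<subseteq> P \<longrightarrow> a \<in> P)" if "a \<in> J" for a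
    using that unfolding J_def by blast
  note sg = ideal.axioms(1)[OF primeideal.axioms(1)]
  have J: "ideal J R"
  proof (rule idealI[OF ring_axioms])
    show "subgroup J (add_monoid R)"
    proof (rule add.subgroupI)
      have "\<zero> \<in> J" by (rule J_I[of _ "{}"]) (simp_all add: additive_subgroup.zero_closed[OF sg])
      then show "J \<noteq> {}" by blast
      fix a assume "a \<in> J"
      from J_E[OF this] obtain F where F: "a \<in> carrier R" "finite F" "F \<subseteq> F0" "\<And>P. primeideal P R \<Longrightarrow> F \<subseteq> P \<Longrightarrow> a \<in> P" by auto
      show "\<ominus> a \<in> J" by (rule J_I[OF _ F(2,3)]) (simp_all add: F additive_subgroup.a_inv_closed[OF sg])
      fix b assume "b \<in> J"
      from J_E[OF this] obtain G where G: "b \<in> carrier R" "finite G" "G \<subseteq> F0" "\<And>P. primeideal P R \<Longrightarrow> G \<subseteq> P \<Longrightarrow> b \<in> P" by auto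
      show "a \<oplus> b \<in> J" by (rule J_I[of _ "F \<union> G"]) (simp_all add: F G additive_subgroup.a_closed[OF sg])
    qed (auto simp: J_def)
    fix a x assume "a \<in> J" and x: "x \<in> carrier R"
    from J_E[OF this(1)] obtain F where F: "a \<in> carrier R" "finite F" "F \<subseteq> F0" "\<And>P. primeideal P R \<Longrightarrow> F \<subseteq> P \<Longrightarrow> a \<in> P" by auto
    show "x \<otimes> a \<in> J" "a \<otimes> x \<in> J"
      by (rule J_I[OF _ F(2,3)], simp_all add: F x ideal.I_l_closed[OF primeideal.axioms(1)] ideal.I_r_closed[OF primeideal.axioms(1)])+
  qed
  \<comment> \<open>A prime above \<open>J\<close> lies in a member of the cover, hence in some
    \<open>D f\<close> inside that member; but \<open>f\<close> itself belongs to
    \<open>J\<close>.\<close>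
  have "\<one> \<in> J"
  proof (rule ccontr)
    assume "\<one> \<notin> J"
    then obtain P where P: "primeideal P R" "J \<subseteq> P" using exists_prime_avoiding[OF J, of "{\<one>}"] by auto
    then obtain U where U: "U \<in> \<U>" "P \<in> U" using h by auto
    then obtain f where f: "f \<in> carrier R" "P \<in> D f" "D f \<subseteq> U" using D_basis h by metis
    then have "f \<in> J" by (intro J_I[of f "{f}"]) (use U in \<open>auto simp: F0_def\<close>)
    then show False using f(2) P(2) unfolding D_def by blast
  qed
  then obtain F where F: "finite F" "F \<subseteq> F0" "\<And>P. primeideal P R \<Longrightarrow> F \<subseteq> P \<Longrightarrow> \<one> \<in> P" unfolding J_def by blast
  then have "\<forall>f \<in> F. \<exists>U \<in> \<U>. D f \<subseteq> U" unfolding F0_def by blast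
  then obtain c where c: "\<And>f. f \<in> F \<Longrightarrow> c f \<in> \<U>" "\<And>f. f \<in> F \<Longrightarrow> D f \<subseteq> c f" by metis
  have "{P. primeideal P R} \<subseteq> \<Union>(c ` F)"
  proof
    fix P assume "P \<in> {P. primeideal P R}"
    then have P: "primeideal P R" by simp
    then obtain f where "f \<in> F" "f \<notin> P" using F(3) one_notin by blast
    then show "P \<in> \<Union>(c ` F)" using c(2) P unfolding D_def by auto
  qed
  then show "\<exists>\<F>. finite \<F> \<and> \<F> \<subseteq> \<U> \<and> {P. primeideal P R} \<subseteq> \<Union>\<F>"
    using c(1) F(1) by (intro exI[of _ "c ` F"]) auto
qed

lemma secD_local: assumes "s \<in> spec_secs R U" "P \<in> U"
  obtains V a f where "openin (zariski R) V" "P \<in> V" "V \<subseteq> U" "a \<in> carrier R" "f \<in> carrier R"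
    "\<forall>Q \<in> V. f \<notin> Q \<and> s Q = fr Q a f"
proof -
  have "\<exists>V. openin (zariski R) V \<and> P \<in> V \<and> V \<subseteq> U \<and> (\<exists>a \<in> carrier R. \<exists>f \<in> carrier R. \<forall>Q \<in> V. f \<notin> Q \<and> s Q = fr Q a f)"
    using assms unfolding spec_sections_def by simp
  then show thesis using that by (elim exE conjE bexE) simp
qed

lemma sec_ext: "s \<in> spec_secs R U \<Longrightarrow> s \<in> extensional U"
  unfolding spec_sections_def by (simp add: PiE_def)

lemma sec_val: "s \<in> spec_secs R U \<Longrightarrow> P \<in> U \<Longrightarrow> s P \<in> carrier (Lo P)"
  unfolding spec_sections_def by (auto dest: PiE_mem)

lemma secI: assumes U: "openin (zariski R) U" and e: "s \<in> extensional U"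
  and l: "\<And>P. P \<in> U \<Longrightarrow> \<exists>V a f. openin (zariski R) V \<and> P \<in> V \<and> V \<subseteq> U \<and> a \<in> carrier R \<and> f \<in> carrier R \<and> (\<forall>Q \<in> V. f \<notin> Q \<and> s Q = fr Q a f)"
  shows "s \<in> spec_secs R U"
proof -
  have "s P \<in> carrier (Lo P)" if P: "P \<in> U" for P
  proof -
    interpret l: localization_set R "carrier R - P" by (rule lset[OF open_prime[OF U P]])
    obtain V a f where "P \<in> V" "a \<in> carrier R" "f \<in> carrier R" "\<forall>Q \<in> V. f \<notin> Q \<and> s Q = fr Q a f"
      using l[OF P] by metis
    then show ?thesis using l.frac_closed[of a f] by auto
  qed
  then have "s \<in> (\<Pi>\<^sub>E P \<in> U. carrier (Lo P))" using e by (auto simp: PiE_def)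
  moreover have "\<forall>P \<in> U. \<exists>V. openin (zariski R) V \<and> P \<in> V \<and> V \<subseteq> U \<and> (\<exists>a \<in> carrier R. \<exists>f \<in> carrier R. \<forall>Q \<in> V. f \<notin> Q \<and> s Q = fr Q a f)"
    using l by meson
  ultimately show ?thesis unfolding spec_sections_def by simp
qed

lemma sec_eq: "s \<in> spec_secs R U \<Longrightarrow> t \<in> spec_secs R U \<Longrightarrow> (\<And>P. P \<in> U \<Longrightarrow> s P = t P) \<Longrightarrow> s = t"
  by (rule extensionalityI[OF sec_ext sec_ext])

lemma sec_mult: "s \<otimes>\<^bsub>spec_sections R U\<^esub> t = (\<lambda>P \<in> U. s P \<otimes>\<^bsub>Lo P\<^esub> t P)"
  and sec_add: "s \<oplus>\<^bsub>spec_sections R U\<^esub> t = (\<lambda>P \<in> U. s P \<oplus>\<^bsub>Lo P\<^esub> t P)"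
  and sec_one: "\<one>\<^bsub>spec_sections R U\<^esub> = (\<lambda>P \<in> U. \<one>\<^bsub>Lo P\<^esub>)"
  and sec_zero: "\<zero>\<^bsub>spec_sections R U\<^esub> = (\<lambda>P \<in> U. \<zero>\<^bsub>Lo P\<^esub>)"
  by (simp_all add: spec_sections_def)

lemma fsec_closed:
  assumes "openin (zariski R) U" "a \<in> carrier R" "f \<in> carrier R" "\<And>Q. Q \<in> U \<Longrightarrow> f \<notin> Q"
  shows "(\<lambda>Q \<in> U. fr Q a f) \<in> spec_secs R U"
proof (rule secI[OF assms(1)])
  fix P assume "P \<in> U"
  then show "\<exists>V a' f'. openin (zariski R) V \<and> P \<in> V \<and> V \<subseteq> U \<and> a' \<in> carrier R \<and> f' \<in> carrier R \<and> (\<forall>Q \<in> V. f' \<notin> Q \<and> (\<lambda>Q \<in> U. fr Q a f) Q = fr Q a' f')"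
    using assms by (intro exI[of _ U] exI[of _ a] exI[of _ f]) simp
qed simp

text \<open>The function \<open>h\<close> supplies the numerator while denominators always multiply.
  Products and sums of sections are both of this shape.\<close>

lemma sec_pointwise:
  assumes U: "openin (zariski R) U" and s: "s \<in> spec_secs R U" and t: "t \<in> spec_secs R U"
    and op: "\<And>a f b g. a \<in> carrier R \<Longrightarrow> f \<in> carrier R \<Longrightarrow> b \<in> carrier R \<Longrightarrow> g \<in> carrier R \<Longrightarrow> h a f b g \<in> carrier R \<and>
      (\<forall>Q \<in> U. f \<notin> Q \<longrightarrow> g \<notin> Q \<longrightarrow> op Q (fr Q a f) (fr Q b g) = fr Q (h a f b g) (f \<otimes> g))"
  shows "(\<lambda>P \<in> U. op P (s P) (t P)) \<in> spec_secs R U"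
proof (rule secI[OF U])
  fix P assume P: "P \<in> U"
  from s P obtain V a f where V: "openin (zariski R) V" "P \<in> V" "V \<subseteq> U" "a \<in> carrier R" "f \<in> carrier R"
    "\<forall>Q \<in> V. f \<notin> Q \<and> s Q = fr Q a f" by (rule secD_local)
  from t P obtain W b g where W: "openin (zariski R) W" "P \<in> W" "W \<subseteq> U" "b \<in> carrier R" "g \<in> carrier R"
    "\<forall>Q \<in> W. g \<notin> Q \<and> t Q = fr Q b g" by (rule secD_local)
  have pw: "f \<otimes> g \<notin> Q \<and> (\<lambda>P \<in> U. op P (s P) (t P)) Q = fr Q (h a f b g) (f \<otimes> g)" if Q: "Q \<in> V \<inter> W" for Q
  proof -
    have QU: "Q \<in> U" "Q \<in> V" "Q \<in> W" using Q V(3) by auto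
    have "f \<otimes> g \<notin> Q" using primeideal.I_prime[OF open_prime[OF U QU(1)] V(5) W(5)] V(6) W(6) QU by auto
    then show ?thesis using op[OF V(4,5) W(4,5)] V(6) W(6) QU by simp
  qed
  show "\<exists>V a f. openin (zariski R) V \<and> P \<in> V \<and> V \<subseteq> U \<and> a \<in> carrier R \<and> f \<in> carrier R \<and> (\<forall>Q \<in> V. f \<notin> Q \<and> (\<lambda>P \<in> U. op P (s P) (t P)) Q = fr Q a f)"
    by (rule exI[of _ "V \<inter> W"], rule exI[of _ "h a f b g"], rule exI[of _ "f \<otimes> g"], intro conjI ballI pw)
      (use openin_Int[OF V(1) W(1)] V(2,3,5) W(2,5) conjunct1[OF op[OF V(4,5) W(4,5)]] in auto)
qed simp

lemma spec_sections_closed2: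
  assumes U: "openin (zariski R) U" and s: "s \<in> spec_secs R U" and t: "t \<in> spec_secs R U"
  shows "s \<otimes>\<^bsub>spec_sections R U\<^esub> t \<in> spec_secs R U" "s \<oplus>\<^bsub>spec_sections R U\<^esub> t \<in> spec_secs R U"
  unfolding sec_mult sec_add
  by (rule sec_pointwise[OF U s t, where op = "\<lambda>Q. monoid.mult (Lo Q)" and h = "\<lambda>a f b g. a \<otimes> b"], use localization_set.frac_mult[OF lset[OF open_prime[OF U]]] in simp)
    (rule sec_pointwise[OF U s t, where op = "\<lambda>Q. ring.add (Lo Q)" and h = "\<lambda>a f b g. a \<otimes> g \<oplus> b \<otimes> f"], use localization_set.frac_add[OF lset[OF open_prime[OF U]]] in simp)

lemma Lo_cring: "primeideal P R \<Longrightarrow> cring (Lo P)"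
  by (rule localization_set.loc_cring[OF lset])

lemma restrict_id: "(\<And>x. x \<in> U \<Longrightarrow> f x = s x) \<Longrightarrow> s \<in> extensional U \<Longrightarrow> restrict f U = s"
  by (rule extensionalityI[of _ U]) auto

lemma spec_sections_cring: assumes U: "openin (zariski R) U" shows "cring (spec_sections R U)"
proof (rule cringI3)
  note p = open_prime[OF U]
  note simps = cring.cring_simprules[OF Lo_cring[OF p]] sec_val
  let ?S = "spec_sections R U"
  fix s t u assume s: "s \<in> carrier ?S" and t: "t \<in> carrier ?S" and u: "u \<in> carrier ?S"
  show "s \<oplus>\<^bsub>?S\<^esub> t \<oplus>\<^bsub>?S\<^esub> u = s \<oplus>\<^bsub>?S\<^esub> (t \<oplus>\<^bsub>?S\<^esub> u) \<and> s \<otimes>\<^bsub>?S\<^esub> t \<otimes>\<^bsub>?S\<^esub> u = s \<otimes>\<^bsub>?S\<^esub> (t \<otimes>\<^bsub>?S\<^esub> u) \<and> (s \<oplus>\<^bsub>?S\<^esub> t) \<otimes>\<^bsub>?S\<^esub> u = s \<otimes>\<^bsub>?S\<^esub> u \<oplus>\<^bsub>?S\<^esub> t \<otimes>\<^bsub>?S\<^esub> u"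
    unfolding sec_mult sec_add by (intro conjI restrict_ext) (use s t u in \<open>simp_all add: simps\<close>)
next
  note cl = spec_sections_closed2[OF U] and p = open_prime[OF U]
  note simps = cring.cring_simprules[OF Lo_cring[OF p]] sec_val monoid.r_one[OF ring.is_monoid[OF cring.axioms(1)[OF Lo_cring[OF p]]]]
  let ?S = "spec_sections R U"
  fix s t assume s: "s \<in> carrier ?S" and t: "t \<in> carrier ?S"
  have "s \<oplus>\<^bsub>?S\<^esub> t = t \<oplus>\<^bsub>?S\<^esub> s" "s \<otimes>\<^bsub>?S\<^esub> t = t \<otimes>\<^bsub>?S\<^esub> s"
    unfolding sec_mult sec_add by (rule restrict_ext, use s t in \<open>simp add: simps\<close>)+
  then show "s \<oplus>\<^bsub>?S\<^esub> t \<in> carrier ?S \<and> s \<otimes>\<^bsub>?S\<^esub> t \<in> carrier ?S \<and> s \<oplus>\<^bsub>?S\<^esub> t = t \<oplus>\<^bsub>?S\<^esub> s \<and> s \<otimes>\<^bsub>?S\<^esub> t = t \<otimes>\<^bsub>?S\<^esub> s"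
    using cl s t by blast
  have "\<zero>\<^bsub>?S\<^esub> \<oplus>\<^bsub>?S\<^esub> s = s" "\<one>\<^bsub>?S\<^esub> \<otimes>\<^bsub>?S\<^esub> s = s"
    unfolding sec_mult sec_add sec_one sec_zero by (rule restrict_id[OF _ sec_ext[OF s]], use s in \<open>simp add: simps\<close>)+
  \<comment> \<open>The constant section of \<open>\<ominus> \<one>\<close>: multiplying by it
    produces the additive inverse, so closure under products also gives closure under
    negation.\<close>
  moreover have m1: "(\<lambda>Q \<in> U. fr Q (\<ominus> \<one>) \<one>) \<in> carrier ?S" (is "?m \<in> _")
    by (rule fsec_closed[OF U]) (use one_notin[OF p] in auto)
  moreover have "?m \<otimes>\<^bsub>?S\<^esub> s \<oplus>\<^bsub>?S\<^esub> s = \<zero>\<^bsub>?S\<^esub>" unfolding sec_mult sec_add sec_zero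
  proof (rule restrict_ext)
    fix P assume P: "P \<in> U"
    interpret l: localization_set R "carrier R - P" by (rule lset[OF p[OF P]])
    interpret L: cring "Lo P" by (rule l.loc_cring)
    have v: "s P \<in> carrier (Lo P)" "fr P (\<ominus> \<one>) \<one> \<in> carrier (Lo P)" using sec_val[OF s P] l.frac_closed[of "\<ominus> \<one>" \<one>] l.W_one by auto
    have "fr P (\<ominus> \<one>) \<one> \<oplus>\<^bsub>Lo P\<^esub> \<one>\<^bsub>Lo P\<^esub> = \<zero>\<^bsub>Lo P\<^esub>"
      unfolding l.loc_one l.loc_zero using l.frac_add_same[of "\<ominus> \<one>" \<one> \<one>] l.W_one by (simp add: l_neg)
    then show "(\<lambda>P \<in> U. ?m P \<otimes>\<^bsub>Lo P\<^esub> s P) P \<oplus>\<^bsub>Lo P\<^esub> s P = \<zero>\<^bsub>Lo P\<^esub>" using v P L.l_distr[OF v(2) L.one_closed v(1)] by simp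
  qed
  ultimately show "\<zero>\<^bsub>?S\<^esub> \<oplus>\<^bsub>?S\<^esub> s = s \<and> \<one>\<^bsub>?S\<^esub> \<otimes>\<^bsub>?S\<^esub> s = s \<and> (\<exists>t \<in> carrier ?S. t \<oplus>\<^bsub>?S\<^esub> s = \<zero>\<^bsub>?S\<^esub>)" using cl(1)[OF m1 s] by blast
next
  note p = open_prime[OF U]
  show "\<zero>\<^bsub>spec_sections R U\<^esub> \<in> spec_secs R U \<and> \<one>\<^bsub>spec_sections R U\<^esub> \<in> spec_secs R U"
    using fsec_closed[OF U zero_closed one_closed] fsec_closed[OF U one_closed one_closed] one_notin[OF p]
      localization_set.loc_one[OF lset[OF p]] localization_set.loc_zero[OF lset[OF p]]
    unfolding sec_one sec_zero by (simp cong: restrict_cong)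
qed

end

section \<open>The structure sheaf of a spectrum and its stalks\<close>

context spectrum
begin

abbreviation pts where "pts \<equiv> {P. primeideal P R}"

declare points_Spec [simp]

lemma points_Spec': "points (Spec R) = pts"
  by simp

lemma pts_open: "openin (zariski R) pts"
  using openin_topspace[of "zariski R"] by (simp add: points_Spec)

lemma restrict_sec:
  assumes "openin (zariski R) U" "openin (zariski R) V" "V \<subseteq> U" "s \<in> spec_secs R U"
  shows "restrict s V \<in> spec_secs R V"
proof (rule secI[OF assms(2)])
  fix P assume P: "P \<in> V"
  from assms(4) subsetD[OF assms(3) P] obtain W a f where W: "openin (zariski R) W" "P \<in> W" "W \<subseteq> U" "a \<in> carrier R" "f \<in> carrier R"
    "\<forall>Q \<in> W. f \<notin> Q \<and> s Q = fr Q a f" by (rule secD_local)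
  show "\<exists>W a f. openin (zariski R) W \<and> P \<in> W \<and> W \<subseteq> V \<and> a \<in> carrier R \<and> f \<in> carrier R \<and> (\<forall>Q \<in> W. f \<notin> Q \<and> restrict s V Q = fr Q a f)"
    by (rule exI[of _ "W \<inter> V"], rule exI[of _ a], rule exI[of _ f]) (use W P assms(2) in auto)
qed simp

lemma ringed_Spec: "ringed_space (Spec R)"
  unfolding ringed_space_def sec_Spec res_Spec top_of_Spec
proof (intro conjI allI impI ballI)
  fix U assume U: "openin (zariski R) U"
  show "cring (spec_sections R U)" by (rule spec_sections_cring[OF U])
next
  fix U V assume h: "openin (zariski R) U \<and> openin (zariski R) V \<and> V \<subseteq> U"
  show "(\<lambda>s. restrict s V) \<in> ring_hom (spec_sections R U) (spec_sections R V)"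
  proof (rule ring_hom_memI)
    fix s assume s: "s \<in> spec_secs R U"
    show "restrict s V \<in> spec_secs R V" using restrict_sec s h by blast
    fix t assume t: "t \<in> spec_secs R U"
    show "restrict (s \<otimes>\<^bsub>spec_sections R U\<^esub> t) V = restrict s V \<otimes>\<^bsub>spec_sections R V\<^esub> restrict t V"
      unfolding sec_mult using h by (intro restrict_ext) auto
    show "restrict (s \<oplus>\<^bsub>spec_sections R U\<^esub> t) V = restrict s V \<oplus>\<^bsub>spec_sections R V\<^esub> restrict t V"
      unfolding sec_add using h by (intro restrict_ext) auto
  next
    show "restrict \<one>\<^bsub>spec_sections R U\<^esub> V = \<one>\<^bsub>spec_sections R V\<^esub>"
      unfolding sec_one using h by (intro restrict_ext) auto
  qed
next
  fix U s assume "s \<in> spec_secs R U"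
  then show "restrict s U = s" using sec_ext extensional_restrict by blast
next
  fix U V W and s :: "'a set \<Rightarrow> ('a \<times> 'a) set" assume "openin (zariski R) U \<and> openin (zariski R) V \<and> openin (zariski R) W \<and> W \<subseteq> V \<and> V \<subseteq> U"
  then show "restrict (restrict s V) W = restrict s W" by (intro restrict_ext) auto
next
  fix \<U> s t assume o: "\<forall>V\<in>\<U>. openin (zariski R) V" and st: "s \<in> spec_secs R (\<Union>\<U>)" "t \<in> spec_secs R (\<Union>\<U>)"
    and e: "\<forall>V\<in>\<U>. restrict s V = restrict t V"
  show "s = t"
  proof (rule sec_eq[OF st])
    fix P assume "P \<in> \<Union>\<U>"
    then obtain V where V: "V \<in> \<U>" "P \<in> V" by auto
    then have "restrict s V P = restrict t V P" using e by simp
    then show "s P = t P" using V by simp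
  qed
next
  fix \<U> and s :: "'a set set \<Rightarrow> 'a set \<Rightarrow> ('a \<times> 'a) set"
  assume h: "(\<forall>V\<in>\<U>. openin (zariski R) V \<and> s V \<in> spec_secs R V) \<and>
           (\<forall>V\<in>\<U>. \<forall>W\<in>\<U>. restrict (s V) (V \<inter> W) = restrict (s W) (V \<inter> W))"
  define t where "t = (\<lambda>P \<in> \<Union>\<U>. s (SOME V. V \<in> \<U> \<and> P \<in> V) P)"
  have tv: "t P = s V P" if V: "V \<in> \<U>" "P \<in> V" for V P
  proof -
    define W where "W = (SOME V. V \<in> \<U> \<and> P \<in> V)"
    have W: "W \<in> \<U>" "P \<in> W" using someI[of "\<lambda>V. V \<in> \<U> \<and> P \<in> V" V] V unfolding W_def by auto
    have "restrict (s V) (V \<inter> W) = restrict (s W) (V \<inter> W)" using h V(1) W(1) by blast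
    then have "restrict (s V) (V \<inter> W) P = restrict (s W) (V \<inter> W) P" by (rule fun_cong)
    then have "s V P = s W P" using V W by simp
    then show ?thesis using V unfolding t_def W_def by auto
  qed
  have "t \<in> spec_secs R (\<Union>\<U>)"
  proof (rule secI)
    show "openin (zariski R) (\<Union>\<U>)" using h by auto
    show "t \<in> extensional (\<Union>\<U>)" unfolding t_def by simp
    fix P assume "P \<in> \<Union>\<U>"
    then obtain V where V: "V \<in> \<U>" "P \<in> V" by auto
    then have "s V \<in> spec_secs R V" using h by simp
    from this V(2) obtain W a f where W: "openin (zariski R) W" "P \<in> W" "W \<subseteq> V" "a \<in> carrier R" "f \<in> carrier R"
      "\<forall>Q \<in> W. f \<notin> Q \<and> s V Q = fr Q a f" by (rule secD_local)
    then have "\<forall>Q \<in> W. f \<notin> Q \<and> t Q = fr Q a f" using tv[OF V(1)] by auto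
    moreover have "W \<subseteq> \<Union>\<U>" using W V by auto
    ultimately show "\<exists>V a f. openin (zariski R) V \<and> P \<in> V \<and> V \<subseteq> \<Union>\<U> \<and> a \<in> carrier R \<and> f \<in> carrier R \<and> (\<forall>Q \<in> V. f \<notin> Q \<and> t Q = fr Q a f)"
      using W by (intro exI[of _ W] exI[of _ a] exI[of _ f]) simp
  qed
  moreover have "\<forall>V\<in>\<U>. restrict t V = s V"
  proof
    fix V assume V: "V \<in> \<U>"
    show "restrict t V = s V" by (rule restrict_id) (use V h sec_ext tv[OF V] in auto)
  qed
  ultimately show "\<exists>t\<in>spec_secs R (\<Union> \<U>). \<forall>V\<in>\<U>. restrict t V = s V" by blast
qed

lemma rspace_Spec: "rspace (Spec R)"
  using ringed_Spec by (rule rspace.intro)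

sublocale S: rspace "Spec R" by (rule rspace_Spec)

definition can where "can a = (\<lambda>Q \<in> pts. fr Q a \<one>)"

abbreviation gcan where "gcan P a \<equiv> germ (Spec R) P pts (can a)"
abbreviation St where "St \<equiv> stalk (Spec R)"

lemma can_closed: "a \<in> carrier R \<Longrightarrow> can a \<in> spec_secs R pts"
  unfolding can_def by (rule fsec_closed[OF pts_open]) (auto simp: one_notin)

lemma can_hom: "can \<in> ring_hom R (spec_sections R pts)"
proof (rule ring_hom_memI)
  fix a b assume ab: "a \<in> carrier R" "b \<in> carrier R"
  show "can (a \<otimes> b) = can a \<otimes>\<^bsub>spec_sections R pts\<^esub> can b" unfolding sec_mult
    unfolding can_def by (rule restrict_ext) (use ab ring_hom_mult[OF localization_set.frac_hom[OF lset]] in simp)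
  show "can (a \<oplus> b) = can a \<oplus>\<^bsub>spec_sections R pts\<^esub> can b" unfolding sec_add
    unfolding can_def by (rule restrict_ext) (use ab ring_hom_add[OF localization_set.frac_hom[OF lset]] in simp)
next
  show "can \<one> = \<one>\<^bsub>spec_sections R pts\<^esub>" unfolding sec_one
    unfolding can_def by (rule restrict_ext) (use ring_hom_one[OF localization_set.frac_hom[OF lset]] in simp)
qed (rule can_closed)

text \<open>A unit near \<open>P\<close> has an invertible value in the localization at
  \<open>P\<close>, which excludes \<open>a \<in> P\<close>. Conversely, the section with value 1/a
  is an inverse over \<open>D a\<close>.\<close>

lemma germ_can_unit_iff:
  assumes P: "primeideal P R" and a: "a \<in> carrier R"
  shows "gcan P a \<in> Units (St P) \<longleftrightarrow> a \<notin> P"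
proof -
  have c: "can a \<in> secs (Spec R) pts" "opn (Spec R) pts" "P \<in> pts" using can_closed[OF a] pts_open P by simp_all
  interpret P: primeideal P R by fact
  show ?thesis
  proof
    assume "gcan P a \<in> Units (St P)"
    then obtain W where W: "openin (zariski R) W" "P \<in> W" "W \<subseteq> pts" "restrict (can a) W \<in> Units (spec_sections R W)"
      using S.germ_unit_iff[OF c(2,3,1)] by auto
    have h: "(\<lambda>s. s P) \<in> ring_hom (spec_sections R W) (Lo P)"
      by (rule ring_hom_memI) (use W(2) in \<open>simp_all add: sec_val sec_mult sec_add sec_one\<close>)
    have "restrict (can a) W P \<in> Units (Lo P)"
      using hom_Units[OF h cring.axioms(1)[OF spec_sections_cring[OF W(1)]] cring.axioms(1)[OF Lo_cring[OF P]] W(4)] by simp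
    then show "a \<notin> P" using P.frac_prime_unit_iff[OF a one_closed one_notin[OF P]] W P by (simp add: can_def)
  next
    assume nP: "a \<notin> P"
    have o: "openin (zariski R) (D a)" "P \<in> D a" "D a \<subseteq> pts" using D_open[OF a] P nP unfolding D_def by auto
    interpret SD: cring "spec_sections R (D a)" by (rule spec_sections_cring[OF o(1)])
    let ?t = "\<lambda>Q \<in> D a. fr Q \<one> a"
    have t: "?t \<in> spec_secs R (D a)" by (rule fsec_closed[OF o(1)]) (use a in \<open>auto simp: D_def\<close>)
    have r: "restrict (can a) (D a) \<in> spec_secs R (D a)" by (rule restrict_sec[OF pts_open o(1,3) can_closed[OF a]])
    have "restrict (can a) (D a) \<otimes>\<^bsub>spec_sections R (D a)\<^esub> ?t = \<one>\<^bsub>spec_sections R (D a)\<^esub>"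
      unfolding sec_mult sec_one
    proof (rule restrict_ext)
      fix Q assume Q: "Q \<in> D a"
      then have pQ: "primeideal Q R" "a \<notin> Q" unfolding D_def by auto
      interpret l: localization_set R "carrier R - Q" by (rule lset[OF pQ(1)])
      have "fr Q a \<one> \<otimes>\<^bsub>Lo Q\<^esub> fr Q \<one> a = fr Q \<one> \<one>"
        using l.frac_mult[of a \<one> \<one> a] l.frac_eqI[of a a \<one> \<one>] a pQ l.W_one by simp
      then show "restrict (can a) (D a) Q \<otimes>\<^bsub>Lo Q\<^esub> ?t Q = \<one>\<^bsub>Lo Q\<^esub>"
        using Q pQ by (simp add: can_def l.loc_one)
    qed
    then have "restrict (can a) (D a) \<in> Units (spec_sections R (D a))" by (rule SD.Units_of_mult_one[OF r t])
    then show "gcan P a \<in> Units (St P)"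
      using S.germ_unit_iff[OF c(2,3,1)] o by auto
  qed
qed

lemma germ_fraction:
  assumes V: "openin (zariski R) V" "P \<in> V" and s: "s \<in> spec_secs R V"
    and af: "a \<in> carrier R" "f \<in> carrier R" and e: "\<forall>Q \<in> V. f \<notin> Q \<and> s Q = fr Q a f"
  shows "gcan P f \<otimes>\<^bsub>St P\<^esub> germ (Spec R) P V s = gcan P a"
proof -
  have Vp: "V \<subseteq> pts" using openin_subset[OF V(1)] by (simp add: points_Spec)
  have o: "opn (Spec R) V" "opn (Spec R) pts" using V(1) pts_open by simp_all
  have c: "can a \<in> secs (Spec R) pts" "can f \<in> secs (Spec R) pts" "s \<in> secs (Spec R) V"
    using can_closed af s by simp_all
  have "gcan P f \<otimes>\<^bsub>St P\<^esub> germ (Spec R) P V s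
      = germ (Spec R) P V (restrict (can f) V \<otimes>\<^bsub>spec_sections R V\<^esub> s)"
    using S.germ_res[OF o(2,1) V(2) Vp c(2)] S.stalk_mult[OF o(1) V(2) S.res_closed[OF o(2,1) Vp c(2)] c(3)] by simp
  also have "restrict (can f) V \<otimes>\<^bsub>spec_sections R V\<^esub> s = restrict (can a) V"
    unfolding sec_mult
  proof (rule restrict_ext)
    fix Q assume Q: "Q \<in> V"
    interpret l: localization_set R "carrier R - Q" by (rule lset[OF open_prime[OF V(1) Q]])
    have "f \<notin> Q" "s Q = fr Q a f" using e Q by auto
    then have "fr Q f \<one> \<otimes>\<^bsub>Lo Q\<^esub> s Q = fr Q a \<one>"
      using l.frac_mult[of f \<one> a f] l.frac_eqI[of "f \<otimes> a" f a \<one>] af l.W_one by simp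
    then show "restrict (can f) V Q \<otimes>\<^bsub>Lo Q\<^esub> s Q = can a Q" using Q Vp by (auto simp: can_def)
  qed
  also have "germ (Spec R) P V (restrict (can a) V) = gcan P a"
    using S.germ_res[OF o(2,1) V(2) Vp c(1)] by simp
  finally show ?thesis .
qed

text \<open>A substitute for the isomorphism of the stalk with the localization. As the germ of
  \<open>f\<close> is a unit, homomorphisms out of the stalk are determined by their values on
  global functions.\<close>

lemma stalk_fraction:
  assumes P: "primeideal P R" and A: "A \<in> carrier (St P)"
  obtains a f where "a \<in> carrier R" "f \<in> carrier R" "f \<notin> P"
    "gcan P f \<otimes>\<^bsub>St P\<^esub> A = gcan P a"
proof -
  from A obtain U s where U: "openin (zariski R) U" "P \<in> U" "s \<in> spec_secs R U" "A = germ (Spec R) P U s"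
    by (rule S.stalkE) simp
  from U(3,2) obtain V a f where V: "openin (zariski R) V" "P \<in> V" "V \<subseteq> U" "a \<in> carrier R" "f \<in> carrier R"
    "\<forall>Q \<in> V. f \<notin> Q \<and> s Q = fr Q a f" by (rule secD_local)
  have e: "\<forall>Q \<in> V. f \<notin> Q \<and> restrict s V Q = fr Q a f" using V by simp
  have AV: "A = germ (Spec R) P V (restrict s V)" using S.germ_res[of U V P s] U V by simp
  have "f \<notin> P" using V by auto
  from that[OF V(4,5) this] germ_fraction[OF V(1,2) restrict_sec[OF U(1) V(1,3) U(3)] V(4,5) e]
  show thesis unfolding AV by blast
qed

text \<open>The localization at \<open>P\<close> is local and maps onto the stalk by a map that
  reflects units; surjectivity is the fraction description of germs.\<close>

lemma lrs_Spec: "locally_ringed_space (Spec R)"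
  unfolding locally_ringed_space_def points_Spec'
proof (intro conjI ballI ringed_Spec)
  fix P assume "P \<in> pts"
  then have P: "primeideal P R" by simp
  interpret l: localization_set R "carrier R - P" by (rule lset[OF P])
  interpret P: primeideal P R by fact
  have Pp: "P \<in> points (Spec R)" using P unfolding points_Spec' by simp
  interpret T: cring "St P" by (rule S.stalk_cring[OF Pp])
  let ?h = "germ (Spec R) P pts \<circ> can"
  have g: "germ (Spec R) P pts \<in> ring_hom (spec_sections R pts) (St P)"
    using S.germ_hom[of pts P] pts_open P by simp
  have h: "?h \<in> ring_hom R (St P)" by (rule ring_hom_trans[OF can_hom g])
  have hW: "?h ` (carrier R - P) \<subseteq> Units (St P)"
    using germ_can_unit_iff[OF P] by auto
  note lift = l.loc_lift_hom[OF T.is_cring h hW]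
  show "local_ring (St P)"
  proof (rule local_ring_surj[OF P.localization_local T.is_cring lift])
    show "carrier (St P) \<subseteq> loc_lift R (St P) ?h ` carrier (Lo P)"
    proof
      fix A assume A: "A \<in> carrier (St P)"
      then obtain a f where af: "a \<in> carrier R" "f \<in> carrier R" "f \<notin> P" "?h f \<otimes>\<^bsub>St P\<^esub> A = ?h a"
        using stalk_fraction[OF P A] by (metis comp_apply)
      then have "A = loc_lift R (St P) ?h (fr P a f)"
        using l.loc_lift_eqI[OF T.is_cring h hW af(1) _ A] by simp
      then show "A \<in> loc_lift R (St P) ?h ` carrier (Lo P)" using l.frac_closed af by auto
    qed
    fix y assume y: "y \<in> carrier (Lo P)" "loc_lift R (St P) ?h y \<in> Units (St P)"
    then obtain a s where as: "a \<in> carrier R" "s \<in> carrier R - P" "y = fr P a s" by (auto elim: l.locE)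
    have "?h a = ?h s \<otimes>\<^bsub>St P\<^esub> loc_lift R (St P) ?h y"
      using l.loc_lift_cross[OF T.is_cring h hW as(1,2)] as(3) by simp
    then have "?h a \<in> Units (St P)" using T.Units_m_closed[OF subsetD[OF hW imageI[OF as(2)]] y(2)] by simp
    then have "a \<notin> P" using germ_can_unit_iff[OF P as(1)] by simp
    then show "y \<in> Units (Lo P)" using P.frac_prime_unit_iff as by auto
  qed
qed

subsection \<open>Morphisms into a spectrum\<close>

text \<open>The image of \<open>x\<close> consists of the functions whose pullback is not invertible
  at \<open>x\<close>, so global functions determine the points. They determine the stalk maps too,
  by cancelling the unit in the fraction description.\<close>

lemma hom_into_Spec_eqI:
  assumes X: "ringed_space X" and f: "f \<in> lrs_hom X (Spec R)" and g: "g \<in> lrs_hom X (Spec R)"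
    and e: "\<And>a. a \<in> carrier R \<Longrightarrow> cm f pts (can a) = cm g pts (can a)"
  shows "f = g"
proof -
  interpret f: lrs_mor X "Spec R" f by (rule lrs_morI[OF X ringed_Spec f])
  interpret g: lrs_mor X "Spec R" g by (rule lrs_morI[OF X ringed_Spec g])
  have o: "opn (Spec R) pts" using pts_open by simp
  have c: "can a \<in> secs (Spec R) pts" if "a \<in> carrier R" for a using can_closed[OF that] by simp
  have pf: "preim f pts = points X" "preim g pts = points X" using f.preim_points g.preim_points by simp_all
  have pp: "primeideal (pt f x) R" "primeideal (pt g x) R" if "x \<in> points X" for x using f.pt_in[OF that] g.pt_in[OF that] by simp_all
  have mem: "a \<in> pt f x \<longleftrightarrow> germ X x (points X) (cm f pts (can a)) \<notin> Units (stalk X x)"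
      "a \<in> pt g x \<longleftrightarrow> germ X x (points X) (cm g pts (can a)) \<notin> Units (stalk X x)"
    if "x \<in> points X" "a \<in> carrier R" for x a
    using f.germ_cm_unit_iff[OF that(1) o _ c[OF that(2)]] g.germ_cm_unit_iff[OF that(1) o _ c[OF that(2)]]
      germ_can_unit_iff[OF pp(1)[OF that(1)] that(2)] germ_can_unit_iff[OF pp(2)[OF that(1)] that(2)] pp[OF that(1)] pf by auto
  have pt: "pt f x = pt g x" if x: "x \<in> points X" for x
  proof (rule Set.set_eqI)
    fix a show "a \<in> pt f x \<longleftrightarrow> a \<in> pt g x"
    proof (cases "a \<in> carrier R")
      case True
      show ?thesis unfolding mem(1)[OF x True] mem(2)[OF x True] e[OF True] by (rule refl)
    next
      case False
      then show ?thesis using ideal.Icarr[OF primeideal.axioms(1)[OF pp(1)[OF x]], of a]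
          ideal.Icarr[OF primeideal.axioms(1)[OF pp(2)[OF x]], of a] by blast
    qed
  qed
  show ?thesis
  proof (rule lrs_hom_eqI[OF X ringed_Spec f g pt])
    fix x V s assume x: "x \<in> points X" and V: "opn (Spec R) V" "pt f x \<in> V" and s: "s \<in> secs (Spec R) V"
    let ?A = "germ (Spec R) (pt f x) V s"
    have A: "?A \<in> carrier (St (pt f x))" by (rule S.germ_in_stalk[OF V s])
    obtain a b where ab: "a \<in> carrier R" "b \<in> carrier R" "b \<notin> pt f x"
      "gcan (pt f x) b \<otimes>\<^bsub>St (pt f x)\<^esub> ?A = gcan (pt f x) a"
      by (rule stalk_fraction[OF pp(1)[OF x] A])
    interpret T: cring "stalk X x" by (rule f.X.stalk_cring[OF x])
    have P: "pt f x \<in> pts" using pp x by simp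
    have gc: "gcan (pt f x) a \<in> carrier (St (pt f x))" if "a \<in> carrier R" for a
      by (rule S.germ_in_stalk[OF o P c[OF that]])
    let ?u = "\<lambda>a. germ X x (points X) (cm f pts (can a))"
    have sf: "stalk_map f x (gcan (pt f x) a) = ?u a" if "a \<in> carrier R" for a
      using f.stalk_map_germ[OF x o P c[OF that]] pf by simp
    have sg: "stalk_map g x (gcan (pt f x) a) = ?u a" if "a \<in> carrier R" for a
      using g.stalk_map_germ[OF x o _ c[OF that]] pf P pt[OF x] e[OF that] by simp
    have uf: "?u b \<otimes>\<^bsub>stalk X x\<^esub> stalk_map f x ?A = ?u a"
      using ring_hom_mult[OF f.stalk_map_hom[OF x] gc[OF ab(2)] A] sf ab by simp
    have ug: "?u b \<otimes>\<^bsub>stalk X x\<^esub> stalk_map g x ?A = ?u a"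
      using ring_hom_mult[OF g.stalk_map_hom[OF x, folded pt[OF x]] gc[OF ab(2)] A] sg[OF ab(1)] sg[OF ab(2)] ab(4) by simp
    have ub: "?u b \<in> Units (stalk X x)" using mem(1)[OF x ab(2)] ab(3) by simp
    have "stalk_map f x ?A = stalk_map g x ?A"
      using T.Units_l_cancel[OF ub f.stalk_map_closed[OF x A], of "stalk_map g x ?A"] g.stalk_map_closed[OF x, of ?A] A pt[OF x] uf ug by simp
    then show "germ X x (preim f V) (cm f V s) = germ X x (preim g V) (cm g V s)"
      using f.stalk_map_germ[OF x V s] g.stalk_map_germ[OF x V(1) _ s] V(2) pt[OF x] by simp
  qed
qed

text \<open>Representatives of a germ agree as functions near \<open>P\<close>, in particular at
  \<open>P\<close>. Reading off this value gives the map from the stalk to the localization.\<close>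

definition val :: "'a set \<Rightarrow> ('a set set \<times> ('a set \<Rightarrow> ('a \<times> 'a) set)) set \<Rightarrow> ('a \<times> 'a) set" where
  "val P A = (THE y. \<forall>(U, s) \<in> A. y = s P)"

lemma val_germ: assumes "opn (Spec R) U" "P \<in> U" "s \<in> secs (Spec R) U"
  shows "val P (germ (Spec R) P U s) = s P"
  unfolding val_def
proof (rule the_equality)
  show "\<forall>(V, t) \<in> germ (Spec R) P U s. s P = t P"
  proof clarify
    fix V t assume "(V, t) \<in> germ (Spec R) P U s"
    then obtain W where W: "P \<in> W" "W \<subseteq> U \<inter> V" "restrict s W = restrict t W" unfolding germ_def by auto
    then have "restrict s W P = restrict t W P" by simp
    then show "s P = t P" using W(1) by simp
  qed
  fix y assume "\<forall>(V, t) \<in> germ (Spec R) P U s. y = t P"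
  then show "y = s P" using S.germ_self[OF assms] by auto
qed

lemma val_hom: assumes P: "primeideal P R" shows "val P \<in> ring_hom (St P) (Lo P)"
proof (rule ring_hom_memI)
  fix A assume "A \<in> carrier (St P)"
  then obtain U s where U: "opn (Spec R) U" "P \<in> U" "s \<in> secs (Spec R) U" "A = germ (Spec R) P U s" by (rule S.stalkE)
  then show "val P A \<in> carrier (Lo P)" using sec_val by (simp add: val_germ)
next
  fix A B assume "A \<in> carrier (St P)" "B \<in> carrier (St P)"
  then obtain U s t where U: "opn (Spec R) U" "P \<in> U" "s \<in> secs (Spec R) U" "A = germ (Spec R) P U s"
    "t \<in> secs (Spec R) U" "B = germ (Spec R) P U t" by (rule S.stalkE2)
  interpret SU: ring "sec (Spec R) U" by (rule S.sec_ring[OF U(1)])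
  show "val P (A \<otimes>\<^bsub>St P\<^esub> B) = val P A \<otimes>\<^bsub>Lo P\<^esub> val P B"
    using U SU.m_closed[OF U(3,5)] by (simp add: S.stalk_mult val_germ) (simp add: sec_mult)
  show "val P (A \<oplus>\<^bsub>St P\<^esub> B) = val P A \<oplus>\<^bsub>Lo P\<^esub> val P B"
    using U SU.a_closed[OF U(3,5)] by (simp add: S.stalk_add val_germ) (simp add: sec_add)
next
  have o: "opn (Spec R) pts" "P \<in> pts" using P pts_open by simp_all
  interpret SU: ring "sec (Spec R) pts" by (rule S.sec_ring[OF o(1)])
  show "val P \<one>\<^bsub>St P\<^esub> = \<one>\<^bsub>Lo P\<^esub>"
    using SU.one_closed P by (simp add: S.stalk_one[OF o] val_germ[OF o] sec_one)
qed

text \<open>Existence half of the correspondence between morphisms into \<open>Spec R\<close> and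
  homomorphisms from \<open>R\<close> to global sections. Point and stalk map are forced: the prime
  of elements that are not invertible at \<open>x\<close>, and the evaluation \<open>val\<close>
  followed by the extension of \<rho> to fractions.\<close>

lemma hom_into_Spec_exists:
  fixes X :: "('p, 'r) ringed_space"
  assumes X: "locally_ringed_space X" and \<rho>: "\<rho> \<in> ring_hom R (sec X (points X))"
  shows "\<exists>f \<in> lrs_hom X (Spec R). (\<forall>a \<in> carrier R. cm f pts (can a) = \<rho> a) \<and>
    (\<forall>x \<in> points X. pt f x = {a \<in> carrier R. germ X x (points X) (\<rho> a) \<notin> Units (stalk X x)})"
proof -
  interpret X: rspace X by (rule lrs_rspace[OF X])
  let ?g = "\<lambda>x a. germ X x (points X) (\<rho> a)"
  have g: "?g x \<in> ring_hom R (stalk X x)" if "x \<in> points X" for x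
    using ring_hom_trans[OF \<rho> X.germ_hom[OF X.opn_points that]] by (simp add: comp_def)
  have \<rho>c: "\<rho> a \<in> secs X (points X)" if "a \<in> carrier R" for a by (rule ring_hom_closed[OF \<rho> that])
  define k where "k = (\<lambda>x. {a \<in> carrier R. ?g x a \<notin> Units (stalk X x)})"
  have k: "primeideal (k x) R" if "x \<in> points X" for x
    unfolding k_def by (rule hom_nonunits_prime[OF is_cring lrs_stalk_local[OF X that] g[OF that]])
  have kW: "?g x s \<in> Units (stalk X x)" if "s \<in> carrier R - k x" for x s using that unfolding k_def by auto
  have kW': "?g x ` (carrier R - k x) \<subseteq> Units (stalk X x)" for x using kW by auto
  define \<psi> where "\<psi> = (\<lambda>x. loc_lift R (stalk X x) (?g x) \<circ> val (k x))"
  have o: "opn (Spec R) pts" using pts_open by simp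
  have c: "can a \<in> secs (Spec R) pts" if "a \<in> carrier R" for a using can_closed[OF that] by simp
  have openk: "opn X {x \<in> points X. k x \<in> V}" if V: "openin (zariski R) V" for V
  proof (subst openin_subopen, intro ballI)
    fix x assume "x \<in> {x \<in> points X. k x \<in> V}"
    then have x: "x \<in> points X" "k x \<in> V" by auto
    obtain f where f: "f \<in> carrier R" "k x \<in> D f" "D f \<subseteq> V" by (rule D_basis[OF V x(2)])
    then have "f \<notin> k x" unfolding D_def by simp
    then have "?g x f \<in> Units (stalk X x)" using f kW by auto
    then obtain W where W: "opn X W" "x \<in> W" "W \<subseteq> points X" "res X (points X) W (\<rho> f) \<in> Units (sec X W)"
      using X.germ_unit_iff[OF X.opn_points x(1) \<rho>c[OF f(1)]] by auto
    have "k y \<in> V" if y: "y \<in> W" for y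
    proof -
      have yp: "y \<in> points X" using y W by auto
      have "?g y f \<in> Units (stalk X y)"
        using X.germ_unit_iff[OF X.opn_points yp \<rho>c[OF f(1)]] W y by auto
      then have "k y \<in> D f" using k[OF yp] unfolding D_def k_def by auto
      then show ?thesis using f by auto
    qed
    then show "\<exists>T. opn X T \<and> x \<in> T \<and> T \<subseteq> {x \<in> points X. k x \<in> V}" using W by (intro exI[of _ W]) auto
  qed
  have \<psi>hom: "\<psi> x \<in> ring_hom (St (k x)) (stalk X x)" if x: "x \<in> points X" for x
    unfolding \<psi>_def
    by (rule ring_hom_trans[OF val_hom[OF k[OF x]]], rule localization_set.loc_lift_hom[OF lset[OF k[OF x]] X.stalk_cring[OF x] g[OF x] kW'])
  have \<psi>can: "\<psi> x (gcan (k x) a) = ?g x a" if x: "x \<in> points X" and a: "a \<in> carrier R" for x a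
  proof -
    interpret l: localization_set R "carrier R - k x" by (rule lset[OF k[OF x]])
    interpret T: cring "stalk X x" by (rule X.stalk_cring[OF x])
    have "\<psi> x (gcan (k x) a) = loc_lift R (stalk X x) (?g x) (fr (k x) a \<one>)"
      using val_germ[OF o _ c[OF a], of "k x"] k[OF x] unfolding \<psi>_def by (simp add: can_def)
    also have "\<dots> = ?g x a"
      by (rule l.loc_lift_eqI[OF T.is_cring g[OF x] kW' a l.W_one ring_hom_closed[OF g[OF x] a]])
        (use ring_hom_one[OF g[OF x]] ring_hom_closed[OF g[OF x] a] in simp_all)
    finally show ?thesis .
  qed
  have "\<exists>f \<in> lrs_hom X (Spec R). (\<forall>x \<in> points X. pt f x = k x) \<and>
     (\<forall>x \<in> points X. \<forall>V s. opn (Spec R) V \<longrightarrow> k x \<in> V \<longrightarrow> s \<in> secs (Spec R) V \<longrightarrow>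
        germ X x (preim f V) (cm f V s) = \<psi> x (germ (Spec R) (k x) V s))"
  proof (rule mor_from_stalks[OF lrs_ringed[OF X] ringed_Spec _ \<psi>hom])
    show "continuous_map (top_of X) (top_of (Spec R)) k"
      unfolding continuous_map_def using openk k by (auto simp: points_Spec)
  next
    fix x A assume x: "x \<in> points X" and A: "A \<in> carrier (St (k x))" and u: "\<psi> x A \<in> Units (stalk X x)"
    obtain a f where af: "a \<in> carrier R" "f \<in> carrier R" "f \<notin> k x"
      "gcan (k x) f \<otimes>\<^bsub>St (k x)\<^esub> A = gcan (k x) a"
      by (rule stalk_fraction[OF k[OF x] A])
    interpret T: cring "stalk X x" by (rule X.stalk_cring[OF x])
    have kp: "k x \<in> pts" using k[OF x] by simp
    interpret T': cring "St (k x)" by (rule S.stalk_cring) (use kp points_Spec' in simp)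
    have gc: "gcan (k x) f \<in> carrier (St (k x))" by (rule S.germ_in_stalk[OF o kp c[OF af(2)]])
    have "?g x f \<otimes>\<^bsub>stalk X x\<^esub> \<psi> x A = ?g x a"
      using ring_hom_mult[OF \<psi>hom[OF x] gc A] \<psi>can[OF x] af by simp
    then have "?g x a \<in> Units (stalk X x)" using T.Units_m_closed[OF _ u, of "?g x f"] kW[of f x] af by auto
    then have "a \<notin> k x" unfolding k_def by simp
    then have "A \<otimes>\<^bsub>St (k x)\<^esub> gcan (k x) f \<in> Units (St (k x))"
      using germ_can_unit_iff[OF k[OF x] af(1)] af(4) T'.m_comm[OF A gc] by simp
    then show "A \<in> Units (St (k x))" by (rule T'.Units_factor[OF A gc])
  next
    fix x V s assume x: "x \<in> points X" and V: "opn (Spec R) V" "k x \<in> V" and s: "s \<in> secs (Spec R) V"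
    have s': "s \<in> spec_secs R V" using s by simp
    from s' V(2) obtain V' a f where V': "openin (zariski R) V'" "k x \<in> V'" "V' \<subseteq> V" "a \<in> carrier R" "f \<in> carrier R"
      "\<forall>Q \<in> V'. f \<notin> Q \<and> s Q = fr Q a f" by (rule secD_local)
    have "f \<notin> k x" using V' by auto
    then obtain W0 where W0: "opn X W0" "x \<in> W0" "W0 \<subseteq> points X" "res X (points X) W0 (\<rho> f) \<in> Units (sec X W0)"
      using X.germ_unit_iff[OF X.opn_points x \<rho>c[OF V'(5)]] kW[of f x] V'(5) by auto
    \<comment> \<open>On this set the pullback of the denominator \<open>f\<close> is invertible and
      \<open>k\<close> stays where \<open>s\<close> is a/f. Hence one quotient of sections
      represents all germs that are required.\<close>
    define W where "W = W0 \<inter> {x \<in> points X. k x \<in> V'}"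
    have W: "opn X W" "x \<in> W" "W \<subseteq> W0" "W \<subseteq> points X" "\<And>y. y \<in> W \<Longrightarrow> k y \<in> V'"
      using W0 V'(2) x openk[OF V'(1)] unfolding W_def by (auto simp: openin_Int)
    have "res X W0 W (res X (points X) W0 (\<rho> f)) \<in> Units (sec X W)"
      by (rule hom_Units[OF X.res_hom[OF W0(1) W(1,3)] X.sec_ring[OF W0(1)] X.sec_ring[OF W(1)] W0(4)])
    then have u: "res X (points X) W (\<rho> f) \<in> Units (sec X W)"
      using X.res_res[OF X.opn_points W0(1) W(1,3) W0(3) \<rho>c[OF V'(5)]] by simp
    interpret SW: cring "sec X W" by (rule X.sec_cring[OF W(1)])
    let ?f = "res X (points X) W (\<rho> f)" and ?a = "res X (points X) W (\<rho> a)"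
    have cc: "?f \<in> secs X W" "?a \<in> secs X W" "inv\<^bsub>sec X W\<^esub> ?f \<in> secs X W"
      using X.res_closed[OF X.opn_points W(1,4) \<rho>c] V' u by auto
    define t where "t = ?a \<otimes>\<^bsub>sec X W\<^esub> inv\<^bsub>sec X W\<^esub> ?f"
    have t: "t \<in> secs X W" "?f \<otimes>\<^bsub>sec X W\<^esub> t = ?a"
      using cc u unfolding t_def by (simp_all add: SW.m_lcomm[of ?f ?a])
    have "germ X y W t = \<psi> y (germ (Spec R) (k y) V s)" if y: "y \<in> W" for y
    proof -
      have yp: "y \<in> points X" using y W by auto
      interpret l: localization_set R "carrier R - k y" by (rule lset[OF k[OF yp]])
      interpret T: cring "stalk X y" by (rule X.stalk_cring[OF yp])
      have ky: "k y \<in> V'" by (rule W(5)[OF y])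
      have "?g y f \<otimes>\<^bsub>stalk X y\<^esub> germ X y W t = ?g y a"
        using X.stalk_mult[OF W(1) y cc(1) t(1)] t(2) X.germ_res[OF X.opn_points W(1) y W(4) \<rho>c] V' by simp
      then have "loc_lift R (stalk X y) (?g y) (fr (k y) a f) = germ X y W t"
        using l.loc_lift_eqI[OF T.is_cring g[OF yp] kW' V'(4) _ X.germ_in_stalk[OF W(1) y t(1)], of f] V' ky by auto
      moreover have "val (k y) (germ (Spec R) (k y) V s) = fr (k y) a f"
        using val_germ[OF V(1) _ s, of "k y"] V' ky by auto
      ultimately show ?thesis unfolding \<psi>_def by simp
    qed
    then show "\<exists>W t. opn X W \<and> x \<in> W \<and> k ` W \<subseteq> V \<and> t \<in> secs X W \<and> (\<forall>y \<in> W. germ X y W t = \<psi> y (germ (Spec R) (k y) V s))"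
      using W t V' by (intro exI[of _ W] exI[of _ t]) auto
  qed
  then obtain f where f: "f \<in> lrs_hom X (Spec R)" and pf: "\<forall>x \<in> points X. pt f x = k x"
    and gf: "\<forall>x \<in> points X. \<forall>V s. opn (Spec R) V \<longrightarrow> k x \<in> V \<longrightarrow> s \<in> secs (Spec R) V \<longrightarrow>
        germ X x (preim f V) (cm f V s) = \<psi> x (germ (Spec R) (k x) V s)" by auto
  interpret f: lrs_mor X "Spec R" f by (rule lrs_morI[OF lrs_ringed[OF X] ringed_Spec f])
  have pr: "preim f pts = points X" using f.preim_points by simp
  have "cm f pts (can a) = \<rho> a" if a: "a \<in> carrier R" for a
  proof (rule X.sec_eqI[OF X.opn_points])
    show "cm f pts (can a) \<in> secs X (points X)" using f.cm_closed[OF o c[OF a]] pr by simp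
    show "\<rho> a \<in> secs X (points X)" by (rule \<rho>c[OF a])
    fix x assume x: "x \<in> points X"
    show "germ X x (points X) (cm f pts (can a)) = germ X x (points X) (\<rho> a)"
      using gf[rule_format, OF x o _ c[OF a]] k[OF x] \<psi>can[OF x a] pr by simp
  qed
  then show ?thesis using f pf unfolding k_def by blast
qed

end

section \<open>Stalk maps of composites, and factorization through closed immersions\<close>

lemma stalk_map_comp:
  assumes X: "ringed_space X" and Y: "ringed_space Y" and Z: "ringed_space Z"
    and f: "f \<in> lrs_hom X Y" and g: "g \<in> lrs_hom Y Z" and x: "x \<in> points X"
    and A: "A \<in> stk Z (pt g (pt f x))"
  shows "stalk_map (g \<circ>\<^sub>s f) x A = stalk_map f x (stalk_map g (pt f x) A)"
proof -
  interpret f: lrs_mor X Y f by (rule lrs_morI[OF X Y f])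
  interpret g: lrs_mor Y Z g by (rule lrs_morI[OF Y Z g])
  interpret gf: lrs_mor X Z "g \<circ>\<^sub>s f" by (rule lrs_morI[OF X Z lrs_comp_hom[OF X Y Z f g]])
  have p: "pt (g \<circ>\<^sub>s f) x = pt g (pt f x)" using x by (simp add: pt_comp f.src_tgt)
  obtain V s where V: "opn Z V" "pt g (pt f x) \<in> V" "s \<in> secs Z V" "A = germ Z (pt g (pt f x)) V s"
    using A by (rule g.Y.stalkE)
  have fx: "pt f x \<in> points Y" "pt f x \<in> preim g V" using f.pt_in[OF x] V by (simp_all add: g.mem_preim)
  have "stalk_map (g \<circ>\<^sub>s f) x A = germ X x (preim f (preim g V)) (cm f (preim g V) (cm g V s))"
    using gf.stalk_map_germ[OF x V(1) _ V(3)] V p cm_comp[of g V s f] g.src_tgt preim_comp[OF X Y Z f g] by simp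
  also have "\<dots> = stalk_map f x (germ Y (pt f x) (preim g V) (cm g V s))"
    by (rule f.stalk_map_germ[OF x g.preim_open[OF V(1)] fx(2) g.cm_closed[OF V(1,3)], symmetric])
  also have "\<dots> = stalk_map f x (stalk_map g (pt f x) A)"
    using g.stalk_map_germ[OF fx(1) V(1,2,3)] V(4) by simp
  finally show ?thesis .
qed

context rspace
begin

lemma germ_zero_iff:
  assumes "opn X U" "x \<in> U" "s \<in> secs X U"
  shows "germ X x U s = \<zero>\<^bsub>stalk X x\<^esub> \<longleftrightarrow> (\<exists>W. opn X W \<and> x \<in> W \<and> W \<subseteq> U \<and> res X U W s = \<zero>\<^bsub>sec X W\<^esub>)"
proof -
  interpret R: ring "sec X U" by (rule sec_ring[OF assms(1)])
  have "germ X x U s = \<zero>\<^bsub>stalk X x\<^esub> \<longleftrightarrow> (\<exists>W. opn X W \<and> x \<in> W \<and> W \<subseteq> U \<inter> U \<and> res X U W s = res X U W \<zero>\<^bsub>sec X U\<^esub>)"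
    unfolding stalk_zero[OF assms(1,2)] by (rule germ_eq_iff[OF assms assms(1,2) R.zero_closed])
  also have "\<dots> \<longleftrightarrow> (\<exists>W. opn X W \<and> x \<in> W \<and> W \<subseteq> U \<and> res X U W s = \<zero>\<^bsub>sec X W\<^esub>)"
    using res_zero[OF assms(1)] by (metis Int_absorb)
  finally show ?thesis .
qed

lemma sec_zeroI:
  assumes "opn X U" "s \<in> secs X U" "\<And>x. x \<in> U \<Longrightarrow> germ X x U s = \<zero>\<^bsub>stalk X x\<^esub>"
  shows "s = \<zero>\<^bsub>sec X U\<^esub>"
proof -
  interpret R: ring "sec X U" by (rule sec_ring[OF assms(1)])
  show ?thesis
    by (rule sec_eqI[OF assms(1,2) R.zero_closed]) (use assms(3) stalk_zero[OF assms(1)] in simp)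
qed

end

text \<open>
  The properties shared by immersions and closed immersions: open sets of the source are induced
  from the target, and sections lift locally.
\<close>

definition local_lift :: "('p, 'r, 'q, 's) morphism \<Rightarrow> bool" where
  "local_lift f \<longleftrightarrow>
     (\<forall>V x s. opn (src f) V \<and> x \<in> V \<and> s \<in> secs (src f) V \<longrightarrow>
       (\<exists>W t. opn (tgt f) W \<and> pt f x \<in> W \<and> preim f W \<subseteq> V \<and> t \<in> secs (tgt f) W \<and>
          cm f W t = res (src f) V (preim f W) s))"

lemma local_liftD:
  assumes "local_lift f" "src f = X" "tgt f = Y" "opn X V" "x \<in> V" "s \<in> secs X V"
  shows "\<exists>W t. opn Y W \<and> pt f x \<in> W \<and> preim f W \<subseteq> V \<and> t \<in> secs Y W \<and> cm f W t = res X V (preim f W) s"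
proof -
  have "\<forall>V x s. opn X V \<and> x \<in> V \<and> s \<in> secs X V \<longrightarrow>
       (\<exists>W t. opn Y W \<and> pt f x \<in> W \<and> preim f W \<subseteq> V \<and> t \<in> secs Y W \<and> cm f W t = res X V (preim f W) s)"
    using assms(1) unfolding local_lift_def assms(2,3) .
  then show ?thesis using assms(4-6) by simp
qed

lemma closed_immersion_preim:
  assumes "closed_immersion f" "opn (src f) V"
  obtains W where "opn (tgt f) W" "preim f W = V"
proof -
  have e: "embedding_map (top_of (src f)) (top_of (tgt f)) (pt f)" using assms(1) unfolding closed_immersion_def by simp
  let ?Y = "subtopology (top_of (tgt f)) (pt f ` points (src f))"
  have h: "homeomorphic_map (top_of (src f)) ?Y (pt f)" using e unfolding embedding_map_def .
  have "openin ?Y (pt f ` V)" using homeomorphic_imp_open_map[OF h] assms(2) unfolding open_map_def by simp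
  then obtain W where W: "opn (tgt f) W" "pt f ` V = W \<inter> pt f ` points (src f)" unfolding openin_subtopology by auto
  have inj: "inj_on (pt f) (points (src f))" using h by (rule homeomorphic_imp_injective_map)
  have V: "V \<subseteq> points (src f)" using assms(2) by (rule openin_subset)
  have "preim f W = V"
  proof (rule subset_antisym)
    show "preim f W \<subseteq> V"
    proof
      fix x assume "x \<in> preim f W"
      then have x: "x \<in> points (src f)" "pt f x \<in> W" unfolding preim_def by auto
      then have "pt f x \<in> pt f ` V" unfolding W(2) by blast
      then show "x \<in> V" using inj_on_image_mem_iff[OF inj x(1) V] by simp
    qed
    show "V \<subseteq> preim f W"
    proof
      fix x assume "x \<in> V"
      then have "pt f x \<in> W" "x \<in> points (src f)" using W(2) V by auto
      then show "x \<in> preim f W" unfolding preim_def by simp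
    qed
  qed
  then show thesis using that W by blast
qed

lemma closed_immersion_inj: "closed_immersion f \<Longrightarrow> inj_on (pt f) (points (src f))"
  unfolding closed_immersion_def embedding_map_def using homeomorphic_imp_injective_map by blast

lemma closed_immersion_hom: "closed_immersion f \<Longrightarrow> f \<in> lrs_hom (src f) (tgt f)"
  unfolding closed_immersion_def by simp

lemma closed_immersion_schemes: "closed_immersion f \<Longrightarrow> scheme (src f)" "closed_immersion f \<Longrightarrow> scheme (tgt f)"
  unfolding closed_immersion_def by simp_all

lemma closed_immersion_local_lift: assumes f: "closed_immersion f" shows "local_lift f"
  unfolding local_lift_def
proof (intro allI impI, elim conjE)
  interpret f: lrs_mor "src f" "tgt f" f
    by (rule lrs_morI) (use closed_immersion_schemes[OF f] scheme_ringed closed_immersion_hom[OF f] in auto)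
  fix V x s assume V: "opn (src f) V" and x: "x \<in> V" and s: "s \<in> secs (src f) V"
  obtain W where W: "opn (tgt f) W" "preim f W = V" using closed_immersion_preim[OF f V] by blast
  have fx: "pt f x \<in> W" using x W f.mem_preim by blast
  have "\<forall>V. \<forall>s \<in> secs (src f) (preim f V). opn (tgt f) V \<longrightarrow>
        (\<forall>y \<in> V. \<exists>W. opn (tgt f) W \<and> y \<in> W \<and> W \<subseteq> V \<and>
          (\<exists>t \<in> secs (tgt f) W. cm f W t = res (src f) (preim f V) (preim f W) s))"
    using f unfolding closed_immersion_def by simp
  from this[rule_format, of s W "pt f x"] W s fx
  obtain W' t where W': "opn (tgt f) W'" "pt f x \<in> W'" "W' \<subseteq> W" "t \<in> secs (tgt f) W'"
    "cm f W' t = res (src f) V (preim f W') s" by auto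
  have "preim f W' \<subseteq> V" using f.preim_mono[OF W'(3)] W by simp
  then show "\<exists>W t. opn (tgt f) W \<and> pt f x \<in> W \<and> preim f W \<subseteq> V \<and> t \<in> secs (tgt f) W \<and> cm f W t = res (src f) V (preim f W) s"
    using W' by blast
qed

lemma local_lift_stalk_surj:
  assumes X: "ringed_space X" and Y: "ringed_space Y" and f: "f \<in> lrs_hom X Y" and l: "local_lift f"
    and x: "x \<in> points X" and A: "A \<in> stk X x"
  obtains B where "B \<in> stk Y (pt f x)" "stalk_map f x B = A"
proof -
  interpret f: lrs_mor X Y f by (rule lrs_morI[OF X Y f])
  obtain V s where V: "opn X V" "x \<in> V" "s \<in> secs X V" "A = germ X x V s" using A by (rule f.X.stalkE)
  obtain W t where W: "opn Y W" "pt f x \<in> W" "preim f W \<subseteq> V" "t \<in> secs Y W" "cm f W t = res X V (preim f W) s"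
    using local_liftD[OF l f.src_tgt V(1-3)] by auto
  have xW: "x \<in> preim f W" using x W by (simp add: f.mem_preim)
  have "stalk_map f x (germ Y (pt f x) W t) = A"
    using f.stalk_map_germ[OF x W(1,2,4)] f.X.germ_res[OF V(1) f.preim_open[OF W(1)] xW W(3) V(3)] W(5) V(4) by simp
  then show thesis using that f.Y.germ_in_stalk[OF W(1,2,4)] by blast
qed

lemma local_lift_nbhd:
  assumes X: "ringed_space X" and Y: "ringed_space Y" and f: "f \<in> lrs_hom X Y" and l: "local_lift f"
    and V: "opn X V" "x \<in> V"
  obtains W where "opn Y W" "pt f x \<in> W" "preim f W \<subseteq> V"
proof -
  interpret f: lrs_mor X Y f by (rule lrs_morI[OF X Y f])
  interpret R: ring "sec X V" by (rule f.X.sec_ring[OF V(1)])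
  show thesis using local_liftD[OF l f.src_tgt V R.zero_closed] that by auto
qed

text \<open>The germ dies on a neighbourhood in \<open>X\<close>. Such a neighbourhood contains the
  preimage of an open set of \<open>Y\<close>, so after shrinking the whole pulled-back section is
  zero: the kernel on stalks is the stalk of the ideal sheaf.\<close>

lemma local_lift_stalk_ker:
  assumes X: "ringed_space X" and Y: "ringed_space Y" and f: "f \<in> lrs_hom X Y" and l: "local_lift f"
    and x: "x \<in> points X" and B: "B \<in> stk Y (pt f x)" "stalk_map f x B = \<zero>\<^bsub>stalk X x\<^esub>"
  obtains V s where "opn Y V" "pt f x \<in> V" "s \<in> secs Y V" "B = germ Y (pt f x) V s"
    "cm f V s = \<zero>\<^bsub>sec X (preim f V)\<^esub>"
proof -
  interpret f: lrs_mor X Y f by (rule lrs_morI[OF X Y f])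
  obtain V s where V: "opn Y V" "pt f x \<in> V" "s \<in> secs Y V" "B = germ Y (pt f x) V s" using B(1) by (rule f.Y.stalkE)
  have xV: "x \<in> preim f V" using x V by (simp add: f.mem_preim)
  have "germ X x (preim f V) (cm f V s) = \<zero>\<^bsub>stalk X x\<^esub>" using f.stalk_map_germ[OF x V(1-3)] B(2) V(4) by simp
  then obtain W where W: "opn X W" "x \<in> W" "W \<subseteq> preim f V" "res X (preim f V) W (cm f V s) = \<zero>\<^bsub>sec X W\<^esub>"
    using f.X.germ_zero_iff[OF f.preim_open[OF V(1)] xV f.cm_closed[OF V(1,3)]] by blast
  obtain W' where W': "opn Y W'" "pt f x \<in> W'" "preim f W' \<subseteq> W" by (rule local_lift_nbhd[OF X Y f l W(1,2)])
  define V' where "V' = V \<inter> W'"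
  have V': "opn Y V'" "pt f x \<in> V'" "V' \<subseteq> V" "preim f V' \<subseteq> W" using V W' f.preim_mono[of V' W'] unfolding V'_def by auto
  have "cm f V' (res Y V V' s) = res X (preim f V) (preim f V') (cm f V s)" by (rule f.cm_res[OF V(1) V'(1,3) V(3)])
  also have "\<dots> = res X W (preim f V') (res X (preim f V) W (cm f V s))"
    by (rule f.X.res_res[OF f.preim_open[OF V(1)] W(1) f.preim_open[OF V'(1)] V'(4) W(3) f.cm_closed[OF V(1,3)], symmetric])
  also have "\<dots> = \<zero>\<^bsub>sec X (preim f V')\<^esub>" unfolding W(4) by (rule f.X.res_zero[OF W(1) f.preim_open[OF V'(1)] V'(4)])
  finally show thesis using that[of V' "res Y V V' s"] V' f.Y.res_closed[OF V(1) V'(1,3) V(3)]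
    f.Y.germ_res[OF V(1) V'(1,2,3) V(3)] V(4) by simp
qed

lemma ring_hom_eq_of_diff:
  assumes R: "ring R" and S: "ring S" and T: "ring T" and f: "f \<in> ring_hom R S" and g: "g \<in> ring_hom R T"
    and k: "\<And>a. a \<in> carrier R \<Longrightarrow> f a = \<zero>\<^bsub>S\<^esub> \<Longrightarrow> g a = \<zero>\<^bsub>T\<^esub>"
    and ab: "a \<in> carrier R" "b \<in> carrier R" "f a = f b"
  shows "g a = g b"
proof -
  interpret f: ring_hom_ring R S f by (rule ring_hom_ringI2[OF R S f])
  interpret g: ring_hom_ring R T g by (rule ring_hom_ringI2[OF R T g])
  have "f (a \<ominus>\<^bsub>R\<^esub> b) = \<zero>\<^bsub>S\<^esub>" using ab by (simp add: f.R.minus_eq f.S.r_neg)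
  then have "g (a \<ominus>\<^bsub>R\<^esub> b) = \<zero>\<^bsub>T\<^esub>" using k ab by simp
  then have "g a \<oplus>\<^bsub>T\<^esub> \<ominus>\<^bsub>T\<^esub> g b = \<zero>\<^bsub>T\<^esub>" using ab by (simp add: f.R.minus_eq)
  then have "\<ominus>\<^bsub>T\<^esub> (\<ominus>\<^bsub>T\<^esub> g b) = g a" by (rule g.S.minus_equality) (use ab in simp_all)
  then show ?thesis using ab by simp
qed

text \<open>A morphism factors through a closed subscheme when it kills its ideal sheaf. The points
  land in the closed set, the stalk maps descend along the surjections on stalks, and local lifts of
  sections show that the descended maps come from a comorphism.\<close>

lemma closed_immersion_factor:
  assumes X: "locally_ringed_space X" and j: "closed_immersion j" and jZ: "j \<in> lrs_hom Z P" and h: "h \<in> lrs_hom X P"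
    and ker: "\<And>V s. opn P V \<Longrightarrow> s \<in> secs P V \<Longrightarrow> cm j V s = \<zero>\<^bsub>sec Z (preim j V)\<^esub> \<Longrightarrow> cm h V s = \<zero>\<^bsub>sec X (preim h V)\<^esub>"
  shows "\<exists>k \<in> lrs_hom X Z. j \<circ>\<^sub>s k = h"
proof -
  have st: "src j = Z" "tgt j = P" using lrs_homD(1,2)[OF jZ] by auto
  have sZ: "scheme Z" and sP: "scheme P" using closed_immersion_schemes[OF j] st by auto
  have rX: "ringed_space X" and rZ: "ringed_space Z" and rP: "ringed_space P" using lrs_ringed[OF X] sZ sP by (simp_all add: scheme_ringed)
  interpret j: lrs_mor Z P j by (rule lrs_morI[OF rZ rP jZ])
  interpret h: lrs_mor X P h by (rule lrs_morI[OF rX rP h])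
  note lift = closed_immersion_local_lift[OF j]
  let ?J = "pt j ` points Z"
  have cl: "opn P (points P - ?J)" using j unfolding closed_immersion_def st by auto
  \<comment> \<open>Over the complement of the closed image the section 1 lies in the kernel of
    \<open>cm j\<close>, because its preimage in \<open>Z\<close> is empty. If \<open>h\<close> met
    this complement, a local ring of \<open>X\<close> would be trivial.\<close>
  have inJ: "pt h x \<in> ?J" if x: "x \<in> points X" for x
  proof (rule ccontr)
    assume n: "pt h x \<notin> ?J"
    let ?V = "points P - ?J"
    have e: "preim j ?V = {}" by (auto simp: j.mem_preim)
    interpret RV: ring "sec P ?V" by (rule j.Y.sec_ring[OF cl])
    have o: "opn Z {}" by simp
    interpret R0: ring "sec Z {}" by (rule j.X.sec_ring[OF o])
    have "cm j ?V \<one>\<^bsub>sec P ?V\<^esub> = \<zero>\<^bsub>sec Z (preim j ?V)\<^esub>"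
      using j.cm_closed[OF cl RV.one_closed] unfolding e by (intro j.X.sec_eqI[OF o]) auto
    then have "cm h ?V \<one>\<^bsub>sec P ?V\<^esub> = \<zero>\<^bsub>sec X (preim h ?V)\<^esub>" by (rule ker[OF cl RV.one_closed])
    then have z: "\<one>\<^bsub>sec X (preim h ?V)\<^esub> = \<zero>\<^bsub>sec X (preim h ?V)\<^esub>" using ring_hom_one[OF h.cm_hom[OF cl]] by simp
    have xV: "x \<in> preim h ?V" using n x h.pt_in[OF x] by (simp add: h.mem_preim)
    have "\<one>\<^bsub>stalk X x\<^esub> = \<zero>\<^bsub>stalk X x\<^esub>"
      using z h.X.stalk_one[OF h.preim_open[OF cl] xV] h.X.stalk_zero[OF h.preim_open[OF cl] xV] by simp
    then show False using local_ring_nontriv[OF lrs_stalk_local[OF X x]] by simp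
  qed
  define k where "k = (\<lambda>x. SOME z. z \<in> points Z \<and> pt j z = pt h x)"
  have k: "k x \<in> points Z" "pt j (k x) = pt h x" if "x \<in> points X" for x
  proof -
    have "\<exists>z. z \<in> points Z \<and> pt j z = pt h x" using inJ[OF that] by auto
    then have "k x \<in> points Z \<and> pt j (k x) = pt h x" unfolding k_def by (rule someI_ex)
    then show "k x \<in> points Z" "pt j (k x) = pt h x" by auto
  qed
  have kerst: "stalk_map h x B = \<zero>\<^bsub>stalk X x\<^esub>"
    if x: "x \<in> points X" and B: "B \<in> stk P (pt h x)" "stalk_map j (k x) B = \<zero>\<^bsub>stalk Z (k x)\<^esub>" for x B
  proof -
    obtain V s where V: "opn P V" "pt h x \<in> V" "s \<in> secs P V" "B = germ P (pt h x) V s" "cm j V s = \<zero>\<^bsub>sec Z (preim j V)\<^esub>"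
      using local_lift_stalk_ker[OF rZ rP jZ lift k(1)[OF x], of B] B k(2)[OF x] by metis
    have xV: "x \<in> preim h V" using x V by (simp add: h.mem_preim)
    show ?thesis using h.stalk_map_germ[OF x V(1-3)] V(4) ker[OF V(1,3,5)] h.X.stalk_zero[OF h.preim_open[OF V(1)] xV] by simp
  qed
  have ringP: "ring (stalk P (pt h x))" if "x \<in> points X" for x by (rule cring.axioms(1)[OF j.Y.stalk_cring[OF h.pt_in[OF that]]])
  have ringX: "ring (stalk X x)" if "x \<in> points X" for x by (rule cring.axioms(1)[OF h.X.stalk_cring[OF that]])
  have ringZ: "ring (stalk Z (k x))" if "x \<in> points X" for x by (rule cring.axioms(1)[OF j.X.stalk_cring[OF k(1)[OF that]]])
  have jhom: "stalk_map j (k x) \<in> ring_hom (stalk P (pt h x)) (stalk Z (k x))" if "x \<in> points X" for x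
    using j.stalk_map_hom[OF k(1)[OF that]] k(2)[OF that] by simp
  \<comment> \<open>Any preimage under the surjection \<open>stalk_map j\<close> may be chosen; two
    choices differ by an element of its kernel, which \<open>h\<close> kills by
    \<open>kerst\<close>.\<close>
  define \<psi> where "\<psi> = (\<lambda>x A. stalk_map h x (SOME B. B \<in> stk P (pt h x) \<and> stalk_map j (k x) B = A))"
  have \<psi>j: "\<psi> x (stalk_map j (k x) B) = stalk_map h x B" if x: "x \<in> points X" and B: "B \<in> stk P (pt h x)" for x B
  proof -
    define B' where "B' = (SOME B'. B' \<in> stk P (pt h x) \<and> stalk_map j (k x) B' = stalk_map j (k x) B)"
    have "B' \<in> stk P (pt h x) \<and> stalk_map j (k x) B' = stalk_map j (k x) B"
      unfolding B'_def by (rule someI_ex) (use B in blast)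
    then have "stalk_map h x B' = stalk_map h x B"
      using ring_hom_eq_of_diff[OF ringP[OF x] ringZ[OF x] ringX[OF x] jhom[OF x] h.stalk_map_hom[OF x] kerst[OF x] _ B] by simp
    then show ?thesis unfolding \<psi>_def B'_def .
  qed
  have jsurj: "\<exists>B \<in> stk P (pt h x). A = stalk_map j (k x) B" if x: "x \<in> points X" and A: "A \<in> stk Z (k x)" for x A
    using local_lift_stalk_surj[OF rZ rP jZ lift k(1)[OF x] A] k(2)[OF x] by metis
  have \<psi>hom: "\<psi> x \<in> ring_hom (stalk Z (k x)) (stalk X x)" if x: "x \<in> points X" for x
  proof (rule ring_hom_memI)
    interpret RP: ring "stalk P (pt h x)" by (rule ringP[OF x])
    fix A assume "A \<in> stk Z (k x)"
    then obtain A' where A: "A' \<in> stk P (pt h x)" "A = stalk_map j (k x) A'" using jsurj[OF x] by blast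
    show "\<psi> x A \<in> stk X x" unfolding A(2) \<psi>j[OF x A(1)] by (rule h.stalk_map_closed[OF x A(1)])
    fix B assume "B \<in> stk Z (k x)"
    then obtain B' where B: "B' \<in> stk P (pt h x)" "B = stalk_map j (k x) B'" using jsurj[OF x] by blast
    show "\<psi> x (A \<otimes>\<^bsub>stalk Z (k x)\<^esub> B) = \<psi> x A \<otimes>\<^bsub>stalk X x\<^esub> \<psi> x B"
      using ring_hom_mult[OF jhom[OF x] A(1) B(1)] ring_hom_mult[OF h.stalk_map_hom[OF x] A(1) B(1)]
        \<psi>j[OF x A(1)] \<psi>j[OF x B(1)] \<psi>j[OF x RP.m_closed[OF A(1) B(1)]] A(2) B(2) by simp
    show "\<psi> x (A \<oplus>\<^bsub>stalk Z (k x)\<^esub> B) = \<psi> x A \<oplus>\<^bsub>stalk X x\<^esub> \<psi> x B"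
      using ring_hom_add[OF jhom[OF x] A(1) B(1)] ring_hom_add[OF h.stalk_map_hom[OF x] A(1) B(1)]
        \<psi>j[OF x A(1)] \<psi>j[OF x B(1)] \<psi>j[OF x RP.a_closed[OF A(1) B(1)]] A(2) B(2) by simp
  next
    interpret RP: ring "stalk P (pt h x)" by (rule ringP[OF x])
    show "\<psi> x \<one>\<^bsub>stalk Z (k x)\<^esub> = \<one>\<^bsub>stalk X x\<^esub>"
      using \<psi>j[OF x RP.one_closed] ring_hom_one[OF jhom[OF x]] ring_hom_one[OF h.stalk_map_hom[OF x]] by simp
  qed
  have "\<exists>f \<in> lrs_hom X Z. (\<forall>x \<in> points X. pt f x = k x) \<and>
     (\<forall>x \<in> points X. \<forall>V s. opn Z V \<longrightarrow> k x \<in> V \<longrightarrow> s \<in> secs Z V \<longrightarrow>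
        germ X x (preim f V) (cm f V s) = \<psi> x (germ Z (k x) V s))"
  proof (rule mor_from_stalks[OF rX rZ _ \<psi>hom])
    show "continuous_map (top_of X) (top_of Z) k"
      unfolding continuous_map_def
    proof (intro conjI allI impI)
      show "k \<in> points X \<rightarrow> points Z" using k by auto
      fix V assume "opn Z V"
      then obtain W where W: "opn P W" "preim j W = V" using closed_immersion_preim[OF j] st by metis
      have "{x \<in> points X. k x \<in> V} = preim h W"
        using k W(2) by (auto simp: h.mem_preim j.mem_preim)
      then show "opn X {x \<in> points X. k x \<in> V}" using h.preim_open[OF W(1)] by simp
    qed
  next
    fix x A assume x: "x \<in> points X" and A: "A \<in> stk Z (k x)" "\<psi> x A \<in> Units (stalk X x)"
    obtain B where B: "B \<in> stk P (pt h x)" "A = stalk_map j (k x) B" using jsurj[OF x A(1)] by blast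
    have "stalk_map h x B \<in> Units (stalk X x)" using A(2) \<psi>j[OF x B(1)] B(2) by simp
    then have "B \<in> Units (stalk P (pt h x))" using h.stalk_map_unit_iff[OF x B(1)] by simp
    then show "A \<in> Units (stalk Z (k x))" unfolding B(2) by (rule hom_Units[OF jhom[OF x] ringP[OF x] ringZ[OF x]])
  next
    fix x V s assume x: "x \<in> points X" and V: "opn Z V" "k x \<in> V" and s: "s \<in> secs Z V"
    obtain W t where W: "opn P W" "pt h x \<in> W" "preim j W \<subseteq> V" "t \<in> secs P W" "cm j W t = res Z V (preim j W) s"
      using local_liftD[OF lift st V s] k(2)[OF x] by auto
    have "germ X y (preim h W) (cm h W t) = \<psi> y (germ Z (k y) V s)" if y: "y \<in> preim h W" for y
    proof -
      have yp: "y \<in> points X" "pt h y \<in> W" using y by (auto simp: h.mem_preim)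
      have ky: "k y \<in> preim j W" using k[OF yp(1)] yp by (simp add: j.mem_preim)
      have "stalk_map j (k y) (germ P (pt h y) W t) = germ Z (k y) V s"
        using j.stalk_map_germ[OF k(1)[OF yp(1)] W(1) _ W(4)] k(2)[OF yp(1)] yp W(5) j.X.germ_res[OF V(1) j.preim_open[OF W(1)] ky W(3) s] by simp
      then show ?thesis using \<psi>j[OF yp(1) j.Y.germ_in_stalk[OF W(1) yp(2) W(4)]] h.stalk_map_germ[OF yp(1) W(1) yp(2) W(4)] by simp
    qed
    moreover have "k ` preim h W \<subseteq> V" using k W by (auto simp: h.mem_preim j.mem_preim)
    moreover have "x \<in> preim h W" using x W by (simp add: h.mem_preim)
    ultimately show "\<exists>W t. opn X W \<and> x \<in> W \<and> k ` W \<subseteq> V \<and> t \<in> secs X W \<and> (\<forall>y \<in> W. germ X y W t = \<psi> y (germ Z (k y) V s))"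
      using h.preim_open[OF W(1)] h.cm_closed[OF W(1,4)] by blast
  qed
  then obtain f where f: "f \<in> lrs_hom X Z" and fk: "(\<forall>x \<in> points X. pt f x = k x) \<and>
     (\<forall>x \<in> points X. \<forall>V s. opn Z V \<longrightarrow> k x \<in> V \<longrightarrow> s \<in> secs Z V \<longrightarrow>
        germ X x (preim f V) (cm f V s) = \<psi> x (germ Z (k x) V s))" by (rule bexE)
  have pf: "pt f x = k x" if "x \<in> points X" for x using fk that by simp
  note gf = fk[THEN conjunct2, rule_format]
  have "j \<circ>\<^sub>s f = h"
  proof (rule lrs_hom_eqI[OF rX rP lrs_comp_hom[OF rX rZ rP f jZ] h])
    fix x assume x: "x \<in> points X"
    show p: "pt (j \<circ>\<^sub>s f) x = pt h x" using x pf k by (simp add: pt_comp lrs_homD(1)[OF f])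
    fix V s assume V: "opn P V" "pt (j \<circ>\<^sub>s f) x \<in> V" and s: "s \<in> secs P V"
    then have hV: "pt h x \<in> V" using p by simp
    have kV: "k x \<in> preim j V" using k[OF x] hV by (simp add: j.mem_preim)
    show "germ X x (preim (j \<circ>\<^sub>s f) V) (cm (j \<circ>\<^sub>s f) V s) = germ X x (preim h V) (cm h V s)"
      unfolding preim_comp[OF rX rZ rP f jZ]
      using cm_comp[of j V s f] V(1) s st gf[OF x j.preim_open[OF V(1)] kV j.cm_closed[OF V(1) s]]
        j.stalk_map_germ[OF k(1)[OF x] V(1) _ s] k(2)[OF x] hV \<psi>j[OF x j.Y.germ_in_stalk[OF V(1) hV s]] h.stalk_map_germ[OF x V(1) hV s] by simp
  qed
  then show ?thesis using f by blast
qed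

section \<open>Transport along injections\<close>

lemma image_ring_cring:
  assumes "cring R" "inj_on f (carrier R)" shows "cring (image_ring f R)"
proof -
  interpret cring R by fact
  interpret S: ring "image_ring f R" by (rule inj_imp_image_ring_is_ring[OF assms(2)])
  have h: "f \<in> ring_hom R (image_ring f R)" using inj_imp_image_ring_iso[OF assms(2)] unfolding ring_iso_def by simp
  show ?thesis
  proof (rule cring.intro[OF S.ring_axioms], rule S.monoid_comm_monoidI)
    fix x y assume "x \<in> carrier (image_ring f R)" "y \<in> carrier (image_ring f R)"
    then obtain a b where ab: "a \<in> carrier R" "b \<in> carrier R" "x = f a" "y = f b" unfolding image_ring_carrier by auto
    show "x \<otimes>\<^bsub>image_ring f R\<^esub> y = y \<otimes>\<^bsub>image_ring f R\<^esub> x"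
      unfolding ab(3,4) ring_hom_mult[OF h ab(1,2), symmetric] ring_hom_mult[OF h ab(2,1), symmetric] m_comm[OF ab(1,2)] by (rule refl)
  qed
qed

lemma image_ring_homs:
  assumes "inj_on f (carrier R)" "ring R"
  shows "f \<in> ring_hom R (image_ring f R)" "inv_into (carrier R) f \<in> ring_hom (image_ring f R) R"
  using inj_imp_image_ring_iso[OF assms(1)] ring_iso_set_sym[OF assms(2) inj_imp_image_ring_iso[OF assms(1)]]
  unfolding ring_iso_def by simp_all

text \<open>Test schemes must have points and sections in one prescribed type, so a space is copied
  along injections. The map \<beta> is injective only over each open set separately, which suffices
  because sections over different open sets are never compared directly.\<close>

locale transport = Y: rspace Y for Y :: "('q, 's) ringed_space" +
  fixes \<alpha> :: "'q \<Rightarrow> 'u" and \<beta> :: "'s \<Rightarrow> 'v"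
  assumes \<alpha>: "inj_on \<alpha> (points Y)" and \<beta>: "\<And>U. opn Y U \<Longrightarrow> inj_on \<beta> (secs Y U)"
begin

abbreviation bk where "bk \<equiv> inv_into (points Y) \<alpha>"
definition pre where "pre W = {y \<in> points Y. \<alpha> y \<in> W}"
abbreviation \<beta>inv where "\<beta>inv U \<equiv> inv_into (secs Y U) \<beta>"

definition E :: "('u, 'v) ringed_space" where
  "E = \<lparr>top_of = pullback_topology (\<alpha> ` points Y) bk (top_of Y),
    sec = (\<lambda>W. image_ring \<beta> (sec Y (pre W))),
    res = (\<lambda>W W' t. \<beta> (res Y (pre W) (pre W') (\<beta>inv (pre W) t)))\<rparr>"

lemma opn_E: "opn E W \<longleftrightarrow> (\<exists>U. opn Y U \<and> W = \<alpha> ` U)"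
proof -
  have e: "bk -` U \<inter> \<alpha> ` points Y = \<alpha> ` U" if "opn Y U" for U
    using Y.opn_sub[OF that] \<alpha> by (auto simp: inv_into_f_f subset_iff)
  have "opn E W \<longleftrightarrow> (\<exists>U. opn Y U \<and> W = bk -` U \<inter> \<alpha> ` points Y)"
    by (simp add: E_def openin_pullback_topology)
  also have "\<dots> \<longleftrightarrow> (\<exists>U. opn Y U \<and> W = \<alpha> ` U)" using e by (intro ex_cong1 conj_cong) simp_all
  finally show ?thesis .
qed

lemma points_E: "points E = \<alpha> ` points Y"
  unfolding E_def by (auto simp: topspace_pullback_topology inv_into_into)

lemma pre_image: "U \<subseteq> points Y \<Longrightarrow> pre (\<alpha> ` U) = U"
  unfolding pre_def using \<alpha> by (auto dest: inj_onD)

lemma pre_open: "opn E W \<Longrightarrow> opn Y (pre W)" and image_pre: "opn E W \<Longrightarrow> \<alpha> ` pre W = W"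
  unfolding opn_E using pre_image Y.opn_sub by auto

lemma pre_mono: "W \<subseteq> W' \<Longrightarrow> pre W \<subseteq> pre W'"
  unfolding pre_def by auto

lemma sec_E: "sec E W = image_ring \<beta> (sec Y (pre W))"
  by (simp add: E_def)

lemma carrier_E: "secs E W = \<beta> ` secs Y (pre W)"
  by (simp add: sec_E image_ring_carrier)

lemma \<beta>inv_\<beta>: "opn Y U \<Longrightarrow> s \<in> secs Y U \<Longrightarrow> \<beta>inv U (\<beta> s) = s"
  by (rule inv_into_f_f[OF \<beta>])

lemma res_E: "opn E W \<Longrightarrow> s \<in> secs Y (pre W) \<Longrightarrow> res E W W' (\<beta> s) = \<beta> (res Y (pre W) (pre W') s)"
  by (simp add: E_def \<beta>inv_\<beta> pre_open)

lemma \<beta>_hom: "opn E W \<Longrightarrow> \<beta> \<in> ring_hom (sec Y (pre W)) (sec E W)"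
  unfolding sec_E by (rule image_ring_homs(1)[OF \<beta>[OF pre_open] Y.sec_ring[OF pre_open]])

lemma \<beta>inv_hom: "opn E W \<Longrightarrow> \<beta>inv (pre W) \<in> ring_hom (sec E W) (sec Y (pre W))"
  unfolding sec_E by (rule image_ring_homs(2)[OF \<beta>[OF pre_open] Y.sec_ring[OF pre_open]])

lemma pre_Union: "pre (\<Union>\<U>) = \<Union>(pre ` \<U>)" and pre_Int: "pre (V \<inter> W) = pre V \<inter> pre W"
  unfolding pre_def by auto

lemma ringed_E: "ringed_space E"
  unfolding ringed_space_def
proof (intro conjI allI impI ballI)
  fix U assume U: "opn E U"
  show "cring (sec E U)" unfolding sec_E by (rule image_ring_cring[OF Y.sec_cring[OF pre_open[OF U]] \<beta>[OF pre_open[OF U]]])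
next
  fix U V assume UV: "opn E U \<and> opn E V \<and> V \<subseteq> U"
  then have o: "opn E U" "opn E V" "V \<subseteq> U" by auto
  have "\<beta> \<circ> (res Y (pre U) (pre V) \<circ> \<beta>inv (pre U)) \<in> ring_hom (sec E U) (sec E V)"
    by (rule ring_hom_trans[OF ring_hom_trans[OF \<beta>inv_hom[OF o(1)] Y.res_hom[OF pre_open[OF o(1)] pre_open[OF o(2)] pre_mono[OF o(3)]]] \<beta>_hom[OF o(2)]])
  then show "res E U V \<in> ring_hom (sec E U) (sec E V)" by (simp add: E_def comp_def)
next
  fix U s assume s: "s \<in> secs E U" and U: "opn E U"
  then obtain s' where s': "s' \<in> secs Y (pre U)" "s = \<beta> s'" unfolding carrier_E by auto
  then show "res E U U s = s" by (simp add: res_E[OF U] Y.res_id[OF pre_open[OF U]])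
next
  fix U V W s assume s: "s \<in> secs E U" and UVW: "opn E U \<and> opn E V \<and> opn E W \<and> W \<subseteq> V \<and> V \<subseteq> U"
  then have o: "opn E U" "opn E V" "opn E W" "W \<subseteq> V" "V \<subseteq> U" by auto
  obtain s' where s': "s' \<in> secs Y (pre U)" "s = \<beta> s'" using s unfolding carrier_E by auto
  note p = pre_open[OF o(1)] pre_open[OF o(2)] pre_open[OF o(3)] pre_mono[OF o(4)] pre_mono[OF o(5)]
  show "res E V W (res E U V s) = res E U W s"
    using res_E[OF o(1) s'(1)] res_E[OF o(2) Y.res_closed[OF p(1,2,5) s'(1)]] Y.res_res[OF p(1,2,3,4,5) s'(1)] s'(2) by simp
next
  fix \<U> s t assume o: "\<forall>V\<in>\<U>. opn E V" and s: "s \<in> secs E (\<Union>\<U>)" and t: "t \<in> secs E (\<Union>\<U>)"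
    and e: "\<forall>V\<in>\<U>. res E (\<Union>\<U>) V s = res E (\<Union>\<U>) V t"
  have U: "opn E (\<Union>\<U>)" using o by auto
  obtain s' where s': "s' \<in> secs Y (pre (\<Union>\<U>))" "s = \<beta> s'" using s unfolding carrier_E by auto
  obtain t' where t': "t' \<in> secs Y (pre (\<Union>\<U>))" "t = \<beta> t'" using t unfolding carrier_E by auto
  have "s' = t'"
  proof (rule Y.sep[of "pre ` \<U>"])
    show "\<And>V. V \<in> pre ` \<U> \<Longrightarrow> opn Y V" using o pre_open by auto
    show "s' \<in> secs Y (\<Union> (pre ` \<U>))" "t' \<in> secs Y (\<Union> (pre ` \<U>))" using s' t' pre_Union by simp_all
    fix V assume "V \<in> pre ` \<U>"
    then obtain W where W: "W \<in> \<U>" "V = pre W" by auto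
    have oW: "opn E W" "W \<subseteq> \<Union>\<U>" using W o by auto
    have "\<beta> (res Y (pre (\<Union>\<U>)) (pre W) s') = \<beta> (res Y (pre (\<Union>\<U>)) (pre W) t')"
      using e W(1) s' t' res_E[OF U s'(1), of W] res_E[OF U t'(1), of W] by simp
    then have "res Y (pre (\<Union>\<U>)) (pre W) s' = res Y (pre (\<Union>\<U>)) (pre W) t'"
      by (rule inj_onD[OF \<beta>[OF pre_open[OF oW(1)]]])
        (use Y.res_closed[OF pre_open[OF U] pre_open[OF oW(1)] pre_mono[OF oW(2)]] s' t' in simp_all)
    then show "res Y (\<Union> (pre ` \<U>)) V s' = res Y (\<Union> (pre ` \<U>)) V t'" using W(2) pre_Union by simp
  qed
  then show "s = t" using s' t' by simp
next
  fix \<U> s assume h: "(\<forall>V\<in>\<U>. opn E V \<and> s V \<in> secs E V) \<and>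
           (\<forall>V\<in>\<U>. \<forall>W\<in>\<U>. res E V (V \<inter> W) (s V) = res E W (V \<inter> W) (s W))"
  then have U: "opn E (\<Union>\<U>)" by auto
  have o: "opn E V" if "V \<in> \<U>" for V using h that by blast
  have s: "\<beta>inv (pre V) (s V) \<in> secs Y (pre V)" "\<beta> (\<beta>inv (pre V) (s V)) = s V" if "V \<in> \<U>" for V
    using h that unfolding carrier_E by (auto intro: inv_into_into f_inv_into_f)
  define s' where "s' = (\<lambda>V. \<beta>inv V (s (\<alpha> ` V)))"
  have s': "s' (pre V) = \<beta>inv (pre V) (s V)" if "V \<in> \<U>" for V using image_pre[OF o[OF that]] by (simp add: s'_def)
  have "\<exists>t\<in>secs Y (\<Union>(pre ` \<U>)). \<forall>V\<in>pre ` \<U>. res Y (\<Union>(pre ` \<U>)) V t = s' V"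
  proof (rule Y.glue)
    show "\<And>V. V \<in> pre ` \<U> \<Longrightarrow> opn Y V" using o pre_open by auto
    show "\<And>V. V \<in> pre ` \<U> \<Longrightarrow> s' V \<in> secs Y V" using s s' by auto
    fix V' W' assume "V' \<in> pre ` \<U>" "W' \<in> pre ` \<U>"
    then obtain V W where VW: "V \<in> \<U>" "V' = pre V" "W \<in> \<U>" "W' = pre W" by auto
    have oVW: "opn E (V \<inter> W)" using o VW by (auto simp: openin_Int)
    have "res E V (V \<inter> W) (s V) = res E W (V \<inter> W) (s W)" using h VW by blast
    then have "\<beta> (res Y (pre V) (pre (V \<inter> W)) (s' V')) = \<beta> (res Y (pre W) (pre (V \<inter> W)) (s' W'))"
      using res_E[OF o[OF VW(1)] s(1)[OF VW(1)], of "V \<inter> W"] res_E[OF o[OF VW(3)] s(1)[OF VW(3)], of "V \<inter> W"]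
        s(2)[OF VW(1)] s(2)[OF VW(3)] s'[OF VW(1)] s'[OF VW(3)] VW by simp
    then have "res Y (pre V) (pre (V \<inter> W)) (s' V') = res Y (pre W) (pre (V \<inter> W)) (s' W')"
      by (rule inj_onD[OF \<beta>[OF pre_open[OF oVW]]])
        (use Y.res_closed[OF pre_open[OF o[OF VW(1)]] pre_open[OF oVW] pre_mono[OF Int_lower1] s(1)[OF VW(1)]]
          Y.res_closed[OF pre_open[OF o[OF VW(3)]] pre_open[OF oVW] pre_mono[OF Int_lower2] s(1)[OF VW(3)]]
          s'[OF VW(1)] s'[OF VW(3)] VW in simp_all)
    then show "res Y V' (V' \<inter> W') (s' V') = res Y W' (V' \<inter> W') (s' W')" using VW pre_Int by simp
  qed
  then obtain t where t: "t \<in> secs Y (pre (\<Union>\<U>))" "\<And>V. V \<in> \<U> \<Longrightarrow> res Y (pre (\<Union>\<U>)) (pre V) t = s' (pre V)"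
    unfolding pre_Union by auto
  show "\<exists>t\<in>secs E (\<Union> \<U>). \<forall>V\<in>\<U>. res E (\<Union> \<U>) V t = s V"
  proof (intro bexI[of _ "\<beta> t"] ballI)
    show "\<beta> t \<in> secs E (\<Union> \<U>)" using t unfolding carrier_E by simp
    fix V assume V: "V \<in> \<U>"
    show "res E (\<Union> \<U>) V (\<beta> t) = s V" unfolding res_E[OF U t(1)] t(2)[OF V] s'[OF V] by (rule s(2)[OF V])
  qed
qed

interpretation E: rspace E by (rule rspace.intro[OF ringed_E])

definition from_E where
  "from_E = \<lparr>src = E, tgt = Y, pt = restrict bk (points E),
     cm = (\<lambda>V. if opn Y V then restrict \<beta> (secs Y V) else (\<lambda>_. undefined))\<rparr>"

definition to_E where
  "to_E = \<lparr>src = Y, tgt = E, pt = restrict \<alpha> (points Y),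
     cm = (\<lambda>W. if opn E W then restrict (\<beta>inv (pre W)) (secs E W) else (\<lambda>_. undefined))\<rparr>"

lemma bk_\<alpha>: "y \<in> points Y \<Longrightarrow> bk (\<alpha> y) = y"
  by (rule inv_into_f_f[OF \<alpha>])

lemma preim_from: "opn Y V \<Longrightarrow> preim from_E V = \<alpha> ` V"
  using Y.opn_sub[of V] bk_\<alpha> by (auto simp: preim_def from_E_def points_E dest: inj_onD[OF \<alpha>])

lemma preim_to: "preim to_E W = pre W"
  by (auto simp: preim_def to_E_def pre_def)

lemma opn_image: "opn Y V \<Longrightarrow> opn E (\<alpha> ` V)" and pre_image': "opn Y V \<Longrightarrow> pre (\<alpha> ` V) = V"
  unfolding opn_E using pre_image Y.opn_sub by auto

lemma unit_E_iff:
  assumes "opn Y V" "y \<in> V" "s \<in> secs Y V"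
  shows "germ E (\<alpha> y) (\<alpha> ` V) (\<beta> s) \<in> Units (stalk E (\<alpha> y)) \<longleftrightarrow> germ Y y V s \<in> Units (stalk Y y)"
proof -
  note oV = opn_image[OF assms(1)] and pV = pre_image'[OF assms(1)]
  have b: "\<beta> s \<in> secs E (\<alpha> ` V)" using assms(3) unfolding carrier_E pV by simp
  have yp: "y \<in> points Y" using Y.opn_sub[OF assms(1)] assms(2) by auto
  show ?thesis
    unfolding E.germ_unit_iff[OF oV imageI[OF assms(2)] b] Y.germ_unit_iff[OF assms]
  proof
    assume "\<exists>W. opn E W \<and> \<alpha> y \<in> W \<and> W \<subseteq> \<alpha> ` V \<and> res E (\<alpha> ` V) W (\<beta> s) \<in> Units (sec E W)"
    then obtain W where W: "opn E W" "\<alpha> y \<in> W" "W \<subseteq> \<alpha> ` V" "res E (\<alpha> ` V) W (\<beta> s) \<in> Units (sec E W)" by blast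
    have "pre W \<subseteq> V" using pre_mono[OF W(3)] pV by simp
    moreover have "y \<in> pre W" using W yp unfolding pre_def by simp
    moreover have r: "res Y V (pre W) s \<in> secs Y (pre W)" by (rule Y.res_closed[OF assms(1) pre_open[OF W(1)] calculation(1) assms(3)])
    have "\<beta>inv (pre W) (res E (\<alpha> ` V) W (\<beta> s)) \<in> Units (sec Y (pre W))"
      by (rule hom_Units[OF \<beta>inv_hom[OF W(1)] E.sec_ring[OF W(1)] Y.sec_ring[OF pre_open[OF W(1)]] W(4)])
    then have "res Y V (pre W) s \<in> Units (sec Y (pre W))"
      using res_E[OF oV, of s W] assms(3) pV \<beta>inv_\<beta>[OF pre_open[OF W(1)] r] by simp
    ultimately show "\<exists>W. opn Y W \<and> y \<in> W \<and> W \<subseteq> V \<and> res Y V W s \<in> Units (sec Y W)" using pre_open[OF W(1)] by blast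
  next
    assume "\<exists>W. opn Y W \<and> y \<in> W \<and> W \<subseteq> V \<and> res Y V W s \<in> Units (sec Y W)"
    then obtain W where W: "opn Y W" "y \<in> W" "W \<subseteq> V" "res Y V W s \<in> Units (sec Y W)" by blast
    have "\<beta> (res Y V W s) \<in> Units (sec E (\<alpha> ` W))"
      using hom_Units[OF \<beta>_hom[OF opn_image[OF W(1)]] _ E.sec_ring[OF opn_image[OF W(1)]]] Y.sec_ring[OF W(1)] W(4) pre_image'[OF W(1)] by simp
    then have "res E (\<alpha> ` V) (\<alpha> ` W) (\<beta> s) \<in> Units (sec E (\<alpha> ` W))"
      using res_E[OF oV, of s "\<alpha> ` W"] assms(3) pV pre_image'[OF W(1)] by simp
    then show "\<exists>W. opn E W \<and> \<alpha> y \<in> W \<and> W \<subseteq> \<alpha> ` V \<and> res E (\<alpha> ` V) W (\<beta> s) \<in> Units (sec E W)"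
      using opn_image[OF W(1)] W by blast
  qed
qed

lemma from_E_hom: "from_E \<in> lrs_hom E Y"
proof (rule lrs_homI[OF ringed_E Y.ringed])
  show "continuous_map (top_of E) (top_of Y) (pt from_E)"
    unfolding continuous_map_def
  proof (intro conjI allI impI)
    show "pt from_E \<in> points E \<rightarrow> points Y" by (auto simp: from_E_def points_E bk_\<alpha>)
    fix V assume V: "opn Y V"
    have "{x \<in> points E. pt from_E x \<in> V} = preim from_E V" by (simp add: preim_def from_E_def)
    then show "opn E {x \<in> points E. pt from_E x \<in> V}" using opn_image[OF V] preim_from[OF V] by simp
  qed
  fix V assume V: "opn Y V"
  show "cm from_E V \<in> ring_hom (sec Y V) (sec E (preim from_E V))"
    unfolding preim_from[OF V]
    by (rule ring_hom_cong[OF Y.sec_ring[OF V] \<beta>_hom[OF opn_image[OF V], unfolded pre_image'[OF V]]]) (simp add: from_E_def V)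
  show "cm from_E V \<in> extensional (secs Y V)" by (simp add: from_E_def V)
  fix W s assume W: "opn Y W" "W \<subseteq> V" and s: "s \<in> secs Y V"
  show "cm from_E W (res Y V W s) = res E (preim from_E V) (preim from_E W) (cm from_E V s)"
    unfolding preim_from[OF V] preim_from[OF W(1)]
    using res_E[OF opn_image[OF V], of s "\<alpha> ` W"] pre_image'[OF V] pre_image'[OF W(1)] s V W Y.res_closed[OF V W s] by (simp add: from_E_def)
next
  fix x V s assume *: "x \<in> points E" "opn Y V" "pt from_E x \<in> V" "s \<in> secs Y V"
     "germ E x (preim from_E V) (cm from_E V s) \<in> Units (stalk E x)"
  obtain y where y: "y \<in> points Y" "x = \<alpha> y" using *(1) unfolding points_E by auto
  have p: "pt from_E x = y" using y *(1) bk_\<alpha> by (simp add: from_E_def)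
  have "germ E (\<alpha> y) (\<alpha> ` V) (\<beta> s) \<in> Units (stalk E (\<alpha> y))"
    using *(5) *(2,4) unfolding preim_from[OF *(2)] y(2) by (simp add: from_E_def)
  then show "germ Y (pt from_E x) V s \<in> Units (stalk Y (pt from_E x))"
    using unit_E_iff[OF *(2) _ *(4), of y] *(3) unfolding p by simp
qed (simp_all add: from_E_def)

lemma to_E_hom: "to_E \<in> lrs_hom Y E"
proof (rule lrs_homI[OF Y.ringed ringed_E])
  show "continuous_map (top_of Y) (top_of E) (pt to_E)"
    unfolding continuous_map_def
  proof (intro conjI allI impI)
    show "pt to_E \<in> points Y \<rightarrow> points E" by (auto simp: to_E_def points_E)
    fix W assume W: "opn E W"
    have "{x \<in> points Y. pt to_E x \<in> W} = pre W" by (auto simp: pre_def to_E_def)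
    then show "opn Y {x \<in> points Y. pt to_E x \<in> W}" using pre_open[OF W] by simp
  qed
  fix V assume V: "opn E V"
  show "cm to_E V \<in> ring_hom (sec E V) (sec Y (preim to_E V))"
    unfolding preim_to
    by (rule ring_hom_cong[OF E.sec_ring[OF V] \<beta>inv_hom[OF V]]) (simp add: to_E_def V)
  show "cm to_E V \<in> extensional (secs E V)" by (simp add: to_E_def V)
  fix W s assume W: "opn E W" "W \<subseteq> V" and s: "s \<in> secs E V"
  obtain s' where s': "s' \<in> secs Y (pre V)" "s = \<beta> s'" using s unfolding carrier_E by auto
  note r = Y.res_closed[OF pre_open[OF V] pre_open[OF W(1)] pre_mono[OF W(2)] s'(1)]
  show "cm to_E W (res E V W s) = res Y (preim to_E V) (preim to_E W) (cm to_E V s)"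
    unfolding preim_to
    using res_E[OF V s'(1), of W] s'(2) r s V W(1) \<beta>inv_\<beta>[OF pre_open[OF V] s'(1)] \<beta>inv_\<beta>[OF pre_open[OF W(1)] r]
      E.res_closed[OF V W s] by (simp add: to_E_def)
next
  fix x V s assume *: "x \<in> points Y" "opn E V" "pt to_E x \<in> V" "s \<in> secs E V"
     "germ Y x (preim to_E V) (cm to_E V s) \<in> Units (stalk Y x)"
  obtain s' where s': "s' \<in> secs Y (pre V)" "s = \<beta> s'" using *(4) unfolding carrier_E by auto
  have p: "pt to_E x = \<alpha> x" using * by (simp add: to_E_def)
  have xV: "x \<in> pre V" using * p unfolding pre_def by simp
  show "germ E (pt to_E x) V s \<in> Units (stalk E (pt to_E x))"
    using unit_E_iff[OF pre_open[OF *(2)] xV s'(1)] *(5) *(2,4) s'(2) image_pre[OF *(2)] \<beta>inv_\<beta>[OF pre_open[OF *(2)] s'(1)]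
    unfolding p preim_to by (simp add: to_E_def)
qed (simp_all add: to_E_def)

lemma to_from: "to_E \<circ>\<^sub>s from_E = lrs_id E"
proof (rule lrs_hom_eqI[OF ringed_E ringed_E lrs_comp_hom[OF ringed_E Y.ringed ringed_E from_E_hom to_E_hom] lrs_id_hom[OF ringed_E]])
  fix x assume x: "x \<in> points E"
  then obtain y where y: "y \<in> points Y" "x = \<alpha> y" unfolding points_E by auto
  show "pt (to_E \<circ>\<^sub>s from_E) x = pt (lrs_id E) x"
    using x y bk_\<alpha> by (simp add: pt_comp from_E_def to_E_def lrs_id_def)
  fix V s assume V: "opn E V" and s: "s \<in> secs E V"
  have "cm (to_E \<circ>\<^sub>s from_E) V s = s"
    using V s pre_open[OF V] cm_comp[of to_E V s from_E] preim_to[of V] f_inv_into_f[of s \<beta> "secs Y (pre V)"]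
      inv_into_into[of s \<beta> "secs Y (pre V)"] unfolding carrier_E by (simp add: to_E_def from_E_def carrier_E)
  then show "germ E x (preim (to_E \<circ>\<^sub>s from_E) V) (cm (to_E \<circ>\<^sub>s from_E) V s) = germ E x (preim (lrs_id E) V) (cm (lrs_id E) V s)"
    unfolding preim_comp[OF ringed_E Y.ringed ringed_E from_E_hom to_E_hom] preim_to preim_from[OF pre_open[OF V]] image_pre[OF V] preim_id[OF V]
    using V s by (simp add: lrs_id_def)
qed

lemma from_to: "from_E \<circ>\<^sub>s to_E = lrs_id Y"
proof (rule lrs_hom_eqI[OF Y.ringed Y.ringed lrs_comp_hom[OF Y.ringed ringed_E Y.ringed to_E_hom from_E_hom] lrs_id_hom[OF Y.ringed]])
  fix x assume x: "x \<in> points Y"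
  show "pt (from_E \<circ>\<^sub>s to_E) x = pt (lrs_id Y) x"
    using x bk_\<alpha> by (simp add: pt_comp from_E_def to_E_def lrs_id_def points_E)
  fix V s assume V: "opn Y V" and s: "s \<in> secs Y V"
  have "cm (from_E \<circ>\<^sub>s to_E) V s = s"
    using V s opn_image[OF V] cm_comp[of from_E V s to_E] preim_from[OF V] \<beta>inv_\<beta>[OF V s] pre_image'[OF V]
    by (simp add: to_E_def from_E_def carrier_E)
  then show "germ Y x (preim (from_E \<circ>\<^sub>s to_E) V) (cm (from_E \<circ>\<^sub>s to_E) V s) = germ Y x (preim (lrs_id Y) V) (cm (lrs_id Y) V s)"
    unfolding preim_comp[OF Y.ringed ringed_E Y.ringed to_E_hom from_E_hom] preim_to preim_from[OF V] pre_image'[OF V] preim_id[OF V]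
    using V s by (simp add: lrs_id_def)
qed

lemma lrs_E: assumes "locally_ringed_space Y" shows "locally_ringed_space E"
  unfolding locally_ringed_space_def
proof (intro conjI ballI ringed_E)
  fix x assume x: "x \<in> points E"
  interpret f: lrs_mor E Y from_E by (rule lrs_morI[OF ringed_E Y.ringed from_E_hom])
  show "local_ring (stalk E x)"
  proof (rule local_ring_surj[OF lrs_stalk_local[OF assms f.pt_in[OF x]] E.stalk_cring[OF x] f.stalk_map_hom[OF x]])
    show "a \<in> Units (stalk Y (pt from_E x))" if "a \<in> stk Y (pt from_E x)" "stalk_map from_E x a \<in> Units (stalk E x)" for a
      using f.stalk_map_unit_iff[OF x] that by simp
    show "stk E x \<subseteq> stalk_map from_E x ` stk Y (pt from_E x)"
    proof
      fix A assume "A \<in> stk E x"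
      then obtain V s where V: "opn E V" "x \<in> V" "s \<in> secs E V" "A = germ E x V s" by (rule E.stalkE)
      obtain s' where s': "s' \<in> secs Y (pre V)" "s = \<beta> s'" using V(3) unfolding carrier_E by auto
      have xp: "pt from_E x \<in> pre V" using V(2) x image_pre[OF V(1)] preim_from[OF pre_open[OF V(1)]] f.mem_preim by blast
      have "stalk_map from_E x (germ Y (pt from_E x) (pre V) s') = A"
        using f.stalk_map_germ[OF x pre_open[OF V(1)] xp s'(1)] s' V(4) preim_from[OF pre_open[OF V(1)]] image_pre[OF V(1)] pre_open[OF V(1)]
        by (simp add: from_E_def)
      then show "A \<in> stalk_map from_E x ` stk Y (pt from_E x)"
        using Y.germ_in_stalk[OF pre_open[OF V(1)] xp s'(1)] by blast
    qed
  qed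
qed

end

section \<open>Spectra of small local rings as test schemes\<close>

text \<open>What is used of the spectrum of \<open>R\<close>, with \<open>E\<close> living in types
  independent of that of \<open>R\<close>. The point \<open>c\<close> is the closed point, \<kappa>
  identifies \<open>R\<close> with the global functions, and the last clause is the mapping
  property, restricted to spaces of the same types as \<open>E\<close>.\<close>

definition local_model :: "('c, 'm) ring_scheme \<Rightarrow> ('p, 'r) ringed_space \<Rightarrow> 'p \<Rightarrow> ('c \<Rightarrow> 'r) \<Rightarrow> bool" where
  "local_model R E c \<kappa> \<longleftrightarrow> local_ring R \<and> scheme E \<and> c \<in> points E \<and>
     (\<forall>W. opn E W \<and> c \<in> W \<longrightarrow> W = points E) \<and>
     \<kappa> \<in> ring_hom R (sec E (points E)) \<and> bij_betw \<kappa> (carrier R) (secs E (points E)) \<and>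
     (\<forall>(X :: ('p, 'r) ringed_space) \<rho>. locally_ringed_space X \<and> \<rho> \<in> ring_hom R (sec X (points X)) \<longrightarrow>
        (\<exists>f \<in> lrs_hom X E. \<forall>a \<in> carrier R. cm f (points E) (\<kappa> a) = \<rho> a))"

lemma card_subset_inj: "|A| \<le>o |UNIV :: 'u set| \<Longrightarrow> \<exists>f :: 'a \<Rightarrow> 'u. inj_on f A"
  using card_of_ordLeq[of A "UNIV :: 'u set"] by blast

lemma card_of_prod3:
  assumes k: "infinite (UNIV :: 'k set)" and A: "|A| \<le>o |UNIV :: 'k set set|" and B: "|B| \<le>o |UNIV :: 'k set set|"
    and C: "|C| \<le>o |UNIV :: 'k set set|"
  shows "|A \<times> B \<times> C| \<le>o |UNIV :: 'k set set|"
proof -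
  have inf: "infinite (UNIV :: 'k set set)" using k by (simp add: Finite_Set.finite_set)
  show ?thesis by (intro card_of_Times_ordLeq_infinite inf A B C)
qed

lemma (in spectrum) can_inj_local:
  assumes l: "local_ring R" and ab: "a \<in> carrier R" "b \<in> carrier R" "can a = can b"
  shows "a = b"
proof -
  let ?m = "{a \<in> carrier R. a \<notin> Units R}"
  have id: "id \<in> ring_hom R R" by (rule ring_hom_memI) simp_all
  have m: "primeideal ?m R" using hom_nonunits_prime[OF is_cring l id] by simp
  interpret l: localization_set R "carrier R - ?m" by (rule lset[OF m])
  have "can a ?m = can b ?m" using ab by simp
  then have "fr ?m a \<one> = fr ?m b \<one>" using m by (simp add: can_def)
  then obtain u where u: "u \<in> carrier R - ?m" "u \<otimes> (\<one> \<otimes> a) = u \<otimes> (\<one> \<otimes> b)"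
    using l.frac_eq_iff[OF ab(1) l.W_one ab(2) l.W_one] by auto
  then have "u \<in> Units R" by simp
  then show "a = b" using u(2) ab Units_l_cancel by simp
qed

text \<open>A distinguished open set containing the closed point belongs to a function outside the
  maximal ideal, that is to a unit, and so it contains every prime.\<close>

lemma (in spectrum) local_nbhd:
  assumes l: "local_ring R" and W: "openin (zariski R) W" "{a \<in> carrier R. a \<notin> Units R} \<in> W"
  shows "W = pts"
proof -
  obtain f where f: "f \<in> carrier R" "{a \<in> carrier R. a \<notin> Units R} \<in> D f" "D f \<subseteq> W" by (rule D_basis[OF W])
  then have "f \<in> Units R" unfolding D_def by simp
  then have "D f = pts" unfolding D_def using ideal_unit_carrier[OF primeideal.axioms(1)] primeideal.I_notcarr by blast
  then show ?thesis using f(3) openin_subset[OF W(1)] by auto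
qed

text \<open>A section is a fraction near the closed point. That neighbourhood is everything and the
  denominator is a unit, so the fraction is a global function.\<close>

lemma (in spectrum) can_surj_local:
  assumes l: "local_ring R" and s: "s \<in> spec_secs R pts"
  shows "\<exists>a \<in> carrier R. s = can a"
proof -
  let ?m = "{a \<in> carrier R. a \<notin> Units R}"
  have id: "id \<in> ring_hom R R" by (rule ring_hom_memI) simp_all
  have m: "primeideal ?m R" using hom_nonunits_prime[OF is_cring l id] by simp
  have mp: "?m \<in> pts" using m by simp
  obtain V a f where V: "openin (zariski R) V" "?m \<in> V" "V \<subseteq> pts" "a \<in> carrier R" "f \<in> carrier R"
    "\<forall>Q \<in> V. f \<notin> Q \<and> s Q = fr Q a f" by (rule secD_local[OF s mp])
  have Vp: "V = pts" by (rule local_nbhd[OF l V(1,2)])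
  have f: "f \<in> Units R" using V(2,5,6) by auto
  have "s = can (a \<otimes> inv f)"
  proof (rule sec_eq[OF s can_closed])
    show "a \<otimes> inv f \<in> carrier R" using V f by simp
    fix Q assume Q: "Q \<in> pts"
    interpret l: localization_set R "carrier R - Q" by (rule lset) (use Q in simp)
    have "f \<otimes> (a \<otimes> inv f) = a" using V f by (simp add: m_lcomm[of f a])
    then have "fr Q a f = fr Q (a \<otimes> inv f) \<one>" using V Vp Q f l.W_one by (intro l.frac_eqI) auto
    then show "s Q = can (a \<otimes> inv f) Q" using V(6) Q Vp by (simp add: can_def)
  qed
  then show ?thesis using V f by auto
qed

lemma restr_points: "restr X (points X) = X"
  by (simp add: restr_def)

text \<open>
  A section over an open set is determined by its graph, a set of triples of a prime ideal and a
  numerator and denominator. This encoding brings the spectrum into the universe.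
\<close>

theorem local_model_exists:
  fixes R :: "('c, 'm) ring_scheme"
  assumes k: "infinite (UNIV :: 'k set)" and ku: "|UNIV :: 'k set set set| \<le>o |UNIV :: 'u set|"
    and l: "local_ring R" and R: "|carrier R| \<le>o |UNIV :: 'k set|"
  shows "\<exists>(E :: ('u, 'u) ringed_space) c \<kappa>. local_model R E c \<kappa>"
proof -
  \<comment> \<open>\<open>|UNIV :: 'k set|\<close> is the cardinal of the type \<open>'k\<close>,
    and each further \<open>set\<close> is one power set. The ring is bounded by \<open>'k\<close>,
    its primes by one power set, and sets of triples by two, which is the bound \<open>ku\<close> on
    \<open>'u\<close>.\<close>
  have k1: "|UNIV :: 'k set| \<le>o |UNIV :: 'k set set|" using card_of_Pow[of "UNIV :: 'k set"] by (simp add: ordLess_imp_ordLeq)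
  have k2: "|UNIV :: 'k set set| \<le>o |UNIV :: 'k set set set|" using card_of_Pow[of "UNIV :: 'k set set"] by (simp add: ordLess_imp_ordLeq)
  have k2u: "|UNIV :: 'k set set| \<le>o |UNIV :: 'u set|" by (rule ordLeq_transitive[OF k2 ku])
  have Ru: "|carrier R| \<le>o |UNIV :: 'u set|" by (rule ordLeq_transitive[OF R ordLeq_transitive[OF k1 k2u]])
  then obtain j :: "'c \<Rightarrow> 'u" where j: "inj_on j (carrier R)" using card_subset_inj by blast
  interpret R: cring R by (rule local_ring_cring[OF l])
  \<comment> \<open>\<open>affine_scheme\<close> asks for a ring over the type of sections, here
    \<open>'u\<close>. The ring is therefore copied before its spectrum is formed.\<close>
  define R' where "R' = image_ring j R"
  have cR': "cring R'" unfolding R'_def by (rule image_ring_cring[OF R.is_cring j])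
  interpret R': spectrum R' by (rule spectrum.intro[OF cR'])
  have carR': "carrier R' = j ` carrier R" unfolding R'_def by (rule image_ring_carrier)
  have jh: "j \<in> ring_hom R R'" and jih: "inv_into (carrier R) j \<in> ring_hom R' R"
    unfolding R'_def by (rule image_ring_homs[OF j R.ring_axioms])+
  have jinv: "inv_into (carrier R) j (j a) = a" if "a \<in> carrier R" for a by (rule inv_into_f_f[OF j that])
  have l': "local_ring R'"
  proof (rule local_ring_surj[OF l cR' jh])
    show "a \<in> Units R" if "a \<in> carrier R" "j a \<in> Units R'" for a
      using hom_Units[OF jih R'.ring_axioms R.ring_axioms that(2)] jinv[OF that(1)] by simp
  qed (simp add: carR')
  have R'k: "|carrier R'| \<le>o |UNIV :: 'k set|" unfolding carR' by (rule ordLeq_transitive[OF card_of_image R])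
  have R'k2: "|carrier R'| \<le>o |UNIV :: 'k set set|" by (rule ordLeq_transitive[OF R'k k1])
  have prim: "|R'.pts| \<le>o |UNIV :: 'k set set|"
  proof -
    have "R'.pts \<subseteq> Pow (carrier R')" using ideal.Icarr[OF primeideal.axioms(1)] by auto
    then have "|R'.pts| \<le>o |Pow (carrier R')|" by (rule card_of_mono1)
    moreover have "|Pow (carrier R')| \<le>o |Pow (UNIV :: 'k set)|" by (rule card_of_Pow_mono[OF R'k])
    ultimately show ?thesis using ordLeq_transitive by fastforce
  qed
  obtain \<alpha> :: "'u set \<Rightarrow> 'u" where \<alpha>: "inj_on \<alpha> R'.pts" using card_subset_inj[OF ordLeq_transitive[OF prim k2u]] by blast
  let ?G = "R'.pts \<times> carrier R' \<times> carrier R'"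
  have "|?G| \<le>o |UNIV :: 'k set set|" by (rule card_of_prod3[OF k prim R'k2 R'k2])
  then have "|Pow ?G| \<le>o |Pow (UNIV :: 'k set set)|" by (rule card_of_Pow_mono)
  then have "|Pow ?G| \<le>o |UNIV :: 'u set|" using ordLeq_transitive[OF _ ku] by simp
  then obtain \<gamma> :: "('u set \<times> 'u \<times> 'u) set \<Rightarrow> 'u" where \<gamma>: "inj_on \<gamma> (Pow ?G)" using card_subset_inj by blast
  define gr where "gr = (\<lambda>s :: 'u set \<Rightarrow> ('u \<times> 'u) set. {(P, a, f). (P, a, f) \<in> ?G \<and> (a, f) \<in> s P})"
  define \<beta> where "\<beta> = \<gamma> \<circ> gr"
  have \<beta>: "inj_on \<beta> (secs (Spec R') U)" if U: "opn (Spec R') U" for U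
  proof (rule inj_onI)
    fix s t assume st: "s \<in> secs (Spec R') U" "t \<in> secs (Spec R') U" and e: "\<beta> s = \<beta> t"
    have g: "gr s = gr t" using e unfolding \<beta>_def comp_def by (rule inj_onD[OF \<gamma>]) (auto simp: gr_def)
    show "s = t"
    proof (rule R'.sec_eq[of s U t])
      fix P assume P: "P \<in> U"
      then have Pp: "P \<in> R'.pts" using R'.open_prime[of U P] U by simp
      interpret lo: localization_set R' "carrier R' - P" by (rule R'.lset) (use Pp in simp)
      have sub: "y \<subseteq> carrier R' \<times> carrier R'" if "y \<in> carrier (R'.Lo P)" for y
        using that unfolding lo.carrier_loc frac_def by auto
      have v: "s P \<subseteq> carrier R' \<times> carrier R'" "t P \<subseteq> carrier R' \<times> carrier R'"
        using sub[OF R'.sec_val[of s U P]] sub[OF R'.sec_val[of t U P]] st P by simp_all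
      have "(a, f) \<in> s P \<longleftrightarrow> (a, f) \<in> t P" if "(a, f) \<in> carrier R' \<times> carrier R'" for a f
      proof -
        have "(P, a, f) \<in> gr s \<longleftrightarrow> (P, a, f) \<in> gr t" using g by simp
        then show ?thesis using Pp that unfolding gr_def by simp
      qed
      then show "s P = t P" using v by blast
    qed (use st in simp_all)
  qed
  have \<alpha>': "inj_on \<alpha> (points (Spec R'))" using \<alpha> by simp
  interpret t: transport "Spec R'" \<alpha> \<beta>
    by (rule transport.intro[OF R'.rspace_Spec]) (unfold_locales, rule \<alpha>', rule \<beta>)
  note lE = t.lrs_E[OF R'.lrs_Spec]
  note rE = t.ringed_E and rS = R'.ringed_Spec
  interpret f: lrs_mor t.E "Spec R'" t.from_E by (rule lrs_morI[OF rE rS t.from_E_hom])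
  interpret g: lrs_mor "Spec R'" t.E t.to_E by (rule lrs_morI[OF rS rE t.to_E_hom])
  have st: "src t.from_E = t.E" "tgt t.from_E = Spec R'" using f.src_tgt by auto
  have "lrs_iso t.from_E"
    unfolding lrs_iso_def st using t.from_E_hom t.to_E_hom t.to_from t.from_to by blast
  then have aff: "affine_scheme t.E" unfolding affine_scheme_def using lE cR' t.from_E_hom by blast
  have sch: "scheme t.E"
    unfolding scheme_def
  proof (intro conjI ballI lE)
    fix x assume "x \<in> points t.E"
    then show "\<exists>U. opn t.E U \<and> x \<in> U \<and> affine_scheme (restr t.E U)"
      using aff by (intro exI[of _ "points t.E"]) (simp add: restr_points)
  qed
  let ?m = "{a \<in> carrier R'. a \<notin> Units R'}"
  have id: "id \<in> ring_hom R' R'" by (rule ring_hom_memI) simp_all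
  have m: "?m \<in> R'.pts" using hom_nonunits_prime[OF cR' l' id] by simp
  define c where "c = \<alpha> ?m"
  have c: "c \<in> points t.E" unfolding t.points_E c_def using m by simp
  have nb: "W = points t.E" if W: "opn t.E W" "c \<in> W" for W
  proof -
    have "?m \<in> t.pre W" using W m unfolding t.pre_def c_def by simp
    then have "t.pre W = R'.pts" using R'.local_nbhd[OF l', of "t.pre W"] t.pre_open[OF W(1)] by simp
    then have "\<alpha> ` t.pre W = \<alpha> ` R'.pts" by simp
    then show ?thesis unfolding t.image_pre[OF W(1)] t.points_E by simp
  qed
  have oS: "opn (Spec R') R'.pts" using R'.pts_open by simp
  have oE: "opn t.E (points t.E)" by simp
  have pE: "t.pre (points t.E) = R'.pts" using t.pre_image'[OF oS] unfolding t.points_E by simp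
  have jb: "bij_betw j (carrier R) (carrier R')" using j carR' by (simp add: bij_betw_def)
  have cb: "bij_betw R'.can (carrier R') (spec_secs R' R'.pts)"
    using R'.can_inj_local[OF l'] R'.can_closed by (auto simp: bij_betw_def inj_on_def dest!: R'.can_surj_local[OF l'])
  have bb: "bij_betw \<beta> (spec_secs R' R'.pts) (secs t.E (points t.E))" using \<beta>[OF oS] unfolding t.carrier_E pE by (simp add: bij_betw_def)
  define \<kappa> where "\<kappa> = \<beta> \<circ> (R'.can \<circ> j)"
  have \<kappa>h: "\<kappa> \<in> ring_hom R (sec t.E (points t.E))" unfolding \<kappa>_def
    by (rule ring_hom_trans[OF ring_hom_trans[OF jh R'.can_hom]]) (use t.\<beta>_hom[OF oE] pE in simp)
  have bij: "bij_betw \<kappa> (carrier R) (secs t.E (points t.E))"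
    unfolding \<kappa>_def by (rule bij_betw_trans[OF bij_betw_trans[OF jb cb] bb])
  have up: "\<exists>F \<in> lrs_hom X t.E. \<forall>a \<in> carrier R. cm F (points t.E) (\<kappa> a) = \<rho> a"
    if X: "locally_ringed_space X" and \<rho>: "\<rho> \<in> ring_hom R (sec X (points X))" for X :: "('u, 'u) ringed_space" and \<rho>
  proof -
    have "\<rho> \<circ> inv_into (carrier R) j \<in> ring_hom R' (sec X (points X))" by (rule ring_hom_trans[OF jih \<rho>])
    from R'.hom_into_Spec_exists[OF X this] obtain F where F: "F \<in> lrs_hom X (Spec R')"
      "\<forall>a \<in> carrier R'. cm F R'.pts (R'.can a) = (\<rho> \<circ> inv_into (carrier R) j) a" by blast
    have rX: "ringed_space X" by (rule lrs_ringed[OF X])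
    show ?thesis
    proof (intro bexI[of _ "t.to_E \<circ>\<^sub>s F"] ballI)
      show "t.to_E \<circ>\<^sub>s F \<in> lrs_hom X t.E" by (rule lrs_comp_hom[OF rX rS rE F(1) t.to_E_hom])
      fix a assume a: "a \<in> carrier R"
      have "cm (t.to_E \<circ>\<^sub>s F) (points t.E) (\<kappa> a) = cm F R'.pts (cm t.to_E (points t.E) (\<kappa> a))"
        using cm_comp[of t.to_E "points t.E" "\<kappa> a" F] g.src_tgt t.preim_to pE ring_hom_closed[OF \<kappa>h a] by simp
      also have "\<dots> = cm F R'.pts (R'.can (j a))" using t.\<beta>inv_\<beta>[OF oS, of "R'.can (j a)"] R'.can_closed[of "j a"] carR' a ring_hom_closed[OF \<kappa>h a] pE by (simp add: t.to_E_def \<kappa>_def)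
      also have "\<dots> = \<rho> a" using F(2) a carR' jinv[OF a] by simp
      finally show "cm (t.to_E \<circ>\<^sub>s F) (points t.E) (\<kappa> a) = \<rho> a" .
    qed
  qed
  have "local_model R t.E c \<kappa>"
    unfolding local_model_def using l sch c nb \<kappa>h bij up by blast
  then show ?thesis by blast
qed

lemma bij_hom_Units:
  assumes R: "ring R" and S: "ring S" and h: "h \<in> ring_hom R S" and b: "bij_betw h (carrier R) (carrier S)"
    and a: "a \<in> carrier R"
  shows "h a \<in> Units S \<longleftrightarrow> a \<in> Units R"
proof
  have iso: "h \<in> ring_iso R S" using h b unfolding ring_iso_def by simp
  have hi: "inv_into (carrier R) h \<in> ring_hom S R" using ring_iso_set_sym[OF R iso] unfolding ring_iso_def by simp
  assume "h a \<in> Units S"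
  from hom_Units[OF hi S R this] show "a \<in> Units R" using bij_betw_inv_into_left[OF b a] by simp
qed (rule hom_Units[OF h R S])

lemma bij_hom_inv:
  assumes R: "ring R" and h: "h \<in> ring_hom R S" and b: "bij_betw h (carrier R) (carrier S)"
  shows "inv_into (carrier R) h \<in> ring_hom S R"
proof -
  have iso: "h \<in> ring_iso R S" using h b unfolding ring_iso_def by simp
  show ?thesis using ring_iso_set_sym[OF R iso] unfolding ring_iso_def by simp
qed

subsection \<open>Affine charts\<close>

text \<open>The isomorphism of an affine open set with a spectrum is unpacked into two inverse
  morphisms, so that either can be composed with others. The ring \<open>B\<close> lives over the
  type of sections, which bounds the local rings of \<open>Z\<close>.\<close>

locale chart = Z: rspace Z + B: spectrum B
  for Z :: "('q, 's) ringed_space" and B :: "'s ring" +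
  fixes U and \<theta> :: "('q, 's, 's set, 's set \<Rightarrow> ('s \<times> 's) set) morphism" and \<theta>'
  assumes U: "opn Z U" and \<theta>: "\<theta> \<in> lrs_hom (restr Z U) (Spec B)" and \<theta>': "\<theta>' \<in> lrs_hom (Spec B) (restr Z U)"
    and \<theta>'\<theta>: "\<theta>' \<circ>\<^sub>s \<theta> = lrs_id (restr Z U)" and \<theta>\<theta>': "\<theta> \<circ>\<^sub>s \<theta>' = lrs_id (Spec B)"

lemma scheme_chart:
  fixes Z :: "('q, 's) ringed_space"
  assumes "scheme Z" "z \<in> points Z"
  obtains U B \<theta> \<theta>' where "chart Z B U \<theta> \<theta>'" "z \<in> U"
proof -
  obtain U where U: "opn Z U" "z \<in> U" "affine_scheme (restr Z U)" using assms unfolding scheme_def by auto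
  then obtain B :: "'s ring" and \<theta> where B: "cring B" "\<theta> \<in> lrs_hom (restr Z U) (Spec B)" "lrs_iso \<theta>" unfolding affine_scheme_def by auto
  have st: "src \<theta> = restr Z U" "tgt \<theta> = Spec B" using lrs_homD(1,2)[OF B(2)] by auto
  obtain \<theta>' where "\<theta>' \<in> lrs_hom (Spec B) (restr Z U)" "\<theta>' \<circ>\<^sub>s \<theta> = lrs_id (restr Z U)" "\<theta> \<circ>\<^sub>s \<theta>' = lrs_id (Spec B)"
    using B(3) unfolding lrs_iso_def st by auto
  then have "chart Z B U \<theta> \<theta>'"
    using scheme_rspace[OF assms(1)] B U spectrum.intro[OF B(1)] by (simp add: chart_def chart_axioms_def)
  then show thesis using that U by blast
qed

context chart
begin

lemma rZU: "ringed_space (restr Z U)" by (rule ringed_restr[OF Z.ringed U])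

sublocale th: lrs_mor "restr Z U" "Spec B" \<theta> by (rule lrs_morI[OF rZU B.ringed_Spec \<theta>])
sublocale th': lrs_mor "Spec B" "restr Z U" \<theta>' by (rule lrs_morI[OF B.ringed_Spec rZU \<theta>'])

lemma pts_U: "points (restr Z U) = U" by (rule points_restr[OF U])

lemma oS: "opn (Spec B) B.pts" using B.pts_open by simp

lemma preim_th: "preim \<theta> B.pts = U" using th.preim_points pts_U by simp
lemma preim_th': "preim \<theta>' U = B.pts" using th'.preim_points pts_U by simp

definition \<iota> where "\<iota> b = cm \<theta> B.pts (B.can b)"

lemma can_sec: "b \<in> carrier B \<Longrightarrow> B.can b \<in> secs (Spec B) B.pts"
  using B.can_closed by simp

lemma \<iota>_hom: "\<iota> \<in> ring_hom B (sec Z U)"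
proof -
  have "cm \<theta> B.pts \<in> ring_hom (spec_sections B B.pts) (sec Z U)" using th.cm_hom[OF oS] preim_th by simp
  from ring_hom_trans[OF B.can_hom this] show ?thesis unfolding \<iota>_def comp_def .
qed

lemma \<iota>_closed: "b \<in> carrier B \<Longrightarrow> \<iota> b \<in> secs Z U" by (rule ring_hom_closed[OF \<iota>_hom])

lemma th_inv: "z \<in> U \<Longrightarrow> pt \<theta>' (pt \<theta> z) = z"
  using arg_cong[OF \<theta>'\<theta>, of "\<lambda>f. pt f z"] pts_U by (simp add: pt_comp th.src_tgt lrs_id_def)

lemma chart_unit_iff:
  assumes "z \<in> U" "b \<in> carrier B"
  shows "germ Z z U (\<iota> b) \<in> Units (stalk Z z) \<longleftrightarrow> b \<notin> pt \<theta> z"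
proof -
  have z: "z \<in> points (restr Z U)" using assms pts_U by simp
  have p: "pt \<theta> z \<in> B.pts" using th.pt_in[OF z] by simp
  have "germ Z z U (\<iota> b) \<in> Units (stalk Z z) \<longleftrightarrow> germ (restr Z U) z U (\<iota> b) \<in> Units (stalk (restr Z U) z)"
    by (rule germ_restr_unit_iff[OF Z.ringed U U order_refl assms(1) \<iota>_closed[OF assms(2)], symmetric])
  also have "\<dots> \<longleftrightarrow> germ (Spec B) (pt \<theta> z) B.pts (B.can b) \<in> Units (stalk (Spec B) (pt \<theta> z))"
    using th.germ_cm_unit_iff[OF z oS p can_sec[OF assms(2)]] unfolding preim_th \<iota>_def by simp
  also have "\<dots> \<longleftrightarrow> b \<notin> pt \<theta> z" by (rule B.germ_can_unit_iff) (use p assms in simp_all)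
  finally show ?thesis .
qed

text \<open>The fraction description of stalks of a spectrum, carried to \<open>Z\<close>. A germ is
  first restricted to \<open>U\<close> and pulled back along \<theta>'; the resulting equation comes
  back through \<theta> because the two are inverse.\<close>

lemma chart_fraction:
  assumes z: "z \<in> U" and A: "A \<in> stk Z z"
  obtains a f where "a \<in> carrier B" "f \<in> carrier B" "germ Z z U (\<iota> f) \<in> Units (stalk Z z)"
    "germ Z z U (\<iota> f) \<otimes>\<^bsub>stalk Z z\<^esub> A = germ Z z U (\<iota> a)"
proof -
  have zp: "z \<in> points (restr Z U)" using z pts_U by simp
  obtain V s where V: "opn Z V" "z \<in> V" "V \<subseteq> U" "s \<in> secs Z V" "A = germ Z z V s"
    by (rule Z.stalkE_sub[OF A U z])
  have oV: "opn (restr Z U) V" "opn (restr Z U) U" using V U by (simp_all add: opn_restr[OF U])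
  let ?A = "germ (restr Z U) z V s"
  have A': "?A \<in> stk (restr Z U) z" by (rule th.X.germ_in_stalk[OF oV(1) V(2)]) (use V in simp)
  have tz: "pt \<theta> z \<in> points (Spec B)" by (rule th.pt_in[OF zp])
  have tt: "pt \<theta>' (pt \<theta> z) = z" by (rule th_inv[OF z])
  define C where "C = stalk_map \<theta>' (pt \<theta> z) ?A"
  have C: "C \<in> stk (Spec B) (pt \<theta> z)" unfolding C_def using th'.stalk_map_closed[OF tz] tt A' by simp
  have "stalk_map \<theta> z C = stalk_map (\<theta>' \<circ>\<^sub>s \<theta>) z ?A"
    unfolding C_def using stalk_map_comp[OF rZU B.ringed_Spec rZU \<theta> \<theta>' zp] tt A' by simp
  also have "\<dots> = ?A"
  proof -
    interpret i: lrs_mor "restr Z U" "restr Z U" "lrs_id (restr Z U)" by (rule lrs_morI[OF rZU rZU lrs_id_hom[OF rZU]])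
    have "pt (lrs_id (restr Z U)) z = z" using zp by (simp add: lrs_id_def)
    then show ?thesis unfolding \<theta>'\<theta> using i.stalk_map_germ[OF zp oV(1)] V preim_id[OF oV(1)] oV(1) by (simp add: lrs_id_def)
  qed
  finally have tC: "stalk_map \<theta> z C = ?A" .
  have pr: "primeideal (pt \<theta> z) B" using tz by simp
  obtain a f where af: "a \<in> carrier B" "f \<in> carrier B" "f \<notin> pt \<theta> z"
    "germ (Spec B) (pt \<theta> z) B.pts (B.can f) \<otimes>\<^bsub>stalk (Spec B) (pt \<theta> z)\<^esub> C = germ (Spec B) (pt \<theta> z) B.pts (B.can a)"
    by (rule B.stalk_fraction[OF pr C])
  have sm: "stalk_map \<theta> z (germ (Spec B) (pt \<theta> z) B.pts (B.can b)) = germ (restr Z U) z U (\<iota> b)" if "b \<in> carrier B" for b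
    using th.stalk_map_germ[OF zp oS _ can_sec[OF that]] tz unfolding preim_th \<iota>_def by simp
  have gc: "germ (Spec B) (pt \<theta> z) B.pts (B.can f) \<in> stk (Spec B) (pt \<theta> z)"
    by (rule B.S.germ_in_stalk[OF oS _ can_sec[OF af(2)]]) (use tz in simp)
  have e: "germ (restr Z U) z U (\<iota> f) \<otimes>\<^bsub>stalk (restr Z U) z\<^esub> ?A = germ (restr Z U) z U (\<iota> a)"
    using ring_hom_mult[OF th.stalk_map_hom[OF zp] gc C] tC sm[OF af(1)] sm[OF af(2)] af(4) by simp
  have c: "\<iota> f \<in> secs Z U" "\<iota> a \<in> secs Z U" using \<iota>_closed af by auto
  have r: "res Z U V (\<iota> f) \<in> secs Z V" by (rule Z.res_closed[OF U V(1,3) c(1)])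
  interpret SV: ring "sec Z V" by (rule Z.sec_ring[OF V(1)])
  have "germ (restr Z U) z V (res Z U V (\<iota> f) \<otimes>\<^bsub>sec Z V\<^esub> s) = germ (restr Z U) z U (\<iota> a)"
  proof -
    have g1: "germ (restr Z U) z V (res Z U V (\<iota> f)) = germ (restr Z U) z U (\<iota> f)"
      using th.X.germ_res[OF oV(2,1) V(2,3)] c by simp
    have g2: "germ (restr Z U) z V (res Z U V (\<iota> f)) \<otimes>\<^bsub>stalk (restr Z U) z\<^esub> ?A = germ (restr Z U) z V (res Z U V (\<iota> f) \<otimes>\<^bsub>sec Z V\<^esub> s)"
      using th.X.stalk_mult[OF oV(1) V(2)] r V(4) by simp
    show ?thesis unfolding g2[symmetric] g1 by (rule e)
  qed
  then have "germ Z z V (res Z U V (\<iota> f) \<otimes>\<^bsub>sec Z V\<^esub> s) = germ Z z U (\<iota> a)"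
    using germ_restr_eq_iff[OF Z.ringed U V(1,3,2) SV.m_closed[OF r V(4)] U order_refl z c(2)] by simp
  then have "germ Z z U (\<iota> f) \<otimes>\<^bsub>stalk Z z\<^esub> A = germ Z z U (\<iota> a)"
    using Z.germ_res[OF U V(1,2,3) c(1)] Z.stalk_mult[OF V(1,2) r V(4)] V(5) by simp
  then show thesis using that[OF af(1,2)] chart_unit_iff[OF z af(2)] af(3) by simp
qed

text \<open>The denominator of a germ goes to a unit of \<open>S\<close>, which can be cancelled, so
  agreement on chart functions is enough.\<close>

lemma hom_eq_on_stalk:
  assumes z: "z \<in> U" and S: "cring S" and f: "f \<in> ring_hom (stalk Z z) S" and g: "g \<in> ring_hom (stalk Z z) S"
    and e: "\<And>b. b \<in> carrier B \<Longrightarrow> f (germ Z z U (\<iota> b)) = g (germ Z z U (\<iota> b))"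
    and A: "A \<in> stk Z z"
  shows "f A = g A"
proof -
  interpret S: cring S by fact
  have zp: "z \<in> points Z" using z Z.opn_sub[OF U] by auto
  interpret T: cring "stalk Z z" by (rule Z.stalk_cring[OF zp])
  obtain a b where ab: "a \<in> carrier B" "b \<in> carrier B" "germ Z z U (\<iota> b) \<in> Units (stalk Z z)"
    "germ Z z U (\<iota> b) \<otimes>\<^bsub>stalk Z z\<^esub> A = germ Z z U (\<iota> a)" by (rule chart_fraction[OF z A])
  have u: "f (germ Z z U (\<iota> b)) \<in> Units S" by (rule hom_Units[OF f T.ring_axioms S.ring_axioms ab(3)])
  have "f (germ Z z U (\<iota> b)) \<otimes>\<^bsub>S\<^esub> f A = f (germ Z z U (\<iota> b)) \<otimes>\<^bsub>S\<^esub> g A"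
    using ring_hom_mult[OF f T.Units_closed[OF ab(3)] A] ring_hom_mult[OF g T.Units_closed[OF ab(3)] A] ab(4) e[OF ab(1)] e[OF ab(2)] by simp
  then show ?thesis using S.Units_l_cancel[OF u ring_hom_closed[OF f A] ring_hom_closed[OF g A]] by simp
qed

end

subsection \<open>Morphisms from the spectrum of a local ring\<close>

locale local_test =
  fixes R :: "('c, 'm) ring_scheme" and E :: "('p, 'r) ringed_space" and c and \<kappa>
  assumes model: "local_model R E c \<kappa>"
begin

lemma R_local: "local_ring R" and E_scheme: "scheme E" and c_in: "c \<in> points E"
  and c_nbhd: "opn E W \<Longrightarrow> c \<in> W \<Longrightarrow> W = points E"
  and \<kappa>_hom: "\<kappa> \<in> ring_hom R (sec E (points E))" and \<kappa>_bij: "bij_betw \<kappa> (carrier R) (secs E (points E))"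
  using model unfolding local_model_def by blast+

lemma hom_exists: "locally_ringed_space (X :: ('p, 'r) ringed_space) \<Longrightarrow> \<rho> \<in> ring_hom R (sec X (points X)) \<Longrightarrow>
        \<exists>f \<in> lrs_hom X E. \<forall>a \<in> carrier R. cm f (points E) (\<kappa> a) = \<rho> a"
  using model unfolding local_model_def by blast

sublocale R: cring R by (rule local_ring_cring[OF R_local])
sublocale E: rspace E by (rule scheme_rspace[OF E_scheme])

lemma rE: "ringed_space E" and lE: "locally_ringed_space E" using E.ringed scheme_lrs[OF E_scheme] by auto

definition \<epsilon> where "\<epsilon> a = germ E c (points E) (\<kappa> a)"

lemma \<kappa>_closed: "a \<in> carrier R \<Longrightarrow> \<kappa> a \<in> secs E (points E)" by (rule ring_hom_closed[OF \<kappa>_hom])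

lemma germ_c_inj:
  assumes "s \<in> secs E (points E)" "t \<in> secs E (points E)" "germ E c (points E) s = germ E c (points E) t"
  shows "s = t"
proof -
  obtain W where W: "opn E W" "c \<in> W" "res E (points E) W s = res E (points E) W t"
    using E.germ_eqD[OF E.opn_points c_in assms(1) E.opn_points c_in assms(2,3)] by auto
  then show ?thesis using c_nbhd[OF W(1,2)] E.res_id[OF E.opn_points] assms by simp
qed

lemma \<epsilon>_hom: "\<epsilon> \<in> ring_hom R (stalk E c)"
  using ring_hom_trans[OF \<kappa>_hom E.germ_hom[OF E.opn_points c_in]] unfolding \<epsilon>_def comp_def .

lemma \<epsilon>_bij: "bij_betw \<epsilon> (carrier R) (stk E c)"
  unfolding bij_betw_def
proof
  show "inj_on \<epsilon> (carrier R)"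
  proof (rule inj_onI)
    fix a b assume ab: "a \<in> carrier R" "b \<in> carrier R" "\<epsilon> a = \<epsilon> b"
    then have "\<kappa> a = \<kappa> b" unfolding \<epsilon>_def using germ_c_inj \<kappa>_closed by simp
    then show "a = b" using \<kappa>_bij ab unfolding bij_betw_def by (auto dest: inj_onD)
  qed
  show "\<epsilon> ` carrier R = stk E c"
  proof
    show "\<epsilon> ` carrier R \<subseteq> stk E c" using ring_hom_closed[OF \<epsilon>_hom] by auto
    show "stk E c \<subseteq> \<epsilon> ` carrier R"
    proof
      fix A assume "A \<in> stk E c"
      then obtain V s where V: "opn E V" "c \<in> V" "s \<in> secs E V" "A = germ E c V s" by (rule E.stalkE)
      then have "V = points E" using c_nbhd by blast
      then obtain a where "a \<in> carrier R" "s = \<kappa> a" using V(3) \<kappa>_bij unfolding bij_betw_def by auto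
      then show "A \<in> \<epsilon> ` carrier R" using V(4) \<open>V = points E\<close> unfolding \<epsilon>_def by blast
    qed
  qed
qed


lemma stalk_ring: "ring (stalk E c)" by (rule cring.axioms(1)[OF E.stalk_cring[OF c_in]])

lemma \<epsilon>_unit_iff: "a \<in> carrier R \<Longrightarrow> \<epsilon> a \<in> Units (stalk E c) \<longleftrightarrow> a \<in> Units R"
  by (rule bij_hom_Units[OF R.ring_axioms stalk_ring \<epsilon>_hom \<epsilon>_bij])

definition \<epsilon>inv where "\<epsilon>inv = inv_into (carrier R) \<epsilon>"

lemma \<epsilon>inv_hom: "\<epsilon>inv \<in> ring_hom (stalk E c) R"
  unfolding \<epsilon>inv_def by (rule bij_hom_inv[OF R.ring_axioms \<epsilon>_hom \<epsilon>_bij])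

lemma \<epsilon>_\<epsilon>inv: "A \<in> stk E c \<Longrightarrow> \<epsilon> (\<epsilon>inv A) = A"
  unfolding \<epsilon>inv_def by (rule bij_betw_inv_into_right[OF \<epsilon>_bij])

lemma \<epsilon>inv_\<epsilon>: "a \<in> carrier R \<Longrightarrow> \<epsilon>inv (\<epsilon> a) = a"
  unfolding \<epsilon>inv_def by (rule bij_betw_inv_into_left[OF \<epsilon>_bij])

lemma \<epsilon>inv_unit_iff: "A \<in> stk E c \<Longrightarrow> \<epsilon>inv A \<in> Units R \<longleftrightarrow> A \<in> Units (stalk E c)"
  using \<epsilon>_unit_iff[of "\<epsilon>inv A"] ring_hom_closed[OF \<epsilon>inv_hom] \<epsilon>_\<epsilon>inv by simp

text \<open>Existence half of the description of morphisms from the spectrum of a local ring as a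
  point \<open>z\<close> with a local homomorphism from its stalk. A chart at \<open>z\<close>
  reduces it to the mapping property of affine schemes.\<close>

lemma hom_realizing:
  fixes Z :: "('q, 's) ringed_space"
  assumes Z: "scheme Z" and z: "z \<in> points Z" and \<phi>: "\<phi> \<in> ring_hom (stalk Z z) R"
    and loc: "\<And>A. A \<in> stk Z z \<Longrightarrow> \<phi> A \<in> Units R \<Longrightarrow> A \<in> Units (stalk Z z)"
  shows "\<exists>f \<in> lrs_hom E Z. pt f c = z \<and> (\<forall>A \<in> stk Z z. stalk_map f c A = \<epsilon> (\<phi> A))"
proof -
  obtain U B \<theta> \<theta>' where ch: "chart Z B U \<theta> \<theta>'" and zU: "z \<in> U" by (rule scheme_chart[OF Z z])
  interpret chart Z B U \<theta> \<theta>' by (rule ch)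
  have rZ: "ringed_space Z" by (rule Z.ringed)
  interpret T: cring "stalk Z z" by (rule Z.stalk_cring[OF z])
  have gh: "germ Z z U \<in> ring_hom (sec Z U) (stalk Z z)" by (rule Z.germ_hom[OF U zU])
  define \<rho> where "\<rho> = \<kappa> \<circ> (\<phi> \<circ> (germ Z z U \<circ> \<iota>))"
  have \<rho>: "\<rho> \<in> ring_hom B (sec E (points E))"
    unfolding \<rho>_def by (rule ring_hom_trans[OF ring_hom_trans[OF ring_hom_trans[OF \<iota>_hom gh] \<phi>] \<kappa>_hom])
  obtain f0 where f0: "f0 \<in> lrs_hom E (Spec B)" and f0c: "\<forall>a \<in> carrier B. cm f0 B.pts (B.can a) = \<rho> a"
    and f0p: "\<forall>x \<in> points E. pt f0 x = {a \<in> carrier B. germ E x (points E) (\<rho> a) \<notin> Units (stalk E x)}"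
    using B.hom_into_Spec_exists[OF lE \<rho>] by blast
  interpret f0: lrs_mor E "Spec B" f0 by (rule lrs_morI[OF rE B.ringed_Spec f0])
  define f1 where "f1 = \<theta>' \<circ>\<^sub>s f0"
  have f1: "f1 \<in> lrs_hom E (restr Z U)" unfolding f1_def by (rule lrs_comp_hom[OF rE B.ringed_Spec rZU f0 \<theta>'])
  interpret f1: lrs_mor E "restr Z U" f1 by (rule lrs_morI[OF rE rZU f1])
  define f where "f = open_incl Z U \<circ>\<^sub>s f1"
  note oi = open_incl_hom[OF rZ U]
  have f: "f \<in> lrs_hom E Z" unfolding f_def by (rule lrs_comp_hom[OF rE rZU rZ f1 oi])
  interpret f: lrs_mor E Z f by (rule lrs_morI[OF rE rZ f])
  have bc: "germ Z z U (\<iota> b) \<in> stk Z z" if "b \<in> carrier B" for b by (rule Z.germ_in_stalk[OF U zU \<iota>_closed[OF that]])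
  \<comment> \<open>Both primes consist of the chart functions that are not invertible at
    \<open>z\<close>. Here the locality of \<phi> enters: without it the closed point could go to a
    generization of \<open>z\<close>.\<close>
  have "pt f0 c = pt \<theta> z"
  proof (rule Set.set_eqI)
    fix b
    show "b \<in> pt f0 c \<longleftrightarrow> b \<in> pt \<theta> z"
    proof (cases "b \<in> carrier B")
      case True
      have "b \<in> pt f0 c \<longleftrightarrow> \<epsilon> (\<phi> (germ Z z U (\<iota> b))) \<notin> Units (stalk E c)"
        using f0p c_in True unfolding \<rho>_def \<epsilon>_def by simp
      also have "\<dots> \<longleftrightarrow> \<phi> (germ Z z U (\<iota> b)) \<notin> Units R"
        using \<epsilon>_unit_iff[OF ring_hom_closed[OF \<phi> bc[OF True]]] by simp
      also have "\<dots> \<longleftrightarrow> germ Z z U (\<iota> b) \<notin> Units (stalk Z z)"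
        using loc[OF bc[OF True]] hom_Units[OF \<phi> T.ring_axioms R.ring_axioms] by blast
      also have "\<dots> \<longleftrightarrow> b \<in> pt \<theta> z" using chart_unit_iff[OF zU True] by simp
      finally show ?thesis .
    next
      case False
      have pr: "primeideal (pt \<theta> z) B" using th.pt_in[of z] zU pts_U by simp
      have "b \<notin> pt \<theta> z" using False ideal.Icarr[OF primeideal.axioms(1)[OF pr], of b] by blast
      then show ?thesis using f0p c_in False by simp
    qed
  qed
  then have "pt f1 c = z" using th_inv[OF zU] c_in by (simp add: f1_def pt_comp f0.src_tgt)
  then have fc: "pt f c = z" using c_in zU by (simp add: f_def pt_comp f1.src_tgt open_incl_def pts_U)
  \<comment> \<open>The preimage of \<open>U\<close> is open and contains the closed point, so all
    of \<open>E\<close> maps into the chart.\<close>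
  have cU: "preim f U = points E" by (rule c_nbhd[OF f.preim_open[OF U]]) (use fc zU c_in in \<open>simp add: f.mem_preim\<close>)
  have fi: "cm f U (\<iota> b) = \<rho> b" if b: "b \<in> carrier B" for b
  proof -
    have oU: "opn (restr Z U) U" using U by (simp add: opn_restr[OF U])
    have t: "tgt (open_incl Z U) = Z" by (simp add: open_incl_def)
    have "cm f U (\<iota> b) = cm f1 U (\<iota> b)"
      using cm_comp[of "open_incl Z U" U "\<iota> b" f1] U \<iota>_closed[OF b] t Z.res_id[OF U \<iota>_closed[OF b]]
      unfolding preim_open_incl[OF rZ U] f_def by (simp add: open_incl_def)
    also have "\<dots> = cm f0 B.pts (cm \<theta>' U (\<iota> b))"
      using cm_comp[of \<theta>' U "\<iota> b" f0] oU \<iota>_closed[OF b] th'.src_tgt unfolding f1_def by (simp add: preim_th')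
    also have "cm \<theta>' U (\<iota> b) = B.can b"
      using arg_cong[OF \<theta>\<theta>', of "\<lambda>f. cm f B.pts (B.can b)"] cm_comp[of \<theta> B.pts "B.can b" \<theta>'] oS can_sec[OF b] th.src_tgt
      unfolding \<iota>_def by (simp add: preim_th lrs_id_def)
    also have "cm f0 B.pts (B.can b) = \<rho> b" using f0c b by simp
    finally show ?thesis .
  qed
  have "stalk_map f c A = \<epsilon> (\<phi> A)" if A: "A \<in> stk Z z" for A
  proof -
    have "stalk_map f c A = (\<epsilon> \<circ> \<phi>) A"
    proof (rule hom_eq_on_stalk[OF zU E.stalk_cring[OF c_in] _ ring_hom_trans[OF \<phi> \<epsilon>_hom] _ A])
      show "stalk_map f c \<in> ring_hom (stalk Z z) (stalk E c)" using f.stalk_map_hom[OF c_in] fc by simp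
      fix b assume b: "b \<in> carrier B"
      show "stalk_map f c (germ Z z U (\<iota> b)) = (\<epsilon> \<circ> \<phi>) (germ Z z U (\<iota> b))"
        using f.stalk_map_germ[OF c_in U _ \<iota>_closed[OF b]] fc zU fi[OF b] unfolding cU \<rho>_def \<epsilon>_def by simp
    qed
    then show ?thesis by simp
  qed
  then show ?thesis using f fc by blast
qed

text \<open>Uniqueness half: both morphisms go into one chart around the common image of the closed
  point, and there they are given by global functions, which are determined by their germs at
  \<open>c\<close>.\<close>

lemma hom_eqI:
  fixes Z :: "('q, 's) ringed_space"
  assumes Z: "scheme Z" and f: "f \<in> lrs_hom E Z" and g: "g \<in> lrs_hom E Z" and p: "pt f c = pt g c"
    and s: "\<And>A. A \<in> stk Z (pt f c) \<Longrightarrow> stalk_map f c A = stalk_map g c A"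
  shows "f = g"
proof -
  have rZ: "ringed_space Z" by (rule scheme_ringed[OF Z])
  interpret f: lrs_mor E Z f by (rule lrs_morI[OF rE rZ f])
  interpret g: lrs_mor E Z g by (rule lrs_morI[OF rE rZ g])
  let ?z = "pt f c"
  obtain U B \<theta> \<theta>' where ch: "chart Z B U \<theta> \<theta>'" and zU: "?z \<in> U" by (rule scheme_chart[OF Z f.pt_in[OF c_in]])
  interpret chart Z B U \<theta> \<theta>' by (rule ch)
  have all: "preim f U = points E" "preim g U = points E"
    by (rule c_nbhd[OF f.preim_open[OF U]], use zU c_in in \<open>simp add: f.mem_preim\<close>)
      (rule c_nbhd[OF g.preim_open[OF U]], use zU c_in p in \<open>simp add: g.mem_preim\<close>)
  have im: "pt f x \<in> U" "pt g x \<in> U" if "x \<in> points E" for x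
    using that all f.mem_preim[of x U] g.mem_preim[of x U] by auto
  obtain f1 where f1: "f1 \<in> lrs_hom E (restr Z U)" "open_incl Z U \<circ>\<^sub>s f1 = f"
    "\<And>V. opn Z V \<Longrightarrow> V \<subseteq> U \<Longrightarrow> cm f1 V = cm f V"
    using lrs_hom_into_open[OF rZ U rE f im(1)] by metis
  obtain g1 where g1: "g1 \<in> lrs_hom E (restr Z U)" "open_incl Z U \<circ>\<^sub>s g1 = g"
    "\<And>V. opn Z V \<Longrightarrow> V \<subseteq> U \<Longrightarrow> cm g1 V = cm g V"
    using lrs_hom_into_open[OF rZ U rE g im(2)] by metis
  have "\<theta> \<circ>\<^sub>s f1 = \<theta> \<circ>\<^sub>s g1"
  proof (rule B.hom_into_Spec_eqI[OF rE lrs_comp_hom[OF rE rZU B.ringed_Spec f1(1) \<theta>] lrs_comp_hom[OF rE rZU B.ringed_Spec g1(1) \<theta>]])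
    fix b assume b: "b \<in> carrier B"
    have "germ E c (points E) (cm f U (\<iota> b)) = germ E c (points E) (cm g U (\<iota> b))"
      using f.stalk_map_germ[OF c_in U zU \<iota>_closed[OF b]] g.stalk_map_germ[OF c_in U _ \<iota>_closed[OF b]] p zU
        s[OF f.Y.germ_in_stalk[OF U zU \<iota>_closed[OF b]]] all by simp
    then have "cm f U (\<iota> b) = cm g U (\<iota> b)"
      using germ_c_inj f.cm_closed[OF U \<iota>_closed[OF b]] g.cm_closed[OF U \<iota>_closed[OF b]] all by simp
    then show "cm (\<theta> \<circ>\<^sub>s f1) B.pts (B.can b) = cm (\<theta> \<circ>\<^sub>s g1) B.pts (B.can b)"
      using cm_comp[of \<theta> B.pts "B.can b" f1] cm_comp[of \<theta> B.pts "B.can b" g1] oS can_sec[OF b] th.src_tgt f1(3)[OF U] g1(3)[OF U]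
      by (simp add: preim_th \<iota>_def)
  qed
  then have "\<theta>' \<circ>\<^sub>s \<theta> \<circ>\<^sub>s f1 = \<theta>' \<circ>\<^sub>s \<theta> \<circ>\<^sub>s g1" by simp
  then have "f1 = g1"
    using lrs_comp_assoc[OF rE rZU B.ringed_Spec rZU f1(1) \<theta> \<theta>'] lrs_comp_assoc[OF rE rZU B.ringed_Spec rZU g1(1) \<theta> \<theta>']
      lrs_id_left[OF rE rZU f1(1)] lrs_id_left[OF rE rZU g1(1)] \<theta>'\<theta> by simp
  then show ?thesis using f1(2) g1(2) by simp
qed

definition at_c where "at_c f A = \<epsilon>inv (stalk_map f c A)"

context
  fixes Z :: "('q, 's) ringed_space" and f
  assumes Z: "scheme Z" and f: "f \<in> lrs_hom E Z"
begin

interpretation f: lrs_mor E Z f by (rule lrs_morI[OF rE scheme_ringed[OF Z] f])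

lemma at_c_hom: "at_c f \<in> ring_hom (stalk Z (pt f c)) R"
  using ring_hom_trans[OF f.stalk_map_hom[OF c_in] \<epsilon>inv_hom] unfolding at_c_def comp_def .

lemma at_c_local: "A \<in> stk Z (pt f c) \<Longrightarrow> at_c f A \<in> Units R \<Longrightarrow> A \<in> Units (stalk Z (pt f c))"
  unfolding at_c_def using \<epsilon>inv_unit_iff[OF f.stalk_map_closed[OF c_in]] f.stalk_map_unit_iff[OF c_in] by simp

lemma \<epsilon>_at_c: "A \<in> stk Z (pt f c) \<Longrightarrow> \<epsilon> (at_c f A) = stalk_map f c A"
  unfolding at_c_def by (rule \<epsilon>_\<epsilon>inv[OF f.stalk_map_closed[OF c_in]])

end

text \<open>Composing the local homomorphism of \<open>h\<close> with the inverse of the stalk map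
  of \<open>i\<close> describes a morphism to \<open>Y\<close>. One point \<open>t\<close> with an
  isomorphism of stalks is enough, since the closed point of \<open>E\<close> controls the whole
  morphism.\<close>

lemma hom_lift_through_iso:
  fixes Z :: "('q, 's) ringed_space" and Y :: "('o, 't) ringed_space"
  assumes Z: "scheme Z" and Y: "scheme Y" and h: "h \<in> lrs_hom E Z" and i: "i \<in> lrs_hom Y Z"
    and t: "t \<in> points Y" "pt i t = pt h c"
    and b: "bij_betw (stalk_map i t) (stk Z (pt h c)) (stk Y t)"
  shows "\<exists>g \<in> lrs_hom E Y. i \<circ>\<^sub>s g = h"
proof -
  have rZ: "ringed_space Z" and rY: "ringed_space Y" using Z Y by (simp_all add: scheme_ringed)
  interpret h: lrs_mor E Z h by (rule lrs_morI[OF rE rZ h])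
  interpret i: lrs_mor Y Z i by (rule lrs_morI[OF rY rZ i])
  have ih: "stalk_map i t \<in> ring_hom (stalk Z (pt h c)) (stalk Y t)" using i.stalk_map_hom[OF t(1)] t(2) by simp
  have rz: "ring (stalk Z (pt h c))" by (rule cring.axioms(1)[OF h.Y.stalk_cring[OF h.pt_in[OF c_in]]])
  have ry: "ring (stalk Y t)" by (rule cring.axioms(1)[OF i.X.stalk_cring[OF t(1)]])
  let ?j = "inv_into (stk Z (pt h c)) (stalk_map i t)"
  have jh: "?j \<in> ring_hom (stalk Y t) (stalk Z (pt h c))" by (rule bij_hom_inv[OF rz ih b])
  have ji: "?j (stalk_map i t A) = A" if "A \<in> stk Z (pt h c)" for A by (rule bij_betw_inv_into_left[OF b that])
  have ij: "stalk_map i t (?j A) = A" if "A \<in> stk Y t" for A by (rule bij_betw_inv_into_right[OF b that])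
  define \<phi> where "\<phi> = at_c h \<circ> ?j"
  have \<phi>: "\<phi> \<in> ring_hom (stalk Y t) R" unfolding \<phi>_def by (rule ring_hom_trans[OF jh at_c_hom[OF Z h]])
  have "A \<in> Units (stalk Y t)" if A: "A \<in> stk Y t" "\<phi> A \<in> Units R" for A
  proof -
    have "?j A \<in> Units (stalk Z (pt h c))" using at_c_local[OF Z h ring_hom_closed[OF jh A(1)]] A(2) unfolding \<phi>_def by simp
    from hom_Units[OF ih rz ry this] show ?thesis using ij[OF A(1)] by simp
  qed
  then obtain g where g: "g \<in> lrs_hom E Y" "pt g c = t" and gs: "\<forall>A \<in> stk Y t. stalk_map g c A = \<epsilon> (\<phi> A)"
    using hom_realizing[OF Y t(1) \<phi>] by blast
  have gg: "pt (i \<circ>\<^sub>s g) c = pt h c" using g c_in t(2) by (simp add: pt_comp lrs_homD(1)[OF g(1)])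
  have "i \<circ>\<^sub>s g = h"
  proof (rule hom_eqI[OF Z lrs_comp_hom[OF rE rY rZ g(1) i] h gg])
    fix A assume "A \<in> stk Z (pt (i \<circ>\<^sub>s g) c)"
    then have A: "A \<in> stk Z (pt h c)" using gg by simp
    have "stalk_map (i \<circ>\<^sub>s g) c A = stalk_map g c (stalk_map i t A)"
      using stalk_map_comp[OF rE rY rZ g(1) i c_in, of A] g(2) t(2) A by simp
    also have "\<dots> = \<epsilon> (at_c h A)" using gs ring_hom_closed[OF ih A] ji[OF A] unfolding \<phi>_def by simp
    also have "\<dots> = stalk_map h c A" by (rule \<epsilon>_at_c[OF Z h A])
    finally show "stalk_map (i \<circ>\<^sub>s g) c A = stalk_map h c A" .
  qed
  then show ?thesis using g(1) by blast
qed

end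

section \<open>Small rings\<close>

text \<open>Every germ is a quotient of two elements of a chart ring, and that ring lives over
  \<open>'s\<close>.\<close>

lemma stalk_small:
  fixes Z :: "('q, 's) ringed_space"
  assumes k: "infinite (UNIV :: 'k set)" and s: "|UNIV :: 's set| \<le>o |UNIV :: 'k set|"
    and Z: "scheme Z" and z: "z \<in> points Z"
  shows "|stk Z z| \<le>o |UNIV :: 'k set|"
proof -
  obtain U and B :: "'s ring" and \<theta> \<theta>' where ch: "chart Z B U \<theta> \<theta>'" and zU: "z \<in> U" by (rule scheme_chart[OF Z z])
  interpret chart Z B U \<theta> \<theta>' by (rule ch)
  interpret T: cring "stalk Z z" by (rule Z.stalk_cring[OF z])
  let ?f = "\<lambda>(a, f). inv\<^bsub>stalk Z z\<^esub> germ Z z U (\<iota> f) \<otimes>\<^bsub>stalk Z z\<^esub> germ Z z U (\<iota> a)"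
  have "stk Z z \<subseteq> ?f ` (UNIV \<times> UNIV)"
  proof
    fix A assume A: "A \<in> stk Z z"
    obtain a f where af: "germ Z z U (\<iota> f) \<in> Units (stalk Z z)"
      "germ Z z U (\<iota> f) \<otimes>\<^bsub>stalk Z z\<^esub> A = germ Z z U (\<iota> a)" by (rule chart_fraction[OF zU A])
    have "?f (a, f) = inv\<^bsub>stalk Z z\<^esub> germ Z z U (\<iota> f) \<otimes>\<^bsub>stalk Z z\<^esub> (germ Z z U (\<iota> f) \<otimes>\<^bsub>stalk Z z\<^esub> A)"
      using af(2) by simp
    also have "\<dots> = A" by (subst T.m_assoc[symmetric]) (use af(1) A in \<open>simp_all add: T.Units_closed\<close>)
    finally show "A \<in> ?f ` (UNIV \<times> UNIV)" by (rule image_eqI[OF sym]) simp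
  qed
  from card_of_mono1[OF this] show ?thesis
    by (rule ordLeq_transitive[OF _ ordLeq_transitive[OF card_of_image card_of_Times_ordLeq_infinite[OF k s s]]])
qed

lemma (in localization_set) localization_small:
  assumes k: "infinite (UNIV :: 'k set)" and s: "|carrier R| \<le>o |UNIV :: 'k set|"
  shows "|carrier L| \<le>o |UNIV :: 'k set|"
proof -
  let ?f = "\<lambda>(a, s). frac R W a s"
  have "carrier L \<subseteq> ?f ` (carrier R \<times> carrier R)" unfolding carrier_loc using W_sub by auto
  from card_of_mono1[OF this] show ?thesis
    by (rule ordLeq_transitive[OF _ ordLeq_transitive[OF card_of_image card_of_Times_ordLeq_infinite[OF k s s]]])
qed

text \<open>Inverses of those elements that are units of \<open>R\<close> are adjoined as well. The
  hull then has the same units as \<open>R\<close> among its elements, which is what keeps it local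
  when \<open>R\<close> is.\<close>

definition ring_step :: "('a, 'm) ring_scheme \<Rightarrow> 'a set \<Rightarrow> 'a set" where
  "ring_step R S = S \<union> ({\<zero>\<^bsub>R\<^esub>, \<one>\<^bsub>R\<^esub>} \<union> ((\<lambda>(a, b). a \<oplus>\<^bsub>R\<^esub> b) ` (S \<times> S) \<union> ((\<lambda>(a, b). a \<otimes>\<^bsub>R\<^esub> b) ` (S \<times> S) \<union>
     ((\<lambda>a. \<ominus>\<^bsub>R\<^esub> a) ` S \<union> (\<lambda>a. inv\<^bsub>R\<^esub> a) ` (S \<inter> Units R)))))"

definition ring_hull :: "('a, 'm) ring_scheme \<Rightarrow> 'a set \<Rightarrow> 'a set" where
  "ring_hull R S = (\<Union>n. (ring_step R ^^ n) S)"

lemma ring_step_small: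
  assumes k: "infinite (UNIV :: 'k set)" and s: "|S| \<le>o |UNIV :: 'k set|"
  shows "|ring_step R S| \<le>o |UNIV :: 'k set|"
proof -
  have p: "|S \<times> S| \<le>o |UNIV :: 'k set|" by (rule card_of_Times_ordLeq_infinite[OF k s s])
  have im: "|f ` T| \<le>o |UNIV :: 'k set|" if "|T| \<le>o |UNIV :: 'k set|" for f :: "'x \<Rightarrow> 'y" and T
    by (rule ordLeq_transitive[OF card_of_image that])
  have u: "|S \<inter> Units R| \<le>o |UNIV :: 'k set|" by (rule ordLeq_transitive[OF card_of_mono1 s]) simp
  have f: "|{\<zero>\<^bsub>R\<^esub>, \<one>\<^bsub>R\<^esub>}| \<le>o |UNIV :: 'k set|" by (rule ordLess_imp_ordLeq[OF finite_ordLess_infinite2]) (use k in simp_all)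
  have un: "|X \<union> Y| \<le>o |UNIV :: 'k set|" if "|X| \<le>o |UNIV :: 'k set|" "|Y| \<le>o |UNIV :: 'k set|" for X Y :: "'a set"
    by (rule card_of_Un_ordLeq_infinite[OF k that])
  show ?thesis unfolding ring_step_def by (intro un im s f p u)
qed

lemma ring_hull_small:
  assumes k: "infinite (UNIV :: 'k set)" and s: "|S| \<le>o |UNIV :: 'k set|"
  shows "|ring_hull R S| \<le>o |UNIV :: 'k set|"
proof -
  have "|(ring_step R ^^ n) S| \<le>o |UNIV :: 'k set|" for n
    by (induction n) (simp_all add: s ring_step_small[OF k])
  moreover have "|UNIV :: nat set| \<le>o |UNIV :: 'k set|" using k infinite_iff_card_of_nat by blast
  ultimately show ?thesis unfolding ring_hull_def by (intro card_of_UNION_ordLeq_infinite[OF k]) auto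
qed

lemma ring_hull_base: "S \<subseteq> ring_hull R S"
  unfolding ring_hull_def using funpow_0[of "ring_step R" S] by (metis UNIV_I UN_upper)

lemma ring_iter_mono: "m \<le> n \<Longrightarrow> (ring_step R ^^ m) S \<subseteq> (ring_step R ^^ n) S"
proof (induction n)
  case (Suc n)
  have "(ring_step R ^^ n) S \<subseteq> (ring_step R ^^ Suc n) S" by (auto simp: ring_step_def)
  then show ?case using Suc by (cases "m = Suc n") auto
qed simp

lemma ring_hull_pair:
  assumes "a \<in> ring_hull R S" "b \<in> ring_hull R S"
  obtains n where "a \<in> (ring_step R ^^ n) S" "b \<in> (ring_step R ^^ n) S"
proof -
  obtain m n where "a \<in> (ring_step R ^^ m) S" "b \<in> (ring_step R ^^ n) S" using assms unfolding ring_hull_def by blast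
  then show thesis using that[of "max m n"] ring_iter_mono[of m "max m n" R S] ring_iter_mono[of n "max m n" R S] by auto
qed

lemma ring_hull_step: "a \<in> ring_step R ((ring_step R ^^ n) S) \<Longrightarrow> a \<in> ring_hull R S"
  unfolding ring_hull_def by (rule UN_I[of "Suc n"]) simp_all

lemma ring_hull_closed:
  shows "\<zero>\<^bsub>R\<^esub> \<in> ring_hull R S" "\<one>\<^bsub>R\<^esub> \<in> ring_hull R S"
    "a \<in> ring_hull R S \<Longrightarrow> b \<in> ring_hull R S \<Longrightarrow> a \<oplus>\<^bsub>R\<^esub> b \<in> ring_hull R S"
    "a \<in> ring_hull R S \<Longrightarrow> b \<in> ring_hull R S \<Longrightarrow> a \<otimes>\<^bsub>R\<^esub> b \<in> ring_hull R S"
    "a \<in> ring_hull R S \<Longrightarrow> \<ominus>\<^bsub>R\<^esub> a \<in> ring_hull R S"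
    "a \<in> ring_hull R S \<Longrightarrow> a \<in> Units R \<Longrightarrow> inv\<^bsub>R\<^esub> a \<in> ring_hull R S"
proof -
  show "\<zero>\<^bsub>R\<^esub> \<in> ring_hull R S" "\<one>\<^bsub>R\<^esub> \<in> ring_hull R S"
    by (rule ring_hull_step[of _ _ 0], simp add: ring_step_def)+
next
  assume "a \<in> ring_hull R S" "b \<in> ring_hull R S"
  then obtain n where n: "a \<in> (ring_step R ^^ n) S" "b \<in> (ring_step R ^^ n) S" by (rule ring_hull_pair)
  have i: "(\<lambda>(a, b). f a b) (a, b) \<in> (\<lambda>(a, b). f a b) ` ((ring_step R ^^ n) S \<times> (ring_step R ^^ n) S)" for f :: "'a \<Rightarrow> 'a \<Rightarrow> 'a"
    by (rule imageI) (use n in simp)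
  show "a \<oplus>\<^bsub>R\<^esub> b \<in> ring_hull R S" "a \<otimes>\<^bsub>R\<^esub> b \<in> ring_hull R S"
    using i[of "add R"] i[of "monoid.mult R"] by (auto intro!: ring_hull_step[of _ _ n] simp: ring_step_def)
next
  assume "a \<in> ring_hull R S"
  then obtain n where n: "a \<in> (ring_step R ^^ n) S" unfolding ring_hull_def by blast
  show "\<ominus>\<^bsub>R\<^esub> a \<in> ring_hull R S" by (rule ring_hull_step[of _ _ n]) (use n in \<open>simp add: ring_step_def\<close>)
  show "inv\<^bsub>R\<^esub> a \<in> ring_hull R S" if "a \<in> Units R" by (rule ring_hull_step[of _ _ n]) (use n that in \<open>simp add: ring_step_def\<close>)
qed

lemma (in ring) ring_hull_carrier: assumes "S \<subseteq> carrier R" shows "ring_hull R S \<subseteq> carrier R"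
proof -
  have st: "ring_step R T \<subseteq> carrier R" if "T \<subseteq> carrier R" for T
    using that unfolding ring_step_def by auto
  have "(ring_step R ^^ n) S \<subseteq> carrier R" for n
    by (induction n) (use assms st in auto)
  then show ?thesis unfolding ring_hull_def by blast
qed

text \<open>It allows two small rings mapping to a large local ring to be compared inside a local
  ring whose spectrum fits into the universe. The agreement of units makes homomorphisms into
  \<open>L\<close> local exactly when they are local into the subring.\<close>

lemma small_local_subring:
  fixes L :: "('a, 'm) ring_scheme"
  assumes k: "infinite (UNIV :: 'k set)" and L: "local_ring L" and S: "S \<subseteq> carrier L" "|S| \<le>o |UNIV :: 'k set|"
  shows "\<exists>D. S \<subseteq> D \<and> D \<subseteq> carrier L \<and> |D| \<le>o |UNIV :: 'k set| \<and> local_ring (L\<lparr>carrier := D\<rparr>) \<and>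
    (\<forall>a \<in> D. a \<in> Units L \<longrightarrow> a \<in> Units (L\<lparr>carrier := D\<rparr>)) \<and> (\<forall>a. a \<in> Units (L\<lparr>carrier := D\<rparr>) \<longrightarrow> a \<in> Units L)"
proof -
  interpret L: cring L by (rule local_ring_cring[OF L])
  let ?D = "ring_hull L S"
  let ?R = "L\<lparr>carrier := ?D\<rparr>"
  have D: "?D \<subseteq> carrier L" by (rule L.ring_hull_carrier[OF S(1)])
  have sr: "subring ?D L" by (rule L.subringI[OF D]) (auto intro: ring_hull_closed)
  have cr: "cring ?R"
    using L.subcring_iff[OF D] L.subcringI'[OF sr] by simp
  interpret R: cring ?R by (rule cr)
  have u1: "a \<in> Units ?R" if "a \<in> ?D" "a \<in> Units L" for a
    using that ring_hull_closed(6)[OF that] by (intro R.Units_of_mult_one[of a "inv\<^bsub>L\<^esub> a"]) simp_all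
  have u2: "a \<in> Units L" if "a \<in> Units ?R" for a
    using that D unfolding Units_def by auto
  have "local_ring ?R" unfolding local_ring_iff
  proof (intro conjI ballI impI cr)
    show "\<one>\<^bsub>?R\<^esub> \<noteq> \<zero>\<^bsub>?R\<^esub>" using local_ring_nontriv[OF L] by simp
    fix a b assume "a \<in> carrier ?R" "b \<in> carrier ?R" "a \<notin> Units ?R \<and> b \<notin> Units ?R"
    then have "a \<in> carrier L" "b \<in> carrier L" "a \<notin> Units L" "b \<notin> Units L" using u1 D by auto
    then have "a \<oplus>\<^bsub>L\<^esub> b \<notin> Units L" using L unfolding local_ring_iff by blast
    then show "a \<oplus>\<^bsub>?R\<^esub> b \<notin> Units ?R" using u2 by auto
  qed
  moreover have "\<forall>a \<in> ?D. a \<in> Units L \<longrightarrow> a \<in> Units ?R" "\<forall>a. a \<in> Units ?R \<longrightarrow> a \<in> Units L" using u1 u2 by simp_all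
  ultimately show ?thesis
    using ring_hull_base[of S L] D ring_hull_small[OF k S(2), of L] by (intro exI[of _ ?D]) simp
qed

section \<open>Tensor products with flat modules\<close>

abbreviation (input) fkeys :: "('a \<Rightarrow>\<^sub>0 int) \<Rightarrow> 'a set" where "fkeys \<equiv> Poly_Mapping.keys"

lemma fkeys_diff: "fkeys a \<subseteq> S \<Longrightarrow> fkeys b \<subseteq> S \<Longrightarrow> fkeys (a - b) \<subseteq> S"
  using keys_diff[of a b] by blast

lemma fkeys_add: "fkeys a \<subseteq> S \<Longrightarrow> fkeys b \<subseteq> S \<Longrightarrow> fkeys (a + b) \<subseteq> S"
  using Poly_Mapping.keys_add[of a b] by blast

lemmas fkeys_induct = free_Abelian_group_induct[consumes 1]

lemma fkeys_extend: "fkeys z \<subseteq> S \<Longrightarrow> (\<And>p. p \<in> S \<Longrightarrow> fkeys (f p) \<subseteq> S') \<Longrightarrow> fkeys (frag_extend f z) \<subseteq> S'"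
  using keys_frag_extend[of f z] by blast

locale module_pair = M: module A M + N: module A N
  for A :: "('a, 'k) ring_scheme" and M :: "('a, 'b) module" and N :: "('a, 'c) module"
begin

abbreviation S where "S \<equiv> carrier M \<times> carrier N"
abbreviation FA where "FA \<equiv> free_Abelian_group S"
abbreviation J where "J \<equiv> tensor_rel A M N"

definition gens where "gens =
     {frag_of (x \<oplus>\<^bsub>M\<^esub> x', y) - frag_of (x, y) - frag_of (x', y)
         | x x' y. x \<in> carrier M \<and> x' \<in> carrier M \<and> y \<in> carrier N} \<union>
      {frag_of (x, y \<oplus>\<^bsub>N\<^esub> y') - frag_of (x, y) - frag_of (x, y')
         | x y y'. x \<in> carrier M \<and> y \<in> carrier N \<and> y' \<in> carrier N} \<union>
      {frag_of (a \<odot>\<^bsub>M\<^esub> x, y) - frag_of (x, a \<odot>\<^bsub>N\<^esub> y)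
         | a x y. a \<in> carrier A \<and> x \<in> carrier M \<and> y \<in> carrier N}"

lemma J_def: "J = generate FA gens"
  unfolding tensor_rel_def gens_def ..

lemma gensE:
  assumes "g \<in> gens"
  obtains x x' y where "x \<in> carrier M" "x' \<in> carrier M" "y \<in> carrier N" "g = frag_of (x \<oplus>\<^bsub>M\<^esub> x', y) - frag_of (x, y) - frag_of (x', y)"
  | x y y' where "x \<in> carrier M" "y \<in> carrier N" "y' \<in> carrier N" "g = frag_of (x, y \<oplus>\<^bsub>N\<^esub> y') - frag_of (x, y) - frag_of (x, y')"
  | a x y where "a \<in> carrier A" "x \<in> carrier M" "y \<in> carrier N" "g = frag_of (a \<odot>\<^bsub>M\<^esub> x, y) - frag_of (x, a \<odot>\<^bsub>N\<^esub> y)"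
  using assms unfolding gens_def by auto

lemma gens_sub: "gens \<subseteq> carrier FA"
proof
  fix g assume "g \<in> gens"
  then show "g \<in> carrier FA" by (cases rule: gensE) (simp_all add: fkeys_diff)
qed

lemma J_subgroup: "subgroup J FA"
  unfolding J_def by (rule group.generate_is_subgroup[OF group_free_Abelian_group gens_sub])

lemma J_keys: "z \<in> J \<Longrightarrow> fkeys z \<subseteq> S"
  using subgroup.mem_carrier[OF J_subgroup] by simp

lemma J_zero: "0 \<in> J" using subgroup.one_closed[OF J_subgroup] by simp

lemma J_add: "z \<in> J \<Longrightarrow> w \<in> J \<Longrightarrow> z + w \<in> J" using subgroup.m_closed[OF J_subgroup] by simp

lemma J_uminus: "z \<in> J \<Longrightarrow> - z \<in> J" using subgroup.m_inv_closed[OF J_subgroup, of z] J_keys[of z] by simp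

lemma J_diff: "z \<in> J \<Longrightarrow> w \<in> J \<Longrightarrow> z - w \<in> J" using J_add[of z "- w"] J_uminus by simp

lemma J_gens: "g \<in> gens \<Longrightarrow> g \<in> J" unfolding J_def by (rule generate.incl)

lemma J_gen1: "x \<in> carrier M \<Longrightarrow> x' \<in> carrier M \<Longrightarrow> y \<in> carrier N \<Longrightarrow> frag_of (x \<oplus>\<^bsub>M\<^esub> x', y) - frag_of (x, y) - frag_of (x', y) \<in> J"
  and J_gen2: "x \<in> carrier M \<Longrightarrow> y \<in> carrier N \<Longrightarrow> y' \<in> carrier N \<Longrightarrow> frag_of (x, y \<oplus>\<^bsub>N\<^esub> y') - frag_of (x, y) - frag_of (x, y') \<in> J"
  and J_gen3: "a \<in> carrier A \<Longrightarrow> x \<in> carrier M \<Longrightarrow> y \<in> carrier N \<Longrightarrow> frag_of (a \<odot>\<^bsub>M\<^esub> x, y) - frag_of (x, a \<odot>\<^bsub>N\<^esub> y) \<in> J"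
  by (rule J_gens, auto simp: gens_def)+

lemma J_induct:
  assumes "z \<in> J" "0 \<in> W" "\<And>a b. a \<in> W \<Longrightarrow> b \<in> W \<Longrightarrow> a - b \<in> W" "\<And>g. g \<in> gens \<Longrightarrow> g \<in> W"
  shows "z \<in> W"
  using assms(1) unfolding J_def
proof (induction rule: generate.induct)
  case (inv h)
  have "- h \<in> W" using assms(3)[OF assms(2) assms(4)[OF inv]] by simp
  then show ?case using gens_sub inv by auto
next
  case (eng a b)
  then show ?case using assms(3)[OF eng(3) assms(3)[OF assms(2) eng(4)]] by simp
qed (use assms in auto)

lemma J_zero_left: assumes "y \<in> carrier N" shows "frag_of (\<zero>\<^bsub>M\<^esub>, y) \<in> J"
  using J_uminus[OF J_gen1[of "\<zero>\<^bsub>M\<^esub>" "\<zero>\<^bsub>M\<^esub>" y]] assms by simp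

lemma J_diff_left:
  assumes x: "x \<in> carrier M" "x' \<in> carrier M" and y: "y \<in> carrier N"
  shows "frag_of (x, y) - frag_of (x', y) - frag_of (x \<ominus>\<^bsub>M\<^esub> x', y) \<in> J"
proof -
  have "(x \<ominus>\<^bsub>M\<^esub> x') \<oplus>\<^bsub>M\<^esub> x' = x" using x by (simp add: M.M.minus_eq M.M.a_assoc M.M.l_neg)
  then show ?thesis using J_gen1[of "x \<ominus>\<^bsub>M\<^esub> x'" x' y] x y by (simp add: algebra_simps)
qed

lemma r_coset_J: assumes z: "z \<in> J" shows "J #>\<^bsub>FA\<^esub> z = J"
  using group.coset_join2[OF group_free_Abelian_group _ J_subgroup z] J_keys[OF z] by simp

lemma r_coset_self: "w \<in> J #>\<^bsub>FA\<^esub> w"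
  unfolding r_coset_def by (rule UN_I[OF J_zero]) simp

lemma J_flip: assumes "z \<in> J" shows "frag_extend (\<lambda>(x, y). frag_of (y, x)) z \<in> tensor_rel A N M"
proof -
  interpret flip: module_pair A N M by unfold_locales
  let ?w = "frag_extend (\<lambda>(x, y). frag_of (y, x))"
  have "z \<in> {z. ?w z \<in> flip.J}" using assms
  proof (rule J_induct)
    fix g assume "g \<in> gens"
    then show "g \<in> {z. ?w z \<in> flip.J}"
    proof (cases rule: gensE)
      case (3 a x y)
      then show ?thesis using flip.J_uminus[OF flip.J_gen3[of a y x]] by (simp add: frag_extend_diff)
    qed (simp_all add: frag_extend_diff flip.J_gen1 flip.J_gen2)
  qed (simp_all add: flip.J_zero flip.J_diff frag_extend_diff)
  then show ?thesis by simp
qed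

end

text \<open>Injectivity of the inclusion of \<open>H\<close> after tensoring, restated for formal
  sums: a sum over \<open>H\<close> that is zero as a tensor over \<open>M\<close> is already zero
  over \<open>H\<close>. Since \<open>H\<close> keeps the elements of \<open>M\<close>, it is one of
  the test modules of \<open>flat_module\<close>.\<close>

lemma tensor_rel_flat_submodule:
  fixes A :: "'a ring" and M :: "('a, 'a) module" and N :: "('a, 'c) module"
  assumes flat: "flat_module A N" and M: "module A M" and H: "submodule H A M"
    and z: "z \<in> tensor_rel A M N" "fkeys z \<subseteq> H \<times> carrier N"
  shows "z \<in> tensor_rel A (M\<lparr>carrier := H\<rparr>) N"
proof -
  let ?H = "M\<lparr>carrier := H\<rparr>"
  interpret M: module A M by (rule M)
  interpret N: module A N using flat unfolding flat_module_def by simp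
  interpret MN: module_pair A M N by unfold_locales
  interpret H: module A ?H by (rule submodule.submodule_is_module[OF H M])
  interpret HN: module_pair A ?H N by unfold_locales
  have sub: "H \<subseteq> carrier M" using subgroup.subset[OF submodule.axioms(1)[OF H]] by simp
  have J0: "w \<in> MN.J" if "w \<in> HN.J" for w
    using that
  proof (rule HN.J_induct)
    fix g assume "g \<in> HN.gens"
    then show "g \<in> MN.J"
      by (cases rule: HN.gensE) (use sub in \<open>auto intro: MN.J_gen1 MN.J_gen2 MN.J_gen3\<close>)
  qed (auto intro: MN.J_zero MN.J_diff)
  have id: "(\<lambda>y. y) \<in> linear_maps A ?H M" unfolding linear_maps_def using sub by auto
  have inj: "inj_on (tensor_map A M N (\<lambda>y. y)) (carrier (tensor A ?H N))"
    using flat H.module_axioms M id unfolding flat_module_def by (metis inj_on_id2)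
  have ex: "frag_extend (\<lambda>p. frag_of p) w = w" for w :: "'a \<times> 'c \<Rightarrow>\<^sub>0 int"
    using frag_expansion[of w, symmetric] by simp
  have e: "tensor_map A M N (\<lambda>y. y) (HN.J #>\<^bsub>HN.FA\<^esub> w) = MN.J" if w: "w \<in> MN.J" for w
  proof -
    have "v \<in> MN.J" if "v \<in> HN.J #>\<^bsub>HN.FA\<^esub> w" for v
      using that w J0 MN.J_add unfolding r_coset_def by auto
    then show ?thesis unfolding tensor_map_def using MN.r_coset_J HN.r_coset_self[of w] by (auto simp: ex split_def)
  qed
  have c: "HN.J #>\<^bsub>HN.FA\<^esub> w \<in> carrier (tensor A ?H N)" if "fkeys w \<subseteq> H \<times> carrier N" for w
    unfolding tensor_def FactGroup_def RCOSETS_def using that by auto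
  have "HN.J #>\<^bsub>HN.FA\<^esub> z = HN.J #>\<^bsub>HN.FA\<^esub> 0"
    by (rule inj_onD[OF inj trans[OF e[OF z(1)] e[OF MN.J_zero, symmetric]] c[OF z(2)] c]) simp
  then show ?thesis using HN.r_coset_J[OF HN.J_zero] HN.r_coset_self[of z] by simp
qed

lemma linear_mapsD:
  assumes "f \<in> linear_maps A M M'"
  shows "x \<in> carrier M \<Longrightarrow> f x \<in> carrier M'" "x \<in> carrier M \<Longrightarrow> y \<in> carrier M \<Longrightarrow> f (x \<oplus>\<^bsub>M\<^esub> y) = f x \<oplus>\<^bsub>M'\<^esub> f y"
    "a \<in> carrier A \<Longrightarrow> x \<in> carrier M \<Longrightarrow> f (a \<odot>\<^bsub>M\<^esub> x) = a \<odot>\<^bsub>M'\<^esub> f x"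
  using assms unfolding linear_maps_def by auto

abbreviation on_left :: "('b \<Rightarrow> 'd) \<Rightarrow> ('b \<times> 'c \<Rightarrow>\<^sub>0 int) \<Rightarrow> ('d \<times> 'c \<Rightarrow>\<^sub>0 int)" where
  "on_left f \<equiv> frag_extend (\<lambda>(x, y). frag_of (f x, y))"

context module_pair
begin

context
  fixes f
  assumes f: "f \<in> linear_maps A M M"
begin

lemma J_on_left: assumes "z \<in> J" shows "on_left f z \<in> J"
proof -
  have "z \<in> {z. on_left f z \<in> J}" using assms
  proof (rule J_induct)
    fix g assume "g \<in> gens"
    then show "g \<in> {z. on_left f z \<in> J}"
      by (cases rule: gensE) (simp_all add: frag_extend_diff linear_mapsD[OF f] J_gen1 J_gen2 J_gen3)
  qed (simp_all add: J_zero J_diff frag_extend_diff)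
  then show ?thesis by simp
qed

lemma f_zero: "f \<zero>\<^bsub>M\<^esub> = \<zero>\<^bsub>M\<^esub>"
  using linear_mapsD(2)[OF f, of "\<zero>\<^bsub>M\<^esub>" "\<zero>\<^bsub>M\<^esub>"] linear_mapsD(1)[OF f, of "\<zero>\<^bsub>M\<^esub>"] by simp

lemma f_eq_diff: assumes "a \<in> carrier M" "b \<in> carrier M" "f a = f b" shows "f (a \<ominus>\<^bsub>M\<^esub> b) = \<zero>\<^bsub>M\<^esub>"
proof -
  have "(a \<ominus>\<^bsub>M\<^esub> b) \<oplus>\<^bsub>M\<^esub> b = a" using assms by (simp add: M.M.minus_eq M.M.a_assoc M.M.l_neg)
  then show ?thesis using linear_mapsD(2)[OF f, of "a \<ominus>\<^bsub>M\<^esub> b" b] linear_mapsD(1)[OF f] assms by simp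
qed

lemma f_uminus: "a \<in> carrier M \<Longrightarrow> f (\<ominus>\<^bsub>M\<^esub> a) = \<ominus>\<^bsub>M\<^esub> f a"
  using linear_mapsD(2)[OF f, of "\<ominus>\<^bsub>M\<^esub> a" a] linear_mapsD(1)[OF f] f_zero
  by (intro M.M.minus_equality[symmetric]) (simp_all add: M.M.l_neg)

context
  fixes X
  assumes X: "submodule X A M"
begin

interpretation X: submodule X A M by (rule X)

lemma submodule_closed:
  "x \<in> X \<Longrightarrow> x \<in> carrier M" "\<zero>\<^bsub>M\<^esub> \<in> X" "x \<in> X \<Longrightarrow> x' \<in> X \<Longrightarrow> x \<oplus>\<^bsub>M\<^esub> x' \<in> X" "x \<in> X \<Longrightarrow> \<ominus>\<^bsub>M\<^esub> x \<in> X"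
  "x \<in> X \<Longrightarrow> x' \<in> X \<Longrightarrow> x \<ominus>\<^bsub>M\<^esub> x' \<in> X"
  using subgroup.mem_carrier[OF X.subgroup_axioms] subgroup.one_closed[OF X.subgroup_axioms] subgroup.m_closed[OF X.subgroup_axioms]
    subgroup.m_inv_closed[OF X.subgroup_axioms] by (simp_all add: a_inv_def M.M.minus_eq)

lemma image_submodule: "submodule (f ` X) A M"
proof (rule M.submoduleI)
  show "f ` X \<subseteq> carrier M" using submodule_closed(1) linear_mapsD(1)[OF f] by auto
  show "\<zero>\<^bsub>M\<^esub> \<in> f ` X" using submodule_closed(2) f_zero by (metis imageI)
  fix y assume "y \<in> f ` X"
  then obtain x where x: "y = f x" "x \<in> X" by blast
  then show "\<ominus>\<^bsub>M\<^esub> y \<in> f ` X" using f_uminus submodule_closed(1,4) by (metis imageI)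
  show "a \<odot>\<^bsub>M\<^esub> y \<in> f ` X" if "a \<in> carrier A" for a
    using linear_mapsD(3)[OF f that, of x] x submodule_closed(1) X.smult_closed[OF that] by (metis imageI)
  fix y' assume "y' \<in> f ` X"
  then obtain x' where "y' = f x'" "x' \<in> X" by blast
  then show "y \<oplus>\<^bsub>M\<^esub> y' \<in> f ` X" using linear_mapsD(2)[OF f, of x x'] x submodule_closed(1,3) by (metis imageI)
qed

lemma kernel_submodule: "submodule {x \<in> X. f x = \<zero>\<^bsub>M\<^esub>} A M"
  by (rule M.submoduleI) (auto simp: submodule_closed f_zero f_uminus linear_mapsD[OF f])

end
end

end

text \<open>Exactness of \<open>ker f \<otimes> N \<rightarrow> X \<otimes> N \<rightarrow> f X \<otimes> N\<close>, in terms of the formal sums that represent tensors.\<close>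

lemma tensor_rel_kernel:
  fixes A :: "'a ring" and M :: "('a, 'a) module" and N :: "('a, 'c) module"
  assumes flat: "flat_module A N" and M: "module A M" and X: "submodule X A M" and f: "f \<in> linear_maps A M M"
    and w: "fkeys w \<subseteq> X \<times> carrier N" "on_left f w \<in> tensor_rel A M N"
  shows "\<exists>w'. fkeys w' \<subseteq> {x \<in> X. f x = \<zero>\<^bsub>M\<^esub>} \<times> carrier N \<and> w - w' \<in> tensor_rel A M N"
proof -
  interpret M: module A M by (rule M)
  interpret N: module A N using flat unfolding flat_module_def by simp
  interpret module_pair A M N by unfold_locales
  interpret X: submodule X A M by fact
  let ?H = "M\<lparr>carrier := f ` X\<rparr>" and ?K = "{x \<in> X. f x = \<zero>\<^bsub>M\<^esub>} \<times> carrier N"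
  note sH = image_submodule[OF f X]
  interpret H: module A ?H by (rule submodule.submodule_is_module[OF sH M])
  interpret HN: module_pair A ?H N by unfold_locales
  note sub = submodule_closed(1)[OF f X] and add = submodule_closed(3)[OF f X] and minus = submodule_closed(5)[OF f X]
  \<comment> \<open>A set-theoretic section of \<open>f\<close> on \<open>X\<close>. It is not
    linear; its failure to be so lies in the kernel of \<open>f\<close>.\<close>
  define \<sigma> where "\<sigma> y = (SOME x. x \<in> X \<and> f x = y)" for y
  have \<sigma>: "\<sigma> (f x) \<in> X" "f (\<sigma> (f x)) = f x" if "x \<in> X" for x
    using someI[of "\<lambda>x'. x' \<in> X \<and> f x' = f x", of x] that unfolding \<sigma>_def by auto
  \<comment> \<open>The formal sums that are represented by tensors over the kernel. Modulo this
    group \<sigma> becomes additive and linear, so it maps the relations over the image of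
    \<open>f\<close> into \<open>K\<close>, while applying \<open>f\<close> and then \<sigma>
    changes a sum only by an element of \<open>K\<close>.\<close>
  define K where "K = {z. \<exists>w'. fkeys w' \<subseteq> ?K \<and> z - w' \<in> J}"
  have K_J: "z \<in> K" if "z \<in> J" for z unfolding K_def using that by (intro CollectI exI[of _ 0]) simp
  have K_diff: "a - b \<in> K" if ab: "a \<in> K" "b \<in> K" for a b
  proof -
    obtain a' b' where "fkeys a' \<subseteq> ?K" "a - a' \<in> J" "fkeys b' \<subseteq> ?K" "b - b' \<in> J" using ab unfolding K_def by auto
    then show ?thesis unfolding K_def using J_diff[of "a - a'" "b - b'"]
      by (intro CollectI exI[of _ "a' - b'"]) (simp add: fkeys_diff algebra_simps)
  qed
  have K_add: "a + b \<in> K" if "a \<in> K" "b \<in> K" for a b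
    using K_diff[OF that(1) K_diff[OF K_J[OF J_zero] that(2)]] by simp
  have K_ker: "frag_of (x, y) - frag_of (x', y) \<in> K" if "x \<in> X" "x' \<in> X" "f x = f x'" "y \<in> carrier N" for x x' y
    unfolding K_def using that J_diff_left[of x x' y] f_eq_diff[OF f sub[OF that(1)] sub[OF that(2)]] minus sub
    by (intro CollectI exI[of _ "frag_of (x \<ominus>\<^bsub>M\<^esub> x', y)"]) simp
  have "fkeys (on_left f w) \<subseteq> f ` X \<times> carrier N"
    by (rule fkeys_extend[OF w(1)]) auto
  then have "on_left f w \<in> HN.J" by (rule tensor_rel_flat_submodule[OF flat M sH w(2)])
  then have "on_left f w \<in> {z. on_left \<sigma> z \<in> K}"
  proof (rule HN.J_induct)
    fix g assume "g \<in> HN.gens"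
    then show "g \<in> {z. on_left \<sigma> z \<in> K}"
    proof (cases rule: HN.gensE)
      case (1 y y' n)
      then obtain x x' where x: "x \<in> X" "x' \<in> X" "y = f x" "y' = f x'" by auto
      note c = \<sigma>(1)[OF x(1)] \<sigma>(1)[OF x(2)]
      have e: "y \<oplus>\<^bsub>M\<^esub> y' = f (x \<oplus>\<^bsub>M\<^esub> x')" using linear_mapsD(2)[OF f sub sub] x by simp
      have "frag_of (\<sigma> (f (x \<oplus>\<^bsub>M\<^esub> x')), n) - frag_of (\<sigma> y \<oplus>\<^bsub>M\<^esub> \<sigma> y', n) \<in> K"
        using K_ker[OF \<sigma>(1)[OF add[OF x(1,2)]] add[OF c] _ 1(3)] \<sigma>(2)[OF add[OF x(1,2)]] \<sigma>(2)[OF x(1)] \<sigma>(2)[OF x(2)]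
          linear_mapsD(2)[OF f sub[OF c(1)] sub[OF c(2)]] x(3,4) e by simp
      from K_add[OF this K_J[OF J_gen1[of "\<sigma> y" "\<sigma> y'" n]]]
      show ?thesis unfolding 1(4) using 1(3) x c sub e by (simp add: frag_extend_diff frag_extend_add algebra_simps)
    next
      case (2 y n n')
      then obtain x where x: "x \<in> X" "y = f x" by auto
      show ?thesis using 2 x K_J[OF J_gen2[OF sub[OF \<sigma>(1)[OF x(1)]], of n n']] by (simp add: frag_extend_diff)
    next
      case (3 a y n)
      then obtain x where x: "x \<in> X" "y = f x" by auto
      note c = \<sigma>(1)[OF x(1)]
      have e: "a \<odot>\<^bsub>M\<^esub> y = f (a \<odot>\<^bsub>M\<^esub> x)" using linear_mapsD(3)[OF f 3(1) sub] x by simp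
      have "frag_of (\<sigma> (f (a \<odot>\<^bsub>M\<^esub> x)), n) - frag_of (a \<odot>\<^bsub>M\<^esub> \<sigma> y, n) \<in> K"
        using K_ker[OF \<sigma>(1)[OF X.smult_closed[OF 3(1) x(1)]] X.smult_closed[OF 3(1) c] _ 3(3)] \<sigma>(2)[OF X.smult_closed[OF 3(1) x(1)]]
          \<sigma>(2)[OF x(1)] linear_mapsD(3)[OF f 3(1) sub[OF c]] x(2) e by simp
      from K_add[OF this K_J[OF J_gen3[of a "\<sigma> y" n]]]
      show ?thesis using 3 x c sub e by (simp add: frag_extend_diff)
    qed
  qed (simp_all add: K_J J_zero K_diff frag_extend_diff)
  moreover have "on_left \<sigma> (on_left f w) - w \<in> K" using w(1)
  proof (induction rule: fkeys_induct)
    case (2 a b)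
    then show ?case using K_diff[of "on_left \<sigma> (on_left f a) - a" "on_left \<sigma> (on_left f b) - b"] by (simp add: frag_extend_diff algebra_simps)
  next
    case (3 p)
    then show ?case using K_ker[of "\<sigma> (f (fst p))" "fst p" "snd p"] \<sigma> by (cases p) simp
  qed (simp add: K_J J_zero)
  ultimately have "w \<in> K" using K_diff[of "on_left \<sigma> (on_left f w)" "on_left \<sigma> (on_left f w) - w"] by simp
  then show ?thesis unfolding K_def by simp
qed

text \<open>The maps are treated one after another: exactness moves \<open>w\<close> to a
  representative over the common kernel of those treated so far. At the end the common kernel is
  zero by \<open>tf\<close>. This induction is why the family must be finite.\<close>

lemma tensor_rel_torsion_free:
  fixes A :: "'a ring" and M :: "('a, 'a) module" and N :: "('a, 'c) module"
  assumes flat: "flat_module A N" and M: "module A M" and F: "finite F" "F \<subseteq> linear_maps A M M"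
    and tf: "\<And>x. x \<in> carrier M \<Longrightarrow> (\<And>f. f \<in> F \<Longrightarrow> f x = \<zero>\<^bsub>M\<^esub>) \<Longrightarrow> x = \<zero>\<^bsub>M\<^esub>"
    and w: "fkeys w \<subseteq> carrier M \<times> carrier N" and fw: "\<And>f. f \<in> F \<Longrightarrow> on_left f w \<in> tensor_rel A M N"
  shows "w \<in> tensor_rel A M N"
proof -
  interpret M: module A M by (rule M)
  interpret N: module A N using flat unfolding flat_module_def by simp
  interpret module_pair A M N by unfold_locales
  have "\<exists>X w'. submodule X A M \<and> (\<forall>x \<in> X. \<forall>f \<in> G. f x = \<zero>\<^bsub>M\<^esub>) \<and> fkeys w' \<subseteq> X \<times> carrier N \<and> w - w' \<in> J"
    if "finite G" "G \<subseteq> F" for G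
    using that
  proof (induction rule: finite_induct)
    case empty
    have "submodule (carrier M) A M" by (rule M.submoduleI) simp_all
    then show ?case using w J_zero by (intro exI[of _ "carrier M"] exI[of _ w]) simp
  next
    case (insert f G)
    then obtain X w' where X: "submodule X A M" "\<forall>x \<in> X. \<forall>f \<in> G. f x = \<zero>\<^bsub>M\<^esub>" and w': "fkeys w' \<subseteq> X \<times> carrier N" "w - w' \<in> J" by auto
    have f: "f \<in> F" "f \<in> linear_maps A M M" using insert.prems F by auto
    have "on_left f w - on_left f (w - w') \<in> J" by (rule J_diff[OF fw[OF f(1)] J_on_left[OF f(2) w'(2)]])
    then have "on_left f w' \<in> J" by (simp add: frag_extend_diff)
    from tensor_rel_kernel[OF flat M X(1) f(2) w'(1) this]
    obtain w'' where w'': "fkeys w'' \<subseteq> {x \<in> X. f x = \<zero>\<^bsub>M\<^esub>} \<times> carrier N" "w' - w'' \<in> J" by blast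
    have "w - w'' \<in> J" using J_add[OF w'(2) w''(2)] by simp
    moreover have "\<forall>x \<in> {x \<in> X. f x = \<zero>\<^bsub>M\<^esub>}. \<forall>g \<in> insert f G. g x = \<zero>\<^bsub>M\<^esub>" using X(2) by blast
    ultimately show ?case using kernel_submodule[OF f(2) X(1)] w''(1) by blast
  qed
  from this[OF F(1) order_refl] obtain X w' where X: "submodule X A M" "\<forall>x \<in> X. \<forall>f \<in> F. f x = \<zero>\<^bsub>M\<^esub>"
    and w': "fkeys w' \<subseteq> X \<times> carrier N" "w - w' \<in> J" by blast
  have "x = \<zero>\<^bsub>M\<^esub>" if "x \<in> X" for x using tf[of x] X(2) that subgroup.mem_carrier[OF submodule.axioms(1)[OF X(1)] that] by auto
  then have "fkeys w' \<subseteq> {\<zero>\<^bsub>M\<^esub>} \<times> carrier N" using w'(1) by auto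
  then have "w' \<in> J"
  proof (induction rule: fkeys_induct)
    case (3 p)
    then show ?case using J_zero_left[of "snd p"] by (cases p) simp
  qed (simp_all add: J_zero J_diff)
  from J_add[OF w'(2) this] show ?thesis by simp
qed

section \<open>The tensor product of two algebras as a ring\<close>

lemma module_via_simps [simp]:
  fixes f :: "'a \<Rightarrow> 'b" and B :: "'b ring"
  shows "carrier (module_via f B) = carrier B" "x \<oplus>\<^bsub>module_via f B\<^esub> y = x \<oplus>\<^bsub>B\<^esub> y" "\<zero>\<^bsub>module_via f B\<^esub> = \<zero>\<^bsub>B\<^esub>"
    "r \<odot>\<^bsub>module_via f B\<^esub> y = f r \<otimes>\<^bsub>B\<^esub> y"
  by (simp_all add: module_via_def ring.defs)

lemma module_via_module:
  assumes A: "cring A" and B: "cring B" and f: "f \<in> ring_hom A B"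
  shows "module A (module_via f B)"
proof -
  interpret B: cring B by fact
  interpret h: ring_hom_cring A B f by (rule ring_hom_cringI2[OF A B f])
  show ?thesis
  proof (rule moduleI)
    show "abelian_group (module_via f B)"
    proof (rule abelian_groupI)
      fix x assume "x \<in> carrier (module_via f B)"
      then show "\<exists>y \<in> carrier (module_via f B). y \<oplus>\<^bsub>module_via f B\<^esub> x = \<zero>\<^bsub>module_via f B\<^esub>"
        by (intro bexI[of _ "\<ominus>\<^bsub>B\<^esub> x"]) (simp_all add: B.l_neg)
    qed (simp_all add: B.a_ac)
  qed (auto simp: A B.l_distr B.r_distr B.m_assoc)
qed

lemma ideal_lift:
  assumes J: "ideal J R" and S: "ring S" and h: "h \<in> ring_hom R S" and z: "\<And>z. z \<in> J \<Longrightarrow> h z = \<zero>\<^bsub>S\<^esub>"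
  shows "\<exists>\<chi> \<in> ring_hom (R Quot J) S. \<forall>z \<in> carrier R. \<chi> (J +>\<^bsub>R\<^esub> z) = h z"
proof -
  interpret J: ideal J R by fact
  interpret S: ring S by fact
  interpret h: ring_hom_ring R S h by (rule ring_hom_ringI2[OF J.ring_axioms S h])
  define \<chi> where "\<chi> = (\<lambda>c. h (SOME z. z \<in> c))"
  have v: "\<chi> (J +>\<^bsub>R\<^esub> z) = h z" if zc: "z \<in> carrier R" for z
  proof -
    have "(SOME w. w \<in> J +>\<^bsub>R\<^esub> z) \<in> J +>\<^bsub>R\<^esub> z" by (rule someI[of "\<lambda>w. w \<in> J +>\<^bsub>R\<^esub> z", OF J.a_rcos_self[OF zc]])
    then obtain j where j: "j \<in> J" "(SOME w. w \<in> J +>\<^bsub>R\<^esub> z) = j \<oplus>\<^bsub>R\<^esub> z" by (auto simp: a_r_coset_def')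
    then show ?thesis unfolding \<chi>_def using zc z[OF j(1)] J.Icarr[OF j(1)] by simp
  qed
  have "\<chi> \<in> ring_hom (R Quot J) S"
  proof (rule ring_hom_memI)
    fix c assume "c \<in> carrier (R Quot J)"
    then show "\<chi> c \<in> carrier S" using v by (auto simp: FactRing_simps)
  next
    fix c c' assume "c \<in> carrier (R Quot J)" "c' \<in> carrier (R Quot J)"
    then obtain a b where ab: "a \<in> carrier R" "c = J +>\<^bsub>R\<^esub> a" "b \<in> carrier R" "c' = J +>\<^bsub>R\<^esub> b" by (auto simp: FactRing_simps)
    note q = J.rcos_ring_hom
    show "\<chi> (c \<otimes>\<^bsub>R Quot J\<^esub> c') = \<chi> c \<otimes>\<^bsub>S\<^esub> \<chi> c'"
      unfolding ab(2,4) ring_hom_mult[OF q ab(1,3), symmetric] using ab v by simp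
    show "\<chi> (c \<oplus>\<^bsub>R Quot J\<^esub> c') = \<chi> c \<oplus>\<^bsub>S\<^esub> \<chi> c'"
      unfolding ab(2,4) ring_hom_add[OF q ab(1,3), symmetric] using ab v by simp
  next
    show "\<chi> \<one>\<^bsub>R Quot J\<^esub> = \<one>\<^bsub>S\<^esub>" unfolding ring_hom_one[OF J.rcos_ring_hom, symmetric] using v by simp
  qed
  then show ?thesis using v by blast
qed

locale tensor_algebra = A: cring A + P: cring O1 + Q: cring O2
  for A :: "'a ring" and O1 :: "'b ring" and O2 :: "'c ring" +
  fixes f1 f2
  assumes f1: "f1 \<in> ring_hom A O1" and f2: "f2 \<in> ring_hom A O2"
begin

abbreviation MP where "MP \<equiv> module_via f1 O1"
abbreviation MQ where "MQ \<equiv> module_via f2 O2"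

sublocale module_pair A MP MQ
  by (intro module_pair.intro module_via_module A.is_cring P.is_cring Q.is_cring f1 f2)

definition pm :: "('b \<times> 'c \<Rightarrow>\<^sub>0 int) \<Rightarrow> ('b \<times> 'c \<Rightarrow>\<^sub>0 int) \<Rightarrow> ('b \<times> 'c \<Rightarrow>\<^sub>0 int)" where
  "pm u v = frag_extend (\<lambda>p. frag_extend (\<lambda>q. frag_of (fst p \<otimes>\<^bsub>O1\<^esub> fst q, snd p \<otimes>\<^bsub>O2\<^esub> snd q)) v) u"

lemma pm_of: "pm (frag_of (x, y)) (frag_of (x', y')) = frag_of (x \<otimes>\<^bsub>O1\<^esub> x', y \<otimes>\<^bsub>O2\<^esub> y')"
  by (simp add: pm_def)

lemma pm_zero [simp]: "pm 0 v = 0" "pm u 0 = 0"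
  by (simp_all add: pm_def frag_extend_eq_0)

lemma pm_diff_left: "pm (a - b) v = pm a v - pm b v"
  by (simp add: pm_def frag_extend_diff)

lemma pm_diff_right: "pm v (a - b) = pm v a - pm v b"
proof -
  have "fkeys v \<subseteq> UNIV" by simp
  then show ?thesis by (induction rule: fkeys_induct) (simp_all add: pm_diff_left, simp add: pm_def frag_extend_diff)
qed

lemma pm_keys: assumes "fkeys u \<subseteq> S" "fkeys v \<subseteq> S" shows "fkeys (pm u v) \<subseteq> S"
  using assms(1)
proof (induction rule: fkeys_induct)
  case (2 a b)
  then show ?case by (simp add: pm_diff_left fkeys_diff)
next
  case (3 p)
  show ?case using assms(2)
  proof (induction rule: fkeys_induct)
    case (3 q)
    then show ?case using \<open>p \<in> S\<close> by (cases p, cases q) (simp add: pm_of)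
  qed (simp_all add: pm_diff_right fkeys_diff)
qed simp

lemmas pm_keys' = pm_keys[unfolded module_via_simps]

lemma pm_comm: assumes "fkeys u \<subseteq> S" "fkeys v \<subseteq> S" shows "pm u v = pm v u"
  using assms(1)
proof (induction rule: fkeys_induct)
  case (3 p)
  show ?case using assms(2)
  proof (induction rule: fkeys_induct)
    case (3 q)
    then show ?case using \<open>p \<in> S\<close> by (cases p, cases q) (simp add: pm_of P.m_comm Q.m_comm)
  qed (simp_all add: pm_diff_right pm_diff_left)
qed (simp_all add: pm_diff_right pm_diff_left)

lemma pm_assoc:
  assumes "fkeys u \<subseteq> S" "fkeys v \<subseteq> S" "fkeys w \<subseteq> S"
  shows "pm (pm u v) w = pm u (pm v w)"
  using assms(1)
proof (induction rule: fkeys_induct)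
  case (3 p)
  show ?case using assms(2)
  proof (induction rule: fkeys_induct)
    case (3 q)
    show ?case using assms(3)
    proof (induction rule: fkeys_induct)
      case (3 r)
      then show ?case using \<open>p \<in> S\<close> \<open>q \<in> S\<close> by (cases p, cases q, cases r) (simp add: pm_of P.m_assoc Q.m_assoc)
    qed (simp_all add: pm_diff_right)
  qed (simp_all add: pm_diff_right pm_diff_left)
qed (simp_all add: pm_diff_left)

lemma pm_one: "fkeys u \<subseteq> S \<Longrightarrow> pm (frag_of (\<one>\<^bsub>O1\<^esub>, \<one>\<^bsub>O2\<^esub>)) u = u"
proof (induction rule: fkeys_induct)
  case (3 q)
  then show ?case by (cases q) (simp add: pm_of)
qed (simp_all add: pm_diff_right)

lemma pm_add: "pm (a + b) v = pm a v + pm b v"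
  by (simp add: pm_def frag_extend_add)

text \<open>The integral monoid ring of the product of the two multiplicative monoids. Its quotient
  by the ideal \<open>J\<close> is the tensor product as a ring; the relations are those of the
  tensor product of modules, so the flatness statements apply to it directly.\<close>

definition FR :: "('b \<times> 'c \<Rightarrow>\<^sub>0 int) ring" where
  "FR = \<lparr>carrier = {z. fkeys z \<subseteq> S}, monoid.mult = pm, one = frag_of (\<one>\<^bsub>O1\<^esub>, \<one>\<^bsub>O2\<^esub>), ring.zero = 0, add = (+)\<rparr>"

sublocale FR: cring FR
proof (rule cringI)
  show "abelian_group FR"
  proof (rule abelian_groupI)
    fix x assume "x \<in> carrier FR"
    then show "\<exists>y \<in> carrier FR. y \<oplus>\<^bsub>FR\<^esub> x = \<zero>\<^bsub>FR\<^esub>" by (intro bexI[of _ "- x"]) (simp_all add: FR_def)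
  qed (simp_all add: FR_def fkeys_add ac_simps)
  show "Group.comm_monoid FR"
  proof (rule comm_monoidI)
    fix x y assume "x \<in> carrier FR" "y \<in> carrier FR"
    then show "x \<otimes>\<^bsub>FR\<^esub> y = y \<otimes>\<^bsub>FR\<^esub> x" by (simp add: FR_def pm_comm)
  qed (simp_all add: FR_def pm_keys' pm_assoc pm_one)
qed (simp add: FR_def pm_add)

lemma FR_simps: "carrier FR = {z. fkeys z \<subseteq> S}" "\<zero>\<^bsub>FR\<^esub> = 0" "x \<oplus>\<^bsub>FR\<^esub> y = x + y" "x \<otimes>\<^bsub>FR\<^esub> y = pm x y"
  "\<one>\<^bsub>FR\<^esub> = frag_of (\<one>\<^bsub>O1\<^esub>, \<one>\<^bsub>O2\<^esub>)"
  by (simp_all add: FR_def)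

lemma FR_uminus: "x \<in> carrier FR \<Longrightarrow> \<ominus>\<^bsub>FR\<^esub> x = - x"
  by (rule FR.minus_equality) (simp_all add: FR_simps)

text \<open>Multiplying a generator of \<open>J\<close> by a single pair gives a generator of the
  same kind; the rest is additivity in both factors.\<close>

lemma pm_J: assumes r: "fkeys r \<subseteq> S" and z: "z \<in> J" shows "pm r z \<in> J"
proof -
  have "z \<in> {z. pm r z \<in> J}" using z
  proof (rule J_induct)
    fix g assume g: "g \<in> gens"
    have "pm r g \<in> J" using r
    proof (induction rule: fkeys_induct)
      case (3 p)
      obtain u v where p: "p = (u, v)" "u \<in> carrier O1" "v \<in> carrier O2" using 3 by auto
      from g show ?case
      proof (cases rule: gensE)
        case (1 x x' y)
        then show ?thesis using p J_gen1[of "u \<otimes>\<^bsub>O1\<^esub> x" "u \<otimes>\<^bsub>O1\<^esub> x'" "v \<otimes>\<^bsub>O2\<^esub> y"]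
          by (simp add: pm_diff_right pm_of P.r_distr)
      next
        case (2 x y y')
        then show ?thesis using p J_gen2[of "u \<otimes>\<^bsub>O1\<^esub> x" "v \<otimes>\<^bsub>O2\<^esub> y" "v \<otimes>\<^bsub>O2\<^esub> y'"]
          by (simp add: pm_diff_right pm_of Q.r_distr)
      next
        case (3 a x y)
        then show ?thesis using p J_gen3[of a "u \<otimes>\<^bsub>O1\<^esub> x" "v \<otimes>\<^bsub>O2\<^esub> y"] ring_hom_closed[OF f1] ring_hom_closed[OF f2]
          by (simp add: pm_diff_right pm_of P.m_lcomm Q.m_lcomm)
      qed
    qed (simp_all add: pm_diff_left J_zero J_diff)
    then show "g \<in> {z. pm r z \<in> J}" by simp
  qed (simp_all add: J_zero pm_diff_right J_diff)
  then show ?thesis by simp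
qed

sublocale J: ideal J FR
proof (rule idealI[OF FR.ring_axioms])
  show "subgroup J (add_monoid FR)"
  proof (rule FR.add.subgroupI)
    show "J \<subseteq> carrier FR" using J_keys by (auto simp: FR_simps)
    show "J \<noteq> {}" using J_zero by auto
    fix a b assume a: "a \<in> J"
    show "\<ominus>\<^bsub>FR\<^esub> a \<in> J" using a FR_uminus[of a] J_keys[OF a] J_uminus by (simp add: FR_simps)
    assume "b \<in> J"
    then show "a \<oplus>\<^bsub>FR\<^esub> b \<in> J" using a J_add by (simp add: FR_simps)
  qed
  fix a x assume a: "a \<in> J" and x: "x \<in> carrier FR"
  then show "x \<otimes>\<^bsub>FR\<^esub> a \<in> J" using pm_J by (simp add: FR_simps)
  then show "a \<otimes>\<^bsub>FR\<^esub> x \<in> J" using FR.m_comm[OF x, of a] J_keys[OF a] by (simp add: FR_simps)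
qed

definition T where "T = FR Quot J"
definition cls where "cls z = J +>\<^bsub>FR\<^esub> z"
definition \<alpha>1 where "\<alpha>1 x = cls (frag_of (x, \<one>\<^bsub>O2\<^esub>))"
definition \<alpha>2 where "\<alpha>2 y = cls (frag_of (\<one>\<^bsub>O1\<^esub>, y))"

sublocale T: cring T unfolding T_def by (rule J.quotient_is_cring[OF FR.is_cring])

lemma cls_hom: "cls \<in> ring_hom FR T" unfolding T_def cls_def[abs_def] by (rule J.rcos_ring_hom)

lemma cls_closed: "fkeys z \<subseteq> S \<Longrightarrow> cls z \<in> carrier T" using ring_hom_closed[OF cls_hom] by (simp add: FR_simps)

lemma carrier_T: "carrier T = cls ` {z. fkeys z \<subseteq> S}"
  unfolding T_def cls_def by (auto simp: FactRing_def A_RCOSETS_def' FR_simps)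

lemma cls_add: "fkeys z \<subseteq> S \<Longrightarrow> fkeys w \<subseteq> S \<Longrightarrow> cls (z + w) = cls z \<oplus>\<^bsub>T\<^esub> cls w"
  using ring_hom_add[OF cls_hom, of z w] by (simp add: FR_simps)

lemma cls_pm: "fkeys z \<subseteq> S \<Longrightarrow> fkeys w \<subseteq> S \<Longrightarrow> cls (pm z w) = cls z \<otimes>\<^bsub>T\<^esub> cls w"
  using ring_hom_mult[OF cls_hom, of z w] by (simp add: FR_simps)

lemma cls_zero_iff: assumes "fkeys z \<subseteq> S" shows "cls z = \<zero>\<^bsub>T\<^esub> \<longleftrightarrow> z \<in> J"
proof -
  have z: "z \<in> carrier FR" using assms by (simp add: FR_simps)
  have "J +>\<^bsub>FR\<^esub> z = J \<longleftrightarrow> z \<in> J" using J.rcos_const_imp_mem[OF z] J.a_rcos_const by blast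
  then show ?thesis by (simp add: T_def cls_def FactRing_def)
qed

lemma cls_eqI: assumes "fkeys z \<subseteq> S" "fkeys w \<subseteq> S" "z - w \<in> J" shows "cls z = cls w"
proof -
  have "cls z = cls ((z - w) + w)" by simp
  also have "\<dots> = cls (z - w) \<oplus>\<^bsub>T\<^esub> cls w" by (rule cls_add[OF fkeys_diff[OF assms(1,2)] assms(2)])
  also have "\<dots> = cls w" using assms cls_zero_iff[OF fkeys_diff[OF assms(1,2)]] cls_closed by simp
  finally show ?thesis .
qed

lemma \<alpha>_closed: "x \<in> carrier O1 \<Longrightarrow> \<alpha>1 x \<in> carrier T" "y \<in> carrier O2 \<Longrightarrow> \<alpha>2 y \<in> carrier T"
  by (simp_all add: \<alpha>1_def \<alpha>2_def cls_closed)

lemma cls_frag: "x \<in> carrier O1 \<Longrightarrow> y \<in> carrier O2 \<Longrightarrow> cls (frag_of (x, y)) = \<alpha>1 x \<otimes>\<^bsub>T\<^esub> \<alpha>2 y"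
  using cls_pm[of "frag_of (x, \<one>\<^bsub>O2\<^esub>)" "frag_of (\<one>\<^bsub>O1\<^esub>, y)"] by (simp add: \<alpha>1_def \<alpha>2_def pm_of)

lemma \<alpha>1_hom: "\<alpha>1 \<in> ring_hom O1 T"
proof (rule ring_hom_memI)
  fix x y assume xy: "x \<in> carrier O1" "y \<in> carrier O1"
  show "\<alpha>1 (x \<otimes>\<^bsub>O1\<^esub> y) = \<alpha>1 x \<otimes>\<^bsub>T\<^esub> \<alpha>1 y"
    using cls_pm[of "frag_of (x, \<one>\<^bsub>O2\<^esub>)" "frag_of (y, \<one>\<^bsub>O2\<^esub>)"] xy by (simp add: \<alpha>1_def pm_of)
  have "\<alpha>1 (x \<oplus>\<^bsub>O1\<^esub> y) = cls (frag_of (x, \<one>\<^bsub>O2\<^esub>) + frag_of (y, \<one>\<^bsub>O2\<^esub>))" unfolding \<alpha>1_def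
    by (rule cls_eqI) (use xy J_gen1[of x y "\<one>\<^bsub>O2\<^esub>"] in \<open>simp_all add: fkeys_add algebra_simps\<close>)
  then show "\<alpha>1 (x \<oplus>\<^bsub>O1\<^esub> y) = \<alpha>1 x \<oplus>\<^bsub>T\<^esub> \<alpha>1 y" using xy by (simp add: \<alpha>1_def cls_add)
qed (rule \<alpha>_closed(1), assumption, simp add: \<alpha>1_def ring_hom_one[OF cls_hom, unfolded FR_simps])

lemma \<alpha>2_hom: "\<alpha>2 \<in> ring_hom O2 T"
proof (rule ring_hom_memI)
  fix x y assume xy: "x \<in> carrier O2" "y \<in> carrier O2"
  show "\<alpha>2 (x \<otimes>\<^bsub>O2\<^esub> y) = \<alpha>2 x \<otimes>\<^bsub>T\<^esub> \<alpha>2 y"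
    using cls_pm[of "frag_of (\<one>\<^bsub>O1\<^esub>, x)" "frag_of (\<one>\<^bsub>O1\<^esub>, y)"] xy by (simp add: \<alpha>2_def pm_of)
  have "\<alpha>2 (x \<oplus>\<^bsub>O2\<^esub> y) = cls (frag_of (\<one>\<^bsub>O1\<^esub>, x) + frag_of (\<one>\<^bsub>O1\<^esub>, y))" unfolding \<alpha>2_def
    by (rule cls_eqI) (use xy J_gen2[of "\<one>\<^bsub>O1\<^esub>" x y] in \<open>simp_all add: fkeys_add algebra_simps\<close>)
  then show "\<alpha>2 (x \<oplus>\<^bsub>O2\<^esub> y) = \<alpha>2 x \<oplus>\<^bsub>T\<^esub> \<alpha>2 y" using xy by (simp add: \<alpha>2_def cls_add)
qed (rule \<alpha>_closed(2), assumption, simp add: \<alpha>2_def ring_hom_one[OF cls_hom, unfolded FR_simps])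

lemma \<alpha>_compat: "a \<in> carrier A \<Longrightarrow> \<alpha>1 (f1 a) = \<alpha>2 (f2 a)"
  unfolding \<alpha>1_def \<alpha>2_def using ring_hom_closed[OF f1] ring_hom_closed[OF f2] J_gen3[of a "\<one>\<^bsub>O1\<^esub>" "\<one>\<^bsub>O2\<^esub>"]
  by (intro cls_eqI) simp_all

lemma T_induct:
  assumes c: "c \<in> carrier T" and z: "R \<zero>\<^bsub>T\<^esub>" and d: "\<And>a b. a \<in> carrier T \<Longrightarrow> b \<in> carrier T \<Longrightarrow> R a \<Longrightarrow> R b \<Longrightarrow> R (a \<ominus>\<^bsub>T\<^esub> b)"
    and g: "\<And>x y. x \<in> carrier O1 \<Longrightarrow> y \<in> carrier O2 \<Longrightarrow> R (\<alpha>1 x \<otimes>\<^bsub>T\<^esub> \<alpha>2 y)"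
  shows "R c"
proof -
  obtain w where w: "fkeys w \<subseteq> S" "c = cls w" using c carrier_T by auto
  have "R (cls w)" using w(1)
  proof (induction rule: fkeys_induct)
    case 1
    show ?case using z cls_zero_iff[of 0] J_zero by simp
  next
    case (2 a b)
    have "cls a = cls ((a - b) + b)" by simp
    also have "\<dots> = cls (a - b) \<oplus>\<^bsub>T\<^esub> cls b" by (rule cls_add[OF fkeys_diff]) (use 2 in simp_all)
    finally have "cls (a - b) = cls a \<ominus>\<^bsub>T\<^esub> cls b" using cls_closed[OF fkeys_diff[OF 2(1,2)]] cls_closed[OF 2(2)]
      by (simp add: T.minus_eq T.a_assoc T.r_neg)
    then show ?case using d[OF cls_closed[OF 2(1)] cls_closed[OF 2(2)] 2(3,4)] by simp
  next
    case (3 p)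
    then show ?case using g cls_frag by (cases p) simp
  qed
  then show ?thesis using w(2) by simp
qed

text \<open>Pure tensors are few and generate the ring, so the small hull of the set of pure tensors
  is everything.\<close>

lemma T_small:
  assumes k: "infinite (UNIV :: 'k set)" and s: "|carrier O1| \<le>o |UNIV :: 'k set|" "|carrier O2| \<le>o |UNIV :: 'k set|"
  shows "|carrier T| \<le>o |UNIV :: 'k set|"
proof -
  let ?G = "(\<lambda>(x, y). \<alpha>1 x \<otimes>\<^bsub>T\<^esub> \<alpha>2 y) ` (carrier O1 \<times> carrier O2)"
  have "|?G| \<le>o |UNIV :: 'k set|"
    by (rule ordLeq_transitive[OF card_of_image card_of_Times_ordLeq_infinite[OF k s]])
  then have h: "|ring_hull T ?G| \<le>o |UNIV :: 'k set|" by (rule ring_hull_small[OF k])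
  have "c \<in> ring_hull T ?G" if "c \<in> carrier T" for c
    using that
  proof (rule T_induct)
    fix x y assume "x \<in> carrier O1" "y \<in> carrier O2"
    then have "\<alpha>1 x \<otimes>\<^bsub>T\<^esub> \<alpha>2 y \<in> ?G" by force
    then show "\<alpha>1 x \<otimes>\<^bsub>T\<^esub> \<alpha>2 y \<in> ring_hull T ?G" by (rule subsetD[OF ring_hull_base])
  qed (simp_all add: ring_hull_closed T.minus_eq)
  then have "carrier T \<subseteq> ring_hull T ?G" by blast
  from ordLeq_transitive[OF card_of_mono1[OF this] h] show ?thesis .
qed

text \<open>The additive map on formal sums with \<gamma>1(x) \<gamma>2(y) as values is
  multiplicative and kills the generators of \<open>J\<close>; the balancing relations use the
  compatibility \<open>c\<close> over \<open>A\<close>. It yields the map from the tensor product to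
  a local ring of the test scheme.\<close>

lemma universal:
  fixes L :: "'l ring"
  assumes L: "cring L" and g1: "\<gamma>1 \<in> ring_hom O1 L" and g2: "\<gamma>2 \<in> ring_hom O2 L" and c: "\<And>a. a \<in> carrier A \<Longrightarrow> \<gamma>1 (f1 a) = \<gamma>2 (f2 a)"
  shows "\<exists>\<chi> \<in> ring_hom T L. (\<forall>x \<in> carrier O1. \<chi> (\<alpha>1 x) = \<gamma>1 x) \<and> (\<forall>y \<in> carrier O2. \<chi> (\<alpha>2 y) = \<gamma>2 y)"
proof -
  interpret L: cring L by fact
  interpret g1: ring_hom_cring O1 L \<gamma>1 by (rule ring_hom_cringI2[OF P.is_cring L g1])
  interpret g2: ring_hom_cring O2 L \<gamma>2 by (rule ring_hom_cringI2[OF Q.is_cring L g2])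
  let ?f = "\<lambda>(x, y). \<gamma>1 x \<otimes>\<^bsub>L\<^esub> \<gamma>2 y"
  have "?f ` S \<subseteq> carrier L" by auto
  from L.add.free_Abelian_group_universal[OF this]
  obtain h where h: "h \<in> hom FA (add_monoid L)" and hf: "\<And>p. p \<in> S \<Longrightarrow> h (frag_of p) = ?f p" by blast
  have hadd: "h (a + b) = h a \<oplus>\<^bsub>L\<^esub> h b" if "fkeys a \<subseteq> S" "fkeys b \<subseteq> S" for a b
    using hom_mult[OF h, of a b] that by simp
  have hc: "h a \<in> carrier L" if "fkeys a \<subseteq> S" for a using hom_in_carrier[OF h, of a] that by simp
  have h0: "h 0 = \<zero>\<^bsub>L\<^esub>" using hadd[of 0 0] hc[of 0] by (simp add: L.add.r_cancel_one')
  have hd: "h (a - b) = h a \<ominus>\<^bsub>L\<^esub> h b" if a: "fkeys a \<subseteq> S" "fkeys b \<subseteq> S" for a b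
  proof -
    have "h a = h ((a - b) + b)" by simp
    also have "\<dots> = h (a - b) \<oplus>\<^bsub>L\<^esub> h b" by (rule hadd[OF fkeys_diff[OF a] a(2)])
    finally show ?thesis using hc[OF a(2)] hc[OF fkeys_diff[OF a]] by (simp add: L.minus_eq L.a_assoc L.r_neg)
  qed
  have hp: "h (pm u v) = h u \<otimes>\<^bsub>L\<^esub> h v" if u: "fkeys u \<subseteq> S" and v: "fkeys v \<subseteq> S" for u v
    using u
  proof (induction rule: fkeys_induct)
    case 1
    show ?case using h0 hc[OF v] by simp
  next
    case (2 a b)
    then show ?case using hc[of a] hc[of b] hc[OF v] pm_keys v by (simp add: pm_diff_left hd L.minus_eq L.l_distr L.l_minus)
  next
    case (3 p)
    then have p: "fkeys (frag_of p) \<subseteq> S" by simp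
    show ?case using v
    proof (induction rule: fkeys_induct)
      case 1
      show ?case using h0 hc[OF p] by simp
    next
      case (2 a b)
      then show ?case using hc[of a] hc[of b] hc[OF p] pm_keys[OF p] by (simp add: pm_diff_right hd L.minus_eq L.r_distr L.r_minus)
    next
      case (3 q)
      then show ?case using \<open>p \<in> S\<close> by (cases p, cases q) (simp add: pm_of hf L.m_ac)
    qed
  qed
  have hom: "h \<in> ring_hom FR L"
    by (rule ring_hom_memI) (simp_all add: FR_simps hc hp hadd hf)
  have J0: "h z = \<zero>\<^bsub>L\<^esub>" if "z \<in> J" for z
  proof -
    have "z \<in> {z \<in> carrier FR. h z = \<zero>\<^bsub>L\<^esub>}" using that
    proof (rule J_induct)
      show "0 \<in> {z \<in> carrier FR. h z = \<zero>\<^bsub>L\<^esub>}" using h0 by (simp add: FR_simps)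
      fix g assume g: "g \<in> gens"
      from J_keys[OF J_gens[OF g]] have gk: "g \<in> carrier FR" by (simp add: FR_simps)
      from g show "g \<in> {z \<in> carrier FR. h z = \<zero>\<^bsub>L\<^esub>}"
      proof (cases rule: gensE)
        case (1 x x' y)
        then have "h g = \<zero>\<^bsub>L\<^esub>" by (simp add: hd fkeys_diff hf L.minus_eq L.l_distr L.r_neg L.a_ac L.r_neg1 L.r_neg2)
        then show ?thesis using gk by simp
      next
        case (2 x y y')
        then have "h g = \<zero>\<^bsub>L\<^esub>" by (simp add: hd fkeys_diff hf L.minus_eq L.r_distr L.r_neg L.a_ac L.r_neg1 L.r_neg2)
        then show ?thesis using gk by simp
      next
        case (3 a x y)
        then have "h g = \<zero>\<^bsub>L\<^esub>" using ring_hom_closed[OF f1] ring_hom_closed[OF f2] g1.hom_closed[of x] g2.hom_closed[of y] g2.hom_closed[of "f2 a"]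
          by (simp add: hd hf c L.minus_eq L.r_neg L.m_ac)
        then show ?thesis using gk by simp
      qed
    qed (simp add: hd h0 fkeys_diff FR_simps L.minus_eq)
    then show ?thesis by simp
  qed
  obtain \<chi> where \<chi>: "\<chi> \<in> ring_hom T L" and \<chi>c: "\<forall>z \<in> carrier FR. \<chi> (cls z) = h z"
    using ideal_lift[OF J.ideal_axioms L.ring_axioms hom J0] unfolding T_def cls_def by blast
  show ?thesis
    by (rule bexI[OF _ \<chi>]) (simp add: \<alpha>1_def \<alpha>2_def \<chi>c FR_simps hf)
qed

lemma on_left_pm: "fkeys w \<subseteq> S \<Longrightarrow> on_left (\<lambda>x. e \<otimes>\<^bsub>O1\<^esub> x) w = pm (frag_of (e, \<one>\<^bsub>O2\<^esub>)) w"
proof (induction rule: fkeys_induct)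
  case (3 p)
  then show ?case by (cases p) (simp add: pm_of)
qed (simp_all add: frag_extend_diff pm_diff_right)

end

text \<open>The case of multiplications by elements of an algebra \<open>R\<close>. Here
  \<open>R\<close> has the type of the base ring, so that as a module it is admissible in
  \<open>flat_module\<close>.\<close>

lemma flat_torsion_free:
  fixes A R :: "'a ring" and N :: "('a, 'c) module"
  assumes R: "cring R" and A: "cring A" and f: "f \<in> ring_hom A R" and flat: "flat_module A N" and F: "finite F" "F \<subseteq> carrier R"
    and tf: "\<And>x. x \<in> carrier R \<Longrightarrow> (\<And>e. e \<in> F \<Longrightarrow> e \<otimes>\<^bsub>R\<^esub> x = \<zero>\<^bsub>R\<^esub>) \<Longrightarrow> x = \<zero>\<^bsub>R\<^esub>"
    and w: "fkeys w \<subseteq> carrier R \<times> carrier N" and ew: "\<And>e. e \<in> F \<Longrightarrow> on_left (\<lambda>x. e \<otimes>\<^bsub>R\<^esub> x) w \<in> tensor_rel A (module_via f R) N"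
  shows "w \<in> tensor_rel A (module_via f R) N"
proof (rule tensor_rel_torsion_free[OF flat module_via_module[OF A R f], of "(\<lambda>e x. e \<otimes>\<^bsub>R\<^esub> x) ` F"])
  interpret R: cring R by (rule R)
  show "(\<lambda>e x. e \<otimes>\<^bsub>R\<^esub> x) ` F \<subseteq> linear_maps A (module_via f R) (module_via f R)"
    using F(2) ring_hom_closed[OF f] by (auto simp: linear_maps_def R.r_distr R.m_lcomm)
qed (use F w ew tf in auto)

text \<open>The two families are cancelled separately, each by the flatness of the other factor: an
  element of \<open>G\<close> acts on \<open>O2\<close>, where it is tested against the flat module
  \<open>O1\<close>, and an element of \<open>F\<close> acts on \<open>O1\<close>, where it is
  tested against \<open>O2\<close>.\<close>

lemma tensor_torsion_free:
  fixes A O1 O2 :: "'a ring"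
  assumes "tensor_algebra A O1 O2 f1 f2"
    and flat: "flat_module A (module_via f1 O1)" "flat_module A (module_via f2 O2)"
    and F: "finite F" "F \<subseteq> carrier O1" and G: "finite G" "G \<subseteq> carrier O2"
    and tf: "\<And>x. x \<in> carrier O1 \<Longrightarrow> (\<And>e. e \<in> F \<Longrightarrow> e \<otimes>\<^bsub>O1\<^esub> x = \<zero>\<^bsub>O1\<^esub>) \<Longrightarrow> x = \<zero>\<^bsub>O1\<^esub>"
    and tg: "\<And>x. x \<in> carrier O2 \<Longrightarrow> (\<And>e. e \<in> G \<Longrightarrow> e \<otimes>\<^bsub>O2\<^esub> x = \<zero>\<^bsub>O2\<^esub>) \<Longrightarrow> x = \<zero>\<^bsub>O2\<^esub>"
    and c: "c \<in> carrier (tensor_algebra.T A O1 O2 f1 f2)"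
    and ec: "\<And>e e'. e \<in> F \<Longrightarrow> e' \<in> G \<Longrightarrow> tensor_algebra.\<alpha>1 A O1 O2 f1 f2 e \<otimes>\<^bsub>tensor_algebra.T A O1 O2 f1 f2\<^esub>
      tensor_algebra.\<alpha>2 A O1 O2 f1 f2 e' \<otimes>\<^bsub>tensor_algebra.T A O1 O2 f1 f2\<^esub> c = \<zero>\<^bsub>tensor_algebra.T A O1 O2 f1 f2\<^esub>"
  shows "c = \<zero>\<^bsub>tensor_algebra.T A O1 O2 f1 f2\<^esub>"
proof -
  interpret tensor_algebra A O1 O2 f1 f2 by fact
  interpret swap: module_pair A MQ MP by unfold_locales
  let ?flip = "\<lambda>z. frag_extend (\<lambda>(x, y). frag_of (y, x)) z"
  obtain w where w: "fkeys w \<subseteq> S" "c = cls w" using c carrier_T by auto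
  have flip_flip: "?flip (?flip v) = v" for v :: "'a \<times> 'a \<Rightarrow>\<^sub>0 int"
  proof -
    have "fkeys v \<subseteq> UNIV" by simp
    then show ?thesis
    proof (induction rule: fkeys_induct)
      case (3 p)
      show ?case by (cases p) simp
    qed (simp_all add: frag_extend_diff)
  qed
  have pm_w: "pm (frag_of (e, e')) w \<in> J" if e: "e \<in> F" "e' \<in> G" for e e'
  proof -
    have c: "e \<in> carrier O1" "e' \<in> carrier O2" using e F(2) G(2) by auto
    then have k: "fkeys (frag_of (e, e')) \<subseteq> S" by simp
    have "cls (pm (frag_of (e, e')) w) = \<zero>\<^bsub>T\<^esub>" unfolding cls_pm[OF k w(1)] cls_frag[OF c] w(2)[symmetric] by (rule ec[OF e])
    then show ?thesis using cls_zero_iff[OF pm_keys[OF k w(1)]] by simp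
  qed
  have "on_left (\<lambda>x. e \<otimes>\<^bsub>O1\<^esub> x) w \<in> J" if e: "e \<in> F" for e
  proof -
    have ec: "e \<in> carrier O1" using e F(2) by blast
    define v where "v = pm (frag_of (e, \<one>\<^bsub>O2\<^esub>)) w"
    have v: "fkeys v \<subseteq> S" unfolding v_def using pm_keys[OF _ w(1)] ec by simp
    \<comment> \<open>After exchange of the factors \<open>O2\<close> is the test module and
      \<open>O1\<close> the flat one. The vector \<open>v\<close> is already multiplied by
      \<open>e\<close>, so that a further multiplication by \<open>e'\<close> gives the product
      assumed to vanish.\<close>
    have "?flip v \<in> swap.J"
    proof (rule flat_torsion_free[OF Q.is_cring A.is_cring f2 flat(1) G tg])
      show "fkeys (?flip v) \<subseteq> carrier O2 \<times> carrier MP" by (rule fkeys_extend[OF v]) auto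
      fix e' assume e': "e' \<in> G"
      then have ec': "e' \<in> carrier O2" using G(2) by blast
      have "on_left (\<lambda>x. e' \<otimes>\<^bsub>O2\<^esub> x) (?flip v) = ?flip (pm (frag_of (\<one>\<^bsub>O1\<^esub>, e')) v)"
        using v
      proof (induction rule: fkeys_induct)
        case (3 p)
        then show ?case by (cases p) (simp add: pm_of)
      qed (simp_all add: frag_extend_diff pm_diff_right)
      also have "pm (frag_of (\<one>\<^bsub>O1\<^esub>, e')) v = pm (frag_of (e, e')) w"
        unfolding v_def using pm_assoc[OF _ _ w(1), of "frag_of (\<one>\<^bsub>O1\<^esub>, e')" "frag_of (e, \<one>\<^bsub>O2\<^esub>)"] ec ec' by (simp add: pm_of)
      finally show "on_left (\<lambda>x. e' \<otimes>\<^bsub>O2\<^esub> x) (?flip v) \<in> swap.J" using J_flip[OF pm_w[OF e e']] by simp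
    qed
    from swap.J_flip[OF this] have "v \<in> J" unfolding flip_flip .
    then show ?thesis unfolding v_def on_left_pm[OF w(1)] .
  qed
  note eJ = this
  \<comment> \<open>Now the roles are reversed: \<open>F\<close> acts on the test module
    \<open>O1\<close>, and \<open>O2\<close> is flat.\<close>
  have "w \<in> J" by (rule flat_torsion_free[OF P.is_cring A.is_cring f1 flat(2) F tf]) (assumption, assumption, use w(1) in simp, rule eJ)
  then show ?thesis unfolding w(2) cls_zero_iff[OF w(1)] .
qed

section \<open>Distinguished open sets of a scheme\<close>

definition inv_locus :: "('p, 'r) ringed_space \<Rightarrow> 'p set \<Rightarrow> 'r \<Rightarrow> 'p set" where
  "inv_locus Z V f = {v \<in> V. germ Z v V f \<in> Units (stalk Z v)}"

context chart
begin

lemma inv_locus_eq: "b \<in> carrier B \<Longrightarrow> inv_locus Z U (\<iota> b) = preim \<theta> (B.D b)"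
  using chart_unit_iff th.pt_in pts_U by (auto simp: inv_locus_def th.mem_preim B.D_def)

lemma inv_locus_open: assumes "b \<in> carrier B" shows "opn Z (inv_locus Z U (\<iota> b))"
proof -
  have "opn (Spec B) (B.D b)" using B.D_open[OF assms] by (simp add: Spec_def)
  from th.preim_open[OF this] show ?thesis unfolding inv_locus_eq[OF assms] by (simp add: opn_restr[OF U])
qed

lemma inv_locus_basis:
  assumes V: "opn Z V" "V \<subseteq> U" and z: "z \<in> V"
  obtains b where "b \<in> carrier B" "z \<in> inv_locus Z U (\<iota> b)" "inv_locus Z U (\<iota> b) \<subseteq> V"
proof -
  have zU: "z \<in> U" using z V by blast
  have "opn (restr Z U) V" using V by (simp add: opn_restr[OF U])
  from th'.preim_open[OF this] have o: "openin (zariski B) (preim \<theta>' V)" by (simp add: Spec_def)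
  have p: "pt \<theta> z \<in> B.pts" using th.pt_in[of z] zU pts_U by simp
  then have "pt \<theta> z \<in> preim \<theta>' V" using th_inv[OF zU] z by (simp add: th'.mem_preim)
  then obtain b where b: "b \<in> carrier B" "pt \<theta> z \<in> B.D b" "B.D b \<subseteq> preim \<theta>' V" by (rule B.D_basis[OF o])
  have "inv_locus Z U (\<iota> b) \<subseteq> V"
  proof
    fix v assume "v \<in> inv_locus Z U (\<iota> b)"
    then have "v \<in> preim \<theta> (B.D b)" unfolding inv_locus_eq[OF b(1)] .
    then have v: "v \<in> U" "pt \<theta> v \<in> preim \<theta>' V" using b(3) pts_U by (auto simp: th.mem_preim)
    then show "v \<in> V" using th_inv[OF v(1)] by (simp add: th'.mem_preim)
  qed
  moreover have "z \<in> inv_locus Z U (\<iota> b)" unfolding inv_locus_eq[OF b(1)] using b(2) zU pts_U by (simp add: th.mem_preim)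
  ultimately show thesis using that b(1) by blast
qed

text \<open>Quasi-compactness of \<open>d\<close> is applied to such a \<open>U\<close>: the
  preimage of an affine chart is compact.\<close>

lemma chart_compact: "compactin (top_of Z) U"
proof -
  have "compactin (top_of (Spec B)) B.pts" using B.compact_points by (simp add: Spec_def)
  from image_compactin[OF this th'.cont] have "compactin (top_of (restr Z U)) (pt \<theta>' ` B.pts)" .
  moreover have "pt \<theta>' ` B.pts = U"
  proof
    show "pt \<theta>' ` B.pts \<subseteq> U" using th'.pt_in pts_U by auto
    show "U \<subseteq> pt \<theta>' ` B.pts"
    proof
      fix z assume z: "z \<in> U"
      then have "pt \<theta> z \<in> B.pts" using th.pt_in[of z] pts_U by simp
      then show "z \<in> pt \<theta>' ` B.pts" using th_inv[OF z] by (rule_tac image_eqI[of _ _ "pt \<theta> z"]) simp_all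
    qed
  qed
  ultimately show ?thesis by (simp add: restr_def compactin_subtopology)
qed

end

section \<open>Schematic closures of quasi-compact immersions\<close>

locale qc_closure =
  fixes T1 T1c P :: "('p, 'r) ringed_space" and d dc i :: "('p, 'r, 'p, 'r) morphism"
  assumes imm: "immersion d" and dh: "d \<in> lrs_hom T1 P" and qc: "quasi_compact d"
    and clos: "schematic_closure d dc" and dch: "dc \<in> lrs_hom T1c P"
    and ih: "i \<in> lrs_hom T1 T1c" and comp: "dc \<circ>\<^sub>s i = d"
begin

lemma dc_closed: "closed_immersion dc" using clos by (simp add: schematic_closure_def)

lemma schemes: "scheme T1" "scheme T1c" "scheme P"
  using imm dc_closed lrs_homD(1,2)[OF dh] lrs_homD(1,2)[OF dch] by (simp_all add: immersion_def closed_immersion_def)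

lemma ringed: "ringed_space T1" "ringed_space T1c" "ringed_space P"
  using schemes by (simp_all add: scheme_ringed)

sublocale d: lrs_mor T1 P d by (rule lrs_morI[OF ringed(1,3) dh])
sublocale dc: lrs_mor T1c P dc by (rule lrs_morI[OF ringed(2,3) dch])
sublocale i: lrs_mor T1 T1c i by (rule lrs_morI[OF ringed(1,2) ih])

lemma pt_d: "t \<in> points T1 \<Longrightarrow> pt dc (pt i t) = pt d t"
  using pt_comp[of t i dc] lrs_homD(1)[OF ih] comp by simp

lemma ker_iff:
  assumes V: "opn P V" and s: "s \<in> secs P V"
  shows "cm dc V s = \<zero>\<^bsub>sec T1c (preim dc V)\<^esub> \<longleftrightarrow> cm d V s = \<zero>\<^bsub>sec T1 (preim d V)\<^esub>"
proof -
  have "a_kernel (sec P V) (sec T1c (preim dc V)) (cm dc V) = a_kernel (sec P V) (sec T1 (preim d V)) (cm d V)"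
    using clos V lrs_homD(1,2)[OF dh] lrs_homD(1)[OF dch] by (simp add: schematic_closure_def)
  then have "s \<in> a_kernel (sec P V) (sec T1c (preim dc V)) (cm dc V) \<longleftrightarrow> s \<in> a_kernel (sec P V) (sec T1 (preim d V)) (cm d V)" by simp
  then show ?thesis using s by (simp add: a_kernel_def')
qed

text \<open>\<open>U\<close> is an open set in which the immersion \<open>d\<close> is closed. Over
  \<open>U\<close> the closure adds no points: the section 1 on the part of \<open>U\<close> off
  \<open>T1\<close> is zero on \<open>T1\<close>, whose preimage there is empty, and hence zero on
  the closure.\<close>

lemma open_part:
  obtains U where "opn P U" "local_lift d" "preim dc U \<subseteq> pt i ` points T1" "pt d ` points T1 \<subseteq> U"
proof -
  obtain U g where U: "opn P U" and gh: "g \<in> lrs_hom T1 (restr P U)" and gc: "closed_immersion g" and dg: "d = open_incl P U \<circ>\<^sub>s g"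
    using imm lrs_homD(1,2)[OF dh] by (auto simp: immersion_def)
  have rPU: "ringed_space (restr P U)" by (rule ringed_restr[OF ringed(3) U])
  interpret g: lrs_mor T1 "restr P U" g by (rule lrs_morI[OF ringed(1) rPU gh])
  have PU: "points (restr P U) = U" by (rule points_restr[OF U])
  have ptg: "pt d t = pt g t" "pt g t \<in> U" if t: "t \<in> points T1" for t
  proof -
    show gU: "pt g t \<in> U" using g.pt_in[OF t] PU by simp
    have "pt d t = pt (open_incl P U) (pt g t)" unfolding dg by (rule pt_comp) (simp add: g.src_tgt t)
    then show "pt d t = pt g t" using gU PU by (simp add: open_incl_def)
  qed
  have pre: "preim d W = preim g W" for W unfolding preim_def by (auto simp: d.src_tgt g.src_tgt ptg)
  have lift: "local_lift d"
    unfolding local_lift_def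
  proof (intro allI impI)
    fix V x s assume "opn (src d) V \<and> x \<in> V \<and> s \<in> secs (src d) V"
    then have V: "opn T1 V" "x \<in> V" "s \<in> secs T1 V" by (simp_all add: d.src_tgt)
    obtain W t where W: "opn (restr P U) W" "pt g x \<in> W" "preim g W \<subseteq> V" "t \<in> secs (restr P U) W"
      and e: "cm g W t = res T1 V (preim g W) s"
      using local_liftD[OF closed_immersion_local_lift[OF gc] g.src_tgt V] by blast
    have W': "opn P W" "W \<subseteq> U" using W(1) by (simp_all add: opn_restr[OF U])
    have t: "t \<in> secs P W" using W(4) by simp
    have "cm d W t = cm g (preim (open_incl P U) W) (cm (open_incl P U) W t)"
      unfolding dg by (rule cm_comp) (use W' t in \<open>simp_all add: open_incl_def\<close>)
    also have "\<dots> = cm g W t" using W' t d.Y.res_id[OF W'(1) t]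
      unfolding preim_open_incl[OF ringed(3) U] by (simp add: open_incl_def Int_absorb2)
    finally have "cm d W t = res T1 V (preim d W) s" using e pre by simp
    moreover have "pt d x \<in> W" using ptg(1)[of x] W(2) V openin_subset by fastforce
    ultimately show "\<exists>W t. opn (tgt d) W \<and> pt d x \<in> W \<and> preim d W \<subseteq> V \<and> t \<in> secs (tgt d) W \<and>
          cm d W t = res (src d) V (preim d W) s"
      using W' t W(3) pre by (intro exI[of _ W] exI[of _ t]) (simp add: d.src_tgt)
  qed
  have cl: "closedin (top_of (restr P U)) (pt g ` points T1)" using gc by (simp add: closed_immersion_def g.src_tgt)
  have "preim dc U \<subseteq> pt i ` points T1"
  proof
    fix z assume "z \<in> preim dc U"
    then have z: "z \<in> points T1c" "pt dc z \<in> U" by (simp_all add: dc.mem_preim)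
    have "pt dc z \<in> pt d ` points T1"
    proof (rule ccontr)
      assume n: "pt dc z \<notin> pt d ` points T1"
      let ?V = "U - pt g ` points T1"
      have "opn (restr P U) ?V" using cl PU by (simp add: closedin_def)
      then have V: "opn P ?V" by (simp add: opn_restr[OF U])
      have "pt g ` points T1 = pt d ` points T1" by (rule image_cong) (simp_all add: ptg)
      then have zV: "pt dc z \<in> ?V" using n z by simp
      have e: "preim d ?V = {}" unfolding pre by (auto simp: g.mem_preim)
      interpret PV: cring "sec P ?V" by (rule d.Y.sec_cring[OF V])
      have "cm d ?V \<one>\<^bsub>sec P ?V\<^esub> = \<zero>\<^bsub>sec T1 (preim d ?V)\<^esub>"
        by (rule d.X.sec_zeroI[OF d.preim_open[OF V] d.cm_closed[OF V PV.one_closed]]) (use e in simp)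
      then have "cm dc ?V \<one>\<^bsub>sec P ?V\<^esub> = \<zero>\<^bsub>sec T1c (preim dc ?V)\<^esub>" using ker_iff[OF V PV.one_closed] by simp
      moreover have "cm dc ?V \<one>\<^bsub>sec P ?V\<^esub> = \<one>\<^bsub>sec T1c (preim dc ?V)\<^esub>" by (rule ring_hom_one[OF dc.cm_hom[OF V]])
      moreover have zp: "z \<in> preim dc ?V" using z zV by (simp add: dc.mem_preim)
      ultimately have "\<one>\<^bsub>stalk T1c z\<^esub> = \<zero>\<^bsub>stalk T1c z\<^esub>"
        using dc.X.stalk_one[OF dc.preim_open[OF V] zp] dc.X.stalk_zero[OF dc.preim_open[OF V] zp] by simp
      then show False using local_ring_nontriv[OF lrs_stalk_local[OF scheme_lrs[OF schemes(2)] z(1)]] by simp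
    qed
    then obtain t where t: "t \<in> points T1" "pt dc z = pt dc (pt i t)" using pt_d by auto
    have "z = pt i t" using inj_onD[OF closed_immersion_inj[OF dc_closed] t(2)] z(1) i.pt_in[OF t(1)] by (simp add: dc.src_tgt)
    then show "z \<in> pt i ` points T1" using t(1) by blast
  qed
  moreover have "pt d ` points T1 \<subseteq> U" using ptg by auto
  ultimately show thesis using that U lift by blast
qed

lemma d_lift: "local_lift d" by (rule open_part)

lemma dc_lift: "local_lift dc" by (rule closed_immersion_local_lift[OF dc_closed])

text \<open>Surjectivity is inherited from \<open>d\<close>. For injectivity a germ is lifted to
  \<open>P\<close>; if it dies on \<open>T1\<close>, a section representing it already dies there,
  and the ideals of \<open>T1\<close> and of its closure are the same.\<close>

lemma i_stalk_bij:
  assumes t: "t \<in> points T1"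
  shows "bij_betw (stalk_map i t) (stk T1c (pt i t)) (stk T1 t)"
proof -
  have it: "pt i t \<in> points T1c" by (rule i.pt_in[OF t])
  note h = i.stalk_map_hom[OF t]
  interpret A: cring "stalk T1c (pt i t)" by (rule dc.X.stalk_cring[OF it])
  interpret B: cring "stalk T1 t" by (rule d.X.stalk_cring[OF t])
  interpret h: ring_hom_cring "stalk T1c (pt i t)" "stalk T1 t" "stalk_map i t" by (rule ring_hom_cringI2[OF A.is_cring B.is_cring h])
  have sd: "stalk_map i t (stalk_map dc (pt i t) b) = stalk_map d t b" if "b \<in> stk P (pt d t)" for b
    using stalk_map_comp[OF ringed(1,2,3) ih dch t, of b] that by (simp add: comp pt_d[OF t])
  have "stalk_map i t ` stk T1c (pt i t) = stk T1 t"
  proof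
    show "stalk_map i t ` stk T1c (pt i t) \<subseteq> stk T1 t" using h.hom_closed by auto
    show "stk T1 t \<subseteq> stalk_map i t ` stk T1c (pt i t)"
    proof
      fix y assume "y \<in> stk T1 t"
      then obtain b where b: "b \<in> stk P (pt d t)" "stalk_map d t b = y"
        by (rule local_lift_stalk_surj[OF ringed(1,3) dh d_lift t])
      then show "y \<in> stalk_map i t ` stk T1c (pt i t)"
        using sd[OF b(1)] dc.stalk_map_closed[OF it, of b] by (intro image_eqI[of _ _ "stalk_map dc (pt i t) b"]) (simp_all add: pt_d[OF t])
    qed
  qed
  moreover have "a = \<zero>\<^bsub>stalk T1c (pt i t)\<^esub>" if a: "a \<in> stk T1c (pt i t)" "stalk_map i t a = \<zero>\<^bsub>stalk T1 t\<^esub>" for a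
  proof -
    obtain b where b: "b \<in> stk P (pt dc (pt i t))" "stalk_map dc (pt i t) b = a"
      by (rule local_lift_stalk_surj[OF ringed(2,3) dch dc_lift it a(1)])
    have b': "b \<in> stk P (pt d t)" using b(1) by (simp add: pt_d[OF t])
    have "stalk_map d t b = \<zero>\<^bsub>stalk T1 t\<^esub>" using sd[OF b'] b(2) a(2) by simp
    then obtain V s where V: "opn P V" "pt d t \<in> V" "s \<in> secs P V" "b = germ P (pt d t) V s" "cm d V s = \<zero>\<^bsub>sec T1 (preim d V)\<^esub>"
      by (rule local_lift_stalk_ker[OF ringed(1,3) dh d_lift t b'])
    have V': "pt dc (pt i t) \<in> V" using V(2) by (simp add: pt_d[OF t])
    have "a = germ T1c (pt i t) (preim dc V) (cm dc V s)"
      using dc.stalk_map_germ[OF it V(1) V' V(3)] b(2) V(4) by (simp add: pt_d[OF t])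
    also have "cm dc V s = \<zero>\<^bsub>sec T1c (preim dc V)\<^esub>" using ker_iff[OF V(1,3)] V(5) by simp
    also have "germ T1c (pt i t) (preim dc V) \<zero>\<^bsub>sec T1c (preim dc V)\<^esub> = \<zero>\<^bsub>stalk T1c (pt i t)\<^esub>"
      by (rule dc.X.stalk_zero[symmetric, OF dc.preim_open[OF V(1)]]) (use it V' in \<open>simp add: dc.mem_preim\<close>)
    finally show ?thesis .
  qed
  then have "inj_on (stalk_map i t) (stk T1c (pt i t))"
    by (intro inj_onI) (metis A.minus_closed A.r_right_minus_eq B.r_right_minus_eq h.hom_closed h.hom_sub)
  ultimately show ?thesis by (simp add: bij_betw_def)
qed

end

section \<open>Powers of cutting functions, and torsion in the local rings of the closure\<close>

lemma hom_pow:
  assumes h: "h \<in> ring_hom R S" and R: "ring R" and S: "ring S" and a: "a \<in> carrier R"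
  shows "h (a [^]\<^bsub>R\<^esub> (n::nat)) = h a [^]\<^bsub>S\<^esub> n"
proof -
  interpret ring_hom_ring R S h by (rule ring_hom_ringI2[OF R S h])
  show ?thesis using a by (rule hom_nat_pow)
qed

lemma (in monoid) Units_nat_pow: "a \<in> Units G \<Longrightarrow> a [^] (n::nat) \<in> Units G"
  by (induction n) simp_all

lemma (in cring) unit_cancel_zero: assumes u: "u \<in> Units R" and x: "x \<in> carrier R" "u \<otimes> x = \<zero>" shows "x = \<zero>"
proof -
  have uc: "u \<in> carrier R" using u by (rule Units_closed)
  have "x = (inv u \<otimes> u) \<otimes> x" using Units_l_inv[OF u] x(1) by simp
  also have "\<dots> = inv u \<otimes> \<zero>" using m_assoc[OF Units_inv_closed[OF u] uc x(1)] x(2) by simp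
  finally show ?thesis using u by simp
qed

lemma (in rspace) germ_pow_mult:
  assumes V: "opn X V" and W: "opn X W" "W \<subseteq> V" "v \<in> W" and f: "f \<in> secs X V" and s: "s \<in> secs X W"
  shows "germ X v W (res X V W f [^]\<^bsub>sec X W\<^esub> (n::nat) \<otimes>\<^bsub>sec X W\<^esub> s) = germ X v V f [^]\<^bsub>stalk X v\<^esub> n \<otimes>\<^bsub>stalk X v\<^esub> germ X v W s"
proof -
  have vX: "v \<in> points X" using opn_sub[OF W(1)] W(3) by blast
  note g = germ_hom[OF W(1,3)]
  note rf = res_closed[OF V W(1,2) f]
  interpret A: cring "sec X W" by (rule sec_cring[OF W(1)])
  interpret B: cring "stalk X v" by (rule stalk_cring[OF vX])
  show ?thesis
    using ring_hom_mult[OF g A.nat_pow_closed[OF rf] s] hom_pow[OF g A.ring_axioms B.ring_axioms rf]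
      germ_res[OF V W(1,3,2) f] by simp
qed

context qc_closure
begin

abbreviation pull where "pull z V f \<equiv> stalk_map dc z (germ P (pt dc z) V f)"

text \<open>
  The sections \<open>f \<in> F\<close> cut out an open set that contains the image of \<open>T1\<close> near \<open>pt dc z\<close> and lies
  in the open set in which \<open>T1\<close> is closed. Quasi-compactness of \<open>d\<close> makes \<open>F\<close> finite.
\<close>

definition cutting where
  "cutting z V F \<longleftrightarrow> opn P V \<and> pt dc z \<in> V \<and> finite F \<and> F \<subseteq> secs P V \<and>
     pt d ` points T1 \<inter> V \<subseteq> (\<Union>f \<in> F. inv_locus P V f) \<and> (\<forall>f \<in> F. preim dc (inv_locus P V f) \<subseteq> pt i ` points T1)"

lemma pull_closed: "z \<in> points T1c \<Longrightarrow> cutting z V F \<Longrightarrow> f \<in> F \<Longrightarrow> pull z V f \<in> stk T1c z"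
  by (rule dc.stalk_map_closed[OF _ d.Y.germ_in_stalk]) (auto simp: cutting_def)

text \<open>The image of \<open>T1\<close> in an affine chart \<open>V\<close> is compact, so
  finitely many distinguished open sets inside the open part of \<open>P\<close> cover it. Over each
  of them the closure has only points of \<open>T1\<close>.\<close>

lemma cutting_sections:
  assumes z: "z \<in> points T1c"
  obtains V F where "cutting z V F"
proof -
  obtain U where O: "opn P U" "preim dc U \<subseteq> pt i ` points T1" "pt d ` points T1 \<subseteq> U" by (rule open_part)
  obtain V B \<theta> \<theta>' where ch: "chart P B V \<theta> \<theta>'" and zV: "pt dc z \<in> V" by (rule scheme_chart[OF schemes(3) dc.pt_in[OF z]])
  interpret chart P B V \<theta> \<theta>' by (rule ch)
  let ?B = "{b \<in> carrier B. inv_locus P V (\<iota> b) \<subseteq> U}"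
  let ?K = "pt d ` preim d V"
  have V: "opn P V" by (rule U)
  have "compactin (top_of T1) (preim d V)" using qc chart_compact V by (simp add: quasi_compact_def d.src_tgt)
  from image_compactin[OF this d.cont] have K: "compactin (top_of P) ?K" .
  have VU: "opn P (V \<inter> U)" using V O(1) by (rule openin_Int)
  have "?K \<subseteq> \<Union>((\<lambda>b. inv_locus P V (\<iota> b)) ` ?B)"
  proof
    fix v assume "v \<in> ?K"
    then have v: "v \<in> V \<inter> U" using O(3) by (auto simp: d.mem_preim)
    obtain b where "b \<in> carrier B" "v \<in> inv_locus P V (\<iota> b)" "inv_locus P V (\<iota> b) \<subseteq> V \<inter> U"
      by (rule inv_locus_basis[OF VU _ v]) blast+
    then show "v \<in> \<Union>((\<lambda>b. inv_locus P V (\<iota> b)) ` ?B)" by blast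
  qed
  moreover have "\<forall>W \<in> (\<lambda>b. inv_locus P V (\<iota> b)) ` ?B. opn P W" using inv_locus_open by blast
  ultimately obtain \<F> where F: "finite \<F>" "\<F> \<subseteq> (\<lambda>b. inv_locus P V (\<iota> b)) ` ?B" "?K \<subseteq> \<Union>\<F>"
    using K unfolding compactin_def by meson
  then obtain G where G: "G \<subseteq> ?B" "finite G" "\<F> = (\<lambda>b. inv_locus P V (\<iota> b)) ` G" by (meson finite_subset_image)
  have "pt d ` points T1 \<inter> V \<subseteq> ?K" by (auto simp: d.mem_preim)
  then have "pt d ` points T1 \<inter> V \<subseteq> (\<Union>f \<in> \<iota> ` G. inv_locus P V f)" using F(3) G(3) by auto
  moreover have "preim dc (inv_locus P V f) \<subseteq> pt i ` points T1" if "f \<in> \<iota> ` G" for f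
    using that G(1) O(2) by (fastforce simp: dc.mem_preim)
  moreover have "\<iota> ` G \<subseteq> secs P V" using G(1) \<iota>_closed by auto
  ultimately have "cutting z V (\<iota> ` G)" using V zV G(2) by (simp add: cutting_def)
  then show thesis by (rule that)
qed

text \<open>Represent \<open>x\<close> by a section \<open>s\<close> on \<open>P\<close>. The
  products f^N s vanish on the closure near the point, hence on \<open>T1\<close>, where at each
  point some \<open>f\<close> is invertible. So \<open>s\<close> vanishes on \<open>T1\<close>, and
  by the definition of the schematic closure on \<open>T1c\<close>.\<close>

lemma cutting_torsion_free:
  assumes z: "z \<in> points T1c" and cut: "cutting z V F" and x: "x \<in> stk T1c z"
    and fx: "\<And>f. f \<in> F \<Longrightarrow> pull z V f [^]\<^bsub>stalk T1c z\<^esub> (N::nat) \<otimes>\<^bsub>stalk T1c z\<^esub> x = \<zero>\<^bsub>stalk T1c z\<^esub>"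
  shows "x = \<zero>\<^bsub>stalk T1c z\<^esub>"
proof -
  have V: "opn P V" "pt dc z \<in> V" and F: "finite F" "F \<subseteq> secs P V" using cut by (simp_all add: cutting_def)
  let ?y = "pt dc z"
  obtain b where b: "b \<in> carrier (stalk P ?y)" "stalk_map dc z b = x"
    by (rule local_lift_stalk_surj[OF ringed(2,3) dch dc_lift z x])
  obtain W s where W: "opn P W" "?y \<in> W" "W \<subseteq> V" "s \<in> secs P W" "b = germ P ?y W s"
    by (rule d.Y.stalkE_sub[OF b(1) V])
  interpret PW: cring "sec P W" by (rule d.Y.sec_cring[OF W(1)])
  interpret Py: cring "stalk P ?y" by (rule d.Y.stalk_cring[OF dc.pt_in[OF z]])
  interpret Tz: cring "stalk T1c z" by (rule dc.X.stalk_cring[OF z])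
  define u where "u f = res P V W f [^]\<^bsub>sec P W\<^esub> N \<otimes>\<^bsub>sec P W\<^esub> s" for f
  have uc: "u f \<in> secs P W" if "f \<in> F" for f
    unfolding u_def using d.Y.res_closed[OF V(1) W(1,3)] F(2) that W(4) by blast
  have ug: "germ P v W (u f) = germ P v V f [^]\<^bsub>stalk P v\<^esub> N \<otimes>\<^bsub>stalk P v\<^esub> germ P v W s" if "f \<in> F" "v \<in> W" for f v
    unfolding u_def by (rule d.Y.germ_pow_mult[OF V(1) W(1,3) that(2) _ W(4)]) (use F(2) that in blast)
  have "\<exists>W'. opn P W' \<and> ?y \<in> W' \<and> W' \<subseteq> W \<and> cm d W' (res P W W' (u f)) = \<zero>\<^bsub>sec T1 (preim d W')\<^esub>" if f: "f \<in> F" for f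
  proof -
    have fc: "germ P ?y V f \<in> carrier (stalk P ?y)" by (rule d.Y.germ_in_stalk[OF V]) (use F(2) f in blast)
    have g: "germ P ?y W (u f) \<in> carrier (stalk P ?y)" by (rule d.Y.germ_in_stalk[OF W(1,2) uc[OF f]])
    have "stalk_map dc z (germ P ?y W (u f)) = \<zero>\<^bsub>stalk T1c z\<^esub>"
      unfolding ug[OF f W(2)]
      using ring_hom_mult[OF dc.stalk_map_hom[OF z] Py.nat_pow_closed[OF fc] b(1)]
        hom_pow[OF dc.stalk_map_hom[OF z] Py.ring_axioms Tz.ring_axioms fc] fx[OF f] b(2) W(5) by simp
    then obtain V' s' where V': "opn P V'" "?y \<in> V'" "s' \<in> secs P V'" "germ P ?y W (u f) = germ P ?y V' s'"
      "cm dc V' s' = \<zero>\<^bsub>sec T1c (preim dc V')\<^esub>"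
      by (rule local_lift_stalk_ker[OF ringed(2,3) dch dc_lift z g])
    obtain W' where W': "opn P W'" "?y \<in> W'" "W' \<subseteq> W \<inter> V'" "res P W W' (u f) = res P V' W' s'"
      using d.Y.germ_eqD[OF W(1,2) uc[OF f] V'(1-4)] by blast
    have "cm d V' s' = \<zero>\<^bsub>sec T1 (preim d V')\<^esub>" using ker_iff[OF V'(1,3)] V'(5) by simp
    then have "cm d W' (res P V' W' s') = \<zero>\<^bsub>sec T1 (preim d W')\<^esub>"
      using d.cm_res[OF V'(1) W'(1) _ V'(3)] d.X.res_zero[OF d.preim_open[OF V'(1)] d.preim_open[OF W'(1)] d.preim_mono] W'(3) by simp
    then show ?thesis using W' by auto
  qed
  then have "\<forall>f \<in> F. \<exists>W'. opn P W' \<and> ?y \<in> W' \<and> W' \<subseteq> W \<and> cm d W' (res P W W' (u f)) = \<zero>\<^bsub>sec T1 (preim d W')\<^esub>" by simp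
  from bchoice[OF this] obtain W' where W'': "\<forall>f \<in> F. opn P (W' f) \<and> ?y \<in> W' f \<and> W' f \<subseteq> W \<and>
      cm d (W' f) (res P W (W' f) (u f)) = \<zero>\<^bsub>sec T1 (preim d (W' f))\<^esub>" ..
  have W': "opn P (W' f) \<and> ?y \<in> W' f \<and> W' f \<subseteq> W \<and>
      cm d (W' f) (res P W (W' f) (u f)) = \<zero>\<^bsub>sec T1 (preim d (W' f))\<^esub>" if "f \<in> F" for f
    using W'' that by (rule bspec)
  \<comment> \<open>One neighbourhood for all products; it is open because \<open>F\<close> is
    finite.\<close>
  define Y where "Y = \<Inter>(insert W (W' ` F))"
  have Y: "opn P Y" unfolding Y_def by (rule openin_Inter) (use F(1) W W' in auto)
  have yY: "?y \<in> Y" unfolding Y_def using W W' by auto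
  have YW: "Y \<subseteq> W" "\<And>f. f \<in> F \<Longrightarrow> Y \<subseteq> W' f" unfolding Y_def by auto
  note sY = d.Y.res_closed[OF W(1) Y YW(1) W(4)]
  have "cm d Y (res P W Y s) = \<zero>\<^bsub>sec T1 (preim d Y)\<^esub>"
  proof (rule d.X.sec_zeroI[OF d.preim_open[OF Y] d.cm_closed[OF Y sY]])
    fix t assume "t \<in> preim d Y"
    then have t: "t \<in> points T1" "pt d t \<in> Y" by (simp_all add: d.mem_preim)
    then have tW: "pt d t \<in> W" and tV: "pt d t \<in> V" using YW W(3) by auto
    interpret S: cring "stalk T1 t" by (rule d.X.stalk_cring[OF t(1)])
    interpret Q: cring "stalk P (pt d t)" by (rule d.Y.stalk_cring[OF d.pt_in[OF t(1)]])
    note h = d.stalk_map_hom[OF t(1)]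
    \<comment> \<open>The cutting functions cover \<open>T1\<close> inside \<open>V\<close>, so one
      of them is a unit at this point and its power can be cancelled.\<close>
    obtain f where f: "f \<in> F" "germ P (pt d t) V f \<in> Units (stalk P (pt d t))" using cut t(1) tV unfolding cutting_def inv_locus_def by blast
    note gs = d.Y.germ_in_stalk[OF W(1) tW W(4)]
    define \<eta> where "\<eta> = stalk_map d t (germ P (pt d t) W s)"
    have \<eta>c: "\<eta> \<in> stk T1 t" unfolding \<eta>_def by (rule d.stalk_map_closed[OF t(1) gs])
    have tf: "pt d t \<in> W' f" using t(2) YW(2)[OF f(1)] by blast
    have Wf: "opn P (W' f)" "W' f \<subseteq> W" using W'[OF f(1)] by auto
    have "stalk_map d t (germ P (pt d t) W (u f)) = germ T1 t (preim d (W' f)) (cm d (W' f) (res P W (W' f) (u f)))"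
      using d.stalk_map_germ[OF t(1) Wf(1) tf d.Y.res_closed[OF W(1) Wf uc[OF f(1)]]] d.Y.germ_res[OF W(1) Wf(1) tf Wf(2) uc[OF f(1)]] by simp
    also have "\<dots> = \<zero>\<^bsub>stalk T1 t\<^esub>"
      using W'[OF f(1)] d.X.stalk_zero[OF d.preim_open[OF Wf(1)], of t] t(1) tf by (simp add: d.mem_preim)
    finally have "stalk_map d t (germ P (pt d t) V f) [^]\<^bsub>stalk T1 t\<^esub> N \<otimes>\<^bsub>stalk T1 t\<^esub> \<eta> = \<zero>\<^bsub>stalk T1 t\<^esub>"
      unfolding ug[OF f(1) tW] \<eta>_def
      using ring_hom_mult[OF h Q.nat_pow_closed[OF Q.Units_closed[OF f(2)]] gs]
        hom_pow[OF h Q.ring_axioms S.ring_axioms Q.Units_closed[OF f(2)]] by simp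
    moreover have "stalk_map d t (germ P (pt d t) V f) [^]\<^bsub>stalk T1 t\<^esub> N \<in> Units (stalk T1 t)"
      by (rule S.Units_nat_pow[OF hom_Units[OF h Q.ring_axioms S.ring_axioms f(2)]])
    ultimately have "\<eta> = \<zero>\<^bsub>stalk T1 t\<^esub>" using S.unit_cancel_zero \<eta>c by blast
    then show "germ T1 t (preim d Y) (cm d Y (res P W Y s)) = \<zero>\<^bsub>stalk T1 t\<^esub>"
      unfolding \<eta>_def using d.stalk_map_germ[OF t(1) Y t(2) sY] d.Y.germ_res[OF W(1) Y t(2) YW(1) W(4)] by simp
  qed
  then have "cm dc Y (res P W Y s) = \<zero>\<^bsub>sec T1c (preim dc Y)\<^esub>" using ker_iff[OF Y sY] by simp
  then show ?thesis
    using dc.stalk_map_germ[OF z Y yY sY] d.Y.germ_res[OF W(1) Y yY YW(1) W(4)] b(2) W(5)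
      dc.X.stalk_zero[OF dc.preim_open[OF Y], of z] z yY by (simp add: dc.mem_preim)
qed

end

text \<open>If \<open>a\<close> vanished nowhere after localizing at \<open>q\<close> and inverting
  \<open>e\<close>, some prime \<open>r\<close> inside \<open>q\<close> that avoids \<open>e\<close>
  would contain the annihilator of \<open>a\<close>; but at such a prime \<open>a\<close> is killed.
  This turns vanishing at primes into vanishing up to powers, with one exponent and one multiplier
  for all of \<open>G\<close>.\<close>

lemma (in cring) annihilated_up_to_power:
  assumes q: "primeideal q R" and G: "finite G" "G \<subseteq> carrier R" and a: "a \<in> carrier R"
    and kill: "\<And>r e. primeideal r R \<Longrightarrow> r \<subseteq> q \<Longrightarrow> e \<in> G \<Longrightarrow> e \<notin> r \<Longrightarrow> \<exists>w \<in> carrier R - r. w \<otimes> a = \<zero>"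
  shows "\<exists>N::nat. \<exists>w \<in> carrier R - q. \<forall>e \<in> G. e [^] N \<otimes> (w \<otimes> a) = \<zero>"
proof -
  interpret q: primeideal q R by fact
  have q1: "\<one> \<notin> q" using q.I_notcarr q.one_imp_carrier by blast
  have qm: "b \<otimes> c \<in> carrier R - q" if "b \<in> carrier R - q" "c \<in> carrier R - q" for b c
    using that q.I_prime[of b c] by auto
  have one: "\<exists>n::nat. \<exists>w \<in> carrier R - q. e [^] n \<otimes> (w \<otimes> a) = \<zero>" if e: "e \<in> G" for e
  proof (rule ccontr)
    assume no: "\<not> (\<exists>n::nat. \<exists>w \<in> carrier R - q. e [^] n \<otimes> (w \<otimes> a) = \<zero>)"
    have ec: "e \<in> carrier R" using e G by blast
    define I where "I = {b \<in> carrier R. b \<otimes> a = \<zero>}"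
    \<comment> \<open>The multiplicative set generated by \<open>e\<close> and the complement of
      \<open>q\<close>. A prime that misses it lies inside \<open>q\<close> and does not contain
      \<open>e\<close>. The conjunct \<open>(n::nat) = n\<close> only fixes the type of the
      exponent.\<close>
    define W where "W = {e [^] n \<otimes> w | n w. w \<in> carrier R - q \<and> (n::nat) = n}"
    have I: "ideal I R"
    proof (rule idealI[OF ring_axioms])
      show "subgroup I (add_monoid R)"
        by (rule add.subgroupI) (use a in \<open>auto simp: I_def l_distr l_minus intro!: exI[of _ \<zero>]\<close>)
      fix b c assume b: "b \<in> I" and c: "c \<in> carrier R"
      then show "c \<otimes> b \<in> I" using a by (simp add: I_def m_assoc)
      then show "b \<otimes> c \<in> I" using b c by (simp add: I_def m_comm[of b c])
    qed
    have "I \<inter> W = {}"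
    proof (rule ccontr)
      assume "I \<inter> W \<noteq> {}"
      then obtain n w where w: "w \<in> carrier R - q" "(e [^] (n::nat) \<otimes> w) \<otimes> a = \<zero>" unfolding I_def W_def by auto
      then have "e [^] n \<otimes> (w \<otimes> a) = \<zero>" using ec a m_assoc[of "e [^] n" w a] by simp
      then show False using no w(1) by blast
    qed
    moreover have Wq: "w \<in> W" if "w \<in> carrier R - q" for w
      unfolding W_def using that ec by (intro CollectI exI[of _ 0] exI[of _ w]) simp
    moreover have "b \<otimes> c \<in> W" if bc: "b \<in> W" "c \<in> W" for b c
    proof -
      obtain n w n' w' where w: "b = e [^] (n::nat) \<otimes> w" "w \<in> carrier R - q" "c = e [^] (n'::nat) \<otimes> w'" "w' \<in> carrier R - q"
        using bc unfolding W_def by auto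
      have "b \<otimes> c = e [^] (n + n') \<otimes> (w \<otimes> w')"
        using w ec by (simp add: nat_pow_mult[symmetric] m_ac)
      then show ?thesis using qm[OF w(2,4)] unfolding W_def by blast
    qed
    moreover have "W \<subseteq> carrier R" unfolding W_def using ec by auto
    ultimately obtain r where r: "primeideal r R" "I \<subseteq> r" "r \<inter> W = {}"
      using exists_prime_avoiding[OF I, of W] q1 by blast
    interpret r: primeideal r R by (rule r(1))
    have "r \<subseteq> q" using r(3) Wq r.Icarr by blast
    moreover have "e \<in> W" unfolding W_def using ec q1 by (intro CollectI exI[of _ 1] exI[of _ \<one>]) simp
    then have "e \<notin> r" using r(3) by blast
    ultimately obtain w where "w \<in> carrier R - r" "w \<otimes> a = \<zero>" using kill[OF r(1) _ e] by blast
    then show False using r(2) unfolding I_def by blast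
  qed
  have "\<exists>N::nat. \<exists>w \<in> carrier R - q. \<forall>e \<in> H. e [^] N \<otimes> (w \<otimes> a) = \<zero>" if "finite H" "H \<subseteq> G" for H
    using that
  proof (induction rule: finite_induct)
    case empty
    then show ?case using q1 by (intro exI[of _ 0] bexI[of _ \<one>]) simp_all
  next
    case (insert e H)
    then obtain N w where N: "w \<in> carrier R - q" "\<forall>e \<in> H. e [^] (N::nat) \<otimes> (w \<otimes> a) = \<zero>" by auto
    obtain n w' where n: "w' \<in> carrier R - q" "e [^] (n::nat) \<otimes> (w' \<otimes> a) = \<zero>" using one[of e] insert.prems by auto
    have c: "w \<in> carrier R" "w' \<in> carrier R" using N(1) n(1) by auto
    \<comment> \<open>Adding exponents and multiplying the multipliers keeps the old equations and
      gains the new one; the product is regrouped in two ways accordingly.\<close>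
    have "e' [^] (N + n) \<otimes> ((w \<otimes> w') \<otimes> a) = \<zero>" if e': "e' \<in> insert e H" for e'
    proof -
      have ec: "e' \<in> carrier R" using e' insert.prems G by auto
      have "e' [^] (N + n) \<otimes> ((w \<otimes> w') \<otimes> a) = (e' [^] n \<otimes> w') \<otimes> (e' [^] N \<otimes> (w \<otimes> a))"
        using ec c a by (simp add: nat_pow_mult[symmetric] m_ac)
      moreover have "e' [^] (N + n) \<otimes> ((w \<otimes> w') \<otimes> a) = (e' [^] N \<otimes> w) \<otimes> (e' [^] n \<otimes> (w' \<otimes> a))"
        using ec c a by (simp add: nat_pow_mult[symmetric] m_ac)
      ultimately show ?thesis using e' N(2) n(2) ec c by auto
    qed
    then show ?case using qm[OF N(1) n(1)] by blast
  qed
  then show ?thesis using G(1) by blast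
qed

section \<open>Comparison with local test schemes\<close>

text \<open>
  Symmetry and transitivity of the closure are treated at once: the pairs \<open>(b1, b2)\<close> of points of
  \<open>T1c\<close> with \<open>u \<circ>\<^sub>s b1 = v \<circ>\<^sub>s b2\<close> are to be mapped to the points \<open>(e0 \<circ>\<^sub>s b1, e1 \<circ>\<^sub>s b2)\<close> of \<open>T1c\<close>.
  The ring \<open>C\<close> is the local ring of the fibre product of \<open>u\<close> and \<open>v\<close>, before localization.
\<close>

locale core_point = qc_closure T1 T1c P d dc i
  for T1 T1c P :: "('p, 'r) ringed_space" and d dc i +
  fixes T0 B :: "('p, 'r) ringed_space" and p0 p1 e0 e1 u v :: "('p, 'r, 'p, 'r) morphism"
    and X :: "('u, 'u) ringed_space" and h1 h2 m x
    and C :: "'c ring" and \<alpha>1 \<alpha>2 \<chi>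
  assumes univ: "universe_over TYPE('p) TYPE('r) TYPE('u)"
    and T0: "scheme T0" and B: "scheme B" and X: "scheme X"
    and p0: "p0 \<in> lrs_hom P T0" and p1: "p1 \<in> lrs_hom P T0"
    and e0: "e0 \<in> lrs_hom T1c T0" and e1: "e1 \<in> lrs_hom T1c T0" and u: "u \<in> lrs_hom T1c B" and v: "v \<in> lrs_hom T1c B"
    and pair_eq: "\<And>(Y :: ('u, 'u) ringed_space) a b. scheme Y \<Longrightarrow> a \<in> lrs_hom Y P \<Longrightarrow> b \<in> lrs_hom Y P \<Longrightarrow>
      p0 \<circ>\<^sub>s a = p0 \<circ>\<^sub>s b \<Longrightarrow> p1 \<circ>\<^sub>s a = p1 \<circ>\<^sub>s b \<Longrightarrow> a = b"
    and pair_ex: "\<And>(Y :: ('u, 'u) ringed_space) b1 b2. scheme Y \<Longrightarrow> b1 \<in> lrs_hom Y T1c \<Longrightarrow> b2 \<in> lrs_hom Y T1c \<Longrightarrow>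
      u \<circ>\<^sub>s b1 = v \<circ>\<^sub>s b2 \<Longrightarrow> \<exists>a \<in> lrs_hom Y P. p0 \<circ>\<^sub>s a = e0 \<circ>\<^sub>s b1 \<and> p1 \<circ>\<^sub>s a = e1 \<circ>\<^sub>s b2"
    and T1_ex: "\<And>(Y :: ('u, 'u) ringed_space) g1 g2. scheme Y \<Longrightarrow> g1 \<in> lrs_hom Y T1 \<Longrightarrow> g2 \<in> lrs_hom Y T1 \<Longrightarrow>
      u \<circ>\<^sub>s i \<circ>\<^sub>s g1 = v \<circ>\<^sub>s i \<circ>\<^sub>s g2 \<Longrightarrow> \<exists>g \<in> lrs_hom Y T1. p0 \<circ>\<^sub>s d \<circ>\<^sub>s g = e0 \<circ>\<^sub>s i \<circ>\<^sub>s g1 \<and> p1 \<circ>\<^sub>s d \<circ>\<^sub>s g = e1 \<circ>\<^sub>s i \<circ>\<^sub>s g2"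
    and h1: "h1 \<in> lrs_hom X T1c" and h2: "h2 \<in> lrs_hom X T1c" and uv: "u \<circ>\<^sub>s h1 = v \<circ>\<^sub>s h2"
    and m: "m \<in> lrs_hom X P" and m0: "p0 \<circ>\<^sub>s m = e0 \<circ>\<^sub>s h1" and m1: "p1 \<circ>\<^sub>s m = e1 \<circ>\<^sub>s h2"
    and x: "x \<in> points X"
    and C: "cring C" and C_small: "|carrier C| \<le>o |UNIV :: ('p + 'r) list set|"
    and \<alpha>1: "\<alpha>1 \<in> ring_hom (stalk T1c (pt h1 x)) C" and \<alpha>2: "\<alpha>2 \<in> ring_hom (stalk T1c (pt h2 x)) C"
    and \<alpha>_compat: "\<And>A. A \<in> stk B (pt u (pt h1 x)) \<Longrightarrow> \<alpha>1 (stalk_map u (pt h1 x) A) = \<alpha>2 (stalk_map v (pt h2 x) A)"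
    and \<chi>: "\<chi> \<in> ring_hom C (stalk X x)"
    and \<chi>1: "\<And>A. A \<in> stk T1c (pt h1 x) \<Longrightarrow> \<chi> (\<alpha>1 A) = stalk_map h1 x A"
    and \<chi>2: "\<And>A. A \<in> stk T1c (pt h2 x) \<Longrightarrow> \<chi> (\<alpha>2 A) = stalk_map h2 x A"
    and torsion_free: "\<And>V1 F1 V2 F2 N a. cutting (pt h1 x) V1 F1 \<Longrightarrow> cutting (pt h2 x) V2 F2 \<Longrightarrow> a \<in> carrier C \<Longrightarrow>
      (\<And>f g. f \<in> F1 \<Longrightarrow> g \<in> F2 \<Longrightarrow> (\<alpha>1 (pull (pt h1 x) V1 f) \<otimes>\<^bsub>C\<^esub> \<alpha>2 (pull (pt h2 x) V2 g)) [^]\<^bsub>C\<^esub> (N::nat) \<otimes>\<^bsub>C\<^esub> a = \<zero>\<^bsub>C\<^esub>) \<Longrightarrow> a = \<zero>\<^bsub>C\<^esub>"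
begin

abbreviation z1 where "z1 \<equiv> pt h1 x"
abbreviation z2 where "z2 \<equiv> pt h2 x"
abbreviation L where "L \<equiv> stalk X x"

lemma k_inf: "infinite (UNIV :: ('p + 'r) list set)" by (rule infinite_UNIV_listI)

text \<open>Singletons embed a type into its power set, which brings the injection of
  \<open>universe_over\<close> to the form of the bound in
  \<open>local_model_exists\<close>.\<close>

lemma k_u: "|UNIV :: ('p + 'r) list set set set| \<le>o |UNIV :: 'u set|"
proof -
  obtain e :: "('p + 'r) list set set set \<Rightarrow> 'u" where e: "inj e" using univ unfolding universe_over_def by (rule exE)
  show ?thesis by (rule card_of_ordLeqI[of "\<lambda>a. e {a}"]) (use e in \<open>auto intro!: injI dest: injD\<close>)
qed

lemma r_k: "|UNIV :: 'r set| \<le>o |UNIV :: ('p + 'r) list set|"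
  by (rule card_of_ordLeqI[of "\<lambda>r. [Inr r]"]) (simp_all add: inj_on_def)

lemma rT0: "ringed_space T0" and rB: "ringed_space B" and rX: "ringed_space X"
  using T0 B X by (simp_all add: scheme_ringed)

lemma L_local: "local_ring L" by (rule lrs_stalk_local[OF scheme_lrs[OF X] x])

sublocale C: cring C by (rule C)
sublocale L: cring L by (rule local_ring_cring[OF L_local])
sublocale h1: lrs_mor X T1c h1 by (rule lrs_morI[OF rX ringed(2) h1])
sublocale h2: lrs_mor X T1c h2 by (rule lrs_morI[OF rX ringed(2) h2])
sublocale m: lrs_mor X P m by (rule lrs_morI[OF rX ringed(3) m])

text \<open>The point of the fibre product of \<open>u\<close> and \<open>v\<close> that is hit at
  \<open>x\<close>, seen as a prime of \<open>C\<close>. Localizing there gives its local ring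
  \<open>R\<close>, and \<chi>' is the resulting local homomorphism to the local ring of
  \<open>X\<close>.\<close>

definition q where "q = {a \<in> carrier C. \<chi> a \<notin> Units L}"

sublocale q: primeideal q C unfolding q_def by (rule hom_nonunits_prime[OF C L_local \<chi>])

abbreviation W where "W \<equiv> carrier C - q"
abbreviation R where "R \<equiv> localization C W"

sublocale W: localization_set C W by (rule localization_set_prime[OF q.primeideal_axioms])

definition ell where "ell a = frac C W a \<one>\<^bsub>C\<^esub>"
definition \<chi>' where "\<chi>' = loc_lift C L \<chi>"

lemma \<chi>W: "\<chi> ` W \<subseteq> Units L"
proof
  fix y assume "y \<in> \<chi> ` W"
  then obtain a where "y = \<chi> a" "a \<in> W" by (rule imageE)
  then show "y \<in> Units L" unfolding q_def by simp
qed

lemma ell_hom: "ell \<in> ring_hom C R" unfolding ell_def[abs_def] by (rule W.frac_hom)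

lemma ell_closed: "a \<in> carrier C \<Longrightarrow> ell a \<in> carrier R" by (rule ring_hom_closed[OF ell_hom])

lemma \<chi>'_hom: "\<chi>' \<in> ring_hom R L" unfolding \<chi>'_def by (rule W.loc_lift_hom[OF L.is_cring \<chi> \<chi>W])

lemma \<chi>'_ell: "a \<in> carrier C \<Longrightarrow> \<chi>' (ell a) = \<chi> a"
  unfolding \<chi>'_def ell_def by (rule W.loc_lift_eqI[OF L.is_cring \<chi> \<chi>W]) (use ring_hom_closed[OF \<chi>] ring_hom_one[OF \<chi>] W.W_one in simp_all)

lemma R_local: "local_ring R" by (rule q.localization_local)

lemma R_small: "|carrier R| \<le>o |UNIV :: ('p + 'r) list set|" by (rule W.localization_small[OF k_inf C_small])

lemma ell_unit_iff: "a \<in> carrier C \<Longrightarrow> ell a \<in> Units R \<longleftrightarrow> a \<notin> q"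
  unfolding ell_def using q.frac_prime_unit_iff[of a "\<one>\<^bsub>C\<^esub>"] W.W_one by simp

lemma ell_unit: assumes "a \<in> carrier C" "ell a \<in> Units R" shows "\<chi> a \<in> Units L"
proof (rule ccontr)
  assume "\<chi> a \<notin> Units L"
  then have "a \<in> q" unfolding q_def using assms(1) by simp
  then show False using ell_unit_iff[OF assms(1)] assms(2) by simp
qed

lemma \<alpha>1_closed: "A \<in> stk T1c z1 \<Longrightarrow> \<alpha>1 A \<in> carrier C" by (rule ring_hom_closed[OF \<alpha>1])
lemma \<alpha>2_closed: "A \<in> stk T1c z2 \<Longrightarrow> \<alpha>2 A \<in> carrier C" by (rule ring_hom_closed[OF \<alpha>2])

lemma \<psi>1: "ell \<circ> \<alpha>1 \<in> ring_hom (stalk T1c z1) R" by (rule ring_hom_trans[OF \<alpha>1 ell_hom])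
lemma \<psi>2: "ell \<circ> \<alpha>2 \<in> ring_hom (stalk T1c z2) R" by (rule ring_hom_trans[OF \<alpha>2 ell_hom])

text \<open>An element of \<open>C\<close> that becomes a unit at \<open>q\<close> has a unit as its
  image under \<chi>, and on the image of \<alpha>1 that image is the stalk map of
  \<open>h1\<close>, which reflects units.\<close>

lemma \<psi>1_local: "A \<in> stk T1c z1 \<Longrightarrow> (ell \<circ> \<alpha>1) A \<in> Units R \<Longrightarrow> A \<in> Units (stalk T1c z1)"
  unfolding comp_def using ell_unit[OF \<alpha>1_closed, of A] \<chi>1[of A] h1.stalk_map_unit_iff[OF x, of A] by simp

lemma \<psi>2_local: "A \<in> stk T1c z2 \<Longrightarrow> (ell \<circ> \<alpha>2) A \<in> Units R \<Longrightarrow> A \<in> Units (stalk T1c z2)"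
  unfolding comp_def using ell_unit[OF \<alpha>2_closed, of A] \<chi>2[of A] h2.stalk_map_unit_iff[OF x, of A] by simp

lemma uv_pt: "pt u z1 = pt v z2"
  using arg_cong[OF uv, of "\<lambda>f. pt f x"] x by (simp add: pt_comp h1.src_tgt h2.src_tgt)

end

section \<open>The universal pair over the local ring of the fibre product\<close>

context core_point
begin

lemma test_exists:
  "\<exists>(E :: ('u, 'u) ringed_space) c \<kappa>. local_model R E c \<kappa>"
  by (rule local_model_exists[OF k_inf k_u R_local R_small])

context
  fixes E :: "('u, 'u) ringed_space" and c and \<kappa>
  assumes model: "local_model R E c \<kappa>"
begin

interpretation E: local_test R E c \<kappa> using model by (rule local_test.intro)

text \<open>\<beta>1, and likewise \<beta>2, is the projection of the fibre product to
  \<open>T1c\<close>, restricted to the spectrum \<open>E\<close> of its local ring. It is given by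
  its point and its stalk map, so no fibre product has to be formed.\<close>

lemma \<beta>1_exists: "\<exists>\<beta> \<in> lrs_hom E T1c. pt \<beta> c = z1 \<and> (\<forall>A \<in> stk T1c z1. stalk_map \<beta> c A = E.\<epsilon> (ell (\<alpha>1 A)))"
  using E.hom_realizing[OF schemes(2) h1.pt_in[OF x] \<psi>1 \<psi>1_local] unfolding comp_def .

lemma \<beta>2_exists: "\<exists>\<beta> \<in> lrs_hom E T1c. pt \<beta> c = z2 \<and> (\<forall>A \<in> stk T1c z2. stalk_map \<beta> c A = E.\<epsilon> (ell (\<alpha>2 A)))"
  using E.hom_realizing[OF schemes(2) h2.pt_in[OF x] \<psi>2 \<psi>2_local] unfolding comp_def .

context
  fixes \<beta>1 \<beta>2
  assumes \<beta>1: "\<beta>1 \<in> lrs_hom E T1c" and \<beta>1c: "pt \<beta>1 c = z1"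
    and \<beta>1s: "\<And>A. A \<in> stk T1c z1 \<Longrightarrow> stalk_map \<beta>1 c A = E.\<epsilon> (ell (\<alpha>1 A))"
    and \<beta>2: "\<beta>2 \<in> lrs_hom E T1c" and \<beta>2c: "pt \<beta>2 c = z2"
    and \<beta>2s: "\<And>A. A \<in> stk T1c z2 \<Longrightarrow> stalk_map \<beta>2 c A = E.\<epsilon> (ell (\<alpha>2 A))"
begin

interpretation b1: lrs_mor E T1c \<beta>1 by (rule lrs_morI[OF E.rE ringed(2) \<beta>1])
interpretation b2: lrs_mor E T1c \<beta>2 by (rule lrs_morI[OF E.rE ringed(2) \<beta>2])
interpretation u: lrs_mor T1c B u by (rule lrs_morI[OF ringed(2) rB u])
interpretation v: lrs_mor T1c B v by (rule lrs_morI[OF ringed(2) rB v])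

lemma u\<beta>: "u \<circ>\<^sub>s \<beta>1 = v \<circ>\<^sub>s \<beta>2"
proof (rule E.hom_eqI[OF B lrs_comp_hom[OF E.rE ringed(2) rB \<beta>1 u] lrs_comp_hom[OF E.rE ringed(2) rB \<beta>2 v]])
  have p: "pt (u \<circ>\<^sub>s \<beta>1) c = pt u z1" "pt (v \<circ>\<^sub>s \<beta>2) c = pt v z2"
    using E.c_in by (simp_all add: pt_comp b1.src_tgt b2.src_tgt \<beta>1c \<beta>2c)
  then show "pt (u \<circ>\<^sub>s \<beta>1) c = pt (v \<circ>\<^sub>s \<beta>2) c" using uv_pt by simp
  fix A assume "A \<in> stk B (pt (u \<circ>\<^sub>s \<beta>1) c)"
  then have A: "A \<in> stk B (pt u z1)" "A \<in> stk B (pt v z2)" using p uv_pt by simp_all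
  have "stalk_map (u \<circ>\<^sub>s \<beta>1) c A = stalk_map \<beta>1 c (stalk_map u z1 A)"
    using stalk_map_comp[OF E.rE ringed(2) rB \<beta>1 u E.c_in, of A] A by (simp add: \<beta>1c)
  also have "\<dots> = E.\<epsilon> (ell (\<alpha>1 (stalk_map u z1 A)))" by (rule \<beta>1s[OF u.stalk_map_closed[OF h1.pt_in[OF x] A(1)]])
  also have "\<dots> = E.\<epsilon> (ell (\<alpha>2 (stalk_map v z2 A)))" using \<alpha>_compat[OF A(1)] by simp
  also have "\<dots> = stalk_map \<beta>2 c (stalk_map v z2 A)" by (rule \<beta>2s[symmetric, OF v.stalk_map_closed[OF h2.pt_in[OF x] A(2)]])
  also have "\<dots> = stalk_map (v \<circ>\<^sub>s \<beta>2) c A"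
    using stalk_map_comp[OF E.rE ringed(2) rB \<beta>2 v E.c_in, of A] A by (simp add: \<beta>2c)
  finally show "stalk_map (u \<circ>\<^sub>s \<beta>1) c A = stalk_map (v \<circ>\<^sub>s \<beta>2) c A" .
qed

text \<open>\<mu> is what the universal pair is sent to in \<open>P\<close>, its transpose or its
  composite. The question at stake is whether it kills the ideal of \<open>T1c\<close>.\<close>

lemma \<mu>_exists: "\<exists>\<mu> \<in> lrs_hom E P. p0 \<circ>\<^sub>s \<mu> = e0 \<circ>\<^sub>s \<beta>1 \<and> p1 \<circ>\<^sub>s \<mu> = e1 \<circ>\<^sub>s \<beta>2"
  by (rule pair_ex[OF E.E_scheme \<beta>1 \<beta>2 u\<beta>])

context
  fixes \<mu>
  assumes \<mu>: "\<mu> \<in> lrs_hom E P" and \<mu>0: "p0 \<circ>\<^sub>s \<mu> = e0 \<circ>\<^sub>s \<beta>1" and \<mu>1: "p1 \<circ>\<^sub>s \<mu> = e1 \<circ>\<^sub>s \<beta>2"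
begin

interpretation mu: lrs_mor E P \<mu> by (rule lrs_morI[OF E.rE ringed(3) \<mu>])

text \<open>
  The morphism \<open>m\<close> factors near \<open>x\<close> through \<open>\<mu>\<close>. To stay within the universe, the local ring of \<open>X\<close>
  at \<open>x\<close> is replaced by a small local subring.
\<close>

lemma m_eq_\<mu>: "pt m x = pt \<mu> c \<and> (\<forall>A \<in> stk P (pt m x). stalk_map m x A = \<chi>' (E.at_c \<mu> A))"
proof -
  let ?w = "pt m x"
  \<comment> \<open>The images of the two small rings that have to be compared inside the local ring
    of \<open>X\<close>: the stalk of \<open>P\<close> at \<open>pt m x\<close>, and
    \<open>R\<close>.\<close>
  let ?S = "stalk_map m x ` carrier (stalk P ?w) \<union> \<chi>' ` carrier R"
  have w: "?w \<in> points P" by (rule m.pt_in[OF x])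
  have Sc: "?S \<subseteq> carrier L" using m.stalk_map_closed[OF x] ring_hom_closed[OF \<chi>'_hom] by blast
  have "|?S| \<le>o |UNIV :: ('p + 'r) list set|"
    by (rule card_of_Un_ordLeq_infinite[OF k_inf]; rule ordLeq_transitive[OF card_of_image])
      (rule stalk_small[OF k_inf r_k schemes(3) w], rule R_small)
  then obtain D where D: "?S \<subseteq> D" "D \<subseteq> carrier L" "|D| \<le>o |UNIV :: ('p + 'r) list set|" "local_ring (L\<lparr>carrier := D\<rparr>)"
    and DU: "\<forall>a \<in> D. a \<in> Units L \<longrightarrow> a \<in> Units (L\<lparr>carrier := D\<rparr>)" "\<forall>a. a \<in> Units (L\<lparr>carrier := D\<rparr>) \<longrightarrow> a \<in> Units L"
    using small_local_subring[OF k_inf L_local Sc] by blast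
  let ?D = "L\<lparr>carrier := D\<rparr>"
  have "|carrier ?D| \<le>o |UNIV :: ('p + 'r) list set|" using D(3) by simp
  from local_model_exists[OF k_inf k_u D(4) this] obtain ED :: "('u, 'u) ringed_space" and cD \<kappa>D where md: "local_model ?D ED cD \<kappa>D" by blast
  interpret ED: local_test ?D ED cD \<kappa>D using md by (rule local_test.intro)
  have into_D: "h \<in> ring_hom Q ?D" if h: "h \<in> ring_hom Q L" and im: "h ` carrier Q \<subseteq> D" for h and Q :: "'z ring"
    using h im unfolding ring_hom_def by auto
  have mh: "stalk_map m x \<in> ring_hom (stalk P ?w) ?D" by (rule into_D[OF m.stalk_map_hom[OF x]]) (use D(1) in blast)
  have ml: "A \<in> Units (stalk P ?w)" if "A \<in> carrier (stalk P ?w)" "stalk_map m x A \<in> Units ?D" for A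
    using m.stalk_map_unit_iff[OF x that(1)] DU(2) that(2) by blast
  obtain mD where mD: "mD \<in> lrs_hom ED P" "pt mD cD = ?w" and mDs: "\<forall>A \<in> carrier (stalk P ?w). stalk_map mD cD A = ED.\<epsilon> (stalk_map m x A)"
    using ED.hom_realizing[OF schemes(3) w mh ml] by blast
  have ch: "\<chi>' \<in> ring_hom R ?D" by (rule into_D[OF \<chi>'_hom]) (use D(1) in blast)
  have \<pi>h: "\<chi>' \<circ> E.\<epsilon>inv \<in> ring_hom (stalk E c) ?D" by (rule ring_hom_trans[OF E.\<epsilon>inv_hom ch])
  \<comment> \<open>\<chi>' reflects units: if a fraction a/s goes to a unit, so does its numerator,
    and then \<open>a \<notin> q\<close> by the definition of \<open>q\<close>.\<close>
  have \<pi>l: "A \<in> Units (stalk E c)" if A: "A \<in> stk E c" "(\<chi>' \<circ> E.\<epsilon>inv) A \<in> Units ?D" for A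
  proof -
    obtain a s where as: "a \<in> carrier C" "s \<in> W" "E.\<epsilon>inv A = frac C W a s"
      by (rule W.locE[OF ring_hom_closed[OF E.\<epsilon>inv_hom A(1)]])
    have sc: "s \<in> carrier C" using as(2) by blast
    have "\<chi>' (frac C W a s) \<in> Units L" using A(2) DU(2) as(3) by simp
    moreover have "\<chi> s \<in> Units L" using \<chi>W as(2) by blast
    moreover have "\<chi> s \<otimes>\<^bsub>L\<^esub> \<chi>' (frac C W a s) = \<chi> a"
      unfolding \<chi>'_def by (rule W.loc_lift_cross[OF L.is_cring \<chi> \<chi>W as(1,2)])
    ultimately have "\<chi> a \<in> Units L" using L.Units_m_closed by metis
    then have "a \<notin> q" unfolding q_def by simp
    then have "E.\<epsilon>inv A \<in> Units R" unfolding as(3) using q.frac_prime_unit_iff[OF as(1) sc] as(2) by simp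
    then show ?thesis using E.\<epsilon>inv_unit_iff[OF A(1)] by simp
  qed
  obtain \<pi> where \<pi>: "\<pi> \<in> lrs_hom ED E" "pt \<pi> cD = c" and \<pi>s: "\<forall>A \<in> stk E c. stalk_map \<pi> cD A = ED.\<epsilon> ((\<chi>' \<circ> E.\<epsilon>inv) A)"
    using ED.hom_realizing[OF E.E_scheme E.c_in \<pi>h \<pi>l] by blast
  interpret pi: lrs_mor ED E \<pi> by (rule lrs_morI[OF ED.rE E.rE \<pi>(1)])
  interpret mD: lrs_mor ED P mD by (rule lrs_morI[OF ED.rE ringed(3) mD(1)])
  have \<mu>\<pi>: "\<mu> \<circ>\<^sub>s \<pi> \<in> lrs_hom ED P" by (rule lrs_comp_hom[OF ED.rE E.rE ringed(3) \<pi>(1) \<mu>])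
  \<comment> \<open>Proved once for both projections of \<open>P\<close>: each side is followed
    through \<open>T1c\<close>, where \<chi> applied to \<alpha> is the stalk map of
    \<open>h\<close>.\<close>
  have agree: "p \<circ>\<^sub>s mD = p \<circ>\<^sub>s \<mu> \<circ>\<^sub>s \<pi>"
    if p: "p \<in> lrs_hom P T0" and e: "e \<in> lrs_hom T1c T0" and h: "h \<in> lrs_hom X T1c" and \<beta>: "\<beta> \<in> lrs_hom E T1c" "pt \<beta> c = pt h x"
      and mp: "p \<circ>\<^sub>s m = e \<circ>\<^sub>s h" and \<mu>p: "p \<circ>\<^sub>s \<mu> = e \<circ>\<^sub>s \<beta>" and \<alpha>c: "\<And>A. A \<in> stk T1c (pt h x) \<Longrightarrow> \<alpha> A \<in> carrier C"
      and \<chi>\<alpha>: "\<And>A. A \<in> stk T1c (pt h x) \<Longrightarrow> \<chi> (\<alpha> A) = stalk_map h x A"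
      and \<beta>s: "\<And>A. A \<in> stk T1c (pt h x) \<Longrightarrow> stalk_map \<beta> c A = E.\<epsilon> (ell (\<alpha> A))" for p e h \<beta> \<alpha>
  proof -
    interpret p: lrs_mor P T0 p by (rule lrs_morI[OF ringed(3) rT0 p])
    interpret e: lrs_mor T1c T0 e by (rule lrs_morI[OF ringed(2) rT0 e])
    interpret h: lrs_mor X T1c h by (rule lrs_morI[OF rX ringed(2) h])
    interpret b: lrs_mor E T1c \<beta> by (rule lrs_morI[OF E.rE ringed(2) \<beta>(1)])
    let ?z = "pt h x"
    have z: "?z \<in> points T1c" by (rule h.pt_in[OF x])
    have pz: "pt p ?w = pt e ?z" using arg_cong[OF mp, of "\<lambda>f. pt f x"] x by (simp add: pt_comp m.src_tgt h.src_tgt)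
    have as: "p \<circ>\<^sub>s \<mu> \<circ>\<^sub>s \<pi> = e \<circ>\<^sub>s \<beta> \<circ>\<^sub>s \<pi>"
      using lrs_comp_assoc[OF ED.rE E.rE ringed(3) rT0 \<pi>(1) \<mu> p] lrs_comp_assoc[OF ED.rE E.rE ringed(2) rT0 \<pi>(1) \<beta>(1) e] \<mu>p by simp
    have \<beta>\<pi>: "\<beta> \<circ>\<^sub>s \<pi> \<in> lrs_hom ED T1c" by (rule lrs_comp_hom[OF ED.rE E.rE ringed(2) \<pi>(1) \<beta>(1)])
    have b\<pi>c: "pt (\<beta> \<circ>\<^sub>s \<pi>) cD = ?z" using ED.c_in \<pi>(2) \<beta>(2) by (simp add: pt_comp pi.src_tgt)
    have q1: "pt (p \<circ>\<^sub>s mD) cD = pt p ?w" using ED.c_in mD(2) by (simp add: pt_comp mD.src_tgt)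
    have q2: "pt (e \<circ>\<^sub>s \<beta> \<circ>\<^sub>s \<pi>) cD = pt e ?z" using ED.c_in b\<pi>c by (simp add: pt_comp pi.src_tgt)
    show ?thesis unfolding as
    proof (rule ED.hom_eqI[OF T0 lrs_comp_hom[OF ED.rE ringed(3) rT0 mD(1) p] lrs_comp_hom[OF ED.rE ringed(2) rT0 \<beta>\<pi> e]])
      show "pt (p \<circ>\<^sub>s mD) cD = pt (e \<circ>\<^sub>s \<beta> \<circ>\<^sub>s \<pi>) cD" using q1 q2 pz by simp
      fix A assume "A \<in> stk T0 (pt (p \<circ>\<^sub>s mD) cD)"
      then have A: "A \<in> stk T0 (pt p ?w)" "A \<in> stk T0 (pt e ?z)" using q1 pz by simp_all
      let ?B = "stalk_map e ?z A"
      have Bc: "?B \<in> carrier (stalk T1c ?z)" by (rule e.stalk_map_closed[OF z A(2)])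
      have "stalk_map (p \<circ>\<^sub>s mD) cD A = stalk_map mD cD (stalk_map p ?w A)"
        using stalk_map_comp[OF ED.rE ringed(3) rT0 mD(1) p ED.c_in, of A] A(1) by (simp add: mD(2))
      also have "\<dots> = ED.\<epsilon> (stalk_map m x (stalk_map p ?w A))" using mDs p.stalk_map_closed[OF w A(1)] by simp
      also have "stalk_map m x (stalk_map p ?w A) = stalk_map (p \<circ>\<^sub>s m) x A"
        by (rule stalk_map_comp[symmetric, OF rX ringed(3) rT0 m p x A(1)])
      also have "\<dots> = stalk_map h x ?B" unfolding mp by (rule stalk_map_comp[OF rX ringed(2) rT0 h e x A(2)])
      also have "\<dots> = \<chi>' (ell (\<alpha> ?B))" using \<chi>'_ell[OF \<alpha>c[OF Bc]] \<chi>\<alpha>[OF Bc] by simp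
      also have "ED.\<epsilon> \<dots> = ED.\<epsilon> ((\<chi>' \<circ> E.\<epsilon>inv) (stalk_map \<beta> c ?B))" unfolding \<beta>s[OF Bc] comp_def E.\<epsilon>inv_\<epsilon>[OF ell_closed[OF \<alpha>c[OF Bc]]] ..
      also have "\<dots> = stalk_map \<pi> cD (stalk_map \<beta> c ?B)" using \<pi>s b.stalk_map_closed[OF E.c_in, of ?B] Bc \<beta>(2) by simp
      also have "\<dots> = stalk_map (\<beta> \<circ>\<^sub>s \<pi>) cD ?B"
        using stalk_map_comp[OF ED.rE E.rE ringed(2) \<pi>(1) \<beta>(1) ED.c_in, of ?B] Bc \<pi>(2) \<beta>(2) by simp
      also have "\<dots> = stalk_map (e \<circ>\<^sub>s \<beta> \<circ>\<^sub>s \<pi>) cD A"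
        using stalk_map_comp[OF ED.rE ringed(2) rT0 \<beta>\<pi> e ED.c_in, of A] A(2) by (simp add: b\<pi>c)
      finally show "stalk_map (p \<circ>\<^sub>s mD) cD A = stalk_map (e \<circ>\<^sub>s \<beta> \<circ>\<^sub>s \<pi>) cD A" .
    qed
  qed
  \<comment> \<open>Both have the same two projections, so they agree as morphisms to
    \<open>P\<close>. Comparing points and stalk maps at the closed point then gives the claim, as
    \<open>ED.\<epsilon>\<close> is injective.\<close>
  have "mD = \<mu> \<circ>\<^sub>s \<pi>"
    by (rule pair_eq[OF ED.E_scheme mD(1) \<mu>\<pi> agree[OF p0 e0 h1 \<beta>1 \<beta>1c m0 \<mu>0 \<alpha>1_closed \<chi>1 \<beta>1s] agree[OF p1 e1 h2 \<beta>2 \<beta>2c m1 \<mu>1 \<alpha>2_closed \<chi>2 \<beta>2s]])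
  then have e: "mD = \<mu> \<circ>\<^sub>s \<pi>" .
  have pt_eq: "?w = pt \<mu> c" using mD(2) ED.c_in \<pi>(2) unfolding e by (simp add: pt_comp pi.src_tgt)
  have "stalk_map m x A = \<chi>' (E.at_c \<mu> A)" if A: "A \<in> carrier (stalk P ?w)" for A
  proof -
    have A': "A \<in> stk P (pt \<mu> c)" using A pt_eq by simp
    have "ED.\<epsilon> (stalk_map m x A) = stalk_map mD cD A" using mDs A by simp
    also have "\<dots> = stalk_map \<pi> cD (stalk_map \<mu> c A)"
      unfolding e using stalk_map_comp[OF ED.rE E.rE ringed(3) \<pi>(1) \<mu> ED.c_in, of A] A' \<pi>(2) by simp
    also have "\<dots> = ED.\<epsilon> (\<chi>' (E.at_c \<mu> A))" using \<pi>s mu.stalk_map_closed[OF E.c_in A'] by (simp add: E.at_c_def)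
    finally have eq: "ED.\<epsilon> (stalk_map m x A) = ED.\<epsilon> (\<chi>' (E.at_c \<mu> A))" .
    have c1: "stalk_map m x A \<in> carrier ?D" by (rule ring_hom_closed[OF mh A])
    have c2: "\<chi>' (E.at_c \<mu> A) \<in> carrier ?D" by (rule ring_hom_closed[OF ch ring_hom_closed[OF E.at_c_hom[OF schemes(3) \<mu>] A']])
    show ?thesis by (rule inj_onD[OF bij_betw_imp_inj_on[OF ED.\<epsilon>_bij] eq c1 c2])
  qed
  then show ?thesis using pt_eq by blast
qed

text \<open>The unit condition sends the closed point of \<open>ER\<close> to a point where a
  cutting function is invertible, hence to a point of \<open>T1\<close>. There \<open>i\<close> is
  bijective on stalks, so the whole morphism lifts. The statement serves both members of the
  pair.\<close>

lemma lift_to_T1: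
  fixes ER :: "('u, 'u) ringed_space" and Q :: "('z, 'zz) ring_scheme"
  assumes t: "local_test Q ER cr \<kappa>r" and \<theta>: "\<theta> \<in> ring_hom R Q"
    and \<nu>: "\<nu> \<in> lrs_hom ER E" and \<nu>s: "\<And>a. a \<in> carrier R \<Longrightarrow> cm \<nu> (points E) (\<kappa> a) = \<kappa>r (\<theta> a)"
    and \<beta>: "\<beta> \<in> lrs_hom E T1c" and \<beta>c: "pt \<beta> c = z"
    and \<beta>s: "\<And>A. A \<in> stk T1c z \<Longrightarrow> stalk_map \<beta> c A = E.\<epsilon> (ell (\<alpha> A))"
    and \<alpha>c: "\<And>A. A \<in> stk T1c z \<Longrightarrow> \<alpha> A \<in> carrier C"
    and cut: "cutting z V F" and f: "f \<in> F" and unit: "\<theta> (ell (\<alpha> (pull z V f))) \<in> Units Q"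
  shows "\<exists>g \<in> lrs_hom ER T1. i \<circ>\<^sub>s g = \<beta> \<circ>\<^sub>s \<nu>"
proof -
  interpret ER: local_test Q ER cr \<kappa>r by (rule t)
  interpret b: lrs_mor E T1c \<beta> by (rule lrs_morI[OF E.rE ringed(2) \<beta>])
  interpret n: lrs_mor ER E \<nu> by (rule lrs_morI[OF ER.rE E.rE \<nu>])
  have z: "z \<in> points T1c" using b.pt_in[OF E.c_in] \<beta>c by simp
  have V: "opn P V" "pt dc z \<in> V" and fc: "f \<in> secs P V" using cut f by (auto simp: cutting_def)
  note db = lrs_comp_hom[OF E.rE ringed(2,3) \<beta> dch]
  note \<beta>\<nu> = lrs_comp_hom[OF ER.rE E.rE ringed(2) \<nu> \<beta>]
  interpret db: lrs_mor E P "dc \<circ>\<^sub>s \<beta>" by (rule lrs_morI[OF E.rE ringed(3) db])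
  interpret bn: lrs_mor ER T1c "\<beta> \<circ>\<^sub>s \<nu>" by (rule lrs_morI[OF ER.rE ringed(2) \<beta>\<nu>])
  note dbn = lrs_comp_hom[OF ER.rE E.rE ringed(3) \<nu> db]
  interpret dbn: lrs_mor ER P "(dc \<circ>\<^sub>s \<beta>) \<circ>\<^sub>s \<nu>" by (rule lrs_morI[OF ER.rE ringed(3) dbn])
  have dbc: "pt (dc \<circ>\<^sub>s \<beta>) c = pt dc z" using E.c_in \<beta>c by (simp add: pt_comp b.src_tgt)
  have all: "preim (dc \<circ>\<^sub>s \<beta>) V = points E"
    by (rule E.c_nbhd[OF db.preim_open[OF V(1)]]) (use E.c_in V(2) dbc in \<open>simp add: db.mem_preim\<close>)
  have all': "preim ((dc \<circ>\<^sub>s \<beta>) \<circ>\<^sub>s \<nu>) V = points ER"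
    unfolding preim_comp[OF ER.rE E.rE ringed(3) \<nu> db] all by (rule n.preim_points)
  let ?A = "germ P (pt dc z) V f"
  have A: "?A \<in> stk P (pt dc z)" by (rule d.Y.germ_in_stalk[OF V fc])
  have A': "stalk_map dc z ?A \<in> stk T1c z" by (rule dc.stalk_map_closed[OF z A])
  let ?a = "ell (\<alpha> (stalk_map dc z ?A))"
  have ac: "?a \<in> carrier R" by (rule ell_closed[OF \<alpha>c[OF A']])
  have "germ E c (points E) (cm (dc \<circ>\<^sub>s \<beta>) V f) = stalk_map (dc \<circ>\<^sub>s \<beta>) c ?A"
    using db.stalk_map_germ[OF E.c_in V(1) _ fc] V(2) dbc all by simp
  also have "\<dots> = stalk_map \<beta> c (stalk_map dc z ?A)"
    using stalk_map_comp[OF E.rE ringed(2,3) \<beta> dch E.c_in, of ?A] A by (simp add: \<beta>c)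
  also have "\<dots> = germ E c (points E) (\<kappa> ?a)" unfolding \<beta>s[OF A'] E.\<epsilon>_def ..
  finally have g: "germ E c (points E) (cm (dc \<circ>\<^sub>s \<beta>) V f) = germ E c (points E) (\<kappa> ?a)" .
  have cc: "cm (dc \<circ>\<^sub>s \<beta>) V f \<in> secs E (points E)" using db.cm_closed[OF V(1) fc] all by simp
  have "cm (dc \<circ>\<^sub>s \<beta>) V f = \<kappa> ?a" by (rule E.germ_c_inj[OF cc E.\<kappa>_closed[OF ac] g])
  then have "cm ((dc \<circ>\<^sub>s \<beta>) \<circ>\<^sub>s \<nu>) V f = \<kappa>r (\<theta> ?a)"
    using cm_comp[of "dc \<circ>\<^sub>s \<beta>" V f \<nu>] V(1) fc all \<nu>s[OF ac] by (simp add: db.src_tgt del: tgt_comp)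
  then have "germ ER cr (preim ((dc \<circ>\<^sub>s \<beta>) \<circ>\<^sub>s \<nu>) V) (cm ((dc \<circ>\<^sub>s \<beta>) \<circ>\<^sub>s \<nu>) V f) = ER.\<epsilon> (\<theta> ?a)"
    unfolding all' ER.\<epsilon>_def by simp
  then have un: "germ ER cr (preim ((dc \<circ>\<^sub>s \<beta>) \<circ>\<^sub>s \<nu>) V) (cm ((dc \<circ>\<^sub>s \<beta>) \<circ>\<^sub>s \<nu>) V f) \<in> Units (stalk ER cr)"
    using ER.\<epsilon>_unit_iff[OF ring_hom_closed[OF \<theta> ac]] unit by simp
  let ?z' = "pt (\<beta> \<circ>\<^sub>s \<nu>) cr"
  have dz': "pt ((dc \<circ>\<^sub>s \<beta>) \<circ>\<^sub>s \<nu>) cr = pt dc ?z'"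
    unfolding lrs_comp_assoc[OF ER.rE E.rE ringed(2,3) \<nu> \<beta> dch] by (rule pt_comp) (simp add: ER.c_in n.src_tgt)
  have z'V: "pt dc ?z' \<in> V" using all' ER.c_in dbn.mem_preim[of cr V] unfolding dz' by simp
  have "germ P (pt dc ?z') V f \<in> Units (stalk P (pt dc ?z'))"
    using dbn.germ_cm_unit_iff[OF ER.c_in V(1) _ fc] un z'V unfolding dz' by simp
  then have "?z' \<in> preim dc (inv_locus P V f)" using z'V bn.pt_in[OF ER.c_in] by (simp add: dc.mem_preim inv_locus_def)
  then have "?z' \<in> pt i ` points T1" using cut f unfolding cutting_def by blast
  then obtain t where tt: "t \<in> points T1" "pt i t = ?z'" by auto
  show ?thesis
    using ER.hom_lift_through_iso[OF schemes(2,1) \<beta>\<nu> ih tt] i_stalk_bij[OF tt(1)] tt(2) by simp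
qed

text \<open>Over the localization at \<open>r\<close> both members of the universal pair lift to
  \<open>T1\<close>. The equivalence relation on \<open>T1\<close> provides a morphism to
  \<open>T1\<close> with the required projections, and by uniqueness it lies over \<mu>. As
  \<open>s\<close> vanishes on \<open>T1\<close>, the numerator \<open>a\<close> becomes zero in
  this localization.\<close>

lemma killed_at_prime:
  assumes V: "opn P V" "pt \<mu> c \<in> V" and s: "s \<in> secs P V" "cm dc V s = \<zero>\<^bsub>sec T1c (preim dc V)\<^esub>"
    and a: "a \<in> carrier C" "w0 \<in> W" "E.at_c \<mu> (germ P (pt \<mu> c) V s) = frac C W a w0"
    and r: "primeideal r C" "r \<subseteq> q" and cut: "cutting z1 V1 F1" "cutting z2 V2 F2" and f: "f \<in> F1" "g \<in> F2"
    and fr: "\<alpha>1 (pull z1 V1 f) \<otimes>\<^bsub>C\<^esub> \<alpha>2 (pull z2 V2 g) \<notin> r"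
  shows "\<exists>w \<in> carrier C - r. w \<otimes>\<^bsub>C\<^esub> a = \<zero>\<^bsub>C\<^esub>"
proof -
  interpret r: primeideal r C by (rule r(1))
  let ?Wr = "carrier C - r" and ?Q = "localization C (carrier C - r)"
  interpret Wr: localization_set C ?Wr by (rule localization_set_prime[OF r(1)])
  have Qs: "|carrier ?Q| \<le>o |UNIV :: ('p + 'r) list set|" by (rule Wr.localization_small[OF k_inf C_small])
  from local_model_exists[OF k_inf k_u r.localization_local Qs]
  obtain ER :: "('u, 'u) ringed_space" and cr \<kappa>r where "local_model ?Q ER cr \<kappa>r" by blast
  then have tr: "local_test ?Q ER cr \<kappa>r" by (rule local_test.intro)
  interpret ER: local_test ?Q ER cr \<kappa>r by (rule tr)
  let ?l = "\<lambda>a. frac C ?Wr a \<one>\<^bsub>C\<^esub>"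
  have lh: "?l \<in> ring_hom C ?Q" by (rule Wr.frac_hom)
  have lu: "?l a \<in> Units ?Q" if "a \<in> carrier C" "a \<notin> r" for a
    using Wr.frac_unit[of a "\<one>\<^bsub>C\<^esub>"] that Wr.W_one by simp
  have lW: "?l ` W \<subseteq> Units ?Q"
  proof
    fix y assume "y \<in> ?l ` W"
    then obtain a where y: "y = ?l a" "a \<in> W" by (rule imageE)
    then have "a \<in> carrier C" "a \<notin> r" using r(2) by auto
    then show "y \<in> Units ?Q" unfolding y(1) by (rule lu)
  qed
  note ll = ER.R.is_cring lh lW
  define \<theta> where "\<theta> = loc_lift C ?Q ?l"
  have \<theta>h: "\<theta> \<in> ring_hom R ?Q" unfolding \<theta>_def by (rule W.loc_lift_hom[OF ll])
  have \<theta>l: "\<theta> (ell a) = ?l a" if "a \<in> carrier C" for a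
    unfolding \<theta>_def ell_def
    by (rule W.loc_lift_eqI[OF ll]) (use that ring_hom_closed[OF lh] ring_hom_one[OF lh] ER.R.l_one W.W_one in simp_all)
  have "(\<lambda>a. \<kappa>r (\<theta> a)) \<in> ring_hom R (sec ER (points ER))"
    using ring_hom_trans[OF \<theta>h ER.\<kappa>_hom] by (simp add: comp_def)
  \<comment> \<open>\<nu> is the map of spectra for the further localization from \<open>q\<close>
    to \<open>r\<close>, which exists because \<open>r\<close> is contained in \<open>q\<close>. It
    comes from the mapping property of \<open>E\<close>, since \<open>E\<close> and
    \<open>ER\<close> live in the same universe.\<close>
  from E.hom_exists[OF ER.lE this] obtain \<nu> where \<nu>: "\<nu> \<in> lrs_hom ER E" and \<nu>s: "\<forall>a \<in> carrier R. cm \<nu> (points E) (\<kappa> a) = \<kappa>r (\<theta> a)" by blast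
  interpret n: lrs_mor ER E \<nu> by (rule lrs_morI[OF ER.rE E.rE \<nu>])
  note f1 = \<alpha>1_closed[OF pull_closed[OF h1.pt_in[OF x] cut(1) f(1)]]
  note f2 = \<alpha>2_closed[OF pull_closed[OF h2.pt_in[OF x] cut(2) f(2)]]
  have n1: "\<alpha>1 (pull z1 V1 f) \<notin> r" using fr r.I_r_closed f2 by blast
  have n2: "\<alpha>2 (pull z2 V2 g) \<notin> r" using fr r.I_l_closed f1 by blast
  obtain g1 where g1: "g1 \<in> lrs_hom ER T1" "i \<circ>\<^sub>s g1 = \<beta>1 \<circ>\<^sub>s \<nu>"
  proof (rule bexE[OF lift_to_T1[OF tr \<theta>h \<nu> bspec[OF \<nu>s] \<beta>1 \<beta>1c \<beta>1s \<alpha>1_closed cut(1) f(1)]])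
    show "\<theta> (ell (\<alpha>1 (pull z1 V1 f))) \<in> Units ?Q" unfolding \<theta>l[OF f1] by (rule lu[OF f1 n1])
  qed
  obtain g2 where g2: "g2 \<in> lrs_hom ER T1" "i \<circ>\<^sub>s g2 = \<beta>2 \<circ>\<^sub>s \<nu>"
  proof (rule bexE[OF lift_to_T1[OF tr \<theta>h \<nu> bspec[OF \<nu>s] \<beta>2 \<beta>2c \<beta>2s \<alpha>2_closed cut(2) f(2)]])
    show "\<theta> (ell (\<alpha>2 (pull z2 V2 g))) \<in> Units ?Q" unfolding \<theta>l[OF f2] by (rule lu[OF f2 n2])
  qed
  have through: "e \<circ>\<^sub>s i \<circ>\<^sub>s g = (e \<circ>\<^sub>s \<beta>) \<circ>\<^sub>s \<nu>"
    if "e \<in> lrs_hom T1c Y" "ringed_space Y" "i \<circ>\<^sub>s g = \<beta> \<circ>\<^sub>s \<nu>" "\<beta> \<in> lrs_hom E T1c" for e \<beta> g and Y :: "('p, 'r) ringed_space"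
    unfolding that(3) by (rule lrs_comp_assoc[symmetric, OF ER.rE E.rE ringed(2) that(2) \<nu> that(4) that(1)])
  have "u \<circ>\<^sub>s i \<circ>\<^sub>s g1 = v \<circ>\<^sub>s i \<circ>\<^sub>s g2"
    unfolding through[OF u rB g1(2) \<beta>1] through[OF v rB g2(2) \<beta>2] u\<beta> ..
  from T1_ex[OF ER.E_scheme g1(1) g2(1) this] obtain g' where g': "g' \<in> lrs_hom ER T1"
    "p0 \<circ>\<^sub>s d \<circ>\<^sub>s g' = e0 \<circ>\<^sub>s i \<circ>\<^sub>s g1" "p1 \<circ>\<^sub>s d \<circ>\<^sub>s g' = e1 \<circ>\<^sub>s i \<circ>\<^sub>s g2" by blast
  have "d \<circ>\<^sub>s g' = \<mu> \<circ>\<^sub>s \<nu>"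
  proof (rule pair_eq[OF ER.E_scheme lrs_comp_hom[OF ER.rE ringed(1,3) g'(1) dh] lrs_comp_hom[OF ER.rE E.rE ringed(3) \<nu> \<mu>]])
    show "p0 \<circ>\<^sub>s d \<circ>\<^sub>s g' = p0 \<circ>\<^sub>s \<mu> \<circ>\<^sub>s \<nu>"
      unfolding g'(2) through[OF e0 rT0 g1(2) \<beta>1] \<mu>0[symmetric] by (rule lrs_comp_assoc[OF ER.rE E.rE ringed(3) rT0 \<nu> \<mu> p0])
    show "p1 \<circ>\<^sub>s d \<circ>\<^sub>s g' = p1 \<circ>\<^sub>s \<mu> \<circ>\<^sub>s \<nu>"
      unfolding g'(3) through[OF e1 rT0 g2(2) \<beta>2] \<mu>1[symmetric] by (rule lrs_comp_assoc[OF ER.rE E.rE ringed(3) rT0 \<nu> \<mu> p1])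
  qed
  then have eq: "cm (\<mu> \<circ>\<^sub>s \<nu>) V s = cm (d \<circ>\<^sub>s g') V s" by simp
  interpret g': lrs_mor ER T1 g' by (rule lrs_morI[OF ER.rE ringed(1) g'(1)])
  have all: "preim \<mu> V = points E"
    by (rule E.c_nbhd[OF mu.preim_open[OF V(1)]]) (use E.c_in V(2) in \<open>simp add: mu.mem_preim\<close>)
  have all': "preim (\<mu> \<circ>\<^sub>s \<nu>) V = points ER" unfolding preim_comp[OF ER.rE E.rE ringed(3) \<nu> \<mu>] all by (rule n.preim_points)
  then have allg: "preim g' (preim d V) = points ER" using \<open>d \<circ>\<^sub>s g' = \<mu> \<circ>\<^sub>s \<nu>\<close> preim_comp[OF ER.rE ringed(1,3) g'(1) dh, of V] by simp
  have "cm d V s = \<zero>\<^bsub>sec T1 (preim d V)\<^esub>" using ker_iff[OF V(1) s(1)] s(2) by simp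
  then have "cm (d \<circ>\<^sub>s g') V s = \<zero>\<^bsub>sec ER (points ER)\<^esub>"
    using cm_comp[of d V s g'] V(1) s(1) ring_hom_zero[OF g'.cm_hom[OF d.preim_open[OF V(1)]] d.X.sec_ring[OF d.preim_open[OF V(1)]]] ER.E.sec_ring[OF ER.E.opn_points] allg
    by (simp add: d.src_tgt)
  moreover
  let ?A = "germ P (pt \<mu> c) V s"
  have A: "?A \<in> stk P (pt \<mu> c)" by (rule d.Y.germ_in_stalk[OF V s(1)])
  have bc: "E.at_c \<mu> ?A \<in> carrier R" by (rule ring_hom_closed[OF E.at_c_hom[OF schemes(3) \<mu>] A])
  have g: "germ E c (points E) (cm \<mu> V s) = germ E c (points E) (\<kappa> (E.at_c \<mu> ?A))"
    using mu.stalk_map_germ[OF E.c_in V s(1)] E.\<epsilon>_at_c[OF schemes(3) \<mu> A] unfolding all E.\<epsilon>_def by simp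
  have cc: "cm \<mu> V s \<in> secs E (points E)" using mu.cm_closed[OF V(1) s(1)] all by simp
  have "cm \<mu> V s = \<kappa> (E.at_c \<mu> ?A)" by (rule E.germ_c_inj[OF cc E.\<kappa>_closed[OF bc] g])
  then have "cm (\<mu> \<circ>\<^sub>s \<nu>) V s = \<kappa>r (\<theta> (E.at_c \<mu> ?A))"
    using cm_comp[of \<mu> V s \<nu>] V(1) s(1) all \<nu>s bc by (simp add: mu.src_tgt)
  ultimately have "\<kappa>r (\<theta> (E.at_c \<mu> ?A)) = \<kappa>r \<zero>\<^bsub>?Q\<^esub>"
    using eq ring_hom_zero[OF ER.\<kappa>_hom ER.R.ring_axioms ER.E.sec_ring[OF ER.E.opn_points]] by simp
  then have \<theta>0: "\<theta> (frac C W a w0) = \<zero>\<^bsub>?Q\<^esub>"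
    using inj_onD[OF bij_betw_imp_inj_on[OF ER.\<kappa>_bij], of "\<theta> (E.at_c \<mu> ?A)" "\<zero>\<^bsub>?Q\<^esub>"] ring_hom_closed[OF \<theta>h bc] ER.R.zero_closed a(3) by simp
  have "?l w0 \<otimes>\<^bsub>?Q\<^esub> \<theta> (frac C W a w0) = ?l a" unfolding \<theta>_def by (rule W.loc_lift_cross[OF ll a(1,2)])
  moreover have "?l w0 \<otimes>\<^bsub>?Q\<^esub> \<zero>\<^bsub>?Q\<^esub> = \<zero>\<^bsub>?Q\<^esub>" by (rule ER.R.r_null[OF ring_hom_closed[OF lh W.W_closed[OF a(2)]]])
  ultimately have "?l a = \<zero>\<^bsub>?Q\<^esub>" unfolding \<theta>0 by (rule trans[OF sym])
  then have "frac C ?Wr a \<one>\<^bsub>C\<^esub> = frac C ?Wr \<zero>\<^bsub>C\<^esub> \<one>\<^bsub>C\<^esub>" unfolding Wr.loc_zero .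
  then obtain w where "w \<in> ?Wr" "w \<otimes>\<^bsub>C\<^esub> (\<one>\<^bsub>C\<^esub> \<otimes>\<^bsub>C\<^esub> a) = w \<otimes>\<^bsub>C\<^esub> (\<one>\<^bsub>C\<^esub> \<otimes>\<^bsub>C\<^esub> \<zero>\<^bsub>C\<^esub>)"
    using Wr.frac_eq_iff[OF a(1) Wr.W_one C.zero_closed Wr.W_one] by blast
  then show ?thesis using a(1) by (intro bexI[of _ w]) auto
qed

text \<open>The pullback of \<open>s\<close> is a fraction with numerator \<open>a\<close> in
  \<open>C\<close>, which is killed at every prime below \<open>q\<close> where some product of
  cutting functions is invertible. So powers of all products kill \<open>w \<otimes> a\<close> for
  one \<open>w\<close> outside \<open>q\<close>, and torsion-freeness of \<open>C\<close> makes it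
  zero.\<close>

lemma at_c_\<mu>_zero:
  assumes V: "opn P V" "pt \<mu> c \<in> V" and s: "s \<in> secs P V" "cm dc V s = \<zero>\<^bsub>sec T1c (preim dc V)\<^esub>"
  shows "E.at_c \<mu> (germ P (pt \<mu> c) V s) = \<zero>\<^bsub>R\<^esub>"
proof -
  have "E.at_c \<mu> (germ P (pt \<mu> c) V s) \<in> carrier R"
    by (rule ring_hom_closed[OF E.at_c_hom[OF schemes(3) \<mu>] d.Y.germ_in_stalk[OF V s(1)]])
  then obtain a w0 where a: "a \<in> carrier C" "w0 \<in> W" "E.at_c \<mu> (germ P (pt \<mu> c) V s) = frac C W a w0" by (rule W.locE)
  obtain V1 F1 where c1: "cutting z1 V1 F1" by (rule cutting_sections[OF h1.pt_in[OF x]])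
  obtain V2 F2 where c2: "cutting z2 V2 F2" by (rule cutting_sections[OF h2.pt_in[OF x]])
  note cut = c1 c2
  let ?e = "\<lambda>(f, g). \<alpha>1 (pull z1 V1 f) \<otimes>\<^bsub>C\<^esub> \<alpha>2 (pull z2 V2 g)"
  have G: "finite (?e ` (F1 \<times> F2))" using cut by (simp add: cutting_def)
  have Gc: "?e ` (F1 \<times> F2) \<subseteq> carrier C"
    using \<alpha>1_closed[OF pull_closed[OF h1.pt_in[OF x] cut(1)]] \<alpha>2_closed[OF pull_closed[OF h2.pt_in[OF x] cut(2)]] by auto
  have kill: "\<exists>w \<in> carrier C - r. w \<otimes>\<^bsub>C\<^esub> a = \<zero>\<^bsub>C\<^esub>" if r: "primeideal r C" "r \<subseteq> q" "e \<in> ?e ` (F1 \<times> F2)" "e \<notin> r" for r e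
  proof -
    obtain f g where fg: "f \<in> F1" "g \<in> F2" "e = ?e (f, g)" using r(3) by blast
    show ?thesis by (rule killed_at_prime[OF V s a r(1,2) cut fg(1,2)]) (use r(4) fg(3) in simp)
  qed
  have "\<exists>N::nat. \<exists>w \<in> W. \<forall>e \<in> ?e ` (F1 \<times> F2). e [^]\<^bsub>C\<^esub> N \<otimes>\<^bsub>C\<^esub> (w \<otimes>\<^bsub>C\<^esub> a) = \<zero>\<^bsub>C\<^esub>"
    by (rule C.annihilated_up_to_power[OF q.primeideal_axioms G Gc a(1)]) (rule kill)
  then obtain N :: nat and w where w: "w \<in> W" "\<forall>e \<in> ?e ` (F1 \<times> F2). e [^]\<^bsub>C\<^esub> N \<otimes>\<^bsub>C\<^esub> (w \<otimes>\<^bsub>C\<^esub> a) = \<zero>\<^bsub>C\<^esub>" by (elim exE bexE)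
  have wc: "w \<in> carrier C" using w(1) by blast
  have "w \<otimes>\<^bsub>C\<^esub> a = \<zero>\<^bsub>C\<^esub>"
  proof (rule torsion_free[OF cut C.m_closed[OF wc a(1)]])
    fix f g assume "f \<in> F1" "g \<in> F2"
    then have "?e (f, g) \<in> ?e ` (F1 \<times> F2)" by blast
    from bspec[OF w(2) this] show "(\<alpha>1 (pull z1 V1 f) \<otimes>\<^bsub>C\<^esub> \<alpha>2 (pull z2 V2 g)) [^]\<^bsub>C\<^esub> N \<otimes>\<^bsub>C\<^esub> (w \<otimes>\<^bsub>C\<^esub> a) = \<zero>\<^bsub>C\<^esub>" by simp
  qed
  then have "w \<otimes>\<^bsub>C\<^esub> (\<one>\<^bsub>C\<^esub> \<otimes>\<^bsub>C\<^esub> a) = w \<otimes>\<^bsub>C\<^esub> (w0 \<otimes>\<^bsub>C\<^esub> \<zero>\<^bsub>C\<^esub>)" using wc a by simp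
  then have "frac C W a w0 = frac C W \<zero>\<^bsub>C\<^esub> \<one>\<^bsub>C\<^esub>"
    using W.frac_eq_iff[OF a(1,2) C.zero_closed W.W_one] w(1) by blast
  then show ?thesis unfolding a(3) W.loc_zero .
qed

end
end
end

text \<open>The stalk map of \<open>m\<close> factors through \<open>R\<close> by way of \<mu>,
  where the section is already zero. The auxiliary objects over \<open>E\<close> are chosen here and
  no longer occur in the conclusion.\<close>

lemma cm_m_germ_zero:
  assumes V: "opn P V" "pt m x \<in> V" and s: "s \<in> secs P V" "cm dc V s = \<zero>\<^bsub>sec T1c (preim dc V)\<^esub>"
  shows "germ X x (preim m V) (cm m V s) = \<zero>\<^bsub>L\<^esub>"
proof -
  obtain E :: "('u, 'u) ringed_space" and c \<kappa> where md: "local_model R E c \<kappa>" using test_exists by blast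
  interpret E: local_test R E c \<kappa> using md by (rule local_test.intro)
  obtain \<beta>1 where b1: "\<beta>1 \<in> lrs_hom E T1c" "pt \<beta>1 c = z1" "\<forall>A \<in> stk T1c z1. stalk_map \<beta>1 c A = E.\<epsilon> (ell (\<alpha>1 A))"
    using \<beta>1_exists[OF md] by blast
  obtain \<beta>2 where b2: "\<beta>2 \<in> lrs_hom E T1c" "pt \<beta>2 c = z2" "\<forall>A \<in> stk T1c z2. stalk_map \<beta>2 c A = E.\<epsilon> (ell (\<alpha>2 A))"
    using \<beta>2_exists[OF md] by blast
  note b = b1(1,2) bspec[OF b1(3)] b2(1,2) bspec[OF b2(3)]
  obtain \<mu> where mu: "\<mu> \<in> lrs_hom E P" "p0 \<circ>\<^sub>s \<mu> = e0 \<circ>\<^sub>s \<beta>1" "p1 \<circ>\<^sub>s \<mu> = e1 \<circ>\<^sub>s \<beta>2"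
    using \<mu>_exists[OF md b] by blast
  have A: "germ P (pt m x) V s \<in> stk P (pt m x)" by (rule d.Y.germ_in_stalk[OF V s(1)])
  note e = m_eq_\<mu>[OF md b mu]
  have V': "pt \<mu> c \<in> V" using e V(2) by simp
  have "stalk_map m x (germ P (pt m x) V s) = \<chi>' (E.at_c \<mu> (germ P (pt m x) V s))" using e A by blast
  also have "E.at_c \<mu> (germ P (pt m x) V s) = \<zero>\<^bsub>R\<^esub>"
    using at_c_\<mu>_zero[OF md b mu V(1) V' s] e by simp
  also have "\<chi>' \<zero>\<^bsub>R\<^esub> = \<zero>\<^bsub>L\<^esub>" by (rule ring_hom_zero[OF \<chi>'_hom E.R.ring_axioms L.ring_axioms])
  finally show ?thesis using m.stalk_map_germ[OF x V s(1)] by simp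
qed

end

section \<open>Symmetry and transitivity of the closure\<close>

text \<open>A morphism to \<open>P\<close> factors through the closure once the ideal dies in each
  local ring of \<open>X\<close>. The type of \<open>C\<close> stays free because symmetry and
  transitivity use rings over different types.\<close>

lemma lift_through_closure:
  fixes X :: "('u, 'u) ringed_space" and C :: "'p \<Rightarrow> 'c ring"
  assumes X: "scheme X" and dc: "closed_immersion dc" "dc \<in> lrs_hom T1c P" and m: "m \<in> lrs_hom X P"
    and core: "\<And>x. x \<in> points X \<Longrightarrow> \<exists>(C :: 'c ring) \<alpha>1 \<alpha>2 \<chi>.
      core_point T1 T1c P d dc i T0 B p0 p1 e0 e1 u v X h1 h2 m x C \<alpha>1 \<alpha>2 \<chi>"
  shows "\<exists>k \<in> lrs_hom X T1c. dc \<circ>\<^sub>s k = m"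
proof (rule closed_immersion_factor[OF scheme_lrs[OF X] dc m])
  have P: "scheme P" using closed_immersion_schemes(2)[OF dc(1)] lrs_homD(2)[OF dc(2)] by simp
  interpret m: lrs_mor X P m by (rule lrs_morI[OF scheme_ringed[OF X] scheme_ringed[OF P] m])
  fix V s assume V: "opn P V" and s: "s \<in> secs P V" and z: "cm dc V s = \<zero>\<^bsub>sec T1c (preim dc V)\<^esub>"
  show "cm m V s = \<zero>\<^bsub>sec X (preim m V)\<^esub>"
  proof (rule m.X.sec_zeroI[OF m.preim_open[OF V] m.cm_closed[OF V s]])
    fix x assume "x \<in> preim m V"
    then have x: "x \<in> points X" "pt m x \<in> V" by (simp_all add: m.mem_preim)
    obtain C :: "'c ring" and \<alpha>1 \<alpha>2 \<chi> where
      c: "core_point T1 T1c P d dc i T0 B p0 p1 e0 e1 u v X h1 h2 m x C \<alpha>1 \<alpha>2 \<chi>"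
      using core[OF x(1)] by (elim exE)
    show "germ X x (preim m V) (cm m V s) = \<zero>\<^bsub>stalk X x\<^esub>"
      by (rule core_point.cm_m_germ_zero[OF c V x(2) s z])
  qed
qed

text \<open>The equivalence relation on \<open>T1\<close> is put into statements about pairs of
  morphisms, without fixing structure morphisms to \<open>S\<close>. The composites formed from one
  test morphism can then be used as they arise.\<close>

locale relation_closure = qc_closure T1 T1c P d dc i
  for T1 T1c P :: "('p, 'r) ringed_space" and d dc i +
  fixes T0 S :: "('p, 'r) ringed_space" and t0 p0 p1 :: "('p, 'r, 'p, 'r) morphism" and X :: "('u, 'u) ringed_space"
  assumes univ: "universe_over TYPE('p) TYPE('r) TYPE('u)"
    and T0: "scheme T0" and S: "scheme S" and X: "scheme X"
    and t0: "t0 \<in> lrs_hom T0 S" and p0: "p0 \<in> lrs_hom P T0" and p1: "p1 \<in> lrs_hom P T0" and tp: "t0 \<circ>\<^sub>s p0 = t0 \<circ>\<^sub>s p1"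
    and pair_ex: "\<And>(Y :: ('u, 'u) ringed_space) a b. scheme Y \<Longrightarrow> a \<in> lrs_hom Y T0 \<Longrightarrow> b \<in> lrs_hom Y T0 \<Longrightarrow>
      t0 \<circ>\<^sub>s a = t0 \<circ>\<^sub>s b \<Longrightarrow> \<exists>h \<in> lrs_hom Y P. p0 \<circ>\<^sub>s h = a \<and> p1 \<circ>\<^sub>s h = b"
    and pair_eq: "\<And>(Y :: ('u, 'u) ringed_space) a b. scheme Y \<Longrightarrow> a \<in> lrs_hom Y P \<Longrightarrow> b \<in> lrs_hom Y P \<Longrightarrow>
      p0 \<circ>\<^sub>s a = p0 \<circ>\<^sub>s b \<Longrightarrow> p1 \<circ>\<^sub>s a = p1 \<circ>\<^sub>s b \<Longrightarrow> a = b"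
    and sym_T1: "\<And>(Y :: ('u, 'u) ringed_space) g. scheme Y \<Longrightarrow> g \<in> lrs_hom Y T1 \<Longrightarrow>
      \<exists>g' \<in> lrs_hom Y T1. p0 \<circ>\<^sub>s d \<circ>\<^sub>s g' = p1 \<circ>\<^sub>s d \<circ>\<^sub>s g \<and> p1 \<circ>\<^sub>s d \<circ>\<^sub>s g' = p0 \<circ>\<^sub>s d \<circ>\<^sub>s g"
    and trans_T1: "\<And>(Y :: ('u, 'u) ringed_space) g1 g2. scheme Y \<Longrightarrow> g1 \<in> lrs_hom Y T1 \<Longrightarrow> g2 \<in> lrs_hom Y T1 \<Longrightarrow>
      p1 \<circ>\<^sub>s d \<circ>\<^sub>s g1 = p0 \<circ>\<^sub>s d \<circ>\<^sub>s g2 \<Longrightarrow> \<exists>g \<in> lrs_hom Y T1. p0 \<circ>\<^sub>s d \<circ>\<^sub>s g = p0 \<circ>\<^sub>s d \<circ>\<^sub>s g1 \<and> p1 \<circ>\<^sub>s d \<circ>\<^sub>s g = p1 \<circ>\<^sub>s d \<circ>\<^sub>s g2"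
    and flat0: "flat_morphism (p0 \<circ>\<^sub>s dc)" and flat1: "flat_morphism (p1 \<circ>\<^sub>s dc)"
begin

lemma rT0: "ringed_space T0" and rS: "ringed_space S" and rX: "ringed_space X"
  using T0 S X by (simp_all add: scheme_ringed)

lemma k_inf: "infinite (UNIV :: ('p + 'r) list set)" by (rule infinite_UNIV_listI)

lemma r_k: "|UNIV :: 'r set| \<le>o |UNIV :: ('p + 'r) list set|"
  by (rule card_of_ordLeqI[of "\<lambda>r. [Inr r]"]) (simp_all add: inj_on_def)

lemma d0: "p0 \<circ>\<^sub>s dc \<in> lrs_hom T1c T0" and d1: "p1 \<circ>\<^sub>s dc \<in> lrs_hom T1c T0"
  by (rule lrs_comp_hom[OF ringed(2,3) rT0 dch p0], rule lrs_comp_hom[OF ringed(2,3) rT0 dch p1])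

context
  fixes Y :: "('u, 'u) ringed_space"
  assumes Y: "scheme Y"
begin

lemma rY: "ringed_space Y" using Y scheme_ringed by blast

lemma via_dc: "h \<in> lrs_hom Y T1c \<Longrightarrow> p \<in> lrs_hom P T0 \<Longrightarrow> (p \<circ>\<^sub>s dc) \<circ>\<^sub>s h = p \<circ>\<^sub>s dc \<circ>\<^sub>s h"
  by (rule lrs_comp_assoc[OF rY ringed(2,3) rT0 _ dch])

lemma via_i: "g \<in> lrs_hom Y T1 \<Longrightarrow> p \<in> lrs_hom P T0 \<Longrightarrow> (p \<circ>\<^sub>s dc) \<circ>\<^sub>s i \<circ>\<^sub>s g = p \<circ>\<^sub>s d \<circ>\<^sub>s g"
  using via_dc[OF lrs_comp_hom[OF rY ringed(1,2) _ ih]] lrs_comp_assoc[OF rY ringed(1,2,3) _ ih dch] comp by simp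

lemma t0_via: assumes h: "h \<in> lrs_hom Y P" shows "t0 \<circ>\<^sub>s p0 \<circ>\<^sub>s h = t0 \<circ>\<^sub>s p1 \<circ>\<^sub>s h"
  using lrs_comp_assoc[OF rY ringed(3) rT0 rS h p0 t0] lrs_comp_assoc[OF rY ringed(3) rT0 rS h p1 t0] tp by simp

lemma t0_dc: assumes h: "h \<in> lrs_hom Y T1c" shows "t0 \<circ>\<^sub>s (p0 \<circ>\<^sub>s dc) \<circ>\<^sub>s h = t0 \<circ>\<^sub>s (p1 \<circ>\<^sub>s dc) \<circ>\<^sub>s h"
  unfolding via_dc[OF h p0] via_dc[OF h p1] by (rule t0_via[OF lrs_comp_hom[OF rY ringed(2,3) h dch]])

lemma d_hom: assumes h: "h \<in> lrs_hom Y T1c" shows "(p0 \<circ>\<^sub>s dc) \<circ>\<^sub>s h \<in> lrs_hom Y T0" "(p1 \<circ>\<^sub>s dc) \<circ>\<^sub>s h \<in> lrs_hom Y T0"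
  by (rule lrs_comp_hom[OF rY ringed(2) rT0 h d0], rule lrs_comp_hom[OF rY ringed(2) rT0 h d1])

end

text \<open>The scheme of pairs is \<open>T1c\<close> itself: \<open>u\<close> and \<open>v\<close>
  are identities, and \<open>e0\<close>, \<open>e1\<close> are the two projections in reverse
  order.\<close>

lemma symmetric_lift:
  assumes h: "h \<in> lrs_hom X T1c"
  shows "\<exists>k \<in> lrs_hom X T1c. p0 \<circ>\<^sub>s dc \<circ>\<^sub>s k = p1 \<circ>\<^sub>s dc \<circ>\<^sub>s h \<and> p1 \<circ>\<^sub>s dc \<circ>\<^sub>s k = p0 \<circ>\<^sub>s dc \<circ>\<^sub>s h"
proof -
  interpret h: lrs_mor X T1c h by (rule lrs_morI[OF rX ringed(2) h])
  note idh = lrs_id_hom[OF ringed(2)]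
  have ex: "\<exists>a \<in> lrs_hom Y P. p0 \<circ>\<^sub>s a = (p1 \<circ>\<^sub>s dc) \<circ>\<^sub>s b1 \<and> p1 \<circ>\<^sub>s a = (p0 \<circ>\<^sub>s dc) \<circ>\<^sub>s b2"
    if Y: "scheme Y" and b: "b1 \<in> lrs_hom Y T1c" "b2 \<in> lrs_hom Y T1c" "lrs_id T1c \<circ>\<^sub>s b1 = lrs_id T1c \<circ>\<^sub>s b2" for Y :: "('u, 'u) ringed_space" and b1 b2
  proof -
    have e: "b1 = b2" using lrs_id_left[OF rY[OF Y] ringed(2)] b by simp
    show ?thesis unfolding e by (rule pair_ex[OF Y d_hom(2,1)[OF Y b(2)] t0_dc[OF Y b(2), symmetric]])
  qed
  have ex1: "\<exists>g \<in> lrs_hom Y T1. p0 \<circ>\<^sub>s d \<circ>\<^sub>s g = (p1 \<circ>\<^sub>s dc) \<circ>\<^sub>s i \<circ>\<^sub>s g1 \<and> p1 \<circ>\<^sub>s d \<circ>\<^sub>s g = (p0 \<circ>\<^sub>s dc) \<circ>\<^sub>s i \<circ>\<^sub>s g2"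
    if Y: "scheme Y" and g: "g1 \<in> lrs_hom Y T1" "g2 \<in> lrs_hom Y T1" "lrs_id T1c \<circ>\<^sub>s i \<circ>\<^sub>s g1 = lrs_id T1c \<circ>\<^sub>s i \<circ>\<^sub>s g2" for Y :: "('u, 'u) ringed_space" and g1 g2
  proof -
    note c = lrs_comp_hom[OF rY[OF Y] ringed(1,2) _ ih]
    have e: "i \<circ>\<^sub>s g2 = i \<circ>\<^sub>s g1" using lrs_id_left[OF rY[OF Y] ringed(2)] c g by simp
    show ?thesis unfolding e via_i[OF Y g(1) p0] via_i[OF Y g(1) p1] by (rule sym_T1[OF Y g(1)])
  qed
  obtain m where m: "m \<in> lrs_hom X P" "p0 \<circ>\<^sub>s m = (p1 \<circ>\<^sub>s dc) \<circ>\<^sub>s h" "p1 \<circ>\<^sub>s m = (p0 \<circ>\<^sub>s dc) \<circ>\<^sub>s h"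
    using ex[OF X h h refl] by blast
  have "\<exists>k \<in> lrs_hom X T1c. dc \<circ>\<^sub>s k = m"
  proof (rule lift_through_closure[OF X dc_closed dch m(1)])
    fix x assume x: "x \<in> points X"
    let ?z = "pt h x"
    let ?C = "stalk T1c ?z"
    have z: "?z \<in> points T1c" by (rule h.pt_in[OF x])
    interpret C: cring ?C by (rule dc.X.stalk_cring[OF z])
    \<comment> \<open>Both families act on the same ring. The power of a product splits, and the
      torsion statement at \<open>?z\<close> is applied twice, to cancel the factors of
      \<open>F'\<close> inside and those of \<open>F\<close> outside.\<close>
    have tf: "a = \<zero>\<^bsub>?C\<^esub>" if cut: "cutting ?z V F" "cutting ?z V' F'" and a: "a \<in> carrier ?C"
      and fg: "\<And>f g. f \<in> F \<Longrightarrow> g \<in> F' \<Longrightarrow> (pull ?z V f \<otimes>\<^bsub>?C\<^esub> pull ?z V' g) [^]\<^bsub>?C\<^esub> (N::nat) \<otimes>\<^bsub>?C\<^esub> a = \<zero>\<^bsub>?C\<^esub>" for V F V' F' a N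
    proof (rule cutting_torsion_free[OF z cut(1) a])
      fix f assume f: "f \<in> F"
      note cf = pull_closed[OF z cut(1) f]
      show "pull ?z V f [^]\<^bsub>?C\<^esub> N \<otimes>\<^bsub>?C\<^esub> a = \<zero>\<^bsub>?C\<^esub>"
      proof (rule cutting_torsion_free[OF z cut(2)])
        show "pull ?z V f [^]\<^bsub>?C\<^esub> N \<otimes>\<^bsub>?C\<^esub> a \<in> carrier ?C" using a cf by simp
        fix g assume g: "g \<in> F'"
        note cg = pull_closed[OF z cut(2) g]
        show "pull ?z V' g [^]\<^bsub>?C\<^esub> N \<otimes>\<^bsub>?C\<^esub> (pull ?z V f [^]\<^bsub>?C\<^esub> N \<otimes>\<^bsub>?C\<^esub> a) = \<zero>\<^bsub>?C\<^esub>"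
          using fg[OF f g] cf cg a C.pow_mult_distrib[OF C.m_comm[OF cf cg] cf cg] by (simp add: C.m_ac)
      qed
    qed
    have idr: "(\<lambda>a. a) \<in> ring_hom ?C ?C" by (rule ring_hom_memI) simp_all
    have "core_point T1 T1c P d dc i T0 T1c p0 p1 (p1 \<circ>\<^sub>s dc) (p0 \<circ>\<^sub>s dc) (lrs_id T1c) (lrs_id T1c) X h h m x
        ?C (\<lambda>a. a) (\<lambda>a. a) (stalk_map h x)"
      by (rule core_point.intro[OF qc_closure_axioms], intro core_point_axioms.intro)
        (rule univ, rule T0, rule schemes(2), rule X, rule p0, rule p1, rule d1, rule d0, rule idh, rule idh, (rule pair_eq; assumption),
         (rule ex; assumption), (rule ex1; assumption), rule h, rule h, rule refl, rule m(1), rule m(2), rule m(3), rule x, rule C.is_cring,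
         rule stalk_small[OF k_inf r_k schemes(2) z], rule idr, rule idr, rule refl, rule h.stalk_map_hom[OF x], rule refl, rule refl, (rule tf; assumption))
    then show "\<exists>(C :: ('p set \<times> 'r) set ring) \<alpha>1 \<alpha>2 \<chi>.
      core_point T1 T1c P d dc i T0 T1c p0 p1 (p1 \<circ>\<^sub>s dc) (p0 \<circ>\<^sub>s dc) (lrs_id T1c) (lrs_id T1c) X h h m x C \<alpha>1 \<alpha>2 \<chi>"
      by (intro exI)
  qed
  then obtain k where k: "k \<in> lrs_hom X T1c" "dc \<circ>\<^sub>s k = m" by blast
  show ?thesis using k m(2,3) via_dc[OF X h p0] via_dc[OF X h p1] by (intro bexI[of _ k]) simp_all
qed

text \<open>Composability compares the second coordinate of the first member with the first
  coordinate of the second. The stalks are thus tensored over \<open>T0\<close> with the first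
  factor flat through \<open>p1\<close> and the second through \<open>p0\<close>, and both flatness
  assumptions enter.\<close>

lemma transitive_lift:
  assumes h1: "h1 \<in> lrs_hom X T1c" and h2: "h2 \<in> lrs_hom X T1c" and h12: "p1 \<circ>\<^sub>s dc \<circ>\<^sub>s h1 = p0 \<circ>\<^sub>s dc \<circ>\<^sub>s h2"
  shows "\<exists>k \<in> lrs_hom X T1c. p0 \<circ>\<^sub>s dc \<circ>\<^sub>s k = p0 \<circ>\<^sub>s dc \<circ>\<^sub>s h1 \<and> p1 \<circ>\<^sub>s dc \<circ>\<^sub>s k = p1 \<circ>\<^sub>s dc \<circ>\<^sub>s h2"
proof -
  interpret h1: lrs_mor X T1c h1 by (rule lrs_morI[OF rX ringed(2) h1])
  interpret h2: lrs_mor X T1c h2 by (rule lrs_morI[OF rX ringed(2) h2])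
  interpret d0: lrs_mor T1c T0 "p0 \<circ>\<^sub>s dc" by (rule lrs_morI[OF ringed(2) rT0 d0])
  interpret d1: lrs_mor T1c T0 "p1 \<circ>\<^sub>s dc" by (rule lrs_morI[OF ringed(2) rT0 d1])
  have uv: "(p1 \<circ>\<^sub>s dc) \<circ>\<^sub>s h1 = (p0 \<circ>\<^sub>s dc) \<circ>\<^sub>s h2" using h12 via_dc[OF X h1 p1] via_dc[OF X h2 p0] by simp
  have ex: "\<exists>a \<in> lrs_hom Y P. p0 \<circ>\<^sub>s a = (p0 \<circ>\<^sub>s dc) \<circ>\<^sub>s b1 \<and> p1 \<circ>\<^sub>s a = (p1 \<circ>\<^sub>s dc) \<circ>\<^sub>s b2"
    if Y: "scheme Y" and b: "b1 \<in> lrs_hom Y T1c" "b2 \<in> lrs_hom Y T1c" "(p1 \<circ>\<^sub>s dc) \<circ>\<^sub>s b1 = (p0 \<circ>\<^sub>s dc) \<circ>\<^sub>s b2" for Y :: "('u, 'u) ringed_space" and b1 b2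
    by (rule pair_ex[OF Y d_hom(1)[OF Y b(1)] d_hom(2)[OF Y b(2)]]) (simp add: t0_dc[OF Y b(1)] t0_dc[OF Y b(2), symmetric] b(3))
  have ex1: "\<exists>g \<in> lrs_hom Y T1. p0 \<circ>\<^sub>s d \<circ>\<^sub>s g = (p0 \<circ>\<^sub>s dc) \<circ>\<^sub>s i \<circ>\<^sub>s g1 \<and> p1 \<circ>\<^sub>s d \<circ>\<^sub>s g = (p1 \<circ>\<^sub>s dc) \<circ>\<^sub>s i \<circ>\<^sub>s g2"
    if Y: "scheme Y" and g: "g1 \<in> lrs_hom Y T1" "g2 \<in> lrs_hom Y T1" "(p1 \<circ>\<^sub>s dc) \<circ>\<^sub>s i \<circ>\<^sub>s g1 = (p0 \<circ>\<^sub>s dc) \<circ>\<^sub>s i \<circ>\<^sub>s g2" for Y :: "('u, 'u) ringed_space" and g1 g2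
    unfolding via_i[OF Y g(1) p0] via_i[OF Y g(2) p1] using trans_T1[OF Y g(1,2)] g(3) unfolding via_i[OF Y g(1) p1] via_i[OF Y g(2) p0] .
  obtain m where m: "m \<in> lrs_hom X P" "p0 \<circ>\<^sub>s m = (p0 \<circ>\<^sub>s dc) \<circ>\<^sub>s h1" "p1 \<circ>\<^sub>s m = (p1 \<circ>\<^sub>s dc) \<circ>\<^sub>s h2"
    using ex[OF X h1 h2 uv] by blast
  have "\<exists>k \<in> lrs_hom X T1c. dc \<circ>\<^sub>s k = m"
  proof (rule lift_through_closure[OF X dc_closed dch m(1)])
    fix x assume x: "x \<in> points X"
    let ?z1 = "pt h1 x" and ?z2 = "pt h2 x"
    let ?O1 = "stalk T1c ?z1" and ?O2 = "stalk T1c ?z2" and ?y = "pt (p1 \<circ>\<^sub>s dc) ?z1"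
    let ?f1 = "stalk_map (p1 \<circ>\<^sub>s dc) ?z1" and ?f2 = "stalk_map (p0 \<circ>\<^sub>s dc) ?z2"
    have z: "?z1 \<in> points T1c" "?z2 \<in> points T1c" using h1.pt_in[OF x] h2.pt_in[OF x] by auto
    have y: "pt (p0 \<circ>\<^sub>s dc) ?z2 = ?y"
      using arg_cong[OF uv, of "\<lambda>f. pt f x"] x by (simp add: pt_comp[of x h1 "p1 \<circ>\<^sub>s dc"] pt_comp[of x h2 "p0 \<circ>\<^sub>s dc"] h1.src_tgt h2.src_tgt)
    have f2: "?f2 \<in> ring_hom (stalk T0 ?y) ?O2" using d0.stalk_map_hom[OF z(2)] y by simp
    interpret A: cring "stalk T0 ?y" by (rule d0.Y.stalk_cring[OF d1.pt_in[OF z(1)]])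
    interpret O1: cring ?O1 by (rule dc.X.stalk_cring[OF z(1)])
    interpret O2: cring ?O2 by (rule dc.X.stalk_cring[OF z(2)])
    interpret L: cring "stalk X x" by (rule h1.X.stalk_cring[OF x])
    have ta: "tensor_algebra (stalk T0 ?y) ?O1 ?O2 ?f1 ?f2"
      by (intro tensor_algebra.intro tensor_algebra_axioms.intro A.is_cring O1.is_cring O2.is_cring d1.stalk_map_hom[OF z(1)] f2)
    interpret T: tensor_algebra "stalk T0 ?y" ?O1 ?O2 ?f1 ?f2 by (rule ta)
    have flat_at: "flat_module (stalk T0 (pt p z)) (module_via (stalk_map p z) (stalk T1c z))"
      if "flat_morphism p" "p \<in> lrs_hom T1c T0" "z \<in> points T1c" for p z
      using that lrs_homD(1,2)[OF that(2)] unfolding flat_morphism_def by metis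
    have fl1: "flat_module (stalk T0 ?y) (module_via ?f1 ?O1)" by (rule flat_at[OF flat1 d1 z(1)])
    have fl2: "flat_module (stalk T0 ?y) (module_via ?f2 ?O2)" using flat_at[OF flat0 d0 z(2)] unfolding y .
    have "stalk_map h1 x (?f1 a) = stalk_map h2 x (?f2 a)" if a: "a \<in> carrier (stalk T0 ?y)" for a
      using stalk_map_comp[OF rX ringed(2) rT0 h1 d1 x, of a] stalk_map_comp[OF rX ringed(2) rT0 h2 d0 x, of a] a y uv by simp
    from T.universal[OF L.is_cring h1.stalk_map_hom[OF x] h2.stalk_map_hom[OF x] this]
    obtain \<chi> where \<chi>: "\<chi> \<in> ring_hom T.T (stalk X x)" "\<forall>a \<in> carrier ?O1. \<chi> (T.\<alpha>1 a) = stalk_map h1 x a" "\<forall>a \<in> carrier ?O2. \<chi> (T.\<alpha>2 a) = stalk_map h2 x a" by blast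
    have tf: "a = \<zero>\<^bsub>T.T\<^esub>" if cut: "cutting ?z1 V1 F1" "cutting ?z2 V2 F2" and a: "a \<in> carrier T.T" and fg: "\<And>f g. f \<in> F1 \<Longrightarrow> g \<in> F2 \<Longrightarrow>
        (T.\<alpha>1 (pull ?z1 V1 f) \<otimes>\<^bsub>T.T\<^esub> T.\<alpha>2 (pull ?z2 V2 g)) [^]\<^bsub>T.T\<^esub> (N::nat) \<otimes>\<^bsub>T.T\<^esub> a = \<zero>\<^bsub>T.T\<^esub>" for V1 F1 V2 F2 a N
    proof (rule tensor_torsion_free[OF ta fl1 fl2 _ _ _ _ _ _ a])
      let ?g1 = "pull ?z1 V1" and ?g2 = "pull ?z2 V2"
      note g1c = pull_closed[OF z(1) cut(1)] and g2c = pull_closed[OF z(2) cut(2)]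
      \<comment> \<open>Powers with the common exponent \<open>N\<close> are taken as the finite
        families. As \<alpha>1 and \<alpha>2 are homomorphisms, the power of a product of images is
        the product of the images of the powers.\<close>
      let ?F = "(\<lambda>f. ?g1 f [^]\<^bsub>?O1\<^esub> N) ` F1" and ?G = "(\<lambda>f. ?g2 f [^]\<^bsub>?O2\<^esub> N) ` F2"
      show "finite ?F" "finite ?G" using cut by (simp_all add: cutting_def)
      show "?F \<subseteq> carrier ?O1" by (rule image_subsetI) (rule O1.nat_pow_closed[OF g1c])
      show "?G \<subseteq> carrier ?O2" by (rule image_subsetI) (rule O2.nat_pow_closed[OF g2c])
      show "b = \<zero>\<^bsub>?O1\<^esub>" if b: "b \<in> carrier ?O1" and e: "\<And>e. e \<in> ?F \<Longrightarrow> e \<otimes>\<^bsub>?O1\<^esub> b = \<zero>\<^bsub>?O1\<^esub>" for b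
        by (rule cutting_torsion_free[OF z(1) cut(1) b]) (rule e, rule imageI)
      show "b = \<zero>\<^bsub>?O2\<^esub>" if b: "b \<in> carrier ?O2" and e: "\<And>e. e \<in> ?G \<Longrightarrow> e \<otimes>\<^bsub>?O2\<^esub> b = \<zero>\<^bsub>?O2\<^esub>" for b
        by (rule cutting_torsion_free[OF z(2) cut(2) b]) (rule e, rule imageI)
      fix e e' assume "e \<in> ?F" "e' \<in> ?G"
      then obtain f g where e: "e = ?g1 f [^]\<^bsub>?O1\<^esub> N" "f \<in> F1" "e' = ?g2 g [^]\<^bsub>?O2\<^esub> N" "g \<in> F2" by (elim imageE)
      note f = g1c[OF e(2)] and g = g2c[OF e(4)]
      have "T.\<alpha>1 e \<otimes>\<^bsub>T.T\<^esub> T.\<alpha>2 e' = (T.\<alpha>1 (?g1 f) \<otimes>\<^bsub>T.T\<^esub> T.\<alpha>2 (?g2 g)) [^]\<^bsub>T.T\<^esub> N"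
        unfolding e(1,3) hom_pow[OF T.\<alpha>1_hom O1.ring_axioms T.T.ring_axioms f] hom_pow[OF T.\<alpha>2_hom O2.ring_axioms T.T.ring_axioms g]
        by (rule T.T.pow_mult_distrib[symmetric, OF T.T.m_comm[OF T.\<alpha>_closed(1)[OF f] T.\<alpha>_closed(2)[OF g]] T.\<alpha>_closed(1)[OF f] T.\<alpha>_closed(2)[OF g]])
      then show "T.\<alpha>1 e \<otimes>\<^bsub>T.T\<^esub> T.\<alpha>2 e' \<otimes>\<^bsub>T.T\<^esub> a = \<zero>\<^bsub>T.T\<^esub>" using fg[OF e(2,4)] by simp
    qed
    have "core_point T1 T1c P d dc i T0 T0 p0 p1 (p0 \<circ>\<^sub>s dc) (p1 \<circ>\<^sub>s dc) (p1 \<circ>\<^sub>s dc) (p0 \<circ>\<^sub>s dc) X h1 h2 m x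
        T.T T.\<alpha>1 T.\<alpha>2 \<chi>"
      by (rule core_point.intro[OF qc_closure_axioms], intro core_point_axioms.intro)
        (rule univ, rule T0, rule T0, rule X, rule p0, rule p1, rule d0, rule d1, rule d1, rule d0, (rule pair_eq; assumption),
         (rule ex; assumption), (rule ex1; assumption), rule h1, rule h2, rule uv, rule m(1), rule m(2), rule m(3), rule x, rule T.T.is_cring,
         rule T.T_small[OF k_inf stalk_small[OF k_inf r_k schemes(2) z(1)] stalk_small[OF k_inf r_k schemes(2) z(2)]],
         rule T.\<alpha>1_hom, rule T.\<alpha>2_hom, (rule T.\<alpha>_compat; assumption), rule \<chi>(1), (rule bspec[OF \<chi>(2)]; assumption), (rule bspec[OF \<chi>(3)]; assumption), (rule tf; assumption))
    then show "\<exists>(C :: (('p set \<times> 'r) set \<times> ('p set \<times> 'r) set \<Rightarrow>\<^sub>0 int) set ring) \<alpha>1 \<alpha>2 \<chi>.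
      core_point T1 T1c P d dc i T0 T0 p0 p1 (p0 \<circ>\<^sub>s dc) (p1 \<circ>\<^sub>s dc) (p1 \<circ>\<^sub>s dc) (p0 \<circ>\<^sub>s dc) X h1 h2 m x C \<alpha>1 \<alpha>2 \<chi>"
      by (intro exI)
  qed
  then obtain k where k: "k \<in> lrs_hom X T1c" "dc \<circ>\<^sub>s k = m" by blast
  show ?thesis using k m(2,3) via_dc[OF X h1 p0] via_dc[OF X h2 p1] by (intro bexI[of _ k]) simp_all
qed

end

section \<open>From statements about pairs of test morphisms back to equivalence relations\<close>

lemma open_incl_points: assumes "ringed_space X" shows "open_incl X (points X) = lrs_id X"
proof -
  interpret X: rspace X using assms by (rule rspace.intro)
  have "(if opn X V then (\<lambda>s \<in> secs X V. res X V (V \<inter> points X) s) else (\<lambda>_. undefined)) =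
      (if opn X V then (\<lambda>s \<in> secs X V. s) else (\<lambda>_. undefined))" for V
  proof (cases "opn X V")
    case True
    then have V: "V \<inter> points X = V" using X.opn_sub by blast
    show ?thesis unfolding V using True X.res_id[OF True] by (auto intro!: restrict_ext)
  qed simp
  then show ?thesis by (simp add: open_incl_def lrs_id_def restr_points)
qed

lemma closed_immersion_immersion: assumes f: "closed_immersion f" shows "immersion f"
proof -
  have s: "scheme (src f)" "scheme (tgt f)" using closed_immersion_schemes f by auto
  note r = s[THEN scheme_ringed]
  note h = closed_immersion_hom[OF f]
  show ?thesis unfolding immersion_def
    by (intro conjI s exI[of _ "points (tgt f)"] bexI[of _ f])
      (simp_all add: restr_points h f open_incl_points[OF r(2)] lrs_id_left[OF r h])
qed

theorem propositionB2p1: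
  fixes S T0 T1 P T1c :: "('p, 'r) ringed_space"
    and t0 p0 p1 d i dc :: "('p, 'r, 'p, 'r) morphism"
  assumes "universe_over TYPE('p) TYPE('r) TYPE('u)"
    and "scheme S" and "scheme T0" and "t0 \<in> lrs_hom T0 S"
    and "src p0 = P" and "src p1 = P"
    and "is_fibre_product TYPE('u) t0 t0 p0 p1"
    and "d \<in> lrs_hom T1 P"
    and "equivalence_relation TYPE('u) t0 p0 p1 d"
    and "quasi_compact d"
    and "dc \<in> lrs_hom T1c P" and "schematic_closure d dc"
    and "i \<in> lrs_hom T1 T1c" and "dc \<circ>\<^sub>s i = d"
    and "flat_morphism (p0 \<circ>\<^sub>s dc)" and "flat_morphism (p1 \<circ>\<^sub>s dc)"
  shows "equivalence_relation TYPE('u) t0 p0 p1 dc"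
proof -
  note univ = assms(1) and S = assms(2) and T0 = assms(3) and t0 = assms(4) and dh = assms(8) and dch = assms(11) and ih = assms(13)
  have st: "src t0 = T0" "tgt t0 = S" by (rule lrs_homD[OF t0])+
  have fp: "scheme P" "p0 \<in> lrs_hom P T0" "p1 \<in> lrs_hom P T0" "t0 \<circ>\<^sub>s p0 = t0 \<circ>\<^sub>s p1"
    and ex1: "\<And>(Y :: ('u, 'u) ringed_space) a b. scheme Y \<Longrightarrow> a \<in> lrs_hom Y T0 \<Longrightarrow> b \<in> lrs_hom Y T0 \<Longrightarrow> t0 \<circ>\<^sub>s a = t0 \<circ>\<^sub>s b \<Longrightarrow>
      \<exists>!h. h \<in> lrs_hom Y P \<and> p0 \<circ>\<^sub>s h = a \<and> p1 \<circ>\<^sub>s h = b"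
    using assms(7) unfolding is_fibre_product_def assms(5,6) st by blast+
  have sd: "src d = T1" "src dc = T1c" by (rule lrs_homD(1)[OF dh], rule lrs_homD(1)[OF dch])
  have imm: "immersion d" using assms(9) by (simp add: equivalence_relation_def)
  interpret qc_closure T1 T1c P d dc i
    by (rule qc_closure.intro) (rule imm, rule dh, rule assms, rule assms, rule dch, rule ih, rule assms)
  have rT0: "ringed_space T0" and rS: "ringed_space S" using T0 S by (simp_all add: scheme_ringed)
  define R where "R e x = {(p0 \<circ>\<^sub>s e \<circ>\<^sub>s h, p1 \<circ>\<^sub>s e \<circ>\<^sub>s h) | h. h \<in> over_hom x (t0 \<circ>\<^sub>s p0 \<circ>\<^sub>s e)}"
    for e :: "('p, 'r, 'p, 'r) morphism" and x :: "('u, 'u, 'p, 'r) morphism"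
  have equiv_d: "equiv (over_hom x t0) (R d x)" if "scheme (src x)" "x \<in> lrs_hom (src x) S" for x
    using assms(9) that unfolding equivalence_relation_def st R_def by blast
  have over: "h \<in> over_hom x (t0 \<circ>\<^sub>s p0 \<circ>\<^sub>s e) \<longleftrightarrow> h \<in> lrs_hom (src x) Z \<and> t0 \<circ>\<^sub>s p0 \<circ>\<^sub>s e \<circ>\<^sub>s h = x"
    if x: "scheme (src x)" and e: "e \<in> lrs_hom Z P" and Z: "ringed_space Z" for h x e and Z :: "('p, 'r) ringed_space"
  proof -
    have rX: "ringed_space (src x)" using x scheme_ringed by blast
    have "(t0 \<circ>\<^sub>s p0 \<circ>\<^sub>s e) \<circ>\<^sub>s h = t0 \<circ>\<^sub>s p0 \<circ>\<^sub>s e \<circ>\<^sub>s h" if h: "h \<in> lrs_hom (src x) Z"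
      unfolding lrs_comp_assoc[OF rX Z rT0 rS h lrs_comp_hom[OF Z ringed(3) rT0 e fp(2)] t0] lrs_comp_assoc[OF rX Z ringed(3) rT0 h e fp(2)] ..
    then show ?thesis using lrs_homD(1)[OF e] by (auto simp: over_hom_def)
  qed
  \<comment> \<open>The condition of lying over the base is put on the first coordinate alone. The
    second one then lies over the same base, because
    \<open>t0 \<circ>\<^sub>s p0 = t0 \<circ>\<^sub>s p1\<close>.\<close>
  have R_iff: "(a, b) \<in> R e x \<longleftrightarrow> (\<exists>h \<in> lrs_hom (src x) Z. t0 \<circ>\<^sub>s a = x \<and> a = p0 \<circ>\<^sub>s e \<circ>\<^sub>s h \<and> b = p1 \<circ>\<^sub>s e \<circ>\<^sub>s h)"
    if "scheme (src x)" "e \<in> lrs_hom Z P" "ringed_space Z" for a b x e and Z :: "('p, 'r) ringed_space"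
    unfolding R_def using over[OF that] by auto
  have loc: "relation_closure T1 T1c P d dc i T0 S t0 p0 p1 X" if X: "scheme X" for X :: "('u, 'u) ringed_space"
  proof (intro relation_closure.intro qc_closure_axioms relation_closure_axioms.intro)
    show "universe_over TYPE('p) TYPE('r) TYPE('u)" by (rule univ)
    show "\<exists>h \<in> lrs_hom Y P. p0 \<circ>\<^sub>s h = a \<and> p1 \<circ>\<^sub>s h = b"
      if "scheme Y" "a \<in> lrs_hom Y T0" "b \<in> lrs_hom Y T0" "t0 \<circ>\<^sub>s a = t0 \<circ>\<^sub>s b" for Y :: "('u, 'u) ringed_space" and a b
      using ex1[OF that] by blast
    show "a = b" if Y: "scheme Y" and ab: "a \<in> lrs_hom Y P" "b \<in> lrs_hom Y P" "p0 \<circ>\<^sub>s a = p0 \<circ>\<^sub>s b" "p1 \<circ>\<^sub>s a = p1 \<circ>\<^sub>s b" for Y :: "('u, 'u) ringed_space" and a b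
    proof -
      have rY: "ringed_space Y" using Y scheme_ringed by blast
      have "t0 \<circ>\<^sub>s p0 \<circ>\<^sub>s b = t0 \<circ>\<^sub>s p1 \<circ>\<^sub>s b"
        using lrs_comp_assoc[OF rY ringed(3) rT0 rS ab(2) fp(2) t0] lrs_comp_assoc[OF rY ringed(3) rT0 rS ab(2) fp(3) t0] fp(4) by simp
      from ex1[OF Y lrs_comp_hom[OF rY ringed(3) rT0 ab(2) fp(2)] lrs_comp_hom[OF rY ringed(3) rT0 ab(2) fp(3)] this]
      show ?thesis using ab by blast
    qed
    fix Y :: "('u, 'u) ringed_space" and g assume Y: "scheme Y" and g: "g \<in> lrs_hom Y T1"
    have rY: "ringed_space Y" using Y scheme_ringed by blast
    have hom: "p \<circ>\<^sub>s d \<circ>\<^sub>s g \<in> lrs_hom Y T0" if p: "p \<in> lrs_hom P T0" and g: "g \<in> lrs_hom Y T1" for p g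
      by (rule lrs_comp_hom[OF rY ringed(3) rT0 lrs_comp_hom[OF rY ringed(1,3) g dh] p])
    \<comment> \<open>The hypothesis speaks of morphisms over one fixed structure morphism. The one
      that \<open>g\<close> induces on \<open>Y\<close> puts both coordinates of \<open>g\<close>
      into the same \<open>over_hom\<close> set.\<close>
    let ?x = "t0 \<circ>\<^sub>s p0 \<circ>\<^sub>s d \<circ>\<^sub>s g"
    have xh: "?x \<in> lrs_hom Y S" by (rule lrs_comp_hom[OF rY rT0 rS hom[OF fp(2) g] t0])
    have sx: "src ?x = Y" by (rule lrs_homD(1)[OF xh])
    have eq: "equiv (over_hom ?x t0) (R d ?x)" by (rule equiv_d) (simp_all only: sx Y xh)
    have mem: "(a, b) \<in> R d ?x \<longleftrightarrow> (\<exists>h \<in> lrs_hom Y T1. t0 \<circ>\<^sub>s a = ?x \<and> a = p0 \<circ>\<^sub>s d \<circ>\<^sub>s h \<and> b = p1 \<circ>\<^sub>s d \<circ>\<^sub>s h)" for a b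
      using R_iff[of ?x, unfolded sx, OF Y dh ringed(1)] .
    have m1: "(p0 \<circ>\<^sub>s d \<circ>\<^sub>s g, p1 \<circ>\<^sub>s d \<circ>\<^sub>s g) \<in> R d ?x" using mem g by blast
    then have "(p1 \<circ>\<^sub>s d \<circ>\<^sub>s g, p0 \<circ>\<^sub>s d \<circ>\<^sub>s g) \<in> R d ?x" using eq unfolding equiv_def sym_def by blast
    then show "\<exists>g' \<in> lrs_hom Y T1. p0 \<circ>\<^sub>s d \<circ>\<^sub>s g' = p1 \<circ>\<^sub>s d \<circ>\<^sub>s g \<and> p1 \<circ>\<^sub>s d \<circ>\<^sub>s g' = p0 \<circ>\<^sub>s d \<circ>\<^sub>s g"
      unfolding mem by metis
    fix g2 assume g2: "g2 \<in> lrs_hom Y T1" and e: "p1 \<circ>\<^sub>s d \<circ>\<^sub>s g = p0 \<circ>\<^sub>s d \<circ>\<^sub>s g2"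
    \<comment> \<open>A composable pair automatically lies over one base: the second coordinate of
      \<open>g\<close> lies over \<open>?x\<close>, and it is the first coordinate of
      \<open>g2\<close>.\<close>
    have "p1 \<circ>\<^sub>s d \<circ>\<^sub>s g \<in> over_hom ?x t0" using eq m1 unfolding equiv_def by blast
    then have "t0 \<circ>\<^sub>s p0 \<circ>\<^sub>s d \<circ>\<^sub>s g2 = ?x" unfolding e over_hom_def by simp
    then have "(p0 \<circ>\<^sub>s d \<circ>\<^sub>s g2, p1 \<circ>\<^sub>s d \<circ>\<^sub>s g2) \<in> R d ?x" using mem g2 by blast
    then have "(p0 \<circ>\<^sub>s d \<circ>\<^sub>s g, p1 \<circ>\<^sub>s d \<circ>\<^sub>s g2) \<in> R d ?x" using m1 eq unfolding e equiv_def trans_def by blast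
    then show "\<exists>g' \<in> lrs_hom Y T1. p0 \<circ>\<^sub>s d \<circ>\<^sub>s g' = p0 \<circ>\<^sub>s d \<circ>\<^sub>s g \<and> p1 \<circ>\<^sub>s d \<circ>\<^sub>s g' = p1 \<circ>\<^sub>s d \<circ>\<^sub>s g2"
      unfolding mem by metis
  qed (rule T0 S X t0 fp assms(15,16))+
  have "equiv (over_hom x t0) (R dc x)" if sx: "scheme (src x)" and x: "x \<in> lrs_hom (src x) S" for x
  proof -
    interpret relation_closure T1 T1c P d dc i T0 S t0 p0 p1 "src x" by (rule loc[OF sx])
    note mem = R_iff[OF sx dch ringed(2)]
    note eqd = equiv_d[OF sx x, unfolded equiv_def]
    have rX: "ringed_space (src x)" using sx scheme_ringed by blast
    have dch': "dc \<circ>\<^sub>s h \<in> lrs_hom (src x) P" if "h \<in> lrs_hom (src x) T1c" for h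
      by (rule lrs_comp_hom[OF rX ringed(2,3) that dch])
    have t0_eq: "t0 \<circ>\<^sub>s p1 \<circ>\<^sub>s dc \<circ>\<^sub>s h = t0 \<circ>\<^sub>s p0 \<circ>\<^sub>s dc \<circ>\<^sub>s h" if "h \<in> lrs_hom (src x) T1c" for h
      by (rule t0_via[OF sx dch'[OF that], symmetric])
    show ?thesis
    proof (rule equivI)
      show "R dc x \<subseteq> over_hom x t0 \<times> over_hom x t0"
      proof (rule subrelI)
        fix a b assume "(a, b) \<in> R dc x"
        then obtain h where h: "h \<in> lrs_hom (src x) T1c" "t0 \<circ>\<^sub>s a = x" "a = p0 \<circ>\<^sub>s dc \<circ>\<^sub>s h" "b = p1 \<circ>\<^sub>s dc \<circ>\<^sub>s h"
          unfolding mem by (elim bexE conjE)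
        have "a \<in> lrs_hom (src x) T0" "b \<in> lrs_hom (src x) T0"
          unfolding h(3,4) by (rule lrs_comp_hom[OF rX ringed(3) rT0 dch'[OF h(1)] fp(2)], rule lrs_comp_hom[OF rX ringed(3) rT0 dch'[OF h(1)] fp(3)])
        moreover have "t0 \<circ>\<^sub>s b = x" using h(2) t0_eq[OF h(1)] unfolding h(3,4) by simp
        ultimately show "(a, b) \<in> over_hom x t0 \<times> over_hom x t0" using h(2) by (simp add: over_hom_def st)
      qed
      show "refl_on (over_hom x t0) (R dc x)"
      proof (rule refl_onI)
        fix a assume a: "a \<in> over_hom x t0"
        then have "(a, a) \<in> R d x" using eqd unfolding refl_on_def by blast
        then obtain g where g: "g \<in> lrs_hom (src x) T1" "t0 \<circ>\<^sub>s a = x" "a = p0 \<circ>\<^sub>s d \<circ>\<^sub>s g" "a = p1 \<circ>\<^sub>s d \<circ>\<^sub>s g"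
          unfolding R_iff[OF sx dh ringed(1)] by (elim bexE conjE)
        \<comment> \<open>A morphism to \<open>T1\<close> that represents the pair (a, a) is sent
          into the closure by \<open>i\<close>, with unchanged projections.\<close>
        have ig: "i \<circ>\<^sub>s g \<in> lrs_hom (src x) T1c" by (rule lrs_comp_hom[OF rX ringed(1,2) g(1) ih])
        have "dc \<circ>\<^sub>s i \<circ>\<^sub>s g = d \<circ>\<^sub>s g" using lrs_comp_assoc[OF rX ringed(1,2,3) g(1) ih dch] comp by simp
        then show "(a, a) \<in> R dc x" unfolding mem using ig g(2,3,4) by (intro bexI[of _ "i \<circ>\<^sub>s g"]) simp_all
      qed
      show "sym (R dc x)"
      proof (rule symI)
        fix a b assume "(a, b) \<in> R dc x"
        then obtain h where h: "h \<in> lrs_hom (src x) T1c" "t0 \<circ>\<^sub>s a = x" "a = p0 \<circ>\<^sub>s dc \<circ>\<^sub>s h" "b = p1 \<circ>\<^sub>s dc \<circ>\<^sub>s h"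
          unfolding mem by (elim bexE conjE)
        have "t0 \<circ>\<^sub>s b = x" using h(2) t0_eq[OF h(1)] unfolding h(3,4) by simp
        then show "(b, a) \<in> R dc x" unfolding mem using symmetric_lift[OF h(1)] h(3,4) by metis
      qed
      show "trans (R dc x)"
      proof (rule transI)
        fix a b c assume "(a, b) \<in> R dc x" "(b, c) \<in> R dc x"
        then obtain h1 h2 where h: "h1 \<in> lrs_hom (src x) T1c" "t0 \<circ>\<^sub>s a = x" "a = p0 \<circ>\<^sub>s dc \<circ>\<^sub>s h1" "b = p1 \<circ>\<^sub>s dc \<circ>\<^sub>s h1"
          "h2 \<in> lrs_hom (src x) T1c" "b = p0 \<circ>\<^sub>s dc \<circ>\<^sub>s h2" "c = p1 \<circ>\<^sub>s dc \<circ>\<^sub>s h2"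
          unfolding mem by (elim bexE conjE)
        have "p1 \<circ>\<^sub>s dc \<circ>\<^sub>s h1 = p0 \<circ>\<^sub>s dc \<circ>\<^sub>s h2" using h(4,6) by simp
        from transitive_lift[OF h(1,5) this] show "(a, c) \<in> R dc x" unfolding mem using h(2,3,7) by metis
      qed
    qed
  qed
  then show ?thesis
    unfolding equivalence_relation_def R_def sd assms(5) st
    using schemes(2) dch closed_immersion_immersion[OF dc_closed] by blast
qed

end
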